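(* Let $R$ be a graded ring, $M$ and $N$ be graded $R$-modules, and $$C_\bullet:\quad\cdots\to C_1\to C_0\to 0$$ be a homogeneous complex of graded $R$-modules with $H_0(C_\bullet)=M$. For an integer $\ell$, consider the conditions $U_\ell$: ${}^*\operatorname{Ext}^{\ell-j}_R(H_j(C_\bullet),N)=0$ for all integers $j$ with $1\le j\le \ell$; $V_\ell$: ${}^*\operatorname{Ext}^{\ell-j}_R(C_j,N)=0$ for all integers $j$ with $0\le j\le \ell-1$. Fix an integer $i$. The following statements hold. (a) If $U_{i-1}$, $U_i$, $V_{i-1}$, and $V_i$ all hold, then there is a natural homogeneous isomorphism $H^i({}^*\operatorname{Hom}_R(C_\bullet,N))\simeq{}^*\operatorname{Ext}^i_R(M,N)$. (b) If $U_i$, $V_{i-1}$, and $V_i$ hold, then there is a natural homogeneous surjection ${}^*\operatorname{Ext}^i_R(M,N)\twoheadrightarrow H^i({}^*\operatorname{Hom}_R(C_\bullet,N))$. (c) If $U_{i-1}$, $U_i$, and $V_i$ hold, then there is a natural homogeneous surjection $H^i({}^*\operatorname{Hom}_R(C_\bullet,N))\twoheadrightarrow{}^*\operatorname{Ext}^i_R(M,N)$. (d) If $U_{i-1}$, $U_i$, and $V_{i-1}$ hold, then there is a natural homogeneous injection $H^i({}^*\operatorname{Hom}_R(C_\bullet,N))\hookrightarrow{}^*\operatorname{Ext}^i_R(M,N)$. (e) If $U_{i-1}$, $V_{i-1}$, and $V_i$ hold, then there is a natural homogeneous injection ${}^*\operatorname{Ext}^i_R(M,N)\hookrightarrow H^i({}^*\operatorname{Hom}_R(C_\bullet,N))$.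 (f) If $U_i$ and $V_{i-1}$ hold, then $H^i({}^*\operatorname{Hom}_R(C_\bullet,N))$ is a natural homogeneous subquotient of ${}^*\operatorname{Ext}^i_R(M,N)$. (g) If $U_{i-1}$ and $V_i$ hold, then ${}^*\operatorname{Ext}^i_R(M,N)$ is a natural homogeneous subquotient of $H^i({}^*\operatorname{Hom}_R(C_\bullet,N))$.
   Context: Rings are commutative; graded means $\mathbb Z$-graded (possibly trivially graded). ${}^*\operatorname{Hom}_R(M,N)$ and ${}^*\operatorname{Ext}^i_R(M,N)$ are the graded Hom and Ext modules (i.e. ${}^*\operatorname{Hom}_R(M,N)=\bigoplus_n\{\text{homogeneous }R\text{-linear maps }M\to N\text{ of degree }n\}$ and ${}^*\operatorname{Ext}^i_R$ are its derived functors in the category of graded modules). By convention ${}^*\operatorname{Ext}^i_R(M,N)=0$ for $i<0$. A graded module $N'$ is a homogeneous subquotient of a graded module $M'$ if $N'$ is isomorphic to a homogeneous submodule of a graded homomorphic image of $M'$. No finiteness is assumed on $R$, $M$, $N$ or the $C_j$. *)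

theory Defs
  imports "HOL-Algebra.Module" "HOL-Algebra.AbelCoset" "HOL-Library.FSet"
begin

section \<open>Graded rings and graded modules\<close>

record 'a gring = "'a ring" + rgr :: "int \<Rightarrow> 'a set"

record ('a, 'b) gmod = "('a, 'b) module" + mgr :: "int \<Rightarrow> 'b set"

text \<open>The family \<open>A\<close> of additive subgroups is a direct sum decomposition of \<open>G\<close>; \<open>f n\<close> below is
  the homogeneous component of \<open>x\<close> in degree \<open>n\<close>.\<close>

definition graded_by :: "('b, 'x) ring_scheme \<Rightarrow> (int \<Rightarrow> 'b set) \<Rightarrow> bool" where
  "graded_by G A \<longleftrightarrow>
     (\<forall>n. additive_subgroup (A n) G) \<and>
     (\<forall>x\<in>carrier G. \<exists>!f. (\<forall>n. f n \<in> A n) \<and> finite {n. f n \<noteq> \<zero>\<^bsub>G\<^esub>} \<and>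
        x = (\<Oplus>\<^bsub>G\<^esub>n\<in>{n. f n \<noteq> \<zero>\<^bsub>G\<^esub>}. f n))"

definition graded_ring :: "'a gring \<Rightarrow> bool" where
  "graded_ring R \<longleftrightarrow>
     cring R \<and> graded_by R (rgr R) \<and>
     (\<forall>m n. \<forall>a\<in>rgr R m. \<forall>b\<in>rgr R n. a \<otimes>\<^bsub>R\<^esub> b \<in> rgr R (m + n))"

definition graded_module :: "'a gring \<Rightarrow> ('a, 'b) gmod \<Rightarrow> bool" where
  "graded_module R M \<longleftrightarrow>
     module R M \<and> graded_by M (mgr M) \<and>
     (\<forall>m n. \<forall>a\<in>rgr R m. \<forall>x\<in>mgr M n. a \<odot>\<^bsub>M\<^esub> x \<in> mgr M (m + n))"

definition zero_module :: "('a, 'b) gmod \<Rightarrow> bool" where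
  "zero_module M \<longleftrightarrow> carrier M = {\<zero>\<^bsub>M\<^esub>}"

definition linear_map :: "'a gring \<Rightarrow> ('a, 'b) gmod \<Rightarrow> ('a, 'c) gmod \<Rightarrow> ('b \<Rightarrow> 'c) \<Rightarrow> bool" where
  "linear_map R M N f \<longleftrightarrow>
     f \<in> carrier M \<rightarrow> carrier N \<and>
     (\<forall>x\<in>carrier M. \<forall>y\<in>carrier M. f (x \<oplus>\<^bsub>M\<^esub> y) = f x \<oplus>\<^bsub>N\<^esub> f y) \<and>
     (\<forall>a\<in>carrier R. \<forall>x\<in>carrier M. f (a \<odot>\<^bsub>M\<^esub> x) = a \<odot>\<^bsub>N\<^esub> f x)"

definition homogeneous_map ::
    "'a gring \<Rightarrow> ('a, 'b) gmod \<Rightarrow> ('a, 'c) gmod \<Rightarrow> int \<Rightarrow> ('b \<Rightarrow> 'c) \<Rightarrow> bool" where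
  "homogeneous_map R M N n f \<longleftrightarrow>
     linear_map R M N f \<and> (\<forall>k. \<forall>x\<in>mgr M k. f x \<in> mgr N (k + n))"

text \<open>The morphisms of the category of graded modules are the homogeneous maps of degree 0.\<close>

abbreviation graded_hom :: "'a gring \<Rightarrow> ('a, 'b) gmod \<Rightarrow> ('a, 'c) gmod \<Rightarrow> ('b \<Rightarrow> 'c) \<Rightarrow> bool" where
  "graded_hom R M N f \<equiv> homogeneous_map R M N 0 f"

definition graded_iso :: "'a gring \<Rightarrow> ('a, 'b) gmod \<Rightarrow> ('a, 'c) gmod \<Rightarrow> ('b \<Rightarrow> 'c) \<Rightarrow> bool" where
  "graded_iso R M N f \<longleftrightarrow> graded_hom R M N f \<and> bij_betw f (carrier M) (carrier N)"

definition graded_surj :: "'a gring \<Rightarrow> ('a, 'b) gmod \<Rightarrow> ('a, 'c) gmod \<Rightarrow> ('b \<Rightarrow> 'c) \<Rightarrow> bool" where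
  "graded_surj R M N f \<longleftrightarrow> graded_hom R M N f \<and> f ` carrier M = carrier N"

definition graded_inj :: "'a gring \<Rightarrow> ('a, 'b) gmod \<Rightarrow> ('a, 'c) gmod \<Rightarrow> ('b \<Rightarrow> 'c) \<Rightarrow> bool" where
  "graded_inj R M N f \<longleftrightarrow> graded_hom R M N f \<and> inj_on f (carrier M)"

definition restrict_gmod :: "('a, 'b) gmod \<Rightarrow> 'b set \<Rightarrow> ('a, 'b) gmod" where
  "restrict_gmod M L = M\<lparr>carrier := L, mgr := (\<lambda>n. L \<inter> mgr M n)\<rparr>"

definition homogeneous_submodule :: "'a gring \<Rightarrow> ('a, 'b) gmod \<Rightarrow> 'b set \<Rightarrow> bool" where
  "homogeneous_submodule R M L \<longleftrightarrow> submodule L R M \<and> graded_module R (restrict_gmod M L)"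


section \<open>The graded Hom module\<close>

text \<open>The direct sum over \<open>n\<close> of the homogeneous maps of degree \<open>n\<close> is formed inside the linear
  maps. Elements are functions made \<open>undefined\<close> off \<open>carrier M\<close>, so that equality of
  elements is equality of maps.\<close>

definition gHom_deg :: "'a gring \<Rightarrow> ('a, 'b) gmod \<Rightarrow> ('a, 'c) gmod \<Rightarrow> int \<Rightarrow> ('b \<Rightarrow> 'c) set" where
  "gHom_deg R M N n = {f \<in> extensional (carrier M). homogeneous_map R M N n f}"

definition gHom :: "'a gring \<Rightarrow> ('a, 'b) gmod \<Rightarrow> ('a, 'c) gmod \<Rightarrow> ('a, 'b \<Rightarrow> 'c) gmod" where
  "gHom R M N =
     \<lparr>carrier = {(\<lambda>x\<in>carrier M. \<Oplus>\<^bsub>N\<^esub>n\<in>F. g n x) | F g. finite F \<and> (\<forall>n\<in>F. g n \<in> gHom_deg R M N n)},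
      mult = undefined, one = undefined,
      zero = (\<lambda>x\<in>carrier M. \<zero>\<^bsub>N\<^esub>),
      add = (\<lambda>f g. \<lambda>x\<in>carrier M. f x \<oplus>\<^bsub>N\<^esub> g x),
      smult = (\<lambda>a f. \<lambda>x\<in>carrier M. a \<odot>\<^bsub>N\<^esub> f x),
      mgr = gHom_deg R M N\<rparr>"


section \<open>Complexes and homology\<close>

text \<open>Complexes are indexed homologically by all integers: \<open>diff C j\<close> maps \<open>obj C j\<close> to
  \<open>obj C (j - 1)\<close>. A cochain complex \<open>K\<close> is regarded as a complex in this sense by placing
  its term in cohomological degree \<open>i\<close> at the index \<open>- i\<close>, so that its \<open>i\<close>-th cohomology is
  \<open>homology K (- i)\<close>.\<close>

record ('a, 'b) cpx =
  obj :: "int \<Rightarrow> ('a, 'b) gmod"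
  diff :: "int \<Rightarrow> 'b \<Rightarrow> 'b"

definition graded_complex :: "'a gring \<Rightarrow> ('a, 'b) cpx \<Rightarrow> bool" where
  "graded_complex R C \<longleftrightarrow>
     (\<forall>j. graded_module R (obj C j) \<and> graded_hom R (obj C j) (obj C (j - 1)) (diff C j) \<and>
        (\<forall>x\<in>carrier (obj C j). diff C (j - 1) (diff C j x) = \<zero>\<^bsub>obj C (j - 2)\<^esub>))"

definition chain_map :: "'a gring \<Rightarrow> ('a, 'b) cpx \<Rightarrow> ('a, 'c) cpx \<Rightarrow> (int \<Rightarrow> 'b \<Rightarrow> 'c) \<Rightarrow> bool" where
  "chain_map R C D f \<longleftrightarrow>
     (\<forall>j. graded_hom R (obj C j) (obj D j) (f j) \<and>
        (\<forall>x\<in>carrier (obj C j). f (j - 1) (diff C j x) = diff D j (f j x)))"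

definition gquot :: "('a, 'b) gmod \<Rightarrow> 'b set \<Rightarrow> 'b set \<Rightarrow> ('a, 'b set) gmod" where
  "gquot A Z B =
     \<lparr>carrier = (\<lambda>z. B +>\<^bsub>A\<^esub> z) ` Z,
      mult = undefined, one = undefined,
      zero = B,
      add = (\<lambda>X Y. X <+>\<^bsub>A\<^esub> Y),
      smult = (\<lambda>a X. \<Union>x\<in>X. B +>\<^bsub>A\<^esub> (a \<odot>\<^bsub>A\<^esub> x)),
      mgr = (\<lambda>n. (\<lambda>z. B +>\<^bsub>A\<^esub> z) ` (Z \<inter> mgr A n))\<rparr>"

definition cycles :: "('a, 'b) cpx \<Rightarrow> int \<Rightarrow> 'b set" where
  "cycles C j = {x \<in> carrier (obj C j). diff C j x = \<zero>\<^bsub>obj C (j - 1)\<^esub>}"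

definition boundaries :: "('a, 'b) cpx \<Rightarrow> int \<Rightarrow> 'b set" where
  "boundaries C j = diff C (j + 1) ` carrier (obj C (j + 1))"

definition homology :: "('a, 'b) cpx \<Rightarrow> int \<Rightarrow> ('a, 'b set) gmod" where
  "homology C j = gquot (obj C j) (cycles C j) (boundaries C j)"

text \<open>The map induced on homology by a chain map \<open>f\<close> into \<open>D\<close>: the class of \<open>z\<close> goes to the class
  of \<open>f j z\<close>.\<close>

definition homology_map :: "('a, 'c) cpx \<Rightarrow> (int \<Rightarrow> 'b \<Rightarrow> 'c) \<Rightarrow> int \<Rightarrow> 'b set \<Rightarrow> 'c set" where
  "homology_map D f j X = (\<Union>z\<in>X. boundaries D j +>\<^bsub>obj D j\<^esub> f j z)"

definition hom_cpx :: "'a gring \<Rightarrow> ('a, 'b) cpx \<Rightarrow> ('a, 'c) gmod \<Rightarrow> ('a, 'b \<Rightarrow> 'c) cpx" where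
  "hom_cpx R C N =
     \<lparr>obj = (\<lambda>j. gHom R (obj C (- j)) N),
      diff = (\<lambda>j u. \<lambda>x\<in>carrier (obj C (1 - j)). u (diff C (1 - j) x))\<rparr>"

text \<open>For \<open>f\<close> from \<open>C'\<close> to \<open>C\<close> and \<open>h\<close> from \<open>N\<close> to \<open>N'\<close>, the map \<open>u \<mapsto> h \<circ> u \<circ> f\<close> from
  \<open>hom_cpx R C N\<close> to \<open>hom_cpx R C' N'\<close>.\<close>

definition hom_cpx_map ::
    "('a, 'd) cpx \<Rightarrow> (int \<Rightarrow> 'd \<Rightarrow> 'b) \<Rightarrow> ('n \<Rightarrow> 'k) \<Rightarrow> int \<Rightarrow> ('b \<Rightarrow> 'n) \<Rightarrow> 'd \<Rightarrow> 'k" where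
  "hom_cpx_map C' f h = (\<lambda>j u. \<lambda>x\<in>carrier (obj C' (- j)). h (u (f (- j) x)))"


section \<open>The standard graded free resolution\<close>

text \<open>The free graded module on the set \<open>G\<close>, the basis element of \<open>s \<in> G\<close> having degree \<open>dg s\<close>.\<close>

definition free_gmod :: "'a gring \<Rightarrow> 'g set \<Rightarrow> ('g \<Rightarrow> int) \<Rightarrow> ('a, 'g \<Rightarrow> 'a) gmod" where
  "free_gmod R G dg =
     (let F = {f. (\<forall>s\<in>G. f s \<in> carrier R) \<and> (\<forall>s. s \<notin> G \<longrightarrow> f s = \<zero>\<^bsub>R\<^esub>) \<and> finite {s. f s \<noteq> \<zero>\<^bsub>R\<^esub>}}
      in \<lparr>carrier = F,
          mult = undefined, one = undefined,
          zero = (\<lambda>s. \<zero>\<^bsub>R\<^esub>),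
          add = (\<lambda>f g s. f s \<oplus>\<^bsub>R\<^esub> g s),
          smult = (\<lambda>a f s. a \<otimes>\<^bsub>R\<^esub> f s),
          mgr = (\<lambda>n. {f \<in> F. \<forall>s\<in>G. f s \<in> rgr R (n - dg s)})\<rparr>)"

text \<open>\<open>F\<^sub>0\<close> is free on the nonzero homogeneous elements of \<open>M\<close>, and \<open>F\<^sub>n\<^sub>+\<^sub>1\<close> is free on the nonzero
  homogeneous elements of the kernel of \<open>F\<^sub>n \<rightarrow> F\<^sub>n\<^sub>-\<^sub>1\<close> (where \<open>F\<^sub>-\<^sub>1 = M\<close>). So that one type serves
  for all \<open>n\<close>, basis elements are named recursively: \<open>Elt d x\<close> is the generator of \<open>F\<^sub>0\<close> for
  \<open>x\<close> of degree \<open>d\<close>, and \<open>Syz d s\<close> is the generator of \<open>F\<^sub>n\<^sub>+\<^sub>1\<close> for the element of \<open>F\<^sub>n\<close> of degree \<open>d\<close>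
  whose finitely many nonzero coefficients are listed in \<open>s\<close>.\<close>

datatype ('a, 'm) gen = Elt int 'm | Syz int "(('a, 'm) gen \<times> 'a) fset"

primrec gen_deg :: "('a, 'm) gen \<Rightarrow> int" where
  "gen_deg (Elt d x) = d"
| "gen_deg (Syz d s) = d"

definition encode :: "'a gring \<Rightarrow> ('g \<Rightarrow> 'a) \<Rightarrow> ('g \<times> 'a) fset" where
  "encode R f = Abs_fset {(s, f s) | s. f s \<noteq> \<zero>\<^bsub>R\<^esub>}"

definition decode :: "'a gring \<Rightarrow> ('g \<times> 'a) fset \<Rightarrow> 'g \<Rightarrow> 'a" where
  "decode R S s = (if \<exists>a. (s, a) |\<in>| S then THE a. (s, a) |\<in>| S else \<zero>\<^bsub>R\<^esub>)"

primrec elt_val :: "('a, 'm) gen \<Rightarrow> 'm" where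
  "elt_val (Elt d x) = x"
| "elt_val (Syz d s) = undefined"

primrec syz_val :: "'a gring \<Rightarrow> ('a, 'm) gen \<Rightarrow> (('a, 'm) gen \<Rightarrow> 'a)" where
  "syz_val R (Elt d x) = undefined"
| "syz_val R (Syz d s) = decode R s"

text \<open>The augmentation of \<open>F\<^sub>0\<close> onto \<open>M\<close> and the differential of \<open>F\<^sub>n\<^sub>+\<^sub>1\<close> into \<open>F\<^sub>n\<close>: each sends a basis
  element to the element that it names.\<close>

definition res_aug :: "'a gring \<Rightarrow> ('a, 'm) gmod \<Rightarrow> (('a, 'm) gen \<Rightarrow> 'a) \<Rightarrow> 'm" where
  "res_aug R M f = (\<Oplus>\<^bsub>M\<^esub>s\<in>{s. f s \<noteq> \<zero>\<^bsub>R\<^esub>}. f s \<odot>\<^bsub>M\<^esub> elt_val s)"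

definition res_diff :: "'a gring \<Rightarrow> (('a, 'm) gen \<Rightarrow> 'a) \<Rightarrow> (('a, 'm) gen \<Rightarrow> 'a)" where
  "res_diff R f = (\<lambda>t. \<Oplus>\<^bsub>R\<^esub>s\<in>{s. f s \<noteq> \<zero>\<^bsub>R\<^esub>}. f s \<otimes>\<^bsub>R\<^esub> syz_val R s t)"

primrec res_gens :: "'a gring \<Rightarrow> ('a, 'm) gmod \<Rightarrow> nat \<Rightarrow> ('a, 'm) gen set" where
  "res_gens R M 0 = {Elt d x | d x. x \<in> mgr M d \<and> x \<noteq> \<zero>\<^bsub>M\<^esub>}"
| "res_gens R M (Suc n) =
     {Syz d (encode R f) | d f.
        f \<in> mgr (free_gmod R (res_gens R M n) gen_deg) d \<and> f \<noteq> (\<lambda>s. \<zero>\<^bsub>R\<^esub>) \<and>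
        (if n = 0 then res_aug R M f = \<zero>\<^bsub>M\<^esub> else res_diff R f = (\<lambda>s. \<zero>\<^bsub>R\<^esub>))}"

definition resolution :: "'a gring \<Rightarrow> ('a, 'm) gmod \<Rightarrow> ('a, ('a, 'm) gen \<Rightarrow> 'a) cpx" where
  "resolution R M =
     \<lparr>obj = (\<lambda>j. free_gmod R (if j < 0 then {} else res_gens R M (nat j)) gen_deg),
      diff = (\<lambda>j. if j \<le> 0 then (\<lambda>f s. \<zero>\<^bsub>R\<^esub>) else res_diff R)\<rparr>"


section \<open>The graded Ext modules\<close>

text \<open>Since the resolution vanishes in negative degrees, \<open>gExt R M N i\<close> is zero for \<open>i < 0\<close>.\<close>

definition gExt :: "'a gring \<Rightarrow> ('a, 'm) gmod \<Rightarrow> ('a, 'n) gmod \<Rightarrow> int \<Rightarrow>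
    ('a, ((('a, 'm) gen \<Rightarrow> 'a) \<Rightarrow> 'n) set) gmod" where
  "gExt R M N i = homology (hom_cpx R (resolution R M) N) (- i)"

text \<open>Functoriality of Ext: for \<open>g\<close> from \<open>M'\<close> to \<open>M\<close> and \<open>h\<close> from \<open>N\<close> to \<open>N'\<close> the map from
  \<open>gExt R M N i\<close> to \<open>gExt R M' N' i\<close> is induced by a lift of \<open>g\<close> to the resolutions; by the
  comparison theorem a lift exists and the induced map does not depend on its choice.\<close>

definition lifts :: "'a gring \<Rightarrow> ('a, 'm) gmod \<Rightarrow> ('a, 'k) gmod \<Rightarrow> ('m \<Rightarrow> 'k) \<Rightarrow>
    (int \<Rightarrow> (('a, 'm) gen \<Rightarrow> 'a) \<Rightarrow> (('a, 'k) gen \<Rightarrow> 'a)) \<Rightarrow> bool" where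
  "lifts R M' M g p \<longleftrightarrow>
     chain_map R (resolution R M') (resolution R M) p \<and>
     (\<forall>x\<in>carrier (obj (resolution R M') 0). res_aug R M (p 0 x) = g (res_aug R M' x))"

definition gExt_map :: "'a gring \<Rightarrow> ('a, 'm) gmod \<Rightarrow> ('a, 'k) gmod \<Rightarrow> ('a, 'l) gmod \<Rightarrow>
    ('m \<Rightarrow> 'k) \<Rightarrow> ('n \<Rightarrow> 'l) \<Rightarrow> int \<Rightarrow>
    ((('a, 'k) gen \<Rightarrow> 'a) \<Rightarrow> 'n) set \<Rightarrow> ((('a, 'm) gen \<Rightarrow> 'a) \<Rightarrow> 'l) set" where
  "gExt_map R M' M N' g h i =
     homology_map (hom_cpx R (resolution R M') N')
       (hom_cpx_map (resolution R M') (SOME p. lifts R M' M g p) h) (- i)"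


section \<open>Situations, and naturality in them\<close>

text \<open>A nonnegative complex \<open>cx\<close>, a module \<open>md\<close> identified with its 0-th homology by \<open>idn\<close>,
  and a coefficient module \<open>cf\<close>.\<close>

record ('a, 'c, 'm, 'n) situation =
  cx :: "('a, 'c) cpx"
  md :: "('a, 'm) gmod"
  idn :: "'c set \<Rightarrow> 'm"
  cf :: "('a, 'n) gmod"

definition is_situation :: "'a gring \<Rightarrow> ('a, 'c, 'm, 'n) situation \<Rightarrow> bool" where
  "is_situation R S \<longleftrightarrow>
     graded_complex R (cx S) \<and> (\<forall>j<0. zero_module (obj (cx S) j)) \<and>
     graded_module R (md S) \<and> graded_module R (cf S) \<and>
     graded_iso R (homology (cx S) 0) (md S) (idn S)"

text \<open>A morphism from \<open>S\<close> to \<open>S'\<close> consists of maps of complexes and of modules from those of \<open>S'\<close> to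
  those of \<open>S\<close>, compatible with the identifications, and a map from the coefficients of \<open>S\<close> to
  those of \<open>S'\<close>: cohomology and Ext are both contravariant in the complex and covariant in the
  coefficients.\<close>

definition situation_hom :: "'a gring \<Rightarrow> ('a, 'c, 'm, 'n) situation \<Rightarrow> ('a, 'c, 'm, 'n) situation \<Rightarrow>
    (int \<Rightarrow> 'c \<Rightarrow> 'c) \<Rightarrow> ('m \<Rightarrow> 'm) \<Rightarrow> ('n \<Rightarrow> 'n) \<Rightarrow> bool" where
  "situation_hom R S S' f g h \<longleftrightarrow>
     chain_map R (cx S') (cx S) f \<and> graded_hom R (md S') (md S) g \<and>
     graded_hom R (cf S) (cf S') h \<and>
     (\<forall>X\<in>carrier (homology (cx S') 0). g (idn S' X) = idn S (homology_map (cx S) f 0 X))"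

text \<open>A functor on situations consists of a value at \<open>S\<close>
  and a map for every morphism of situations.\<close>

type_synonym ('a, 'c, 'm, 'n, 'x) sit_functor =
  "(('a, 'c, 'm, 'n) situation \<Rightarrow> ('a, 'x) gmod) \<times>
   (('a, 'c, 'm, 'n) situation \<Rightarrow> ('a, 'c, 'm, 'n) situation \<Rightarrow>
      (int \<Rightarrow> 'c \<Rightarrow> 'c) \<Rightarrow> ('m \<Rightarrow> 'm) \<Rightarrow> ('n \<Rightarrow> 'n) \<Rightarrow> 'x \<Rightarrow> 'x)"

definition coho_functor :: "'a gring \<Rightarrow> int \<Rightarrow> ('a, 'c, 'm, 'n, ('c \<Rightarrow> 'n) set) sit_functor" where
  "coho_functor R i =
     (\<lambda>S. homology (hom_cpx R (cx S) (cf S)) (- i),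
      \<lambda>S S' f g h. homology_map (hom_cpx R (cx S') (cf S')) (hom_cpx_map (cx S') f h) (- i))"

definition ext_functor :: "'a gring \<Rightarrow> int \<Rightarrow>
    ('a, 'c, 'm, 'n, ((('a, 'm) gen \<Rightarrow> 'a) \<Rightarrow> 'n) set) sit_functor" where
  "ext_functor R i =
     (\<lambda>S. gExt R (md S) (cf S) i,
      \<lambda>S S' f g h. gExt_map R (md S') (md S) (cf S') g h i)"

definition natural_hom :: "'a gring \<Rightarrow> ('a, 'c, 'm, 'n) situation set \<Rightarrow>
    ('a, 'c, 'm, 'n, 'x) sit_functor \<Rightarrow> ('a, 'c, 'm, 'n, 'y) sit_functor \<Rightarrow>
    (('a, 'c, 'm, 'n) situation \<Rightarrow> 'x \<Rightarrow> 'y) \<Rightarrow> bool" where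
  "natural_hom R \<S> F G \<tau> \<longleftrightarrow>
     (\<forall>S\<in>\<S>. graded_hom R (fst F S) (fst G S) (\<tau> S)) \<and>
     (\<forall>S\<in>\<S>. \<forall>S'\<in>\<S>. \<forall>f g h. situation_hom R S S' f g h \<longrightarrow>
        (\<forall>x\<in>carrier (fst F S). \<tau> S' (snd F S S' f g h x) = snd G S S' f g h (\<tau> S x)))"

definition natural_iso_exists where
  "natural_iso_exists R \<S> F G \<longleftrightarrow>
     (\<exists>\<tau>. natural_hom R \<S> F G \<tau> \<and> (\<forall>S\<in>\<S>. graded_iso R (fst F S) (fst G S) (\<tau> S)))"

definition natural_surj_exists where
  "natural_surj_exists R \<S> F G \<longleftrightarrow>
     (\<exists>\<tau>. natural_hom R \<S> F G \<tau> \<and> (\<forall>S\<in>\<S>. graded_surj R (fst F S) (fst G S) (\<tau> S)))"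

definition natural_inj_exists where
  "natural_inj_exists R \<S> F G \<longleftrightarrow>
     (\<exists>\<tau>. natural_hom R \<S> F G \<tau> \<and> (\<forall>S\<in>\<S>. graded_inj R (fst F S) (fst G S) (\<tau> S)))"

text \<open>\<open>F S\<close> is isomorphic, by \<open>\<iota> S\<close>, to a homogeneous submodule \<open>L S\<close> of the homomorphic image \<open>Q S\<close>
  of \<open>G S\<close> under \<open>p S\<close>, where \<open>Q\<close>, \<open>p\<close> and \<open>\<iota>\<close> are natural (functoriality of \<open>Q\<close> is automatic,
  as \<open>p S\<close> is surjective). Every homomorphic image of \<open>G S\<close> is isomorphic to a module of
  cosets in \<open>G S\<close>, so it is no restriction to take the elements of \<open>Q S\<close> in the type
  \<open>'y set\<close>.\<close>

definition natural_subquotient :: "'a gring \<Rightarrow> ('a, 'c, 'm, 'n) situation set \<Rightarrow>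
    ('a, 'c, 'm, 'n, 'x) sit_functor \<Rightarrow> ('a, 'c, 'm, 'n, 'y) sit_functor \<Rightarrow> bool" where
  "natural_subquotient R \<S> F G \<longleftrightarrow>
     (\<exists>(Q :: ('a, 'c, 'm, 'n) situation \<Rightarrow> ('a, 'y set) gmod) p L \<iota>.
        (\<forall>S\<in>\<S>. graded_module R (Q S) \<and> graded_surj R (fst G S) (Q S) (p S) \<and>
           homogeneous_submodule R (Q S) (L S) \<and>
           graded_iso R (fst F S) (restrict_gmod (Q S) (L S)) (\<iota> S)) \<and>
        (\<forall>S\<in>\<S>. \<forall>S'\<in>\<S>. \<forall>f g h. situation_hom R S S' f g h \<longrightarrow>
           (\<exists>q. graded_hom R (Q S) (Q S') q \<and>
              (\<forall>x\<in>carrier (fst G S). q (p S x) = p S' (snd G S S' f g h x)) \<and>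
              (\<forall>x\<in>carrier (fst F S). q (\<iota> S x) = \<iota> S' (snd F S S' f g h x)))))"


section \<open>The vanishing conditions\<close>

definition condU :: "'a gring \<Rightarrow> ('a, 'c, 'm, 'n) situation \<Rightarrow> int \<Rightarrow> bool" where
  "condU R S l \<longleftrightarrow>
     (\<forall>j. 1 \<le> j \<and> j \<le> l \<longrightarrow> zero_module (gExt R (homology (cx S) j) (cf S) (l - j)))"

definition condV :: "'a gring \<Rightarrow> ('a, 'c, 'm, 'n) situation \<Rightarrow> int \<Rightarrow> bool" where
  "condV R S l \<longleftrightarrow>
     (\<forall>j. 0 \<le> j \<and> j \<le> l - 1 \<longrightarrow> zero_module (gExt R (obj (cx S) j) (cf S) (l - j)))"

end

theory Submission
  imports Defs
begin

text \<open>Let \<open>P \<rightarrow> C\<close> be a surjective quasi-isomorphism from a nonnegative complex of free modules, and let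
  \<open>F \<rightarrow> M\<close> be the standard resolution. Since \<open>P\<close> is free, \<open>P \<rightarrow> C \<rightarrow> M\<close> lifts to \<open>P \<rightarrow> F\<close>, uniquely up to homotopy,
  and there are two natural maps into one module:
  \<open>\<beta>: H\<^sup>i(Hom(C, N)) \<rightarrow> H\<^sup>i(Hom(P, N))\<close> and \<open>\<alpha>: Ext\<^sup>i(M, N) \<rightarrow> H\<^sup>i(Hom(P, N))\<close>.
  Each of them is injective (surjective) when the cohomology of \<open>Hom(K, N)\<close> vanishes in degree \<open>i\<close> (\<open>i + 1\<close>), where
  \<open>K\<close> is the mapping cone of \<open>P \<rightarrow> C\<close> or of \<open>P \<rightarrow> F\<close>. For any nonnegative complex \<open>K\<close>, the cohomology of
  \<open>Hom(K, N)\<close> in degree \<open>l\<close> vanishes if \<open>Ext\<^sup>l\<^sup>-\<^sup>j(H\<^sub>j(K), N) = 0\<close> for all \<open>j \<le> l\<close> and \<open>Ext\<^sup>l\<^sup>-\<^sup>1\<^sup>-\<^sup>j(K\<^sub>j, N) = 0\<close> for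
  all \<open>j \<le> l - 2\<close>: a cocycle kills the cycles and so factors through the boundaries, and the obstruction to extending it
  to \<open>K\<^sub>l\<^sub>-\<^sub>1\<close> is removed by descending through the cokernels \<open>K\<^sub>j / B\<^sub>j\<close>. The cone of \<open>P \<rightarrow> C\<close> is acyclic and its
  terms are those of \<open>C\<close> up to free summands, so the conditions \<open>V\<close> control \<open>\<beta>\<close>; the cone of \<open>P \<rightarrow> F\<close> is free and its
  homology is that of \<open>C\<close> in positive degrees, shifted by one, so the conditions \<open>U\<close> control \<open>\<alpha>\<close>. All seven
  statements follow by composing one of the maps with the inverse of the other, or by passing to subquotients.\<close>

section \<open>Graded modules\<close>

text \<open>Neither complex maps to the other directly: the terms of \<open>C\<close> need not be
  projective, so \<open>C \<rightarrow> M\<close> does not lift to \<open>C \<rightarrow> F\<close>,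
  and \<open>C\<close> need not be exact, so \<open>F \<rightarrow> M\<close> does not lift to
  \<open>F \<rightarrow> C\<close>. The free complex \<open>P\<close> maps to both. Hence \<alpha>
  and \<beta> point into the same module, and each statement asks either that one of them be
  bijective or that one be onto and the other injective. Degrees \<open>i\<close> and
  \<open>i + 1\<close> of the two cones see the conditions with index \<open>i - 1\<close> and
  \<open>i\<close>, which explains the pairs of hypotheses.

  Long exact sequences are never formed. Vanishing is an extension property of homogeneous cocycles
  (\<open>coh_vanishes\<close>); it does not depend on the projective complex chosen over a given
  base, so the cone of a lift of an injection may serve as a resolution of the cokernel.

  Types cannot be quantified inside a formula, so \<open>P\<close> is a canonical complex over one
  recursive type of generators, like the standard resolution. Maps between such complexes are chosen
  lifts; the choice is harmless, since two lifts of one map are homotopic.\<close>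

lemma module_image:
  fixes M :: "('a, 'b, 'm) module_scheme" and K :: "('a, 'c, 'k) module_scheme"
  assumes M: "module R M" and im: "f ` carrier M = carrier K"
    and add: "\<And>x y. x \<in> carrier M \<Longrightarrow> y \<in> carrier M \<Longrightarrow> f (x \<oplus>\<^bsub>M\<^esub> y) = f x \<oplus>\<^bsub>K\<^esub> f y"
    and zero: "f \<zero>\<^bsub>M\<^esub> = \<zero>\<^bsub>K\<^esub>"
    and smult: "\<And>a x. a \<in> carrier R \<Longrightarrow> x \<in> carrier M \<Longrightarrow> f (a \<odot>\<^bsub>M\<^esub> x) = a \<odot>\<^bsub>K\<^esub> f x"
  shows "module R K"
proof -
  interpret M: module R M by (rule M)
  have ex: "\<exists>x\<in>carrier M. X = f x" if "X \<in> carrier K" for X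
    using that im by blast
  have cl: "f x \<in> carrier K" if "x \<in> carrier M" for x
    using that im by blast
  have "abelian_group K"
  proof (rule abelian_groupI)
    show "x \<oplus>\<^bsub>K\<^esub> y \<in> carrier K" if "x \<in> carrier K" "y \<in> carrier K" for x y
      using ex[OF that(1)] ex[OF that(2)] add cl by (metis M.a_closed)
    show "\<zero>\<^bsub>K\<^esub> \<in> carrier K"
      using cl[of "\<zero>\<^bsub>M\<^esub>"] zero by simp
    show "x \<oplus>\<^bsub>K\<^esub> y \<oplus>\<^bsub>K\<^esub> z = x \<oplus>\<^bsub>K\<^esub> (y \<oplus>\<^bsub>K\<^esub> z)"
      if "x \<in> carrier K" "y \<in> carrier K" "z \<in> carrier K" for x y z
      using ex[OF that(1)] ex[OF that(2)] ex[OF that(3)] add by (metis M.a_closed M.a_assoc)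
    show "x \<oplus>\<^bsub>K\<^esub> y = y \<oplus>\<^bsub>K\<^esub> x" if "x \<in> carrier K" "y \<in> carrier K" for x y
      using ex[OF that(1)] ex[OF that(2)] add by (metis M.a_comm)
    show "\<zero>\<^bsub>K\<^esub> \<oplus>\<^bsub>K\<^esub> x = x" if "x \<in> carrier K" for x
      using ex[OF that] add zero by (metis M.l_zero M.zero_closed)
    show "\<exists>y\<in>carrier K. y \<oplus>\<^bsub>K\<^esub> x = \<zero>\<^bsub>K\<^esub>" if "x \<in> carrier K" for x
      using ex[OF that] add zero cl by (metis M.l_neg M.a_inv_closed)
  qed
  then show ?thesis
  proof (rule moduleI[OF M.is_cring])
    show "a \<odot>\<^bsub>K\<^esub> x \<in> carrier K" if "a \<in> carrier R" "x \<in> carrier K" for a x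
      using ex[OF that(2)] smult cl that by (metis M.smult_closed)
    show "(a \<oplus>\<^bsub>R\<^esub> b) \<odot>\<^bsub>K\<^esub> x = a \<odot>\<^bsub>K\<^esub> x \<oplus>\<^bsub>K\<^esub> b \<odot>\<^bsub>K\<^esub> x"
      if "a \<in> carrier R" "b \<in> carrier R" "x \<in> carrier K" for a b x
      using ex[OF that(3)] smult add that
      by (metis M.smult_closed M.smult_l_distr M.R.a_closed)
    show "a \<odot>\<^bsub>K\<^esub> (x \<oplus>\<^bsub>K\<^esub> y) = a \<odot>\<^bsub>K\<^esub> x \<oplus>\<^bsub>K\<^esub> a \<odot>\<^bsub>K\<^esub> y"
      if "a \<in> carrier R" "x \<in> carrier K" "y \<in> carrier K" for a x y
      using ex[OF that(2)] ex[OF that(3)] smult add that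
      by (metis M.smult_closed M.smult_r_distr M.a_closed)
    show "(a \<otimes>\<^bsub>R\<^esub> b) \<odot>\<^bsub>K\<^esub> x = a \<odot>\<^bsub>K\<^esub> (b \<odot>\<^bsub>K\<^esub> x)"
      if "a \<in> carrier R" "b \<in> carrier R" "x \<in> carrier K" for a b x
      using ex[OF that(3)] smult that
      by (metis M.smult_closed M.smult_assoc1 M.R.m_closed)
    show "\<one>\<^bsub>R\<^esub> \<odot>\<^bsub>K\<^esub> x = x" if "x \<in> carrier K" for x
      using ex[OF that] smult by (metis M.smult_one M.R.one_closed)
  qed
qed

text \<open>Two decompositions of one element differ by a finite homogeneous sum equal to zero, so
  uniqueness reduces to independence. A finite expression over any index set becomes one over its
  exact support once zero terms are dropped.\<close>

lemma graded_by_I: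
  assumes G: "abelian_group G"
    and sub: "\<And>n. additive_subgroup (A n) G"
    and ex: "\<And>x. x \<in> carrier G \<Longrightarrow>
      \<exists>F g. finite F \<and> (\<forall>n\<in>F. g n \<in> A n) \<and> x = (\<Oplus>\<^bsub>G\<^esub>n\<in>F. g n)"
    and ind: "\<And>F g. finite F \<Longrightarrow> (\<And>n. n \<in> F \<Longrightarrow> g n \<in> A n) \<Longrightarrow>
      (\<Oplus>\<^bsub>G\<^esub>n\<in>F. g n) = \<zero>\<^bsub>G\<^esub> \<Longrightarrow> \<forall>n\<in>F. g n = \<zero>\<^bsub>G\<^esub>"
  shows "graded_by G A"
proof -
  interpret G: abelian_group G by (rule G)
  have Ac: "\<And>n x. x \<in> A n \<Longrightarrow> x \<in> carrier G"
    using additive_subgroup.a_subset[OF sub] by blast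
  have A0: "\<zero>\<^bsub>G\<^esub> \<in> A n" for n
    using additive_subgroup.zero_closed[OF sub] .
  have "\<exists>!f. (\<forall>n. f n \<in> A n) \<and> finite {n. f n \<noteq> \<zero>\<^bsub>G\<^esub>} \<and>
        x = (\<Oplus>\<^bsub>G\<^esub>n\<in>{n. f n \<noteq> \<zero>\<^bsub>G\<^esub>}. f n)" if x: "x \<in> carrier G" for x
  proof -
    obtain F g where F: "finite F" "\<forall>n\<in>F. g n \<in> A n" "x = (\<Oplus>\<^bsub>G\<^esub>n\<in>F. g n)"
      using ex[OF x] by blast
    define f where "f n = (if n \<in> F then g n else \<zero>\<^bsub>G\<^esub>)" for n
    show ?thesis
    proof (rule ex1I[of _ f], intro conjI)
      show "\<forall>n. f n \<in> A n" using F(2) A0 by (simp add: f_def)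
      have sub: "{n. f n \<noteq> \<zero>\<^bsub>G\<^esub>} \<subseteq> F" by (auto simp: f_def)
      then show "finite {n. f n \<noteq> \<zero>\<^bsub>G\<^esub>}" using F(1) finite_subset by blast
      have "x = (\<Oplus>\<^bsub>G\<^esub>n\<in>F. f n)"
        unfolding F(3) by (rule G.finsum_cong') (use F(2) Ac in \<open>auto simp: f_def\<close>)
      also have "\<dots> = (\<Oplus>\<^bsub>G\<^esub>n\<in>{n. f n \<noteq> \<zero>\<^bsub>G\<^esub>}. f n)"
        by (rule G.add.finprod_mono_neutral_cong_right[OF F(1) sub])
          (use F(2) Ac in \<open>auto simp: f_def\<close>)
      finally show "x = (\<Oplus>\<^bsub>G\<^esub>n\<in>{n. f n \<noteq> \<zero>\<^bsub>G\<^esub>}. f n)" .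
    next
      fix h assume h: "(\<forall>n. h n \<in> A n) \<and> finite {n. h n \<noteq> \<zero>\<^bsub>G\<^esub>} \<and>
        x = (\<Oplus>\<^bsub>G\<^esub>n\<in>{n. h n \<noteq> \<zero>\<^bsub>G\<^esub>}. h n)"
      \<comment> \<open>The supports of the two decompositions need not agree; over their union they
        can be subtracted term by term.\<close>
      define E where "E = F \<union> {n. h n \<noteq> \<zero>\<^bsub>G\<^esub>}"
      have E: "finite E" using F(1) h by (simp add: E_def)
      have fA: "f n \<in> A n" for n using F(2) A0 by (simp add: f_def)
      have hA: "h n \<in> A n" for n using h by blast
      have 1: "x = (\<Oplus>\<^bsub>G\<^esub>n\<in>E. f n)"
        unfolding F(3) by (rule G.add.finprod_mono_neutral_cong_left[OF E])
          (use F(2) Ac in \<open>force simp: f_def E_def\<close>)+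
      have xh: "x = (\<Oplus>\<^bsub>G\<^esub>n\<in>{n. h n \<noteq> \<zero>\<^bsub>G\<^esub>}. h n)" using h by blast
      have 2: "x = (\<Oplus>\<^bsub>G\<^esub>n\<in>E. h n)"
        apply (subst xh) by (rule G.add.finprod_mono_neutral_cong_left[OF E])
          (use hA Ac in \<open>auto simp: E_def\<close>)
      have mA: "\<ominus>\<^bsub>G\<^esub> h n \<in> A n" for n
        using additive_subgroup.a_inv_closed[OF sub hA] .
      have dA: "f n \<oplus>\<^bsub>G\<^esub> \<ominus>\<^bsub>G\<^esub> h n \<in> A n" for n
        using additive_subgroup.a_closed[OF sub fA mA] .
      \<comment> \<open>Adding the termwise differences to the sum for \<open>h\<close> gives the
        sum for \<open>f\<close>. Both sums are \<open>x\<close>, so the differences sum to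
        zero.\<close>
      have 3: "(\<Oplus>\<^bsub>G\<^esub>n\<in>E. h n) \<oplus>\<^bsub>G\<^esub> (\<Oplus>\<^bsub>G\<^esub>n\<in>E. f n \<oplus>\<^bsub>G\<^esub> \<ominus>\<^bsub>G\<^esub> h n)
          = (\<Oplus>\<^bsub>G\<^esub>n\<in>E. h n \<oplus>\<^bsub>G\<^esub> (f n \<oplus>\<^bsub>G\<^esub> \<ominus>\<^bsub>G\<^esub> h n))"
        by (rule G.finsum_addf[symmetric]) (use Ac hA dA in auto)
      have "\<dots> = (\<Oplus>\<^bsub>G\<^esub>n\<in>E. f n)"
      proof (rule G.finsum_cong')
        fix n
        have "h n \<in> carrier G" "f n \<in> carrier G" using Ac hA fA by auto
        then show "h n \<oplus>\<^bsub>G\<^esub> (f n \<oplus>\<^bsub>G\<^esub> \<ominus>\<^bsub>G\<^esub> h n) = f n"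
          by (simp add: G.a_lcomm G.r_neg)
      qed (use Ac fA in auto)
      with 1 2 3 have "x \<oplus>\<^bsub>G\<^esub> (\<Oplus>\<^bsub>G\<^esub>n\<in>E. f n \<oplus>\<^bsub>G\<^esub> \<ominus>\<^bsub>G\<^esub> h n) = x" by simp
      moreover have "(\<Oplus>\<^bsub>G\<^esub>n\<in>E. f n \<oplus>\<^bsub>G\<^esub> \<ominus>\<^bsub>G\<^esub> h n) \<in> carrier G"
        by (rule G.finsum_closed) (use Ac dA in auto)
      ultimately have "(\<Oplus>\<^bsub>G\<^esub>n\<in>E. f n \<oplus>\<^bsub>G\<^esub> \<ominus>\<^bsub>G\<^esub> h n) = \<zero>\<^bsub>G\<^esub>"
        using x G.r_neg1[OF x] G.l_neg[OF x] by metis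
      then have 4: "\<forall>n\<in>E. f n \<oplus>\<^bsub>G\<^esub> \<ominus>\<^bsub>G\<^esub> h n = \<zero>\<^bsub>G\<^esub>"
        using ind[OF E, of "\<lambda>n. f n \<oplus>\<^bsub>G\<^esub> \<ominus>\<^bsub>G\<^esub> h n"] dA by blast
      show "h = f"
      proof
        fix n
        show "h n = f n"
        proof (cases "n \<in> E")
          case True
          with 4 have "f n \<oplus>\<^bsub>G\<^esub> \<ominus>\<^bsub>G\<^esub> h n = \<zero>\<^bsub>G\<^esub>" by blast
          then show ?thesis
            by (metis G.minus_equality G.minus_minus G.a_inv_closed Ac fA hA)
        next
          case False
          then show ?thesis by (auto simp: E_def f_def)
        qed
      qed
    qed
  qed
  then show ?thesis using sub unfolding graded_by_def by blast
qed

section \<open>Rules of calculation in graded modules\<close>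

locale graded_base =
  fixes R :: "'a gring"
  assumes graded_ring: "graded_ring R"
begin

lemma cring: "cring R" and rgr_graded: "graded_by R (rgr R)"
  and rgr_mult: "a \<in> rgr R m \<Longrightarrow> b \<in> rgr R n \<Longrightarrow> a \<otimes>\<^bsub>R\<^esub> b \<in> rgr R (m + n)"
  using graded_ring unfolding graded_ring_def by auto

lemma
  assumes "graded_module R M"
  shows gm_module: "module R M" and gm_graded: "graded_by M (mgr M)"
    and gm_smult_mgr: "a \<in> rgr R m \<Longrightarrow> x \<in> mgr M n \<Longrightarrow> a \<odot>\<^bsub>M\<^esub> x \<in> mgr M (m + n)"
    and gm_mgr: "additive_subgroup (mgr M n) M"
    and gm_abelian: "abelian_group M"
  using assms unfolding graded_module_def graded_by_def module_def by auto

lemma mgr_carrier: "graded_module R M \<Longrightarrow> x \<in> mgr M n \<Longrightarrow> x \<in> carrier M"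
  using additive_subgroup.a_subset[OF gm_mgr] by blast

lemma mgr_zero [simp]: "graded_module R M \<Longrightarrow> \<zero>\<^bsub>M\<^esub> \<in> mgr M n"
  using additive_subgroup.zero_closed[OF gm_mgr] .

lemma mgr_add [simp]:
  "graded_module R M \<Longrightarrow> x \<in> mgr M n \<Longrightarrow> y \<in> mgr M n \<Longrightarrow> x \<oplus>\<^bsub>M\<^esub> y \<in> mgr M n"
  using additive_subgroup.a_closed[OF gm_mgr] .

lemma mgr_neg [simp]: "graded_module R M \<Longrightarrow> x \<in> mgr M n \<Longrightarrow> \<ominus>\<^bsub>M\<^esub> x \<in> mgr M n"
  using additive_subgroup.a_inv_closed[OF gm_mgr] .

lemmas gm_monoid = abelian_group.axioms(1)[OF gm_abelian]

lemmas gm_zero [simp] = abelian_monoid.zero_closed[OF gm_monoid]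
  and gm_add [simp] = abelian_monoid.a_closed[OF gm_monoid]
  and gm_l_zero [simp] = abelian_monoid.l_zero[OF gm_monoid]
  and gm_r_zero [simp] = abelian_monoid.r_zero[OF gm_monoid]
  and gm_assoc = abelian_monoid.a_assoc[OF gm_monoid]
  and gm_comm = abelian_monoid.a_comm[OF gm_monoid]
  and gm_lcomm = abelian_monoid.a_lcomm[OF gm_monoid]
  and gm_neg [simp] = abelian_group.a_inv_closed[OF gm_abelian]
  and gm_l_neg [simp] = abelian_group.l_neg[OF gm_abelian]
  and gm_r_neg [simp] = abelian_group.r_neg[OF gm_abelian]
  and gm_neg_neg [simp] = abelian_group.minus_minus[OF gm_abelian]
  and gm_neg_add = abelian_group.minus_add[OF gm_abelian]
  and gm_cancel1 [simp] = abelian_group.r_neg1[OF gm_abelian]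
  and gm_cancel2 [simp] = abelian_group.r_neg2[OF gm_abelian]
  and gm_smult [simp] = module.smult_closed[OF gm_module]
  and gm_smult_zero [simp] = module.smult_r_null[OF gm_module]
  and gm_zero_smult [simp] = module.smult_l_null[OF gm_module]
  and gm_one_smult [simp] = module.smult_one[OF gm_module]
  and gm_smult_add = module.smult_r_distr[OF gm_module]
  and gm_add_smult = module.smult_l_distr[OF gm_module]
  and gm_mult_smult = module.smult_assoc1[OF gm_module]
  and gm_smult_neg = module.smult_r_minus[OF gm_module]

lemma
  assumes "graded_module R M"
  shows gm_neg_eqI: "x \<in> carrier M \<Longrightarrow> y \<in> carrier M \<Longrightarrow> x \<oplus>\<^bsub>M\<^esub> y = \<zero>\<^bsub>M\<^esub> \<Longrightarrow> x = \<ominus>\<^bsub>M\<^esub> y"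
    and gm_eq_diff: "x \<in> carrier M \<Longrightarrow> y \<in> carrier M \<Longrightarrow> x \<oplus>\<^bsub>M\<^esub> \<ominus>\<^bsub>M\<^esub> y = \<zero>\<^bsub>M\<^esub> \<Longrightarrow> x = y"
    and gm_neg_zero [simp]: "\<ominus>\<^bsub>M\<^esub> \<zero>\<^bsub>M\<^esub> = \<zero>\<^bsub>M\<^esub>"
proof -
  interpret M: module R M by (rule gm_module[OF assms])
  show "x \<oplus>\<^bsub>M\<^esub> y = \<zero>\<^bsub>M\<^esub> \<Longrightarrow> x = \<ominus>\<^bsub>M\<^esub> y" if "x \<in> carrier M" "y \<in> carrier M"
    using that M.minus_equality[of x y] by simp
  show "x \<oplus>\<^bsub>M\<^esub> \<ominus>\<^bsub>M\<^esub> y = \<zero>\<^bsub>M\<^esub> \<Longrightarrow> x = y" if "x \<in> carrier M" "y \<in> carrier M"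
    using that M.minus_equality[of x "\<ominus>\<^bsub>M\<^esub> y"] by simp
  show "\<ominus>\<^bsub>M\<^esub> \<zero>\<^bsub>M\<^esub> = \<zero>\<^bsub>M\<^esub>" by simp
qed

lemmas gm_ac = gm_assoc gm_comm gm_lcomm

end


section \<open>Homogeneous components\<close>

lemma graded_by_ex:
  assumes "graded_by G A" "x \<in> carrier G"
  obtains f where "\<And>n. f n \<in> A n" "finite {n. f n \<noteq> \<zero>\<^bsub>G\<^esub>}" "x = (\<Oplus>\<^bsub>G\<^esub>n\<in>{n. f n \<noteq> \<zero>\<^bsub>G\<^esub>}. f n)"
  using assms unfolding graded_by_def by blast

definition component :: "('b, 'x) ring_scheme \<Rightarrow> (int \<Rightarrow> 'b set) \<Rightarrow> 'b \<Rightarrow> int \<Rightarrow> 'b" where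
  "component G A x = (THE f. (\<forall>n. f n \<in> A n) \<and> finite {n. f n \<noteq> \<zero>\<^bsub>G\<^esub>} \<and>
     x = (\<Oplus>\<^bsub>G\<^esub>n\<in>{n. f n \<noteq> \<zero>\<^bsub>G\<^esub>}. f n))"

lemma
  assumes "graded_by G A" "x \<in> carrier G"
  shows component_mem: "component G A x n \<in> A n"
    and component_finite: "finite {n. component G A x n \<noteq> \<zero>\<^bsub>G\<^esub>}"
    and component_sum: "(\<Oplus>\<^bsub>G\<^esub>n\<in>{n. component G A x n \<noteq> \<zero>\<^bsub>G\<^esub>}. component G A x n) = x"
proof -
  have "\<exists>!f. (\<forall>n. f n \<in> A n) \<and> finite {n. f n \<noteq> \<zero>\<^bsub>G\<^esub>} \<and> x = (\<Oplus>\<^bsub>G\<^esub>n\<in>{n. f n \<noteq> \<zero>\<^bsub>G\<^esub>}. f n)"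
    using assms unfolding graded_by_def by blast
  from theI'[OF this, folded component_def]
  show "component G A x n \<in> A n" "finite {n. component G A x n \<noteq> \<zero>\<^bsub>G\<^esub>}"
    "(\<Oplus>\<^bsub>G\<^esub>n\<in>{n. component G A x n \<noteq> \<zero>\<^bsub>G\<^esub>}. component G A x n) = x" by auto
qed

text \<open>The index set may contain degrees whose term is zero, so components can be read off any
  finite homogeneous expression.\<close>

lemma component_eqI:
  assumes G: "abelian_group G" and gr: "graded_by G A"
    and F: "finite F" "\<And>n. n \<in> F \<Longrightarrow> g n \<in> A n" and x: "x = (\<Oplus>\<^bsub>G\<^esub>n\<in>F. g n)"
  shows "component G A x n = (if n \<in> F then g n else \<zero>\<^bsub>G\<^esub>)"
proof -
  interpret G: abelian_group G by (rule G)
  have sub: "additive_subgroup (A n) G" for n using gr unfolding graded_by_def by blast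
  have Ac: "\<And>n x. x \<in> A n \<Longrightarrow> x \<in> carrier G"
    using additive_subgroup.a_subset[OF sub] by blast
  have xc: "x \<in> carrier G" unfolding x by (rule G.finsum_closed) (use F Ac in auto)
  define f where "f n = (if n \<in> F then g n else \<zero>\<^bsub>G\<^esub>)" for n
  have ex1: "\<exists>!f. (\<forall>n. f n \<in> A n) \<and> finite {n. f n \<noteq> \<zero>\<^bsub>G\<^esub>} \<and> x = (\<Oplus>\<^bsub>G\<^esub>n\<in>{n. f n \<noteq> \<zero>\<^bsub>G\<^esub>}. f n)"
    using gr xc unfolding graded_by_def by blast
  have "component G A x = f"
    unfolding component_def
  proof (rule the1_equality[OF ex1], intro conjI allI)
    show "f n \<in> A n" for n using F(2) additive_subgroup.zero_closed[OF sub] by (simp add: f_def)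
    have s: "{n. f n \<noteq> \<zero>\<^bsub>G\<^esub>} \<subseteq> F" by (auto simp: f_def)
    then show "finite {n. f n \<noteq> \<zero>\<^bsub>G\<^esub>}" using F(1) finite_subset by blast
    show "x = (\<Oplus>\<^bsub>G\<^esub>n\<in>{n. f n \<noteq> \<zero>\<^bsub>G\<^esub>}. f n)"
      unfolding x by (rule G.add.finprod_mono_neutral_cong_right[OF F(1) s])
        (use F(2) Ac in \<open>auto simp: f_def\<close>)
  qed
  then show ?thesis by (simp add: f_def)
qed

lemma component_homogeneous:
  assumes G: "abelian_group G" and gr: "graded_by G A" and x: "x \<in> A m"
  shows "component G A x n = (if n = m then x else \<zero>\<^bsub>G\<^esub>)"
proof -
  interpret G: abelian_group G by (rule G)
  have "additive_subgroup (A m) G" using gr unfolding graded_by_def by blast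
  then have "x \<in> carrier G" using x additive_subgroup.a_subset by blast
  then have "x = (\<Oplus>\<^bsub>G\<^esub>n\<in>{m}. x)" by simp
  from component_eqI[OF G gr _ _ this] x show ?thesis by auto
qed

lemma graded_by_independent:
  assumes G: "abelian_group G" and gr: "graded_by G A"
    and F: "finite F" "\<And>n. n \<in> F \<Longrightarrow> g n \<in> A n" and z: "(\<Oplus>\<^bsub>G\<^esub>n\<in>F. g n) = \<zero>\<^bsub>G\<^esub>" and n: "n \<in> F"
  shows "g n = \<zero>\<^bsub>G\<^esub>"
proof -
  have "\<zero>\<^bsub>G\<^esub> \<in> A n"
    using gr additive_subgroup.zero_closed unfolding graded_by_def by blast
  with component_homogeneous[OF G gr this, of n] component_eqI[OF G gr F z[symmetric], of n] n
  show ?thesis by simp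
qed

context graded_base
begin

abbreviation comp :: "('a, 'b) gmod \<Rightarrow> 'b \<Rightarrow> int \<Rightarrow> 'b" where
  "comp M \<equiv> component M (mgr M)"

lemma
  assumes "graded_module R M" "x \<in> carrier M"
  shows comp_mgr [simp]: "comp M x n \<in> mgr M n"
    and comp_carrier [simp]: "comp M x n \<in> carrier M"
    and comp_finite: "finite {n. comp M x n \<noteq> \<zero>\<^bsub>M\<^esub>}"
    and comp_sum: "(\<Oplus>\<^bsub>M\<^esub>n\<in>{n. comp M x n \<noteq> \<zero>\<^bsub>M\<^esub>}. comp M x n) = x"
  by (rule component_mem[OF gm_graded[OF assms(1)] assms(2)]
      component_finite[OF gm_graded[OF assms(1)] assms(2)]
      component_sum[OF gm_graded[OF assms(1)] assms(2)]
      mgr_carrier[OF assms(1) component_mem[OF gm_graded[OF assms(1)] assms(2)]])+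

lemma comp_homogeneous: "graded_module R M \<Longrightarrow> x \<in> mgr M m \<Longrightarrow>
    comp M x n = (if n = m then x else \<zero>\<^bsub>M\<^esub>)"
  by (rule component_homogeneous[OF gm_abelian gm_graded])

lemma gm_finsum_closed:
  assumes "graded_module R M" "\<And>i. i \<in> I \<Longrightarrow> g i \<in> carrier M"
  shows "(\<Oplus>\<^bsub>M\<^esub>i\<in>I. g i) \<in> carrier M"
proof -
  interpret M: module R M by (rule gm_module[OF assms(1)])
  show ?thesis by (rule M.finsum_closed) (use assms(2) in auto)
qed

lemma finsum_mem:
  assumes M: "graded_module R M" and L: "L \<subseteq> carrier M"
    and z: "\<zero>\<^bsub>M\<^esub> \<in> L" and add: "\<And>x y. x \<in> L \<Longrightarrow> y \<in> L \<Longrightarrow> x \<oplus>\<^bsub>M\<^esub> y \<in> L"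
    and g: "\<And>i. i \<in> I \<Longrightarrow> g i \<in> L"
  shows "(\<Oplus>\<^bsub>M\<^esub>i\<in>I. g i) \<in> L"
proof -
  interpret M: module R M by (rule gm_module[OF M])
  show ?thesis
  proof (cases "finite I")
    case True
    then show ?thesis using g
    proof (induction I)
      case (insert i I)
      have "(\<Oplus>\<^bsub>M\<^esub>i\<in>insert i I. g i) = g i \<oplus>\<^bsub>M\<^esub> (\<Oplus>\<^bsub>M\<^esub>i\<in>I. g i)"
        by (rule M.finsum_insert) (use insert L in auto)
      then show ?case using insert add by simp
    qed (simp add: z)
  qed (simp add: z M.finsum_infinite)
qed

text \<open>Every element is the sum of its finitely many components, so closure under addition
  reduces a property to homogeneous elements.\<close>

lemma graded_induct [consumes 2, case_names zero add hom]:
  assumes M: "graded_module R M" and x: "x \<in> carrier M"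
    and z: "P \<zero>\<^bsub>M\<^esub>"
    and add: "\<And>x y. x \<in> carrier M \<Longrightarrow> y \<in> carrier M \<Longrightarrow> P x \<Longrightarrow> P y \<Longrightarrow> P (x \<oplus>\<^bsub>M\<^esub> y)"
    and hom: "\<And>n x. x \<in> mgr M n \<Longrightarrow> P x"
  shows "P x"
proof -
  have "(\<Oplus>\<^bsub>M\<^esub>n\<in>{n. comp M x n \<noteq> \<zero>\<^bsub>M\<^esub>}. comp M x n) \<in> {x \<in> carrier M. P x}"
    by (rule finsum_mem[OF M]) (use M x z add hom[OF comp_mgr[OF M x]] in auto)
  then show ?thesis using comp_sum[OF M x] by simp
qed

section \<open>Homogeneous maps\<close>

lemma homogeneous_mapI:
  assumes "\<And>x. x \<in> carrier M \<Longrightarrow> f x \<in> carrier N"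
    and "\<And>x y. x \<in> carrier M \<Longrightarrow> y \<in> carrier M \<Longrightarrow> f (x \<oplus>\<^bsub>M\<^esub> y) = f x \<oplus>\<^bsub>N\<^esub> f y"
    and "\<And>a x. a \<in> carrier R \<Longrightarrow> x \<in> carrier M \<Longrightarrow> f (a \<odot>\<^bsub>M\<^esub> x) = a \<odot>\<^bsub>N\<^esub> f x"
    and "\<And>k x. x \<in> mgr M k \<Longrightarrow> f x \<in> mgr N (k + n)"
  shows "homogeneous_map R M N n f"
  using assms unfolding homogeneous_map_def linear_map_def by auto

lemma
  assumes "homogeneous_map R M N n f"
  shows hm_closed: "x \<in> carrier M \<Longrightarrow> f x \<in> carrier N"
    and hm_add: "x \<in> carrier M \<Longrightarrow> y \<in> carrier M \<Longrightarrow> f (x \<oplus>\<^bsub>M\<^esub> y) = f x \<oplus>\<^bsub>N\<^esub> f y"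
    and hm_smult: "a \<in> carrier R \<Longrightarrow> x \<in> carrier M \<Longrightarrow> f (a \<odot>\<^bsub>M\<^esub> x) = a \<odot>\<^bsub>N\<^esub> f x"
    and hm_mgr: "x \<in> mgr M k \<Longrightarrow> f x \<in> mgr N (k + n)"
    and hm_linear: "linear_map R M N f"
  using assms unfolding homogeneous_map_def linear_map_def by auto

lemma
  assumes "linear_map R M N f"
  shows lin_closed: "x \<in> carrier M \<Longrightarrow> f x \<in> carrier N"
    and lin_add: "x \<in> carrier M \<Longrightarrow> y \<in> carrier M \<Longrightarrow> f (x \<oplus>\<^bsub>M\<^esub> y) = f x \<oplus>\<^bsub>N\<^esub> f y"
    and lin_smult: "a \<in> carrier R \<Longrightarrow> x \<in> carrier M \<Longrightarrow> f (a \<odot>\<^bsub>M\<^esub> x) = a \<odot>\<^bsub>N\<^esub> f x"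
  using assms unfolding linear_map_def by auto

lemma
  assumes M: "module R M" and N: "module R N" and f: "linear_map R M N f"
  shows lin_zero: "f \<zero>\<^bsub>M\<^esub> = \<zero>\<^bsub>N\<^esub>"
    and lin_neg: "x \<in> carrier M \<Longrightarrow> f (\<ominus>\<^bsub>M\<^esub> x) = \<ominus>\<^bsub>N\<^esub> f x"
    and lin_finsum: "(\<And>i. i \<in> I \<Longrightarrow> g i \<in> carrier M) \<Longrightarrow> f (\<Oplus>\<^bsub>M\<^esub>i\<in>I. g i) = (\<Oplus>\<^bsub>N\<^esub>i\<in>I. f (g i))"
proof -
  interpret M: module R M by (rule M)
  interpret N: module R N by (rule N)
  note fc = lin_closed[OF f] and fa = lin_add[OF f] and fs = lin_smult[OF f]
  show f0: "f \<zero>\<^bsub>M\<^esub> = \<zero>\<^bsub>N\<^esub>"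
    using fs[of "\<zero>\<^bsub>R\<^esub>" "\<zero>\<^bsub>M\<^esub>"] fc[of "\<zero>\<^bsub>M\<^esub>"] by simp
  show "f (\<ominus>\<^bsub>M\<^esub> x) = \<ominus>\<^bsub>N\<^esub> f x" if "x \<in> carrier M"
    using fa[of "\<ominus>\<^bsub>M\<^esub> x" x] f0 that N.minus_equality[of "f (\<ominus>\<^bsub>M\<^esub> x)" "f x"] fc[of x] fc[of "\<ominus>\<^bsub>M\<^esub> x"]
    by (simp add: M.l_neg)
  show "f (\<Oplus>\<^bsub>M\<^esub>i\<in>I. g i) = (\<Oplus>\<^bsub>N\<^esub>i\<in>I. f (g i))" if "\<And>i. i \<in> I \<Longrightarrow> g i \<in> carrier M"
  proof (cases "finite I")
    case True
    then show ?thesis using that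
    proof (induction I)
      case (insert i I)
      then have *: "g \<in> I \<rightarrow> carrier M" "g i \<in> carrier M" by auto
      have "(\<Oplus>\<^bsub>N\<^esub>i\<in>insert i I. f (g i)) = f (g i) \<oplus>\<^bsub>N\<^esub> (\<Oplus>\<^bsub>N\<^esub>i\<in>I. f (g i))"
        by (rule N.finsum_insert) (use insert fc in auto)
      then show ?case using insert * fa by (simp add: M.finsum_insert)
    qed (simp add: f0)
  qed (simp add: f0 M.finsum_infinite N.finsum_infinite)
qed

lemma
  assumes M: "graded_module R M" and N: "graded_module R N" and f: "homogeneous_map R M N n f"
  shows hm_zero: "f \<zero>\<^bsub>M\<^esub> = \<zero>\<^bsub>N\<^esub>"
    and hm_neg: "x \<in> carrier M \<Longrightarrow> f (\<ominus>\<^bsub>M\<^esub> x) = \<ominus>\<^bsub>N\<^esub> f x"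
    and hm_finsum: "(\<And>i. i \<in> I \<Longrightarrow> g i \<in> carrier M) \<Longrightarrow> f (\<Oplus>\<^bsub>M\<^esub>i\<in>I. g i) = (\<Oplus>\<^bsub>N\<^esub>i\<in>I. f (g i))"
  using lin_zero[OF gm_module[OF M] gm_module[OF N] hm_linear[OF f]]
    lin_neg[OF gm_module[OF M] gm_module[OF N] hm_linear[OF f]]
    lin_finsum[OF gm_module[OF M] gm_module[OF N] hm_linear[OF f], of I g] by blast+

lemma hm_compose:
  assumes "homogeneous_map R M N m f" "homogeneous_map R N K n g"
  shows "homogeneous_map R M K (m + n) (\<lambda>x. g (f x))"
  using hm_closed[OF assms(1)] hm_closed[OF assms(2)] hm_add[OF assms(1)] hm_add[OF assms(2)]
    hm_smult[OF assms(1)] hm_smult[OF assms(2)]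
    hm_mgr[OF assms(2) hm_mgr[OF assms(1)], unfolded add.assoc]
  by (intro homogeneous_mapI) simp_all

lemma hm_compose_gh: "graded_hom R M N f \<Longrightarrow> homogeneous_map R N K n g \<Longrightarrow>
    homogeneous_map R M K n (\<lambda>x. g (f x))"
  and hm_compose_hg: "homogeneous_map R M N n f' \<Longrightarrow> graded_hom R N K g' \<Longrightarrow>
    homogeneous_map R M K n (\<lambda>x. g' (f' x))"
  using hm_compose[of M N 0 f K n g] hm_compose[of M N n f' K 0 g'] by simp_all

lemma hm_plus:
  assumes N: "graded_module R N"
    and f: "homogeneous_map R M N n f" and g: "homogeneous_map R M N n g"
  shows "homogeneous_map R M N n (\<lambda>x. f x \<oplus>\<^bsub>N\<^esub> g x)"
  using hm_closed[OF f] hm_closed[OF g] N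
  by (intro homogeneous_mapI)
    (simp_all add: hm_add[OF f] hm_add[OF g] hm_smult[OF f] hm_smult[OF g] hm_mgr[OF f] hm_mgr[OF g]
      gm_ac gm_smult_add)

lemma hm_uminus:
  assumes N: "graded_module R N" and f: "homogeneous_map R M N n f"
  shows "homogeneous_map R M N n (\<lambda>x. \<ominus>\<^bsub>N\<^esub> f x)"
  using hm_closed[OF f] N
  by (intro homogeneous_mapI)
    (simp_all add: hm_add[OF f] hm_smult[OF f] hm_mgr[OF f] gm_neg_add gm_smult_neg)

lemma hm_const_zero: "graded_module R N \<Longrightarrow> homogeneous_map R M N n (\<lambda>_. \<zero>\<^bsub>N\<^esub>)"
  by (intro homogeneous_mapI) simp_all

lemma hm_id: "graded_hom R M M (\<lambda>x. x)"
  by (intro homogeneous_mapI) simp_all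

lemma hm_cong:
  assumes M: "graded_module R M" and f: "homogeneous_map R M N n f"
    and eq: "\<And>x. x \<in> carrier M \<Longrightarrow> g x = f x"
  shows "homogeneous_map R M N n g"
  using hm_closed[OF f] hm_add[OF f] hm_smult[OF f] hm_mgr[OF f] mgr_carrier[OF M] M
  by (intro homogeneous_mapI) (simp_all add: eq)

lemma hm_restrict:
  assumes M: "graded_module R M" and f: "homogeneous_map R M N n f"
  shows "homogeneous_map R M N n (restrict f (carrier M))"
  by (rule hm_cong[OF M f]) simp

text \<open>Applying \<open>f\<close> to the decomposition of \<open>x\<close> gives a homogeneous
  decomposition of \<open>f x\<close>, and that decomposition is unique.\<close>

lemma comp_hom:
  assumes M: "graded_module R M" and N: "graded_module R N" and f: "graded_hom R M N f"
    and x: "x \<in> carrier M"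
  shows "comp N (f x) n = f (comp M x n)"
proof -
  let ?F = "{n. comp M x n \<noteq> \<zero>\<^bsub>M\<^esub>}"
  have "f x = f (\<Oplus>\<^bsub>M\<^esub>n\<in>?F. comp M x n)" using comp_sum[OF M x] by simp
  also have "\<dots> = (\<Oplus>\<^bsub>N\<^esub>n\<in>?F. f (comp M x n))"
    by (rule hm_finsum[OF M N f]) (use M x in auto)
  finally have "comp N (f x) n = (if n \<in> ?F then f (comp M x n) else \<zero>\<^bsub>N\<^esub>)"
    using hm_mgr[OF f comp_mgr[OF M x]]
    by (intro component_eqI[OF gm_abelian[OF N] gm_graded[OF N] comp_finite[OF M x]]) auto
  then show ?thesis using hm_zero[OF M N f] by auto
qed

text \<open>This is how choices of preimages are made homogeneous: a preimage of a homogeneous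
  element is replaced by its component of the same degree.\<close>

lemma homogeneous_preimage:
  assumes M: "graded_module R M" and N: "graded_module R N" and f: "graded_hom R M N f"
    and x: "x \<in> carrier M" and y: "f x \<in> mgr N n"
  shows "f (comp M x n) = f x"
  using comp_hom[OF M N f x, of n] comp_homogeneous[OF N y, of n] by simp

lemma homogeneous_eqI:
  assumes M: "graded_module R M" and N: "graded_module R N"
    and f: "linear_map R M N f" and g: "linear_map R M N g"
    and eq: "\<And>k x. x \<in> mgr M k \<Longrightarrow> f x = g x" and x: "x \<in> carrier M"
  shows "f x = g x"
  using M x
proof (induction rule: graded_induct)
  case zero
  then show ?case
    using lin_zero[OF gm_module[OF M] gm_module[OF N] f] lin_zero[OF gm_module[OF M] gm_module[OF N] g]
    by simp
next
  case (add x y)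
  then show ?case using lin_add[OF f] lin_add[OF g] by simp
qed (rule eq)

text \<open>The kernel of a degree 0 map contains the components of its elements, so its homogeneous
  elements decide injectivity.\<close>

lemma graded_inj_onI:
  assumes M: "graded_module R M" and N: "graded_module R N" and f: "graded_hom R M N f"
    and ker: "\<And>n x. x \<in> mgr M n \<Longrightarrow> f x = \<zero>\<^bsub>N\<^esub> \<Longrightarrow> x = \<zero>\<^bsub>M\<^esub>"
  shows "inj_on f (carrier M)"
proof (rule inj_onI)
  fix x y assume xy: "x \<in> carrier M" "y \<in> carrier M" "f x = f y"
  define z where "z = x \<oplus>\<^bsub>M\<^esub> \<ominus>\<^bsub>M\<^esub> y"
  have z: "z \<in> carrier M" using xy M by (simp add: z_def)
  have "f z = \<zero>\<^bsub>N\<^esub>"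
    using xy M N hm_closed[OF f] by (simp add: z_def hm_add[OF f] hm_neg[OF M N f])
  then have "f (comp M z n) = \<zero>\<^bsub>N\<^esub>" for n
    using comp_hom[OF M N f z, of n] comp_homogeneous[OF N mgr_zero[OF N]] by simp
  then have "comp M z n = \<zero>\<^bsub>M\<^esub>" for n using ker comp_mgr[OF M z] by blast
  then have "(\<Oplus>\<^bsub>M\<^esub>n\<in>{n. comp M z n \<noteq> \<zero>\<^bsub>M\<^esub>}. comp M z n) = \<zero>\<^bsub>M\<^esub>"
    by (simp add: abelian_monoid.finsum_empty[OF abelian_group.axioms(1)[OF gm_abelian[OF M]]])
  then have "z = \<zero>\<^bsub>M\<^esub>"
    using comp_sum[OF M z] by simp
  then show "x = y" using gm_eq_diff[OF M] xy by (simp add: z_def)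
qed

lemma graded_surjI:
  assumes M: "graded_module R M" and N: "graded_module R N" and f: "graded_hom R M N f"
    and sur: "\<And>n y. y \<in> mgr N n \<Longrightarrow> \<exists>x\<in>carrier M. f x = y"
  shows "f ` carrier M = carrier N"
proof
  show "f ` carrier M \<subseteq> carrier N" using hm_closed[OF f] by auto
  show "carrier N \<subseteq> f ` carrier M"
  proof
    fix y assume "y \<in> carrier N"
    with N show "y \<in> f ` carrier M"
    proof (induction rule: graded_induct)
      case zero
      then show ?case using hm_zero[OF M N f] gm_zero[OF M] by force
    next
      case (add x y)
      then show ?case using hm_add[OF f] gm_add[OF M] by (force simp: image_iff)
    next
      case (hom n x)
      then show ?case using sur by force
    qed
  qed
qed

text \<open>The universal property of a surjection, for maps \<open>w\<close> of any degree. What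
  goes beyond plain modules is that \<open>g\<close> respects the grading: a homogeneous element of
  \<open>B\<close> has a homogeneous preimage of the same degree.\<close>

lemma graded_factor:
  assumes M: "graded_module R M" and B: "graded_module R B" and N: "graded_module R N"
    and p: "graded_hom R M B p" and sur: "p ` carrier M = carrier B"
    and w: "homogeneous_map R M N n w"
    and ker: "\<And>x. x \<in> carrier M \<Longrightarrow> p x = \<zero>\<^bsub>B\<^esub> \<Longrightarrow> w x = \<zero>\<^bsub>N\<^esub>"
  obtains g where "homogeneous_map R B N n g" "\<And>x. x \<in> carrier M \<Longrightarrow> g (p x) = w x"
proof -
  \<comment> \<open>Fibres of \<open>p\<close> are cosets of its kernel, so \<open>w\<close> is
    constant on them.\<close>
  have *: "w x = w y" if "x \<in> carrier M" "y \<in> carrier M" "p x = p y" for x y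
  proof -
    have "p (x \<oplus>\<^bsub>M\<^esub> \<ominus>\<^bsub>M\<^esub> y) = \<zero>\<^bsub>B\<^esub>"
      using that hm_closed[OF p] M B by (simp add: hm_add[OF p] hm_neg[OF M B p])
    then have "w (x \<oplus>\<^bsub>M\<^esub> \<ominus>\<^bsub>M\<^esub> y) = \<zero>\<^bsub>N\<^esub>" using ker that M by simp
    then show ?thesis
      using that hm_closed[OF w] M N
      by (simp add: hm_add[OF w] hm_neg[OF M N w] gm_eq_diff)
  qed
  define g where "g b = w (SOME x. x \<in> carrier M \<and> p x = b)" for b
  have g: "g (p x) = w x" if "x \<in> carrier M" for x
    unfolding g_def using someI[of "\<lambda>y. y \<in> carrier M \<and> p y = p x" x] that *
    by blast
  have ex: "\<exists>x\<in>carrier M. b = p x" if "b \<in> carrier B" for b using that sur by blast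
  have "homogeneous_map R B N n g"
  proof (rule homogeneous_mapI)
    show "g b \<in> carrier N" if "b \<in> carrier B" for b
      using ex[OF that] g hm_closed[OF w] by auto
    show "g (b \<oplus>\<^bsub>B\<^esub> c) = g b \<oplus>\<^bsub>N\<^esub> g c" if bc: "b \<in> carrier B" "c \<in> carrier B" for b c
    proof -
      obtain x y where "x \<in> carrier M" "b = p x" "y \<in> carrier M" "c = p y"
        using ex bc by blast
      then show ?thesis using g M by (simp add: hm_add[OF p, symmetric] hm_add[OF w])
    qed
    show "g (a \<odot>\<^bsub>B\<^esub> b) = a \<odot>\<^bsub>N\<^esub> g b" if a: "a \<in> carrier R" and b: "b \<in> carrier B" for a b
    proof -
      obtain x where "x \<in> carrier M" "b = p x" using ex b by blast
      then show ?thesis using g M a by (simp add: hm_smult[OF p, symmetric] hm_smult[OF w])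
    qed
    show "g b \<in> mgr N (k + n)" if b: "b \<in> mgr B k" for k b
    proof -
      obtain x where x: "x \<in> carrier M" "b = p x" using ex mgr_carrier[OF B b] by blast
      then have "p (comp M x k) = b" using homogeneous_preimage[OF M B p] b by simp
      then have "g b = w (comp M x k)" using g[of "comp M x k"] M x by simp
      then show ?thesis using hm_mgr[OF w] comp_mgr[OF M x(1)] by simp
    qed
  qed
  then show ?thesis using g that by blast
qed

end


text \<open>Stated for a graded abelian group so that it applies to the ring itself, whose grading
  \<open>rgr\<close> is not that of a \<open>gmod\<close>.\<close>

lemma graded_by_induct:
  assumes G: "abelian_group G" and gr: "graded_by G A" and x: "x \<in> carrier G"
    and z: "P \<zero>\<^bsub>G\<^esub>"
    and add: "\<And>x y. x \<in> carrier G \<Longrightarrow> y \<in> carrier G \<Longrightarrow> P x \<Longrightarrow> P y \<Longrightarrow> P (x \<oplus>\<^bsub>G\<^esub> y)"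
    and hom: "\<And>n x. x \<in> A n \<Longrightarrow> P x"
  shows "P x"
proof -
  interpret G: abelian_group G by (rule G)
  have Ac: "\<And>n x. x \<in> A n \<Longrightarrow> x \<in> carrier G"
    using gr additive_subgroup.a_subset unfolding graded_by_def by blast
  obtain f where f: "\<And>n. f n \<in> A n" "finite {n. f n \<noteq> \<zero>\<^bsub>G\<^esub>}"
    and xf: "x = (\<Oplus>\<^bsub>G\<^esub>n\<in>{n. f n \<noteq> \<zero>\<^bsub>G\<^esub>}. f n)"
    using graded_by_ex[OF gr x] by blast
  have "P (\<Oplus>\<^bsub>G\<^esub>n\<in>F. f n)" if "finite F" for F
    using that
  proof (induction F)
    case (insert n F)
    have fc: "f \<in> I \<rightarrow> carrier G" for I using f Ac by auto
    have "(\<Oplus>\<^bsub>G\<^esub>n\<in>insert n F. f n) = f n \<oplus>\<^bsub>G\<^esub> (\<Oplus>\<^bsub>G\<^esub>n\<in>F. f n)"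
      by (rule G.finsum_insert) (use insert f Ac in auto)
    then show ?case using add[OF Ac[OF f(1)] G.finsum_closed[OF fc] hom[OF f(1)] insert.IH] by simp
  qed (simp add: z)
  then show ?thesis using f xf by simp
qed

context graded_base
begin

lemma rgr_carrier: "a \<in> rgr R n \<Longrightarrow> a \<in> carrier R"
  using rgr_graded additive_subgroup.a_subset unfolding graded_by_def by blast

lemma rgr_sub: "additive_subgroup (rgr R n) R"
  using rgr_graded unfolding graded_by_def by blast

lemma R_abelian: "abelian_group R"
  using cring cring.axioms(1) ring.is_abelian_group by blast

text \<open>Let \<open>e\<close> be the degree 0 component of the unit. Comparing the components of
  degree \<open>m\<close> in the product of a homogeneous \<open>a\<close> with the unit shows that
  \<open>e\<close> fixes \<open>a\<close>. By additivity \<open>e\<close> fixes every element of the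
  ring, in particular the unit, so the unit is \<open>e\<close>.\<close>

lemma one_rgr: "\<one>\<^bsub>R\<^esub> \<in> rgr R 0"
proof -
  interpret R: cring R by (rule cring)
  let ?e = "component R (rgr R) \<one>\<^bsub>R\<^esub>"
  let ?F = "{n. ?e n \<noteq> \<zero>\<^bsub>R\<^esub>}"
  have e: "?e n \<in> rgr R n" and ec: "?e n \<in> carrier R" and F: "finite ?F"
    and sum: "(\<Oplus>\<^bsub>R\<^esub>n\<in>?F. ?e n) = \<one>\<^bsub>R\<^esub>" for n
    using component_mem[OF rgr_graded R.one_closed] component_finite[OF rgr_graded R.one_closed]
      component_sum[OF rgr_graded R.one_closed] rgr_carrier by blast+
  have 1: "a \<otimes>\<^bsub>R\<^esub> ?e 0 = a" if "a \<in> carrier R" for a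
    using R_abelian rgr_graded that
  proof (rule graded_by_induct)
    show "\<zero>\<^bsub>R\<^esub> \<otimes>\<^bsub>R\<^esub> ?e 0 = \<zero>\<^bsub>R\<^esub>" using ec by simp
    show "(x \<oplus>\<^bsub>R\<^esub> y) \<otimes>\<^bsub>R\<^esub> ?e 0 = x \<oplus>\<^bsub>R\<^esub> y"
      if "x \<in> carrier R" "y \<in> carrier R" "x \<otimes>\<^bsub>R\<^esub> ?e 0 = x" "y \<otimes>\<^bsub>R\<^esub> ?e 0 = y" for x y
      using that ec by (simp add: R.l_distr)
    fix m a assume a: "a \<in> rgr R m"
    have ac: "a \<in> carrier R" using rgr_carrier[OF a] .
    have "a = a \<otimes>\<^bsub>R\<^esub> (\<Oplus>\<^bsub>R\<^esub>n\<in>?F. ?e n)" using sum ac by simp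
    also have "\<dots> = (\<Oplus>\<^bsub>R\<^esub>n\<in>?F. a \<otimes>\<^bsub>R\<^esub> ?e n)"
      by (rule R.finsum_rdistr) (use F ac ec in auto)
    \<comment> \<open>The product of \<open>a\<close> with the component of degree \<open>n\<close>
      has degree \<open>m + n\<close>; reindexing turns the sum into a decomposition by
      degree.\<close>
    also have "\<dots> = (\<Oplus>\<^bsub>R\<^esub>n\<in>(\<lambda>n. m + n) ` ?F. a \<otimes>\<^bsub>R\<^esub> ?e (n - m))"
      by (subst R.add.finprod_reindex) (use ac ec in \<open>auto simp: inj_on_def\<close>)
    finally have "component R (rgr R) a m =
        (if m \<in> (\<lambda>n. m + n) ` ?F then a \<otimes>\<^bsub>R\<^esub> ?e (m - m) else \<zero>\<^bsub>R\<^esub>)"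
      by (intro component_eqI[OF R_abelian rgr_graded]) (use F rgr_mult[OF a e] in auto)
    moreover have "m \<in> (\<lambda>n. m + n) ` ?F \<longleftrightarrow> 0 \<in> ?F" by auto
    ultimately have "component R (rgr R) a m = (if 0 \<in> ?F then a \<otimes>\<^bsub>R\<^esub> ?e 0 else \<zero>\<^bsub>R\<^esub>)" by simp
    then show "a \<otimes>\<^bsub>R\<^esub> ?e 0 = a"
      using component_homogeneous[OF R_abelian rgr_graded a, of m] ac by (cases "0 \<in> ?F") simp_all
  qed
  from 1[of "\<one>\<^bsub>R\<^esub>"] have "?e 0 = \<one>\<^bsub>R\<^esub>" using ec by simp
  then show ?thesis using e[of 0] by simp
qed

lemma neg_smult:
  assumes "module R M" "x \<in> carrier M"
  shows "\<ominus>\<^bsub>M\<^esub> x = (\<ominus>\<^bsub>R\<^esub> \<one>\<^bsub>R\<^esub>) \<odot>\<^bsub>M\<^esub> x"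
proof -
  interpret M: module R M by fact
  show ?thesis using assms(2) M.smult_l_minus[of "\<one>\<^bsub>R\<^esub>" x] by simp
qed

lemma neg_one: "\<ominus>\<^bsub>R\<^esub> \<one>\<^bsub>R\<^esub> \<in> rgr R 0" "\<ominus>\<^bsub>R\<^esub> \<one>\<^bsub>R\<^esub> \<in> carrier R"
  using additive_subgroup.a_inv_closed[OF rgr_sub one_rgr] rgr_carrier by auto

text \<open>Closure of the graded pieces under negation follows from \<open>smult\<close>, because
  negation is multiplication by the negative of the unit, a scalar of degree 0.\<close>

lemma graded_moduleI:
  assumes M: "module R M"
    and sub: "\<And>n. mgr M n \<subseteq> carrier M" and z: "\<And>n. \<zero>\<^bsub>M\<^esub> \<in> mgr M n"
    and add: "\<And>n x y. x \<in> mgr M n \<Longrightarrow> y \<in> mgr M n \<Longrightarrow> x \<oplus>\<^bsub>M\<^esub> y \<in> mgr M n"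
    and smult: "\<And>m n a x. a \<in> rgr R m \<Longrightarrow> x \<in> mgr M n \<Longrightarrow> a \<odot>\<^bsub>M\<^esub> x \<in> mgr M (m + n)"
    and ex: "\<And>x. x \<in> carrier M \<Longrightarrow>
      \<exists>F g. finite F \<and> (\<forall>n\<in>F. g n \<in> mgr M n) \<and> x = (\<Oplus>\<^bsub>M\<^esub>n\<in>F. g n)"
    and ind: "\<And>F g. finite F \<Longrightarrow> (\<And>n. n \<in> F \<Longrightarrow> g n \<in> mgr M n) \<Longrightarrow>
      (\<Oplus>\<^bsub>M\<^esub>n\<in>F. g n) = \<zero>\<^bsub>M\<^esub> \<Longrightarrow> \<forall>n\<in>F. g n = \<zero>\<^bsub>M\<^esub>"
  shows "graded_module R M"
proof -
  interpret M: module R M by (rule M)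
  have neg: "\<ominus>\<^bsub>M\<^esub> x \<in> mgr M n" if "x \<in> mgr M n" for x n
    using smult[OF neg_one(1) that] neg_smult[OF M subsetD[OF sub that]] by simp
  have "additive_subgroup (mgr M n) M" for n
    using z[of n] by (intro additive_subgroupI M.add.subgroupI)
      (use sub add neg in \<open>auto simp: a_inv_def\<close>)
  then have "graded_by M (mgr M)"
    using ex ind by (intro graded_by_I) (auto simp: M.abelian_group_axioms)
  then show ?thesis using M smult unfolding graded_module_def by blast
qed

lemma comp_sum_on:
  assumes M: "graded_module R M" and x: "x \<in> carrier M" and F: "finite F" "{n. comp M x n \<noteq> \<zero>\<^bsub>M\<^esub>} \<subseteq> F"
  shows "(\<Oplus>\<^bsub>M\<^esub>n\<in>F. comp M x n) = x"
proof -
  interpret M: module R M by (rule gm_module[OF M])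
  have "(\<Oplus>\<^bsub>M\<^esub>n\<in>F. comp M x n) = (\<Oplus>\<^bsub>M\<^esub>n\<in>{n. comp M x n \<noteq> \<zero>\<^bsub>M\<^esub>}. comp M x n)"
    by (rule M.M.add.finprod_mono_neutral_cong_right[OF F]) (use M x in auto)
  then show ?thesis using comp_sum[OF M x] by simp
qed

lemma gm_independent:
  "graded_module R M \<Longrightarrow> finite F \<Longrightarrow> (\<And>n. n \<in> F \<Longrightarrow> g n \<in> mgr M n) \<Longrightarrow>
    (\<Oplus>\<^bsub>M\<^esub>n\<in>F. g n) = \<zero>\<^bsub>M\<^esub> \<Longrightarrow> n \<in> F \<Longrightarrow> g n = \<zero>\<^bsub>M\<^esub>"
  by (rule graded_by_independent[OF gm_abelian gm_graded])

end

section \<open>Constructions of graded modules\<close>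

definition gprod :: "('a, 'b) gmod \<Rightarrow> ('a, 'c) gmod \<Rightarrow> ('a, 'b \<times> 'c) gmod" where
  "gprod M N =
     \<lparr>carrier = carrier M \<times> carrier N, mult = undefined, one = undefined,
      zero = (\<zero>\<^bsub>M\<^esub>, \<zero>\<^bsub>N\<^esub>),
      add = (\<lambda>x y. (fst x \<oplus>\<^bsub>M\<^esub> fst y, snd x \<oplus>\<^bsub>N\<^esub> snd y)),
      smult = (\<lambda>a x. (a \<odot>\<^bsub>M\<^esub> fst x, a \<odot>\<^bsub>N\<^esub> snd x)),
      mgr = (\<lambda>n. mgr M n \<times> mgr N n)\<rparr>"

lemma gprod_simps [simp]:
  "carrier (gprod M N) = carrier M \<times> carrier N"
  "\<zero>\<^bsub>gprod M N\<^esub> = (\<zero>\<^bsub>M\<^esub>, \<zero>\<^bsub>N\<^esub>)"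
  "x \<oplus>\<^bsub>gprod M N\<^esub> y = (fst x \<oplus>\<^bsub>M\<^esub> fst y, snd x \<oplus>\<^bsub>N\<^esub> snd y)"
  "a \<odot>\<^bsub>gprod M N\<^esub> x = (a \<odot>\<^bsub>M\<^esub> fst x, a \<odot>\<^bsub>N\<^esub> snd x)"
  "mgr (gprod M N) n = mgr M n \<times> mgr N n"
  by (simp_all add: gprod_def)

lemma restrict_gmod_simps [simp]:
  "carrier (restrict_gmod M L) = L"
  "\<zero>\<^bsub>restrict_gmod M L\<^esub> = \<zero>\<^bsub>M\<^esub>"
  "x \<oplus>\<^bsub>restrict_gmod M L\<^esub> y = x \<oplus>\<^bsub>M\<^esub> y"
  "a \<odot>\<^bsub>restrict_gmod M L\<^esub> x = a \<odot>\<^bsub>M\<^esub> x"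
  "mgr (restrict_gmod M L) n = L \<inter> mgr M n"
  by (simp_all add: restrict_gmod_def)

lemma gquot_simps [simp]:
  "carrier (gquot A Z B) = (\<lambda>z. B +>\<^bsub>A\<^esub> z) ` Z"
  "\<zero>\<^bsub>gquot A Z B\<^esub> = B"
  "X \<oplus>\<^bsub>gquot A Z B\<^esub> Y = X <+>\<^bsub>A\<^esub> Y"
  "a \<odot>\<^bsub>gquot A Z B\<^esub> X = (\<Union>x\<in>X. B +>\<^bsub>A\<^esub> (a \<odot>\<^bsub>A\<^esub> x))"
  "mgr (gquot A Z B) n = (\<lambda>z. B +>\<^bsub>A\<^esub> z) ` (Z \<inter> mgr A n)"
  by (simp_all add: gquot_def)

context graded_base
begin

lemma graded_module_gprod:
  assumes M: "graded_module R M" and N: "graded_module R N"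
  shows "graded_module R (gprod M N)"
proof -
  have mod: "module R (gprod M N)"
  proof (rule moduleI[OF cring])
    show "abelian_group (gprod M N)"
    proof (rule abelian_groupI)
      fix x assume "x \<in> carrier (gprod M N)"
      then show "\<exists>y\<in>carrier (gprod M N). y \<oplus>\<^bsub>gprod M N\<^esub> x = \<zero>\<^bsub>gprod M N\<^esub>"
        using M N by (intro bexI[of _ "(\<ominus>\<^bsub>M\<^esub> fst x, \<ominus>\<^bsub>N\<^esub> snd x)"]) auto
    qed (use M N in \<open>auto simp: gm_ac\<close>)
  qed (use M N in \<open>auto simp: gm_smult_add gm_add_smult gm_mult_smult\<close>)
  have fst: "linear_map R (gprod M N) M fst" and snd: "linear_map R (gprod M N) N snd"
    by (auto simp: linear_map_def)
  have lin_comb: "fst (\<Oplus>\<^bsub>gprod M N\<^esub>n\<in>F. g n) = (\<Oplus>\<^bsub>M\<^esub>n\<in>F. fst (g n))"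
     "snd (\<Oplus>\<^bsub>gprod M N\<^esub>n\<in>F. g n) = (\<Oplus>\<^bsub>N\<^esub>n\<in>F. snd (g n))"
    if "\<And>n. n \<in> F \<Longrightarrow> g n \<in> carrier (gprod M N)" for F :: "int set" and g
    using lin_finsum[OF mod gm_module[OF M] fst, of F g] lin_finsum[OF mod gm_module[OF N] snd, of F g] that
    by blast+
  show ?thesis
  proof (rule graded_moduleI[OF mod])
    fix x assume x: "x \<in> carrier (gprod M N)"
    then have x1: "fst x \<in> carrier M" and x2: "snd x \<in> carrier N" by auto
    let ?F = "{n. comp M (fst x) n \<noteq> \<zero>\<^bsub>M\<^esub>} \<union> {n. comp N (snd x) n \<noteq> \<zero>\<^bsub>N\<^esub>}"
    let ?g = "\<lambda>n. (comp M (fst x) n, comp N (snd x) n)"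
    have F: "finite ?F" using comp_finite[OF M x1] comp_finite[OF N x2] by simp
    have g: "?g n \<in> carrier (gprod M N)" for n using M N x1 x2 by simp
    have "(\<Oplus>\<^bsub>gprod M N\<^esub>n\<in>?F. ?g n) = x"
      by (rule prod_eqI)
        (simp_all only: lin_comb[OF g] fst_conv snd_conv comp_sum_on[OF M x1 F] comp_sum_on[OF N x2 F] Un_upper1 Un_upper2)
    then show "\<exists>F g. finite F \<and> (\<forall>n\<in>F. g n \<in> mgr (gprod M N) n) \<and> x = (\<Oplus>\<^bsub>gprod M N\<^esub>n\<in>F. g n)"
      using F M N x1 x2 by (intro exI[of _ ?F] exI[of _ ?g]) auto
  next
    fix F :: "int set" and g assume F: "finite F" and g: "\<And>n. n \<in> F \<Longrightarrow> g n \<in> mgr (gprod M N) n"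
      and s: "(\<Oplus>\<^bsub>gprod M N\<^esub>n\<in>F. g n) = \<zero>\<^bsub>gprod M N\<^esub>"
    have g1: "fst (g n) \<in> mgr M n" "snd (g n) \<in> mgr N n" if "n \<in> F" for n using g[OF that] by auto
    have gc: "g n \<in> carrier (gprod M N)" if "n \<in> F" for n
      using g[OF that] mgr_carrier[OF M] mgr_carrier[OF N] by auto
    have "(\<Oplus>\<^bsub>M\<^esub>n\<in>F. fst (g n)) = \<zero>\<^bsub>M\<^esub>" "(\<Oplus>\<^bsub>N\<^esub>n\<in>F. snd (g n)) = \<zero>\<^bsub>N\<^esub>"
      using lin_comb[of F g, OF gc] s by simp_all
    then have "fst (g n) = \<zero>\<^bsub>M\<^esub>" "snd (g n) = \<zero>\<^bsub>N\<^esub>" if "n \<in> F" for n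
      using gm_independent[OF M F, of "\<lambda>n. fst (g n)"] gm_independent[OF N F, of "\<lambda>n. snd (g n)"] g1 that
      by blast+
    then show "\<forall>n\<in>F. g n = \<zero>\<^bsub>gprod M N\<^esub>" by (auto simp: prod_eq_iff)
  qed (use M N mgr_carrier[OF M] mgr_carrier[OF N] in \<open>auto simp: gm_smult_mgr\<close>)
qed

text \<open>A checkable criterion for \<open>homogeneous_submodule\<close>: closure under taking
  components is what makes the graded pieces of \<open>L\<close> exhaust \<open>L\<close>.\<close>

definition hsub :: "('a, 'b) gmod \<Rightarrow> 'b set \<Rightarrow> bool" where
  "hsub M L \<longleftrightarrow> L \<subseteq> carrier M \<and> \<zero>\<^bsub>M\<^esub> \<in> L \<and> (\<forall>x\<in>L. \<forall>y\<in>L. x \<oplus>\<^bsub>M\<^esub> y \<in> L) \<and>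
     (\<forall>a\<in>carrier R. \<forall>x\<in>L. a \<odot>\<^bsub>M\<^esub> x \<in> L) \<and> (\<forall>x\<in>L. \<forall>n. comp M x n \<in> L)"

lemma
  assumes "hsub M L"
  shows hsub_carrier: "x \<in> L \<Longrightarrow> x \<in> carrier M" and hsub_zero: "\<zero>\<^bsub>M\<^esub> \<in> L"
    and hsub_add: "x \<in> L \<Longrightarrow> y \<in> L \<Longrightarrow> x \<oplus>\<^bsub>M\<^esub> y \<in> L"
    and hsub_smult: "a \<in> carrier R \<Longrightarrow> x \<in> L \<Longrightarrow> a \<odot>\<^bsub>M\<^esub> x \<in> L"
    and hsub_comp: "x \<in> L \<Longrightarrow> comp M x n \<in> L"
  using assms unfolding hsub_def by auto

lemma hsub_neg: "graded_module R M \<Longrightarrow> hsub M L \<Longrightarrow> x \<in> L \<Longrightarrow> \<ominus>\<^bsub>M\<^esub> x \<in> L"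
  using hsub_smult[of M L _ x, OF _ neg_one(2)] neg_smult[OF gm_module, of M x] hsub_carrier[of M L x] by simp

lemma hsub_whole: "graded_module R M \<Longrightarrow> hsub M (carrier M)"
  unfolding hsub_def by simp

lemma hsub_kernel:
  assumes M: "graded_module R M" and N: "graded_module R N" and f: "graded_hom R M N f"
  shows "hsub M {x \<in> carrier M. f x = \<zero>\<^bsub>N\<^esub>}"
proof -
  have "f (comp M x n) = \<zero>\<^bsub>N\<^esub>" if "x \<in> carrier M" "f x = \<zero>\<^bsub>N\<^esub>" for x n
    using comp_hom[OF M N f that(1), of n] that(2) comp_homogeneous[OF N mgr_zero[OF N]] by simp
  then show ?thesis
    using M N unfolding hsub_def by (auto simp: hm_zero[OF M N f] hm_add[OF f] hm_smult[OF f])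
qed

lemma hsub_image:
  assumes M: "graded_module R M" and N: "graded_module R N" and f: "graded_hom R M N f"
  shows "hsub N (f ` carrier M)"
proof -
  have "\<zero>\<^bsub>N\<^esub> \<in> f ` carrier M" using hm_zero[OF M N f] gm_zero[OF M] by force
  moreover have "f x \<oplus>\<^bsub>N\<^esub> f y \<in> f ` carrier M" if "x \<in> carrier M" "y \<in> carrier M" for x y
    using hm_add[OF f that] gm_add[OF M that] by force
  moreover have "a \<odot>\<^bsub>N\<^esub> f x \<in> f ` carrier M" if "a \<in> carrier R" "x \<in> carrier M" for a x
    using hm_smult[OF f that] gm_smult[OF M that] by force
  moreover have "comp N (f x) n \<in> f ` carrier M" if "x \<in> carrier M" for x n
    using comp_hom[OF M N f that, of n] comp_carrier[OF M that, of n] by auto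
  ultimately show ?thesis using hm_closed[OF f] unfolding hsub_def by auto
qed

lemma hsub_submodule:
  assumes M: "graded_module R M" and L: "hsub M L"
  shows "submodule L R M"
proof -
  interpret M: module R M by (rule gm_module[OF M])
  show ?thesis
    by (rule M.submoduleI)
      (use hsub_carrier[OF L] hsub_zero[OF L] hsub_add[OF L] hsub_smult[OF L] hsub_neg[OF M L] in auto)
qed

lemma graded_module_restrict:
  assumes M: "graded_module R M" and L: "hsub M L"
  shows "graded_module R (restrict_gmod M L)"
proof -
  have mod: "module R (restrict_gmod M L)"
    by (rule module_image[OF submodule.submodule_is_module[OF hsub_submodule[OF M L] gm_module[OF M]],
          where f = "\<lambda>x. x"]) auto
  have inc: "linear_map R (restrict_gmod M L) M (\<lambda>x. x)"
    using hsub_carrier[OF L] by (auto simp: linear_map_def)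
  have lin_comb: "(\<Oplus>\<^bsub>restrict_gmod M L\<^esub>n\<in>F. g n) = (\<Oplus>\<^bsub>M\<^esub>n\<in>F. g n)"
    if "\<And>n. n \<in> F \<Longrightarrow> g n \<in> L" for F :: "int set" and g
    using lin_finsum[OF mod gm_module[OF M] inc, of F g] that by simp
  show ?thesis
  proof (rule graded_moduleI[OF mod])
    fix x assume x: "x \<in> carrier (restrict_gmod M L)"
    then have xL: "x \<in> L" and xM: "x \<in> carrier M" using hsub_carrier[OF L] by auto
    let ?F = "{n. comp M x n \<noteq> \<zero>\<^bsub>M\<^esub>}"
    have "x = (\<Oplus>\<^bsub>restrict_gmod M L\<^esub>n\<in>?F. comp M x n)"
      using lin_comb[of ?F "comp M x", OF hsub_comp[OF L xL]] comp_sum[OF M xM] by simp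
    then show "\<exists>F g. finite F \<and> (\<forall>n\<in>F. g n \<in> mgr (restrict_gmod M L) n) \<and> x = (\<Oplus>\<^bsub>restrict_gmod M L\<^esub>n\<in>F. g n)"
      using comp_finite[OF M xM] M xM hsub_comp[OF L xL]
      by (intro exI[of _ ?F] exI[of _ "comp M x"]) auto
  next
    fix F :: "int set" and g assume F: "finite F" and g: "\<And>n. n \<in> F \<Longrightarrow> g n \<in> mgr (restrict_gmod M L) n"
      and s: "(\<Oplus>\<^bsub>restrict_gmod M L\<^esub>n\<in>F. g n) = \<zero>\<^bsub>restrict_gmod M L\<^esub>"
    have g1: "g n \<in> mgr M n" "g n \<in> L" if "n \<in> F" for n using g[OF that] by auto
    have "(\<Oplus>\<^bsub>M\<^esub>n\<in>F. g n) = \<zero>\<^bsub>M\<^esub>" using s lin_comb[of F g, OF g1(2)] by simp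
    then show "\<forall>n\<in>F. g n = \<zero>\<^bsub>restrict_gmod M L\<^esub>"
      using gm_independent[OF M F g1(1)] by simp
  qed (use M hsub_carrier[OF L] hsub_zero[OF L] hsub_add[OF L] hsub_smult[OF L] rgr_carrier in \<open>auto simp: gm_smult_mgr\<close>)
qed

lemma homogeneous_submodule_hsub:
  "graded_module R M \<Longrightarrow> hsub M L \<Longrightarrow> homogeneous_submodule R M L"
  unfolding homogeneous_submodule_def using hsub_submodule graded_module_restrict by blast

lemma hm_inclusion: "hsub M L \<Longrightarrow> graded_hom R (restrict_gmod M L) M (\<lambda>x. x)"
  using hsub_carrier[of M L] by (intro homogeneous_mapI) auto

lemma hm_into_restrict:
  "graded_module R M \<Longrightarrow> homogeneous_map R M N n f \<Longrightarrow> (\<And>x. x \<in> carrier M \<Longrightarrow> f x \<in> L) \<Longrightarrow>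
    homogeneous_map R M (restrict_gmod N L) n f"
  by (intro homogeneous_mapI) (auto simp: hm_add hm_smult hm_mgr mgr_carrier)

lemma hm_from_restrict:
  "hsub M L \<Longrightarrow> homogeneous_map R M N n f \<Longrightarrow> homogeneous_map R (restrict_gmod M L) N n f"
  using hm_compose_gh[OF hm_inclusion] by blast

context
  fixes A :: "('a, 'b) gmod" and B
  assumes A: "graded_module R A" and B: "hsub A B"
begin

lemma abelian_subgroup_hsub: "abelian_subgroup B A"
proof -
  interpret A: module R A by (rule gm_module[OF A])
  have "additive_subgroup B A"
    using hsub_submodule[OF A B] submodule.axioms(1) by (intro additive_subgroupI) blast
  then show ?thesis by (intro abelian_subgroupI3 A.abelian_group_axioms)
qed

lemma coset_eq_iff:
  assumes "x \<in> carrier A" "y \<in> carrier A"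
  shows "B +>\<^bsub>A\<^esub> x = B +>\<^bsub>A\<^esub> y \<longleftrightarrow> x \<oplus>\<^bsub>A\<^esub> \<ominus>\<^bsub>A\<^esub> y \<in> B"
proof -
  interpret B: abelian_subgroup B A by (rule abelian_subgroup_hsub)
  interpret A: module R A by (rule gm_module[OF A])
  have "B +>\<^bsub>A\<^esub> x = B +>\<^bsub>A\<^esub> y \<longleftrightarrow> x \<in> B +>\<^bsub>A\<^esub> y"
    using B.a_repr_independence'[of x y] B.a_rcos_self[of x] assms by metis
  also have "\<dots> \<longleftrightarrow> x \<oplus>\<^bsub>A\<^esub> \<ominus>\<^bsub>A\<^esub> y \<in> B"
    using B.a_rcos_module[OF assms(2,1)] assms by (simp add: a_minus_def)
  finally show ?thesis .
qed

lemma coset_self: "x \<in> carrier A \<Longrightarrow> x \<in> B +>\<^bsub>A\<^esub> x"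
  using abelian_subgroup.a_rcos_self[OF abelian_subgroup_hsub] by blast

lemma coset_mem: "x \<in> B +>\<^bsub>A\<^esub> y \<Longrightarrow> y \<in> carrier A \<Longrightarrow> x \<in> carrier A \<and> B +>\<^bsub>A\<^esub> x = B +>\<^bsub>A\<^esub> y"
  using abelian_subgroup.a_repr_independence'[OF abelian_subgroup_hsub, of x y]
    abelian_subgroup.a_elemrcos_carrier[OF abelian_subgroup_hsub, of y x] by simp

lemma coset_zero_iff: "x \<in> carrier A \<Longrightarrow> B +>\<^bsub>A\<^esub> x = B \<longleftrightarrow> x \<in> B"
  using coset_eq_iff[of x "\<zero>\<^bsub>A\<^esub>"] A abelian_group.a_coset_add_zero[OF gm_abelian[OF A], of B] hsub_carrier[OF B]
  by (simp add: subset_iff)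

lemma coset_add:
  "x \<in> carrier A \<Longrightarrow> y \<in> carrier A \<Longrightarrow> (B +>\<^bsub>A\<^esub> x) <+>\<^bsub>A\<^esub> (B +>\<^bsub>A\<^esub> y) = B +>\<^bsub>A\<^esub> (x \<oplus>\<^bsub>A\<^esub> y)"
  using abelian_subgroup.a_rcos_sum[OF abelian_subgroup_hsub] by blast

text \<open>Operations on cosets in the definitions are unions over all representatives; they may be
  evaluated at any one of them.\<close>

lemma coset_UN:
  assumes z: "z \<in> carrier A" and f: "\<And>x. x \<in> carrier A \<Longrightarrow> B +>\<^bsub>A\<^esub> x = B +>\<^bsub>A\<^esub> z \<Longrightarrow> f x = f z"
  shows "(\<Union>x\<in>B +>\<^bsub>A\<^esub> z. f x) = f z"
proof -
  have "f x = f z" if "x \<in> B +>\<^bsub>A\<^esub> z" for x using coset_mem[OF that z] f by blast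
  then show ?thesis using coset_self[OF z] by (intro SUP_eq_const) blast+
qed

lemma coset_smult:
  assumes a: "a \<in> carrier R" and z: "z \<in> carrier A"
  shows "(\<Union>x\<in>B +>\<^bsub>A\<^esub> z. B +>\<^bsub>A\<^esub> (a \<odot>\<^bsub>A\<^esub> x)) = B +>\<^bsub>A\<^esub> (a \<odot>\<^bsub>A\<^esub> z)"
proof (rule coset_UN[OF z])
  fix x assume x: "x \<in> carrier A" "B +>\<^bsub>A\<^esub> x = B +>\<^bsub>A\<^esub> z"
  then have "a \<odot>\<^bsub>A\<^esub> (x \<oplus>\<^bsub>A\<^esub> \<ominus>\<^bsub>A\<^esub> z) \<in> B"
    using coset_eq_iff[OF x(1) z] hsub_smult[OF B a] by simp
  then have "a \<odot>\<^bsub>A\<^esub> x \<oplus>\<^bsub>A\<^esub> \<ominus>\<^bsub>A\<^esub> (a \<odot>\<^bsub>A\<^esub> z) \<in> B"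
    using A a x z by (simp add: gm_smult_add gm_smult_neg)
  then show "B +>\<^bsub>A\<^esub> (a \<odot>\<^bsub>A\<^esub> x) = B +>\<^bsub>A\<^esub> (a \<odot>\<^bsub>A\<^esub> z)"
    using coset_eq_iff A a x(1) z by simp
qed

text \<open>Independence is the point. If the classes of homogeneous \<open>z n\<close> of distinct
  degrees sum to zero, then the sum \<open>y\<close> of the \<open>z n\<close> lies in
  \<open>B\<close>. The components of \<open>y\<close> are the \<open>z n\<close>, and
  \<open>B\<close> is closed under components, so each class is zero.\<close>

lemma
  assumes Z: "hsub A Z"
  shows graded_module_gquot: "graded_module R (gquot A Z B)"
    and hm_coset: "graded_hom R (restrict_gmod A Z) (gquot A Z B) (\<lambda>z. B +>\<^bsub>A\<^esub> z)"
proof -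
  let ?Q = "gquot A Z B" and ?q = "\<lambda>z. B +>\<^bsub>A\<^esub> z" and ?Z = "restrict_gmod A Z"
  have Zg: "graded_module R ?Z" by (rule graded_module_restrict[OF A Z])
  have q0: "?q \<zero>\<^bsub>A\<^esub> = B" using coset_zero_iff[of "\<zero>\<^bsub>A\<^esub>"] A hsub_zero[OF B] by simp
  have mod: "module R ?Q"
    by (rule module_image[OF gm_module[OF Zg], of ?q])
      (use hsub_carrier[OF Z] A q0 in \<open>auto simp: coset_add coset_smult\<close>)
  show hm: "graded_hom R ?Z ?Q ?q"
    by (intro homogeneous_mapI)
      (use hsub_carrier[OF Z] A in \<open>auto simp: coset_add coset_smult\<close>)
  note lin = lin_finsum[OF gm_module[OF Zg] mod hm_linear[OF hm]]
  show "graded_module R ?Q"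
  proof (rule graded_moduleI[OF mod])
    show "mgr ?Q n \<subseteq> carrier ?Q" for n by auto
    show "\<zero>\<^bsub>?Q\<^esub> \<in> mgr ?Q n" for n
      using q0 hsub_zero[OF Z] mgr_zero[OF A] by (auto simp: image_iff intro!: bexI[of _ "\<zero>\<^bsub>A\<^esub>"])
    show "X \<oplus>\<^bsub>?Q\<^esub> Y \<in> mgr ?Q n" if "X \<in> mgr ?Q n" "Y \<in> mgr ?Q n" for n X Y
      using that A hsub_carrier[OF Z] hsub_add[OF Z] by (auto simp: coset_add)
    show "a \<odot>\<^bsub>?Q\<^esub> X \<in> mgr ?Q (m + n)" if a: "a \<in> rgr R m" and X: "X \<in> mgr ?Q n" for m n a X
    proof -
      obtain z where z: "z \<in> Z" "z \<in> mgr A n" "X = ?q z" using X by auto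
      then have "a \<odot>\<^bsub>?Q\<^esub> X = ?q (a \<odot>\<^bsub>A\<^esub> z)"
        using a rgr_carrier hsub_carrier[OF Z] by (simp add: coset_smult)
      moreover have "a \<odot>\<^bsub>A\<^esub> z \<in> Z \<inter> mgr A (m + n)"
        using z a rgr_carrier hsub_smult[OF Z] gm_smult_mgr[OF A] by simp
      ultimately show ?thesis by auto
    qed
    show "\<exists>F g. finite F \<and> (\<forall>n\<in>F. g n \<in> mgr ?Q n) \<and> X = (\<Oplus>\<^bsub>?Q\<^esub>n\<in>F. g n)"
      if X: "X \<in> carrier ?Q" for X
    proof -
      obtain z where z: "z \<in> Z" "X = ?q z" using X by auto
      then have zc: "z \<in> carrier ?Z" by simp
      let ?F = "{n. comp ?Z z n \<noteq> \<zero>\<^bsub>?Z\<^esub>}"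
      have "X = (\<Oplus>\<^bsub>?Q\<^esub>n\<in>?F. ?q (comp ?Z z n))"
        using lin[of ?F "comp ?Z z"] comp_sum[OF Zg zc] z comp_carrier[OF Zg zc] by simp
      then show ?thesis
        using comp_finite[OF Zg zc] comp_mgr[OF Zg zc]
        by (intro exI[of _ ?F] exI[of _ "\<lambda>n. ?q (comp ?Z z n)"]) auto
    qed
    fix F :: "int set" and g assume F: "finite F" and g: "\<And>n. n \<in> F \<Longrightarrow> g n \<in> mgr ?Q n"
      and s: "(\<Oplus>\<^bsub>?Q\<^esub>n\<in>F. g n) = \<zero>\<^bsub>?Q\<^esub>"
    have "\<forall>n\<in>F. \<exists>z. z \<in> mgr ?Z n \<and> g n = ?q z" using g by auto
    then obtain z where z: "\<And>n. n \<in> F \<Longrightarrow> z n \<in> mgr ?Z n" "\<And>n. n \<in> F \<Longrightarrow> g n = ?q (z n)" by metis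
    have zZ: "z n \<in> carrier ?Z" if "n \<in> F" for n using mgr_carrier[OF Zg z(1)[OF that]] .
    interpret Q: module R ?Q by (rule mod)
    define y where "y = (\<Oplus>\<^bsub>?Z\<^esub>n\<in>F. z n)"
    have y: "y \<in> Z" "y \<in> carrier A"
      using gm_finsum_closed[of ?Z F z, OF Zg zZ] hsub_carrier[OF Z] unfolding y_def by auto
    have "?q y = (\<Oplus>\<^bsub>?Q\<^esub>n\<in>F. ?q (z n))" using lin[of F z, OF zZ] by (simp add: y_def)
    also have "\<dots> = (\<Oplus>\<^bsub>?Q\<^esub>n\<in>F. g n)"
      by (rule Q.M.finsum_cong') (use z(2) zZ g in auto)
    finally have "y \<in> B" using s y coset_zero_iff by simp
    have "comp ?Z y n = z n" if "n \<in> F" for n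
      by (rule trans[OF component_eqI[OF gm_abelian[OF Zg] gm_graded[OF Zg] F z(1) y_def]])
        (simp_all add: that)
    \<comment> \<open>Closure of \<open>B\<close> concerns components taken in \<open>A\<close>; the
      inclusion of \<open>Z\<close> preserves components.\<close>
    moreover have "comp ?Z y n = comp A y n" for n
      using comp_hom[OF Zg A hm_inclusion[OF Z], of y n] y by simp
    ultimately have "z n \<in> B" if "n \<in> F" for n
      using hsub_comp[OF B \<open>y \<in> B\<close>, of n] that by simp
    then show "\<forall>n\<in>F. g n = \<zero>\<^bsub>?Q\<^esub>"
      using z(2) coset_zero_iff hsub_carrier[OF B] by simp
  qed
qed

lemma hm_coset_whole: "graded_hom R A (gquot A (carrier A) B) (\<lambda>z. B +>\<^bsub>A\<^esub> z)"
  using hm_coset[OF hsub_whole[OF A]] mgr_carrier[OF A]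
  unfolding homogeneous_map_def linear_map_def by auto

end

end


section \<open>Free modules and projectivity\<close>

lemma free_gmod_simps:
  "carrier (free_gmod R G dg) = {f. (\<forall>s\<in>G. f s \<in> carrier R) \<and> (\<forall>s. s \<notin> G \<longrightarrow> f s = \<zero>\<^bsub>R\<^esub>) \<and> finite {s. f s \<noteq> \<zero>\<^bsub>R\<^esub>}}"
  "\<zero>\<^bsub>free_gmod R G dg\<^esub> = (\<lambda>s. \<zero>\<^bsub>R\<^esub>)"
  "f \<oplus>\<^bsub>free_gmod R G dg\<^esub> g = (\<lambda>s. f s \<oplus>\<^bsub>R\<^esub> g s)"
  "a \<odot>\<^bsub>free_gmod R G dg\<^esub> f = (\<lambda>s. a \<otimes>\<^bsub>R\<^esub> f s)"
  "mgr (free_gmod R G dg) n = {f \<in> carrier (free_gmod R G dg). \<forall>s\<in>G. f s \<in> rgr R (n - dg s)}"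
  by (simp_all add: free_gmod_def Let_def)

text \<open>The linear extension of a family \<open>y\<close> of values on a basis, evaluated at the
  element with coefficients \<open>f\<close>. The augmentation and the differentials of both free
  complexes below have this form.\<close>

definition lin_comb :: "'a gring \<Rightarrow> ('a, 'b) gmod \<Rightarrow> ('s \<Rightarrow> 'b) \<Rightarrow> ('s \<Rightarrow> 'a) \<Rightarrow> 'b" where
  "lin_comb R K y f = (\<Oplus>\<^bsub>K\<^esub>s\<in>{s. f s \<noteq> \<zero>\<^bsub>R\<^esub>}. f s \<odot>\<^bsub>K\<^esub> y s)"

definition fdelta :: "'a gring \<Rightarrow> 's \<Rightarrow> 's \<Rightarrow> 'a" where
  "fdelta R s = (\<lambda>t. if t = s then \<one>\<^bsub>R\<^esub> else \<zero>\<^bsub>R\<^esub>)"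

text \<open>Projectivity is stated as being a retract of a free module, whose basis has to be taken in a
  fixed type; this makes it stable under direct sums, hence under mapping cones.\<close>

definition projective :: "'s itself \<Rightarrow> 'a gring \<Rightarrow> ('a, 'b) gmod \<Rightarrow> bool" where
  "projective T R M \<longleftrightarrow> (\<exists>(G :: 's set) dg b \<sigma>. (\<forall>s\<in>G. b s \<in> mgr M (dg s)) \<and>
     graded_hom R M (free_gmod R G dg) \<sigma> \<and> (\<forall>x\<in>carrier M. lin_comb R M b (\<sigma> x) = x))"

context graded_base
begin

lemma free_carrier:
  assumes "f \<in> carrier (free_gmod R G dg)"
  shows "f s \<in> carrier R" "s \<notin> G \<Longrightarrow> f s = \<zero>\<^bsub>R\<^esub>" "finite {s. f s \<noteq> \<zero>\<^bsub>R\<^esub>}" "{s. f s \<noteq> \<zero>\<^bsub>R\<^esub>} \<subseteq> G"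
proof -
  interpret R: cring R by (rule cring)
  show "f s \<in> carrier R" "s \<notin> G \<Longrightarrow> f s = \<zero>\<^bsub>R\<^esub>" "finite {s. f s \<noteq> \<zero>\<^bsub>R\<^esub>}" "{s. f s \<noteq> \<zero>\<^bsub>R\<^esub>} \<subseteq> G"
    using assms by (cases "s \<in> G"; auto simp: free_gmod_simps)+
qed

lemma free_carrierI:
  assumes "\<And>s. s \<in> G \<Longrightarrow> f s \<in> carrier R" "\<And>s. s \<notin> G \<Longrightarrow> f s = \<zero>\<^bsub>R\<^esub>" "finite S" "\<And>s. s \<notin> S \<Longrightarrow> f s = \<zero>\<^bsub>R\<^esub>"
  shows "f \<in> carrier (free_gmod R G dg)"
proof -
  have "{s. f s \<noteq> \<zero>\<^bsub>R\<^esub>} \<subseteq> S" using assms(4) by blast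
  then have "finite {s. f s \<noteq> \<zero>\<^bsub>R\<^esub>}" using assms(3) finite_subset by blast
  then show ?thesis using assms(1,2) by (simp add: free_gmod_simps)
qed

lemma module_free: "module R (free_gmod R G dg)"
proof -
  interpret R: cring R by (rule cring)
  let ?M = "free_gmod R G dg"
  have addc: "(\<lambda>s. f s \<oplus>\<^bsub>R\<^esub> g s) \<in> carrier ?M" if "f \<in> carrier ?M" "g \<in> carrier ?M" for f g
    using free_carrier[OF that(1)] free_carrier[OF that(2)]
    by (intro free_carrierI[of _ _ "{s. f s \<noteq> \<zero>\<^bsub>R\<^esub>} \<union> {s. g s \<noteq> \<zero>\<^bsub>R\<^esub>}"]) auto
  have smc: "(\<lambda>s. a \<otimes>\<^bsub>R\<^esub> f s) \<in> carrier ?M" if "a \<in> carrier R" "f \<in> carrier ?M" for a f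
    using free_carrier[OF that(2)] that(1)
    by (intro free_carrierI[of _ _ "{s. f s \<noteq> \<zero>\<^bsub>R\<^esub>}"]) auto
  have zc: "(\<lambda>s. \<zero>\<^bsub>R\<^esub>) \<in> carrier ?M"
    by (intro free_carrierI[of _ _ "{}"]) auto
  note simps = free_gmod_simps(2-4)
  show ?thesis
  proof (rule moduleI[OF cring])
    show "abelian_group ?M"
    proof (rule abelian_groupI)
      fix f assume f: "f \<in> carrier ?M"
      have "(\<lambda>s. \<ominus>\<^bsub>R\<^esub> \<one>\<^bsub>R\<^esub> \<otimes>\<^bsub>R\<^esub> f s) \<in> carrier ?M" by (rule smc) (use f in auto)
      moreover have "(\<lambda>s. (\<ominus>\<^bsub>R\<^esub> \<one>\<^bsub>R\<^esub> \<otimes>\<^bsub>R\<^esub> f s) \<oplus>\<^bsub>R\<^esub> f s) = (\<lambda>s. \<zero>\<^bsub>R\<^esub>)"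
        using free_carrier(1)[OF f] by (intro ext) (simp add: R.l_minus R.l_neg)
      ultimately show "\<exists>y\<in>carrier ?M. y \<oplus>\<^bsub>?M\<^esub> f = \<zero>\<^bsub>?M\<^esub>"
        unfolding simps by (intro bexI[of _ "\<lambda>s. \<ominus>\<^bsub>R\<^esub> \<one>\<^bsub>R\<^esub> \<otimes>\<^bsub>R\<^esub> f s"])
    qed (unfold simps, insert addc zc free_carrier(1)[of _ G dg],
        simp_all add: fun_eq_iff R.a_assoc R.a_comm R.a_lcomm)
  qed (unfold simps, insert addc smc free_carrier(1)[of _ G dg],
      simp_all add: fun_eq_iff R.l_distr R.r_distr R.m_assoc)
qed

lemma free_finsum:
  assumes "\<And>i. i \<in> I \<Longrightarrow> g i \<in> carrier (free_gmod R G dg)"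
  shows "(\<Oplus>\<^bsub>free_gmod R G dg\<^esub>i\<in>I. g i) s = (\<Oplus>\<^bsub>R\<^esub>i\<in>I. g i s)"
proof -
  interpret F: module R "free_gmod R G dg" by (rule module_free)
  show ?thesis
  proof (cases "finite I")
    case True
    then show ?thesis using assms
    proof (induction I)
      case (insert i I)
      then have g: "g \<in> I \<rightarrow> carrier (free_gmod R G dg)" "g i \<in> carrier (free_gmod R G dg)" by auto
      have gs: "(\<lambda>i. g i s) \<in> I \<rightarrow> carrier R" "g i s \<in> carrier R" using g free_carrier(1)[of _ G dg] by auto
      have "(\<Oplus>\<^bsub>free_gmod R G dg\<^esub>i\<in>insert i I. g i) = g i \<oplus>\<^bsub>free_gmod R G dg\<^esub> (\<Oplus>\<^bsub>free_gmod R G dg\<^esub>i\<in>I. g i)"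
        using insert g by (simp add: F.M.finsum_insert)
      then show ?case using insert gs by (simp add: free_gmod_simps(3) F.R.finsum_insert)
    qed (simp add: free_gmod_simps(2))
  qed (simp add: free_gmod_simps(2) F.M.finsum_infinite F.R.finsum_infinite)
qed

lemma graded_module_free: "graded_module R (free_gmod R G dg)"
proof (rule graded_moduleI[OF module_free])
  interpret R: cring R by (rule cring)
  interpret F: module R "free_gmod R G dg" by (rule module_free)
  let ?M = "free_gmod R G dg"
  let ?c = "component R (rgr R)"
  note simps = free_gmod_simps(2-4)
  fix n
  show "mgr ?M n \<subseteq> carrier ?M" by (auto simp: free_gmod_simps(5))
  show "\<zero>\<^bsub>?M\<^esub> \<in> mgr ?M n"
    using F.M.zero_closed additive_subgroup.zero_closed[OF rgr_sub] by (simp add: free_gmod_simps(2,5))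
  show "x \<oplus>\<^bsub>?M\<^esub> y \<in> mgr ?M n" if "x \<in> mgr ?M n" "y \<in> mgr ?M n" for x y
    using F.M.a_closed[of x y] that additive_subgroup.a_closed[OF rgr_sub] by (simp add: free_gmod_simps(3,5))
  show "a \<odot>\<^bsub>?M\<^esub> x \<in> mgr ?M (m + n)" if "a \<in> rgr R m" "x \<in> mgr ?M n" for a x m
    using F.smult_closed[of a x] that rgr_carrier rgr_mult[of a m "x _" "n - dg _"]
    by (simp add: free_gmod_simps(4,5) add_diff_eq)
next
  interpret R: cring R by (rule cring)
  let ?M = "free_gmod R G dg"
  let ?c = "component R (rgr R)"
  have c0: "?c \<zero>\<^bsub>R\<^esub> n = \<zero>\<^bsub>R\<^esub>" for n
    using component_homogeneous[OF R_abelian rgr_graded additive_subgroup.zero_closed[OF rgr_sub]] by simp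
  fix x assume x: "x \<in> carrier ?M"
  note xc = free_carrier[OF x]
  let ?S = "{s. x s \<noteq> \<zero>\<^bsub>R\<^esub>}"
  \<comment> \<open>A component of degree \<open>m\<close> of the coefficient at \<open>s\<close>
    contributes to total degree \<open>m + dg s\<close>.\<close>
  let ?F = "\<Union>s\<in>?S. (\<lambda>m. m + dg s) ` {m. ?c (x s) m \<noteq> \<zero>\<^bsub>R\<^esub>}"
  let ?g = "\<lambda>n s. ?c (x s) (n - dg s)"
  have cc: "?c (x s) m \<in> rgr R m" for s m using component_mem[OF rgr_graded xc(1)] .
  have F: "finite ?F" using xc(3) component_finite[OF rgr_graded xc(1)] by blast
  have gM: "?g n \<in> mgr ?M n" for n
    using xc cc rgr_carrier[OF cc] c0
    by (auto simp: free_gmod_simps(5) intro!: free_carrierI[of _ _ ?S])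
  then have gc: "?g n \<in> carrier ?M" for n by (simp add: free_gmod_simps(5))
  have "x s = (\<Oplus>\<^bsub>R\<^esub>n\<in>?F. ?c (x s) (n - dg s))" for s
  proof -
    have "(\<Oplus>\<^bsub>R\<^esub>n\<in>?F. ?c (x s) (n - dg s)) = (\<Oplus>\<^bsub>R\<^esub>n\<in>(\<lambda>m. m + dg s) ` {m. ?c (x s) m \<noteq> \<zero>\<^bsub>R\<^esub>}. ?c (x s) (n - dg s))"
    proof (rule R.add.finprod_mono_neutral_cong_right[OF F])
      show "(\<lambda>m. m + dg s) ` {m. ?c (x s) m \<noteq> \<zero>\<^bsub>R\<^esub>} \<subseteq> ?F"
      proof (cases "x s = \<zero>\<^bsub>R\<^esub>")
        case True
        then show ?thesis using c0 by simp
      next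
        case False
        then show ?thesis by (intro UN_upper) simp
      qed
      show "?c (x s) (n - dg s) = \<zero>\<^bsub>R\<^esub>"
        if "n \<in> ?F - (\<lambda>m. m + dg s) ` {m. ?c (x s) m \<noteq> \<zero>\<^bsub>R\<^esub>}" for n
        using that by (force simp: image_iff)
    qed (use rgr_carrier[OF cc] in auto)
    also have "\<dots> = (\<Oplus>\<^bsub>R\<^esub>m\<in>{m. ?c (x s) m \<noteq> \<zero>\<^bsub>R\<^esub>}. ?c (x s) m)"
      by (subst R.add.finprod_reindex) (use rgr_carrier[OF cc] in \<open>auto simp: inj_on_def\<close>)
    also have "\<dots> = x s" by (rule component_sum[OF rgr_graded xc(1)])
    finally show ?thesis by simp
  qed
  then have "x = (\<Oplus>\<^bsub>?M\<^esub>n\<in>?F. ?g n)"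
    by (intro ext) (simp only: free_finsum[OF gc])
  then show "\<exists>F g. finite F \<and> (\<forall>n\<in>F. g n \<in> mgr ?M n) \<and> x = (\<Oplus>\<^bsub>?M\<^esub>n\<in>F. g n)"
    using F gM by (intro exI[of _ ?F] exI[of _ ?g]) simp
next
  interpret R: cring R by (rule cring)
  let ?M = "free_gmod R G dg"
  fix F :: "int set" and g assume F: "finite F" and g: "\<And>n. n \<in> F \<Longrightarrow> g n \<in> mgr ?M n"
    and s: "(\<Oplus>\<^bsub>?M\<^esub>n\<in>F. g n) = \<zero>\<^bsub>?M\<^esub>"
  have gc: "g n \<in> carrier ?M" if "n \<in> F" for n using g[OF that] by (simp add: free_gmod_simps(5))
  have "g n t = \<zero>\<^bsub>R\<^esub>" if n: "n \<in> F" for n t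
  proof (cases "t \<in> G")
    case True
    \<comment> \<open>In the coordinate \<open>t\<close>, total degree \<open>n\<close> means
      coefficient degree \<open>n - dg t\<close>; after this shift independence in \<open>R\<close>
      applies.\<close>
    have "(\<Oplus>\<^bsub>R\<^esub>n\<in>(\<lambda>n. n - dg t) ` F. g (n + dg t) t) = (\<Oplus>\<^bsub>R\<^esub>n\<in>F. g n t)"
      by (subst R.add.finprod_reindex) (use gc free_carrier(1)[of _ G dg] in \<open>auto simp: inj_on_def\<close>)
    also have "\<dots> = \<zero>\<^bsub>R\<^esub>"
      using fun_cong[OF s, of t] free_finsum[of F g G dg t, OF gc] by (simp add: free_gmod_simps(2))
    finally have "g ((n - dg t) + dg t) t = \<zero>\<^bsub>R\<^esub>"
      using F g True n
      by (intro graded_by_independent[OF R_abelian rgr_graded, of "(\<lambda>n. n - dg t) ` F" "\<lambda>n. g (n + dg t) t"])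
        (auto simp: free_gmod_simps(5))
    then show ?thesis by simp
  qed (use free_carrier(2)[OF gc[OF n]] in simp)
  then show "\<forall>n\<in>F. g n = \<zero>\<^bsub>?M\<^esub>" by (auto simp: free_gmod_simps(2))
qed

lemma lin_comb_on:
  assumes K: "graded_module R K" and f: "f \<in> carrier (free_gmod R G dg)"
    and y: "\<And>s. s \<in> S \<Longrightarrow> y s \<in> carrier K" and S: "finite S" "{s. f s \<noteq> \<zero>\<^bsub>R\<^esub>} \<subseteq> S"
  shows "lin_comb R K y f = (\<Oplus>\<^bsub>K\<^esub>s\<in>S. f s \<odot>\<^bsub>K\<^esub> y s)"
proof -
  interpret K: module R K by (rule gm_module[OF K])
  show ?thesis unfolding lin_comb_def
    by (rule K.M.add.finprod_mono_neutral_cong_left[OF S]) (use y free_carrier(1)[OF f] in auto)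
qed

lemma lin_comb_hom:
  assumes K: "graded_module R K" and L: "graded_module R L" and p: "homogeneous_map R K L n p"
    and f: "f \<in> carrier (free_gmod R G dg)" and y: "\<And>s. s \<in> G \<Longrightarrow> y s \<in> carrier K"
  shows "p (lin_comb R K y f) = lin_comb R L (\<lambda>s. p (y s)) f"
proof -
  interpret L: module R L by (rule gm_module[OF L])
  note fc = free_carrier[OF f]
  have yc: "y s \<in> carrier K" if "s \<in> {s. f s \<noteq> \<zero>\<^bsub>R\<^esub>}" for s using that fc(4) y by blast
  have "p (lin_comb R K y f) = (\<Oplus>\<^bsub>L\<^esub>s\<in>{s. f s \<noteq> \<zero>\<^bsub>R\<^esub>}. p (f s \<odot>\<^bsub>K\<^esub> y s))"
    unfolding lin_comb_def using hm_finsum[OF K L p, of "{s. f s \<noteq> \<zero>\<^bsub>R\<^esub>}" "\<lambda>s. f s \<odot>\<^bsub>K\<^esub> y s"] K fc(1) yc by simp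
  also have "\<dots> = lin_comb R L (\<lambda>s. p (y s)) f"
    unfolding lin_comb_def
    by (rule L.M.finsum_cong') (use fc(1) yc hm_smult[OF p] hm_closed[OF p] in auto)
  finally show ?thesis .
qed

lemma lin_comb_cong:
  assumes L: "graded_module R L" and f: "f \<in> carrier (free_gmod R G dg)"
    and y: "\<And>s. s \<in> G \<Longrightarrow> y s = y' s" "\<And>s. s \<in> G \<Longrightarrow> y' s \<in> carrier L"
  shows "lin_comb R L y f = lin_comb R L y' f"
proof -
  interpret L: module R L by (rule gm_module[OF L])
  show ?thesis unfolding lin_comb_def
    by (rule L.M.finsum_cong') (use y free_carrier[OF f] in auto)
qed

text \<open>Freeness: the values on the basis are arbitrary up to degrees, and a uniform shift by
  \<open>n\<close> on generators makes the extension homogeneous of degree \<open>n\<close>.\<close>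

lemma hm_lin_comb:
  assumes K: "graded_module R K" and y: "\<And>s. s \<in> G \<Longrightarrow> y s \<in> mgr K (dg s + n)"
  shows "homogeneous_map R (free_gmod R G dg) K n (lin_comb R K y)"
proof -
  let ?M = "free_gmod R G dg"
  interpret K: module R K by (rule gm_module[OF K])
  interpret F: module R ?M by (rule module_free)
  have yc: "y s \<in> carrier K" if "s \<in> G" for s using mgr_carrier[OF K y[OF that]] .
  show ?thesis
  proof (rule homogeneous_mapI)
    show "lin_comb R K y f \<in> carrier K" if "f \<in> carrier ?M" for f
      unfolding lin_comb_def
      by (rule gm_finsum_closed[OF K]) (use free_carrier[OF that] yc in auto)
    show "lin_comb R K y (f \<oplus>\<^bsub>?M\<^esub> g) = lin_comb R K y f \<oplus>\<^bsub>K\<^esub> lin_comb R K y g"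
      if f: "f \<in> carrier ?M" and g: "g \<in> carrier ?M" for f g
    proof -
      let ?S = "{s. f s \<noteq> \<zero>\<^bsub>R\<^esub>} \<union> {s. g s \<noteq> \<zero>\<^bsub>R\<^esub>}"
      note fc = free_carrier[OF f] and gc = free_carrier[OF g]
      have S: "finite ?S" and yS: "\<And>s. s \<in> ?S \<Longrightarrow> y s \<in> carrier K" using fc gc yc by auto
      have "lin_comb R K y (f \<oplus>\<^bsub>?M\<^esub> g) = (\<Oplus>\<^bsub>K\<^esub>s\<in>?S. (f \<oplus>\<^bsub>?M\<^esub> g) s \<odot>\<^bsub>K\<^esub> y s)"
        by (rule lin_comb_on[OF K F.M.a_closed[OF f g] yS S]) (auto simp: free_gmod_simps(3))
      also have "\<dots> = (\<Oplus>\<^bsub>K\<^esub>s\<in>?S. f s \<odot>\<^bsub>K\<^esub> y s \<oplus>\<^bsub>K\<^esub> g s \<odot>\<^bsub>K\<^esub> y s)"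
        by (rule K.M.finsum_cong') (use fc gc yS in \<open>auto simp: free_gmod_simps(3) K.smult_l_distr\<close>)
      also have "\<dots> = (\<Oplus>\<^bsub>K\<^esub>s\<in>?S. f s \<odot>\<^bsub>K\<^esub> y s) \<oplus>\<^bsub>K\<^esub> (\<Oplus>\<^bsub>K\<^esub>s\<in>?S. g s \<odot>\<^bsub>K\<^esub> y s)"
        by (rule K.M.finsum_addf) (use fc gc yS in auto)
      also have "\<dots> = lin_comb R K y f \<oplus>\<^bsub>K\<^esub> lin_comb R K y g"
        using lin_comb_on[OF K f yS S] lin_comb_on[OF K g yS S] by simp
      finally show ?thesis .
    qed
    show "lin_comb R K y (a \<odot>\<^bsub>?M\<^esub> f) = a \<odot>\<^bsub>K\<^esub> lin_comb R K y f"
      if a: "a \<in> carrier R" and f: "f \<in> carrier ?M" for a f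
    proof -
      let ?S = "{s. f s \<noteq> \<zero>\<^bsub>R\<^esub>}"
      note fc = free_carrier[OF f]
      have yS: "\<And>s. s \<in> ?S \<Longrightarrow> y s \<in> carrier K" using fc yc by auto
      have "lin_comb R K y (a \<odot>\<^bsub>?M\<^esub> f) = (\<Oplus>\<^bsub>K\<^esub>s\<in>?S. (a \<odot>\<^bsub>?M\<^esub> f) s \<odot>\<^bsub>K\<^esub> y s)"
        by (rule lin_comb_on[OF K F.smult_closed[OF a f] yS fc(3)]) (use a in \<open>auto simp: free_gmod_simps(4)\<close>)
      also have "\<dots> = (\<Oplus>\<^bsub>K\<^esub>s\<in>?S. a \<odot>\<^bsub>K\<^esub> (f s \<odot>\<^bsub>K\<^esub> y s))"
        by (rule K.M.finsum_cong') (use fc yS a in \<open>auto simp: free_gmod_simps(4) K.smult_assoc1\<close>)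
      also have "\<dots> = a \<odot>\<^bsub>K\<^esub> lin_comb R K y f"
        unfolding lin_comb_def by (rule K.finsum_smult_ldistr[symmetric]) (use fc a yS in auto)
      finally show ?thesis .
    qed
    show "lin_comb R K y f \<in> mgr K (k + n)" if f: "f \<in> mgr ?M k" for k f
    proof -
      have fm: "f \<in> carrier ?M" "\<And>s. s \<in> G \<Longrightarrow> f s \<in> rgr R (k - dg s)" using f by (auto simp: free_gmod_simps(5))
      note fc = free_carrier[OF fm(1)]
      show ?thesis unfolding lin_comb_def
      proof (rule finsum_mem[OF K])
        fix s assume "s \<in> {s. f s \<noteq> \<zero>\<^bsub>R\<^esub>}"
        then have s: "s \<in> G" using fc(4) by blast
        show "f s \<odot>\<^bsub>K\<^esub> y s \<in> mgr K (k + n)"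
          using gm_smult_mgr[OF K fm(2)[OF s] y[OF s]] by simp
      qed (use K mgr_carrier[OF K] in auto)
    qed
  qed
qed

lemma fdelta_mgr: "s \<in> G \<Longrightarrow> fdelta R s \<in> mgr (free_gmod R G dg) (dg s)"
proof -
  interpret R: cring R by (rule cring)
  assume "s \<in> G"
  then have "fdelta R s \<in> carrier (free_gmod R G dg)"
    by (intro free_carrierI[of _ _ "{s}"]) (auto simp: fdelta_def)
  then show ?thesis
    using one_rgr additive_subgroup.zero_closed[OF rgr_sub] by (auto simp: free_gmod_simps(5) fdelta_def)
qed

lemma lin_comb_delta:
  assumes K: "graded_module R K" and s: "s \<in> G" "y s \<in> carrier K"
  shows "lin_comb R K y (fdelta R s) = y s"
proof -
  interpret R: cring R by (rule cring)
  interpret K: module R K by (rule gm_module[OF K])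
  have d: "fdelta R s \<in> carrier (free_gmod R G (\<lambda>_. 0))"
    using fdelta_mgr[OF s(1), of "\<lambda>_. 0"] by (simp add: free_gmod_simps(5))
  have "lin_comb R K y (fdelta R s) = (\<Oplus>\<^bsub>K\<^esub>t\<in>{s}. fdelta R s t \<odot>\<^bsub>K\<^esub> y t)"
    by (rule lin_comb_on[OF K d]) (use s in \<open>auto simp: fdelta_def\<close>)
  then show ?thesis using s by (simp add: fdelta_def)
qed

text \<open>With the standard basis vectors as generators, the section is the identity on
  coefficient functions.\<close>

lemma projective_free: "projective TYPE('s) R (free_gmod R (G :: 's set) dg)"
proof -
  let ?M = "free_gmod R G dg"
  interpret R: cring R by (rule cring)
  have eq: "lin_comb R ?M (fdelta R) f = f" if f: "f \<in> carrier ?M" for f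
  proof
    fix t
    note fc = free_carrier[OF f]
    let ?S = "{s. f s \<noteq> \<zero>\<^bsub>R\<^esub>}"
    have c: "f s \<odot>\<^bsub>?M\<^esub> fdelta R s \<in> carrier ?M" if "s \<in> ?S" for s
      using fc that fdelta_mgr[of s G dg] graded_module_free[of G dg]
      by (intro gm_smult) (auto simp: free_gmod_simps(5))
    have "lin_comb R ?M (fdelta R) f t = (\<Oplus>\<^bsub>R\<^esub>s\<in>?S. f s \<otimes>\<^bsub>R\<^esub> fdelta R s t)"
      unfolding lin_comb_def by (subst free_finsum[OF c]) (simp_all add: free_gmod_simps(4))
    also have "\<dots> = (\<Oplus>\<^bsub>R\<^esub>s\<in>?S. if t = s then f s else \<zero>\<^bsub>R\<^esub>)"
      by (rule R.finsum_cong') (use fc in \<open>auto simp: fdelta_def\<close>)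
    also have "\<dots> = f t"
    proof (cases "t \<in> ?S")
      case True
      then show ?thesis using fc by (intro R.finsum_singleton) auto
    next
      case False
      then have "(\<Oplus>\<^bsub>R\<^esub>s\<in>?S. if t = s then f s else \<zero>\<^bsub>R\<^esub>) = (\<Oplus>\<^bsub>R\<^esub>s\<in>?S. \<zero>\<^bsub>R\<^esub>)"
        by (intro R.finsum_cong') auto
      then show ?thesis using False by (simp add: R.finsum_zero)
    qed
    finally show "lin_comb R ?M (fdelta R) f t = f t" .
  qed
  show ?thesis unfolding projective_def
    by (rule exI[of _ G], rule exI[of _ dg], rule exI[of _ "fdelta R"], rule exI[of _ "\<lambda>f. f"])
      (simp add: eq fdelta_mgr hm_id)
qed

lemma projective_zero:
  assumes M: "graded_module R M" and z: "zero_module M"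
  shows "projective TYPE('s) R M"
proof -
  have "graded_hom R M (free_gmod R {} (\<lambda>_. 0)) (\<lambda>_ (s::'s). \<zero>\<^bsub>R\<^esub>)"
    using hm_const_zero[OF graded_module_free[of "{}" "\<lambda>_. 0"], of M 0] by (simp add: free_gmod_simps(2))
  moreover have "lin_comb R M b (\<lambda>s. \<zero>\<^bsub>R\<^esub>) = x" if "x \<in> carrier M" for x and b :: "'s \<Rightarrow> _"
    using that z abelian_monoid.finsum_empty[OF abelian_group.axioms(1)[OF gm_abelian[OF M]]]
    by (simp add: zero_module_def lin_comb_def)
  ultimately show ?thesis unfolding projective_def
    by (intro exI[of _ "{}"] exI[of _ "\<lambda>_. 0"] exI[of _ undefined] exI[of _ "\<lambda>_ _. \<zero>\<^bsub>R\<^esub>"]) simp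
qed

text \<open>Each \<open>t (b s)\<close> gets a homogeneous preimage, and these are extended linearly
  along \<sigma>; the retraction identity then gives the lift on all of \<open>M\<close>. The
  hypothesis concerns the image of \<open>t\<close> rather than surjectivity of \<open>p\<close>,
  because \<open>p\<close> will be a map into a product whose image is cut out by compatibility
  conditions.\<close>

lemma projective_lift:
  assumes P: "projective TYPE('s) R M" and M: "graded_module R M" and K: "graded_module R K"
    and L: "graded_module R L"
    and t: "homogeneous_map R M L n t" and p: "graded_hom R K L p"
    and im: "\<And>x. x \<in> carrier M \<Longrightarrow> \<exists>y\<in>carrier K. p y = t x"
  obtains h where "homogeneous_map R M K n h" "\<And>x. x \<in> carrier M \<Longrightarrow> p (h x) = t x"
proof -
  obtain G :: "'s set" and dg b \<sigma> where b: "\<And>s. s \<in> G \<Longrightarrow> b s \<in> mgr M (dg s)"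
    and \<sigma>: "graded_hom R M (free_gmod R G dg) \<sigma>" and \<sigma>b: "\<And>x. x \<in> carrier M \<Longrightarrow> lin_comb R M b (\<sigma> x) = x"
    using P unfolding projective_def by blast
  have bc: "b s \<in> carrier M" if "s \<in> G" for s using mgr_carrier[OF M b[OF that]] .
  have "\<exists>y\<in>mgr K (dg s + n). p y = t (b s)" if s: "s \<in> G" for s
  proof -
    obtain y where y: "y \<in> carrier K" "p y = t (b s)" using im[OF bc[OF s]] by blast
    then have "p (comp K y (dg s + n)) = t (b s)"
      using homogeneous_preimage[OF K L p y(1), of "dg s + n"] hm_mgr[OF t b[OF s]] by simp
    then show ?thesis using comp_mgr[OF K y(1)] by blast
  qed
  then obtain y where y: "\<And>s. s \<in> G \<Longrightarrow> y s \<in> mgr K (dg s + n)" "\<And>s. s \<in> G \<Longrightarrow> p (y s) = t (b s)"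
    by metis
  have yc: "y s \<in> carrier K" if "s \<in> G" for s using mgr_carrier[OF K y(1)[OF that]] .
  show ?thesis
  proof
    show "homogeneous_map R M K n (\<lambda>x. lin_comb R K y (\<sigma> x))"
      by (rule hm_compose_gh[OF \<sigma> hm_lin_comb[OF K y(1)]])
    show "p (lin_comb R K y (\<sigma> x)) = t x" if x: "x \<in> carrier M" for x
    proof -
      note sx = hm_closed[OF \<sigma> x]
      have "p (lin_comb R K y (\<sigma> x)) = lin_comb R L (\<lambda>s. p (y s)) (\<sigma> x)"
        by (rule lin_comb_hom[OF K L p sx yc])
      also have "\<dots> = lin_comb R L (\<lambda>s. t (b s)) (\<sigma> x)"
        by (rule lin_comb_cong[OF L sx]) (use y(2) hm_closed[OF t bc] in auto)
      also have "\<dots> = t (lin_comb R M b (\<sigma> x))"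
        by (rule lin_comb_hom[OF M L t sx bc, symmetric])
      finally show ?thesis using \<sigma>b[OF x] by simp
    qed
  qed
qed

text \<open>The support of a pair of coefficient functions is a disjoint union, so the linear
  combination is computed in each summand separately and carried over by the two inclusions.\<close>

lemma projective_gprod:
  assumes M: "graded_module R M" and N: "graded_module R N"
    and PM: "projective TYPE('s) R M" and PN: "projective TYPE('t) R N"
  shows "projective TYPE('s + 't) R (gprod M N)"
proof -
  interpret R: cring R by (rule cring)
  let ?P = "gprod M N"
  have P: "graded_module R ?P" by (rule graded_module_gprod[OF M N])
  obtain G1 :: "'s set" and dg1 b1 s1 where b1: "\<And>s. s \<in> G1 \<Longrightarrow> b1 s \<in> mgr M (dg1 s)"
    and s1: "graded_hom R M (free_gmod R G1 dg1) s1" and sb1: "\<And>x. x \<in> carrier M \<Longrightarrow> lin_comb R M b1 (s1 x) = x"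
    using PM unfolding projective_def by blast
  obtain G2 :: "'t set" and dg2 b2 s2 where b2: "\<And>s. s \<in> G2 \<Longrightarrow> b2 s \<in> mgr N (dg2 s)"
    and s2: "graded_hom R N (free_gmod R G2 dg2) s2" and sb2: "\<And>x. x \<in> carrier N \<Longrightarrow> lin_comb R N b2 (s2 x) = x"
    using PN unfolding projective_def by blast
  let ?G = "G1 <+> G2" and ?dg = "case_sum dg1 dg2"
  let ?b = "case_sum (\<lambda>s. (b1 s, \<zero>\<^bsub>N\<^esub>)) (\<lambda>s. (\<zero>\<^bsub>M\<^esub>, b2 s))"
  let ?s = "\<lambda>x. case_sum (s1 (fst x)) (s2 (snd x))"
  let ?F = "free_gmod R ?G ?dg"
  have b1c: "b1 s \<in> carrier M" if "s \<in> G1" for s using mgr_carrier[OF M b1[OF that]] .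
  have b2c: "b2 s \<in> carrier N" if "s \<in> G2" for s using mgr_carrier[OF N b2[OF that]] .
  have sc: "?s x \<in> carrier ?F" if "x \<in> carrier ?P" for x
  proof -
    have x: "fst x \<in> carrier M" "snd x \<in> carrier N" using that by auto
    note c1 = free_carrier[OF hm_closed[OF s1 x(1)]] and c2 = free_carrier[OF hm_closed[OF s2 x(2)]]
    show ?thesis
      by (rule free_carrierI[of _ _ "{t. s1 (fst x) t \<noteq> \<zero>\<^bsub>R\<^esub>} <+> {t. s2 (snd x) t \<noteq> \<zero>\<^bsub>R\<^esub>}"])
        (use c1 c2 in \<open>auto split: sum.splits\<close>)
  qed
  have 1: "?b s \<in> mgr ?P (?dg s)" if "s \<in> ?G" for s
    using that b1 b2 mgr_zero[OF M] mgr_zero[OF N] by auto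
  have 2: "graded_hom R ?P ?F ?s"
  proof (rule homogeneous_mapI)
    show "?s (x \<oplus>\<^bsub>?P\<^esub> y) = ?s x \<oplus>\<^bsub>?F\<^esub> ?s y" if "x \<in> carrier ?P" "y \<in> carrier ?P" for x y
      using that hm_add[OF s1, of "fst x" "fst y"] hm_add[OF s2, of "snd x" "snd y"]
      by (intro ext) (auto simp: free_gmod_simps(3) split: sum.split)
    show "?s (a \<odot>\<^bsub>?P\<^esub> x) = a \<odot>\<^bsub>?F\<^esub> ?s x" if "a \<in> carrier R" "x \<in> carrier ?P" for a x
      using that hm_smult[OF s1, of a "fst x"] hm_smult[OF s2, of a "snd x"]
      by (intro ext) (auto simp: free_gmod_simps(4) split: sum.split)
    show "?s x \<in> mgr ?F (k + 0)" if x: "x \<in> mgr ?P k" for k x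
      using sc[OF mgr_carrier[OF P x]] x hm_mgr[OF s1, of "fst x" k] hm_mgr[OF s2, of "snd x" k]
      by (auto simp: free_gmod_simps(5))
  qed (rule sc)
  have 3: "lin_comb R ?P ?b (?s x) = x" if x: "x \<in> carrier ?P" for x
  proof -
    have x': "fst x \<in> carrier M" "snd x \<in> carrier N" using that by auto
    note c1 = free_carrier[OF hm_closed[OF s1 x'(1)]] and c2 = free_carrier[OF hm_closed[OF s2 x'(2)]]
    let ?S1 = "{t. s1 (fst x) t \<noteq> \<zero>\<^bsub>R\<^esub>}" and ?S2 = "{t. s2 (snd x) t \<noteq> \<zero>\<^bsub>R\<^esub>}"
    interpret P: module R ?P by (rule gm_module[OF P])
    have i1: "graded_hom R M ?P (\<lambda>x. (x, \<zero>\<^bsub>N\<^esub>))" and i2: "graded_hom R N ?P (\<lambda>x. (\<zero>\<^bsub>M\<^esub>, x))"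
      using M N by (auto intro!: homogeneous_mapI)
    have S: "{t. ?s x t \<noteq> \<zero>\<^bsub>R\<^esub>} = Inl ` ?S1 \<union> Inr ` ?S2"
    proof (rule Set.set_eqI)
      show "t \<in> {t. ?s x t \<noteq> \<zero>\<^bsub>R\<^esub>} \<longleftrightarrow> t \<in> Inl ` ?S1 \<union> Inr ` ?S2" for t by (cases t) auto
    qed
    have 11: "s1 (fst x) s \<odot>\<^bsub>M\<^esub> b1 s \<in> carrier M" if "s \<in> ?S1" for s
      using that c1 b1c M by (intro gm_smult) auto
    have 22: "s2 (snd x) s \<odot>\<^bsub>N\<^esub> b2 s \<in> carrier N" if "s \<in> ?S2" for s
      using that c2 b2c N by (intro gm_smult) auto
    have pi1: "(\<lambda>s. ?s x s \<odot>\<^bsub>?P\<^esub> ?b s) \<in> Inl ` ?S1 \<rightarrow> carrier ?P"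
      using 11 N c1 by auto
    have pi2: "(\<lambda>s. ?s x s \<odot>\<^bsub>?P\<^esub> ?b s) \<in> Inr ` ?S2 \<rightarrow> carrier ?P"
      using 22 M c2 by auto
    have "lin_comb R ?P ?b (?s x) = (\<Oplus>\<^bsub>?P\<^esub>s\<in>Inl ` ?S1. ?s x s \<odot>\<^bsub>?P\<^esub> ?b s) \<oplus>\<^bsub>?P\<^esub> (\<Oplus>\<^bsub>?P\<^esub>s\<in>Inr ` ?S2. ?s x s \<odot>\<^bsub>?P\<^esub> ?b s)"
      unfolding lin_comb_def S
      by (rule P.M.finsum_Un_disjoint) (use c1 c2 pi1 pi2 in auto)
    also have "(\<Oplus>\<^bsub>?P\<^esub>s\<in>Inl ` ?S1. ?s x s \<odot>\<^bsub>?P\<^esub> ?b s) = (\<Oplus>\<^bsub>?P\<^esub>s\<in>?S1. (s1 (fst x) s \<odot>\<^bsub>M\<^esub> b1 s, \<zero>\<^bsub>N\<^esub>))"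
      unfolding P.M.finsum_reindex[OF pi1 inj_Inl]
      by (rule P.M.finsum_cong') (use 11 N c1 in auto)
    also have "\<dots> = (fst x, \<zero>\<^bsub>N\<^esub>)"
      using hm_finsum[OF M P i1, of ?S1 "\<lambda>s. s1 (fst x) s \<odot>\<^bsub>M\<^esub> b1 s", OF 11] sb1[OF x'(1)] by (simp add: lin_comb_def)
    also have "(\<Oplus>\<^bsub>?P\<^esub>s\<in>Inr ` ?S2. ?s x s \<odot>\<^bsub>?P\<^esub> ?b s) = (\<Oplus>\<^bsub>?P\<^esub>s\<in>?S2. (\<zero>\<^bsub>M\<^esub>, s2 (snd x) s \<odot>\<^bsub>N\<^esub> b2 s))"
      unfolding P.M.finsum_reindex[OF pi2 inj_Inr]
      by (rule P.M.finsum_cong') (use 22 M c2 in auto)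
    also have "\<dots> = (\<zero>\<^bsub>M\<^esub>, snd x)"
      using hm_finsum[OF N P i2, of ?S2 "\<lambda>s. s2 (snd x) s \<odot>\<^bsub>N\<^esub> b2 s", OF 22] sb2[OF x'(2)] by (simp add: lin_comb_def)
    finally show ?thesis using M N x' by simp
  qed
  show ?thesis unfolding projective_def
    by (rule exI[of _ ?G], rule exI[of _ ?dg], rule exI[of _ ?b], rule exI[of _ ?s]) (use 1 2 3 in blast)
qed

end


section \<open>The graded Hom module\<close>

lemma gHom_simps [simp]:
  "\<zero>\<^bsub>gHom R M N\<^esub> = (\<lambda>x\<in>carrier M. \<zero>\<^bsub>N\<^esub>)"
  "f \<oplus>\<^bsub>gHom R M N\<^esub> g = (\<lambda>x\<in>carrier M. f x \<oplus>\<^bsub>N\<^esub> g x)"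
  "a \<odot>\<^bsub>gHom R M N\<^esub> f = (\<lambda>x\<in>carrier M. a \<odot>\<^bsub>N\<^esub> f x)"
  "mgr (gHom R M N) n = {f \<in> extensional (carrier M). homogeneous_map R M N n f}"
  by (simp_all add: gHom_def gHom_deg_def)

context graded_base
begin

text \<open>Membership in \<open>gHom\<close> without the extensionality condition. The family is
  indexed by all degrees and vanishes off \<open>F\<close>, so two such families can be added over a
  common finite index set.\<close>

definition hsum_map :: "('a, 'b) gmod \<Rightarrow> ('a, 'c) gmod \<Rightarrow> ('b \<Rightarrow> 'c) \<Rightarrow> bool" where
  "hsum_map M N f \<longleftrightarrow> (\<exists>F g. finite F \<and> (\<forall>n. homogeneous_map R M N n (g n)) \<and>
     (\<forall>n x. n \<notin> F \<longrightarrow> g n x = \<zero>\<^bsub>N\<^esub>) \<and> (\<forall>x\<in>carrier M. f x = (\<Oplus>\<^bsub>N\<^esub>n\<in>F. g n x)))"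

context
  fixes M :: "('a, 'b) gmod" and N :: "('a, 'c) gmod"
  assumes M: "graded_module R M" and N: "graded_module R N"
begin

lemma hsum_map_cong: "hsum_map M N f \<Longrightarrow> (\<And>x. x \<in> carrier M \<Longrightarrow> g x = f x) \<Longrightarrow> hsum_map M N g"
  unfolding hsum_map_def by auto

lemma carrier_gHom: "f \<in> carrier (gHom R M N) \<longleftrightarrow> f \<in> extensional (carrier M) \<and> hsum_map M N f"
proof
  interpret N: module R N by (rule gm_module[OF N])
  assume "f \<in> carrier (gHom R M N)"
  then obtain F g where F: "finite F" "\<And>n. n \<in> F \<Longrightarrow> g n \<in> gHom_deg R M N n"
    and f: "f = (\<lambda>x\<in>carrier M. \<Oplus>\<^bsub>N\<^esub>n\<in>F. g n x)"
    by (auto simp: gHom_def)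
  \<comment> \<open>Outside \<open>F\<close> the given family is arbitrary; zero is put there to
    meet \<open>hsum_map\<close>.\<close>
  let ?g = "\<lambda>n. if n \<in> F then g n else (\<lambda>_. \<zero>\<^bsub>N\<^esub>)"
  have gh: "homogeneous_map R M N n (g n)" if "n \<in> F" for n
    using F(2)[OF that] by (simp add: gHom_deg_def)
  have h: "homogeneous_map R M N n (?g n)" for n
    using gh hm_const_zero[OF N, of M] by simp
  have "f x = (\<Oplus>\<^bsub>N\<^esub>n\<in>F. ?g n x)" if x: "x \<in> carrier M" for x
  proof -
    have "(\<Oplus>\<^bsub>N\<^esub>n\<in>F. g n x) = (\<Oplus>\<^bsub>N\<^esub>n\<in>F. ?g n x)"
      by (rule N.M.finsum_cong') (use hm_closed[OF gh x] in auto)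
    then show ?thesis using x by (simp add: f)
  qed
  then have "hsum_map M N f"
    unfolding hsum_map_def using F(1) h by (intro exI[of _ F] exI[of _ ?g]) auto
  then show "f \<in> extensional (carrier M) \<and> hsum_map M N f" by (simp add: f)
next
  interpret N: module R N by (rule gm_module[OF N])
  assume f: "f \<in> extensional (carrier M) \<and> hsum_map M N f"
  then obtain F g where F: "finite F" "\<And>n. homogeneous_map R M N n (g n)"
    "\<And>x. x \<in> carrier M \<Longrightarrow> f x = (\<Oplus>\<^bsub>N\<^esub>n\<in>F. g n x)"
    unfolding hsum_map_def by blast
  let ?g = "\<lambda>n. restrict (g n) (carrier M)"
  have "?g n \<in> gHom_deg R M N n" for n
    using hm_restrict[OF M F(2)] by (simp add: gHom_deg_def)
  moreover have "f = (\<lambda>x\<in>carrier M. \<Oplus>\<^bsub>N\<^esub>n\<in>F. ?g n x)"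
    using f F(3) by (intro extensionalityI[of f "carrier M"]) auto
  ultimately have "f \<in> {(\<lambda>x\<in>carrier M. \<Oplus>\<^bsub>N\<^esub>n\<in>F. g n x) | F g. finite F \<and> (\<forall>n\<in>F. g n \<in> gHom_deg R M N n)}"
    using F(1) by (intro CollectI exI[of _ F] exI[of _ ?g] conjI ballI)
  then show "f \<in> carrier (gHom R M N)"
    by (simp only: gHom_def partial_object.select_convs)
qed

lemma hsum_map_homogeneous:
  assumes f: "homogeneous_map R M N m f"
  shows "hsum_map M N f"
proof -
  interpret N: module R N by (rule gm_module[OF N])
  let ?g = "\<lambda>n. if n = m then f else (\<lambda>_. \<zero>\<^bsub>N\<^esub>)"
  show ?thesis unfolding hsum_map_def
    using f hm_const_zero[OF N] hm_closed[OF f] by (intro exI[of _ "{m}"] exI[of _ ?g]) auto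
qed

lemma hsum_map_on:
  assumes F: "finite F" and g: "\<And>n. homogeneous_map R M N n (g n)" "\<And>n x. n \<notin> F \<Longrightarrow> g n x = \<zero>\<^bsub>N\<^esub>"
    and E: "finite E" "F \<subseteq> E" and x: "x \<in> carrier M"
  shows "(\<Oplus>\<^bsub>N\<^esub>n\<in>F. g n x) = (\<Oplus>\<^bsub>N\<^esub>n\<in>E. g n x)"
proof -
  interpret N: module R N by (rule gm_module[OF N])
  show ?thesis
    by (rule N.M.add.finprod_mono_neutral_cong_left[OF E]) (use g hm_closed[OF g(1) x] in auto)
qed

lemma hsum_map_add:
  assumes f: "hsum_map M N f" and g: "hsum_map M N g"
  shows "hsum_map M N (\<lambda>x. f x \<oplus>\<^bsub>N\<^esub> g x)"
proof -
  interpret N: module R N by (rule gm_module[OF N])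
  obtain E a where a: "finite E" "\<And>n. homogeneous_map R M N n (a n)" "\<And>n x. n \<notin> E \<Longrightarrow> a n x = \<zero>\<^bsub>N\<^esub>"
    and fa: "\<And>x. x \<in> carrier M \<Longrightarrow> f x = (\<Oplus>\<^bsub>N\<^esub>n\<in>E. a n x)"
    using f unfolding hsum_map_def by blast
  obtain F b where b: "finite F" "\<And>n. homogeneous_map R M N n (b n)" "\<And>n x. n \<notin> F \<Longrightarrow> b n x = \<zero>\<^bsub>N\<^esub>"
    and gb: "\<And>x. x \<in> carrier M \<Longrightarrow> g x = (\<Oplus>\<^bsub>N\<^esub>n\<in>F. b n x)"
    using g unfolding hsum_map_def by blast
  have "f x \<oplus>\<^bsub>N\<^esub> g x = (\<Oplus>\<^bsub>N\<^esub>n\<in>E \<union> F. a n x \<oplus>\<^bsub>N\<^esub> b n x)" if x: "x \<in> carrier M" for x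
  proof -
    have "f x \<oplus>\<^bsub>N\<^esub> g x = (\<Oplus>\<^bsub>N\<^esub>n\<in>E \<union> F. a n x) \<oplus>\<^bsub>N\<^esub> (\<Oplus>\<^bsub>N\<^esub>n\<in>E \<union> F. b n x)"
      using fa[OF x] gb[OF x] hsum_map_on[OF a _ _ x, where E = "E \<union> F"] hsum_map_on[OF b _ _ x, where E = "E \<union> F"] a b
      x by simp
    also have "\<dots> = (\<Oplus>\<^bsub>N\<^esub>n\<in>E \<union> F. a n x \<oplus>\<^bsub>N\<^esub> b n x)"
      by (rule N.M.finsum_addf[symmetric]) (use hm_closed[OF a(2) x] hm_closed[OF b(2) x] in auto)
    finally show ?thesis .
  qed
  then show ?thesis unfolding hsum_map_def
    using a b hm_plus[OF N a(2) b(2)]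
    by (intro exI[of _ "E \<union> F"] exI[of _ "\<lambda>n x. a n x \<oplus>\<^bsub>N\<^esub> b n x"]) auto
qed

lemma hsum_map_zero: "hsum_map M N (\<lambda>_. \<zero>\<^bsub>N\<^esub>)"
  by (rule hsum_map_homogeneous[OF hm_const_zero[OF N, of M 0]])

lemma hsum_map_linear:
  assumes f: "hsum_map M N f"
  shows "linear_map R M N f"
proof -
  interpret N: module R N by (rule gm_module[OF N])
  obtain E a where a: "finite E" "\<And>n. homogeneous_map R M N n (a n)" "\<And>n x. n \<notin> E \<Longrightarrow> a n x = \<zero>\<^bsub>N\<^esub>"
    and fa: "\<And>x. x \<in> carrier M \<Longrightarrow> f x = (\<Oplus>\<^bsub>N\<^esub>n\<in>E. a n x)"
    using f unfolding hsum_map_def by blast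
  have "f x \<in> carrier N" if x: "x \<in> carrier M" for x
    unfolding fa[OF x] by (rule gm_finsum_closed[OF N]) (rule hm_closed[OF a(2) x])
  moreover have "f (x \<oplus>\<^bsub>M\<^esub> y) = f x \<oplus>\<^bsub>N\<^esub> f y" if x: "x \<in> carrier M" and y: "y \<in> carrier M" for x y
  proof -
    have "(\<Oplus>\<^bsub>N\<^esub>n\<in>E. a n (x \<oplus>\<^bsub>M\<^esub> y)) = (\<Oplus>\<^bsub>N\<^esub>n\<in>E. a n x \<oplus>\<^bsub>N\<^esub> a n y)"
      by (rule N.M.finsum_cong') (use hm_add[OF a(2) x y] hm_closed[OF a(2) x] hm_closed[OF a(2) y] in auto)
    also have "\<dots> = (\<Oplus>\<^bsub>N\<^esub>n\<in>E. a n x) \<oplus>\<^bsub>N\<^esub> (\<Oplus>\<^bsub>N\<^esub>n\<in>E. a n y)"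
      by (rule N.M.finsum_addf) (use hm_closed[OF a(2) x] hm_closed[OF a(2) y] in auto)
    finally show ?thesis using fa x y M by simp
  qed
  moreover have "f (r \<odot>\<^bsub>M\<^esub> x) = r \<odot>\<^bsub>N\<^esub> f x" if r: "r \<in> carrier R" and x: "x \<in> carrier M" for r x
  proof -
    have "(\<Oplus>\<^bsub>N\<^esub>n\<in>E. a n (r \<odot>\<^bsub>M\<^esub> x)) = (\<Oplus>\<^bsub>N\<^esub>n\<in>E. r \<odot>\<^bsub>N\<^esub> a n x)"
      by (rule N.M.finsum_cong') (use hm_smult[OF a(2) r x] hm_closed[OF a(2) x] r in auto)
    also have "\<dots> = r \<odot>\<^bsub>N\<^esub> (\<Oplus>\<^bsub>N\<^esub>n\<in>E. a n x)"
      by (rule N.finsum_smult_ldistr[symmetric]) (use a(1) r hm_closed[OF a(2) x] in auto)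
    finally show ?thesis using fa x r M by simp
  qed
  ultimately show ?thesis by (simp add: linear_map_def)
qed

lemma hsum_map_finsum:
  assumes "finite I" and "\<And>i. i \<in> I \<Longrightarrow> hsum_map M N (f i)"
  shows "hsum_map M N (\<lambda>x. \<Oplus>\<^bsub>N\<^esub>i\<in>I. f i x)"
  using assms
proof (induction I)
  case empty
  interpret N: module R N by (rule gm_module[OF N])
  show ?case using hsum_map_zero by simp
next
  case (insert i I)
  interpret N: module R N by (rule gm_module[OF N])
  have lin: "linear_map R M N (f j)" if "j \<in> insert i I" for j
    using hsum_map_linear insert.prems that by blast
  have eq: "(\<Oplus>\<^bsub>N\<^esub>i\<in>insert i I. f i x) = f i x \<oplus>\<^bsub>N\<^esub> (\<Oplus>\<^bsub>N\<^esub>i\<in>I. f i x)" if x: "x \<in> carrier M" for x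
    by (rule N.M.finsum_insert) (use insert lin_closed[OF lin x] in auto)
  have "hsum_map M N (f i)" "hsum_map M N (\<lambda>x. \<Oplus>\<^bsub>N\<^esub>i\<in>I. f i x)" using insert by blast+
  then show ?case by (rule hsum_map_cong[OF hsum_map_add]) (rule eq)
qed

lemma hm_scalar:
  assumes a: "a \<in> rgr R m" and f: "homogeneous_map R M N n f"
  shows "homogeneous_map R M N (m + n) (\<lambda>x. a \<odot>\<^bsub>N\<^esub> f x)"
proof -
  interpret N: module R N by (rule gm_module[OF N])
  have ac: "a \<in> carrier R" by (rule rgr_carrier[OF a])
  have "a \<odot>\<^bsub>N\<^esub> (b \<odot>\<^bsub>N\<^esub> y) = b \<odot>\<^bsub>N\<^esub> (a \<odot>\<^bsub>N\<^esub> y)" if "b \<in> carrier R" "y \<in> carrier N" for b y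
    using that ac N.smult_assoc1[of a b y] N.smult_assoc1[of b a y] N.R.m_comm[of a b] by simp
  moreover have "a \<odot>\<^bsub>N\<^esub> f x \<in> mgr N (k + (m + n))" if "x \<in> mgr M k" for x k
    using gm_smult_mgr[OF N a hm_mgr[OF f that]] by (simp add: add.left_commute)
  ultimately show ?thesis
    using hm_closed[OF f] hm_add[OF f] hm_smult[OF f] ac
    by (intro homogeneous_mapI) (simp_all add: N.smult_r_distr)
qed

text \<open>An inhomogeneous scalar spreads one degree over several, so the proof is by induction
  over the grading of \<open>R\<close>; a homogeneous scalar merely shifts all degrees.\<close>

lemma hsum_map_smult:
  assumes r: "r \<in> carrier R" and f: "hsum_map M N f"
  shows "hsum_map M N (\<lambda>x. r \<odot>\<^bsub>N\<^esub> f x)"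
  using R_abelian rgr_graded r
proof (rule graded_by_induct)
  interpret N: module R N by (rule gm_module[OF N])
  have fc: "f x \<in> carrier N" if "x \<in> carrier M" for x
    using lin_closed[OF hsum_map_linear[OF f] that] .
  show "hsum_map M N (\<lambda>x. \<zero>\<^bsub>R\<^esub> \<odot>\<^bsub>N\<^esub> f x)"
    by (rule hsum_map_cong[OF hsum_map_zero]) (simp add: fc)
  show "hsum_map M N (\<lambda>x. (a \<oplus>\<^bsub>R\<^esub> b) \<odot>\<^bsub>N\<^esub> f x)" if "a \<in> carrier R" "b \<in> carrier R"
    "hsum_map M N (\<lambda>x. a \<odot>\<^bsub>N\<^esub> f x)" "hsum_map M N (\<lambda>x. b \<odot>\<^bsub>N\<^esub> f x)" for a b
    by (rule hsum_map_cong[OF hsum_map_add[OF that(3,4)]]) (simp add: fc that N.smult_l_distr)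
  show "hsum_map M N (\<lambda>x. a \<odot>\<^bsub>N\<^esub> f x)" if a: "a \<in> rgr R m" for a m
  proof -
    obtain E g where g: "finite E" "\<And>n. homogeneous_map R M N n (g n)" "\<And>n x. n \<notin> E \<Longrightarrow> g n x = \<zero>\<^bsub>N\<^esub>"
      and fg: "\<And>x. x \<in> carrier M \<Longrightarrow> f x = (\<Oplus>\<^bsub>N\<^esub>n\<in>E. g n x)"
      using f unfolding hsum_map_def by blast
    have eq: "a \<odot>\<^bsub>N\<^esub> f x = (\<Oplus>\<^bsub>N\<^esub>n\<in>E. a \<odot>\<^bsub>N\<^esub> g n x)" if x: "x \<in> carrier M" for x
      unfolding fg[OF x]
      by (rule N.finsum_smult_ldistr) (use g(1) rgr_carrier[OF a] hm_closed[OF g(2) x] in auto)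
    show ?thesis
      by (rule hsum_map_cong[OF hsum_map_finsum[OF g(1) hsum_map_homogeneous[OF hm_scalar[OF a g(2)]]]])
        (rule eq)
  qed
qed

lemma gHomD:
  assumes "f \<in> carrier (gHom R M N)"
  shows "f \<in> extensional (carrier M)" "hsum_map M N f" "linear_map R M N f"
    "x \<in> carrier M \<Longrightarrow> f x \<in> carrier N"
  using assms hsum_map_linear[of f] lin_closed[of M N f x] by (simp_all add: carrier_gHom)

lemma gHomI: "hsum_map M N f \<Longrightarrow> restrict f (carrier M) \<in> carrier (gHom R M N)"
  using hsum_map_cong[of f "restrict f (carrier M)"] by (simp add: carrier_gHom)

lemma gHom_eqI:
  "f \<in> carrier (gHom R M N) \<Longrightarrow> g \<in> carrier (gHom R M N) \<Longrightarrow>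
    (\<And>x. x \<in> carrier M \<Longrightarrow> f x = g x) \<Longrightarrow> f = g"
  using gHomD(1) extensionalityI by blast

lemma module_gHom: "module R (gHom R M N)"
proof -
  interpret N: module R N by (rule gm_module[OF N])
  have add: "restrict (\<lambda>x. f x \<oplus>\<^bsub>N\<^esub> g x) (carrier M) \<in> carrier (gHom R M N)"
    if "f \<in> carrier (gHom R M N)" "g \<in> carrier (gHom R M N)" for f g
    by (rule gHomI[OF hsum_map_add]) (use that gHomD in auto)
  have smult: "restrict (\<lambda>x. a \<odot>\<^bsub>N\<^esub> f x) (carrier M) \<in> carrier (gHom R M N)"
    if "a \<in> carrier R" "f \<in> carrier (gHom R M N)" for a f
    by (rule gHomI[OF hsum_map_smult]) (use that gHomD in auto)
  have eq: "restrict u (carrier M) = restrict v (carrier M)" if "\<And>x. x \<in> carrier M \<Longrightarrow> u x = v x" for u v :: "'b \<Rightarrow> 'c"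
    using that by (auto simp: restrict_def)
  have eq': "restrict u (carrier M) = f"
    if "f \<in> carrier (gHom R M N)" "\<And>x. x \<in> carrier M \<Longrightarrow> u x = f x" for u f
    using that gHomD(1)[OF that(1)] by (intro extensionalityI[of _ "carrier M"]) auto
  show ?thesis
  proof (rule moduleI[OF cring])
    show "abelian_group (gHom R M N)"
    proof (rule abelian_groupI)
      show "\<exists>g\<in>carrier (gHom R M N). g \<oplus>\<^bsub>gHom R M N\<^esub> f = \<zero>\<^bsub>gHom R M N\<^esub>"
        if f: "f \<in> carrier (gHom R M N)" for f
      proof
        show "restrict (\<lambda>x. (\<ominus>\<^bsub>R\<^esub> \<one>\<^bsub>R\<^esub>) \<odot>\<^bsub>N\<^esub> f x) (carrier M) \<in> carrier (gHom R M N)"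
          by (rule smult[OF neg_one(2) f])
        show "restrict (\<lambda>x. (\<ominus>\<^bsub>R\<^esub> \<one>\<^bsub>R\<^esub>) \<odot>\<^bsub>N\<^esub> f x) (carrier M) \<oplus>\<^bsub>gHom R M N\<^esub> f = \<zero>\<^bsub>gHom R M N\<^esub>"
          unfolding gHom_simps
          by (rule eq) (use gHomD(4)[OF f] neg_smult[OF gm_module[OF N], symmetric] in \<open>simp add: N.M.l_neg\<close>)
      qed
      show "\<zero>\<^bsub>gHom R M N\<^esub> \<in> carrier (gHom R M N)"
        unfolding gHom_simps by (rule gHomI[OF hsum_map_zero])
    qed (unfold gHom_simps, auto intro!: add eq eq' simp: gHomD(4) N.M.a_ac)
  qed (unfold gHom_simps, auto intro!: add smult eq eq'
      simp: gHomD(4) N.smult_l_distr N.smult_r_distr N.smult_assoc1)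
qed

lemma gHom_finsum:
  assumes "\<And>i. i \<in> I \<Longrightarrow> g i \<in> carrier (gHom R M N)" and x: "x \<in> carrier M"
  shows "(\<Oplus>\<^bsub>gHom R M N\<^esub>i\<in>I. g i) x = (\<Oplus>\<^bsub>N\<^esub>i\<in>I. g i x)"
proof -
  have "linear_map R (gHom R M N) N (\<lambda>f. f x)"
    using x gHomD(4) by (auto simp: linear_map_def)
  from lin_finsum[OF module_gHom gm_module[OF N] this, of I g, OF assms(1)] show ?thesis .
qed

lemma graded_module_gHom: "graded_module R (gHom R M N)"
proof (rule graded_moduleI[OF module_gHom])
  interpret H: module R "gHom R M N" by (rule module_gHom)
  let ?H = "gHom R M N"
  fix n
  show sub: "mgr ?H n \<subseteq> carrier ?H"
    using hsum_map_homogeneous by (auto simp: carrier_gHom)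
  show "\<zero>\<^bsub>?H\<^esub> \<in> mgr ?H n" using hm_restrict[OF M hm_const_zero[OF N]] by simp
  show "f \<oplus>\<^bsub>?H\<^esub> g \<in> mgr ?H n" if "f \<in> mgr ?H n" "g \<in> mgr ?H n" for f g
    using that by (auto intro!: hm_restrict[OF M] hm_plus[OF N])
  show "a \<odot>\<^bsub>?H\<^esub> f \<in> mgr ?H (m + n)" if "a \<in> rgr R m" "f \<in> mgr ?H n" for a f m
    using that by (auto intro!: hm_restrict[OF M] hm_scalar)
next
  interpret N: module R N by (rule gm_module[OF N])
  interpret H: module R "gHom R M N" by (rule module_gHom)
  let ?H = "gHom R M N"
  fix f assume f: "f \<in> carrier ?H"
  then obtain E g where g: "finite E" "\<And>n. homogeneous_map R M N n (g n)" "\<And>n x. n \<notin> E \<Longrightarrow> g n x = \<zero>\<^bsub>N\<^esub>"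
    and fg: "\<And>x. x \<in> carrier M \<Longrightarrow> f x = (\<Oplus>\<^bsub>N\<^esub>n\<in>E. g n x)"
    unfolding carrier_gHom hsum_map_def by blast
  let ?g = "\<lambda>n. restrict (g n) (carrier M)"
  have gm: "?g n \<in> mgr ?H n" for n using hm_restrict[OF M g(2)] by simp
  have gc: "?g n \<in> carrier ?H" for n by (rule gHomI[OF hsum_map_homogeneous[OF g(2)]])
  have "f = (\<Oplus>\<^bsub>?H\<^esub>n\<in>E. ?g n)"
  proof (rule gHom_eqI[OF f])
    show "(\<Oplus>\<^bsub>?H\<^esub>n\<in>E. ?g n) \<in> carrier ?H" using gc by (intro H.M.finsum_closed) auto
    show "f x = (\<Oplus>\<^bsub>?H\<^esub>n\<in>E. ?g n) x" if x: "x \<in> carrier M" for x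
      using gHom_finsum[of E ?g, OF gc x] fg[OF x] x by simp
  qed
  then show "\<exists>F g. finite F \<and> (\<forall>n\<in>F. g n \<in> mgr ?H n) \<and> f = (\<Oplus>\<^bsub>?H\<^esub>n\<in>F. g n)"
    using g(1) gm by (intro exI[of _ E] exI[of _ ?g]) simp
next
  let ?H = "gHom R M N"
  fix F :: "int set" and g assume F: "finite F" and g: "\<And>n. n \<in> F \<Longrightarrow> g n \<in> mgr ?H n"
    and s: "(\<Oplus>\<^bsub>?H\<^esub>n\<in>F. g n) = \<zero>\<^bsub>?H\<^esub>"
  have gh: "homogeneous_map R M N n (g n)" "g n \<in> extensional (carrier M)" if "n \<in> F" for n
    using g[OF that] by auto
  have gc: "g n \<in> carrier ?H" if "n \<in> F" for n
    using gh[OF that] hsum_map_homogeneous by (auto simp: carrier_gHom)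
  have z: "g n x = \<zero>\<^bsub>N\<^esub>" if n: "n \<in> F" and x: "x \<in> mgr M k" for n k x
  proof -
    interpret N: module R N by (rule gm_module[OF N])
    have xc: "x \<in> carrier M" using mgr_carrier[OF M x] .
    have "(\<Oplus>\<^bsub>N\<^esub>n\<in>F. g n x) = \<zero>\<^bsub>N\<^esub>"
      using gHom_finsum[of F g, OF gc xc] fun_cong[OF s, of x] xc by simp
    \<comment> \<open>On \<open>x\<close> of degree \<open>k\<close> the map of degree
      \<open>n\<close> takes a value of degree \<open>k + n\<close>; reindexed in this way, the sum
      is one of homogeneous elements of distinct degrees in \<open>N\<close>.\<close>
    moreover have "(\<Oplus>\<^bsub>N\<^esub>n\<in>(\<lambda>n. k + n) ` F. g (n - k) x) = (\<Oplus>\<^bsub>N\<^esub>n\<in>F. g n x)"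
      by (subst N.M.finsum_reindex) (use hm_closed[OF gh(1) xc] in \<open>auto simp: inj_on_def\<close>)
    ultimately have "g ((k + n) - k) x = \<zero>\<^bsub>N\<^esub>"
      using F n hm_mgr[OF gh(1) x]
      by (intro gm_independent[OF N, of "(\<lambda>n. k + n) ` F" "\<lambda>n. g (n - k) x"]) auto
    then show ?thesis by simp
  qed
  show "\<forall>n\<in>F. g n = \<zero>\<^bsub>?H\<^esub>"
  proof
    fix n assume n: "n \<in> F"
    have "g n x = \<zero>\<^bsub>N\<^esub>" if "x \<in> carrier M" for x
      using homogeneous_eqI[OF M N hm_linear[OF gh(1)[OF n]] hm_linear[OF hm_const_zero[OF N]] z[OF n] that]
      by simp
    then show "g n = \<zero>\<^bsub>?H\<^esub>"
      using gh(2)[OF n] by (intro extensionalityI[of _ "carrier M"]) auto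
  qed
qed

end

lemma hsum_map_compose:
  assumes M: "graded_module R M" and N: "graded_module R N"
    and M': "graded_module R M'" and N': "graded_module R N'"
    and p: "graded_hom R M' M p" and h: "graded_hom R N N' h" and f: "hsum_map M N f"
  shows "hsum_map M' N' (\<lambda>x. h (f (p x)))"
proof -
  obtain E g where g: "finite E" "\<And>n. homogeneous_map R M N n (g n)" "\<And>n x. n \<notin> E \<Longrightarrow> g n x = \<zero>\<^bsub>N\<^esub>"
    and fg: "\<And>x. x \<in> carrier M \<Longrightarrow> f x = (\<Oplus>\<^bsub>N\<^esub>n\<in>E. g n x)"
    using f unfolding hsum_map_def by blast
  have "h (f (p x)) = (\<Oplus>\<^bsub>N'\<^esub>n\<in>E. h (g n (p x)))" if x: "x \<in> carrier M'" for x
    unfolding fg[OF hm_closed[OF p x]]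
    by (rule hm_finsum[OF N N' h]) (rule hm_closed[OF g(2) hm_closed[OF p x]])
  moreover have "homogeneous_map R M' N' n (\<lambda>x. h (g n (p x)))" for n
    by (rule hm_compose_hg[OF hm_compose_gh[OF p g(2)] h])
  ultimately show ?thesis
    unfolding hsum_map_def using g(1,3) hm_zero[OF N N' h]
    by (intro exI[of _ E] exI[of _ "\<lambda>n x. h (g n (p x))"]) auto
qed

lemma graded_hom_gHom:
  assumes M: "graded_module R M" and N: "graded_module R N"
    and M': "graded_module R M'" and N': "graded_module R N'"
    and p: "graded_hom R M' M p" and h: "graded_hom R N N' h"
  shows "graded_hom R (gHom R M N) (gHom R M' N') (\<lambda>u. \<lambda>x\<in>carrier M'. h (u (p x)))"
proof (rule homogeneous_mapI)
  show "(\<lambda>x\<in>carrier M'. h (u (p x))) \<in> carrier (gHom R M' N')" if "u \<in> carrier (gHom R M N)" for u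
    using gHomI[OF M' N' hsum_map_compose[OF assms]] gHomD[OF M N that] by blast
  show "(\<lambda>x\<in>carrier M'. h (u (p x))) \<in> mgr (gHom R M' N') (k + 0)" if "u \<in> mgr (gHom R M N) k" for k u
    using that hm_restrict[OF M' hm_compose_hg[OF hm_compose_gh[OF p] h]] by simp
qed (use gHomD(4)[OF M N] hm_closed[OF p] hm_add[OF h] hm_smult[OF h] in
    \<open>auto simp: restrict_def fun_eq_iff\<close>)

end


section \<open>Complexes\<close>

abbreviation hcls :: "('a, 'b) cpx \<Rightarrow> int \<Rightarrow> 'b \<Rightarrow> 'b set" where
  "hcls C j z \<equiv> boundaries C j +>\<^bsub>obj C j\<^esub> z"

text \<open>Vanishing of the cohomology of \<open>Hom(X, N)\<close> in degree \<open>k\<close>, tested on homogeneous cocycles.\<close>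

definition coh_vanishes :: "'a gring \<Rightarrow> ('a, 'b) cpx \<Rightarrow> ('a, 'c) gmod \<Rightarrow> int \<Rightarrow> bool" where
  "coh_vanishes R X N k \<longleftrightarrow> (\<forall>n u. homogeneous_map R (obj X k) N n u \<and>
     (\<forall>x\<in>carrier (obj X (k + 1)). u (diff X (k + 1) x) = \<zero>\<^bsub>N\<^esub>) \<longrightarrow>
     (\<exists>v. homogeneous_map R (obj X (k - 1)) N n v \<and> (\<forall>x\<in>carrier (obj X k). u x = v (diff X k x))))"

lemma coh_vanishesI:
  assumes "\<And>n u. homogeneous_map R (obj X k) N n u \<Longrightarrow>
     (\<And>x. x \<in> carrier (obj X (k + 1)) \<Longrightarrow> u (diff X (k + 1) x) = \<zero>\<^bsub>N\<^esub>) \<Longrightarrow>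
     \<exists>v. homogeneous_map R (obj X (k - 1)) N n v \<and> (\<forall>x\<in>carrier (obj X k). u x = v (diff X k x))"
  shows "coh_vanishes R X N k"
  using assms unfolding coh_vanishes_def by blast

lemma coh_vanishesE:
  assumes "coh_vanishes R X N k" "homogeneous_map R (obj X k) N n u"
    "\<And>x. x \<in> carrier (obj X (k + 1)) \<Longrightarrow> u (diff X (k + 1) x) = \<zero>\<^bsub>N\<^esub>"
  obtains v where "homogeneous_map R (obj X (k - 1)) N n v" "\<And>x. x \<in> carrier (obj X k) \<Longrightarrow> u x = v (diff X k x)"
  using assms unfolding coh_vanishes_def by blast

context graded_base
begin

lemma
  assumes "graded_complex R C"
  shows gc_module: "graded_module R (obj C j)"
    and gc_diff: "graded_hom R (obj C j) (obj C (j - 1)) (diff C j)"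
    and gc_diff': "graded_hom R (obj C (j + 1)) (obj C j) (diff C (j + 1))"
    and gc_dd: "x \<in> carrier (obj C j) \<Longrightarrow> diff C (j - 1) (diff C j x) = \<zero>\<^bsub>obj C (j - 2)\<^esub>"
    and gc_dd': "x \<in> carrier (obj C (j + 1)) \<Longrightarrow> diff C j (diff C (j + 1) x) = \<zero>\<^bsub>obj C (j - 1)\<^esub>"
proof -
  have *: "graded_module R (obj C i)" "graded_hom R (obj C i) (obj C (i - 1)) (diff C i)"
    "x \<in> carrier (obj C i) \<Longrightarrow> diff C (i - 1) (diff C i x) = \<zero>\<^bsub>obj C (i - 2)\<^esub>" for i x
    using assms unfolding graded_complex_def by blast+
  show "graded_module R (obj C j)" "graded_hom R (obj C j) (obj C (j - 1)) (diff C j)"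
    "graded_hom R (obj C (j + 1)) (obj C j) (diff C (j + 1))"
    "x \<in> carrier (obj C j) \<Longrightarrow> diff C (j - 1) (diff C j x) = \<zero>\<^bsub>obj C (j - 2)\<^esub>"
    using *(1,2)[of j] *(2)[of "j + 1"] *(3)[of x j] by auto
  show "diff C j (diff C (j + 1) x) = \<zero>\<^bsub>obj C (j - 1)\<^esub>" if "x \<in> carrier (obj C (j + 1))"
    using *(3)[OF that] by simp
qed

lemma graded_complexI:
  assumes "\<And>j. graded_module R (obj C j)" "\<And>j. graded_hom R (obj C j) (obj C (j - 1)) (diff C j)"
    "\<And>j x. x \<in> carrier (obj C j) \<Longrightarrow> diff C (j - 1) (diff C j x) = \<zero>\<^bsub>obj C (j - 2)\<^esub>"
  shows "graded_complex R C"
  using assms unfolding graded_complex_def by blast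

lemma
  assumes "chain_map R C D f"
  shows cm_hom: "graded_hom R (obj C j) (obj D j) (f j)"
    and cm_diff: "x \<in> carrier (obj C j) \<Longrightarrow> f (j - 1) (diff C j x) = diff D j (f j x)"
    and cm_diff': "y \<in> carrier (obj C (j + 1)) \<Longrightarrow> f j (diff C (j + 1) y) = diff D (j + 1) (f (j + 1) y)"
proof -
  have *: "graded_hom R (obj C i) (obj D i) (f i)"
    "x \<in> carrier (obj C i) \<Longrightarrow> f (i - 1) (diff C i x) = diff D i (f i x)" for i x
    using assms unfolding chain_map_def by blast+
  show "graded_hom R (obj C j) (obj D j) (f j)"
    "x \<in> carrier (obj C j) \<Longrightarrow> f (j - 1) (diff C j x) = diff D j (f j x)"
    "y \<in> carrier (obj C (j + 1)) \<Longrightarrow> f j (diff C (j + 1) y) = diff D (j + 1) (f (j + 1) y)"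
    using *(1)[of j] *(2)[of x j] *(2)[of y "j + 1"] by auto
qed

lemma chain_mapI:
  assumes "\<And>j. graded_hom R (obj C j) (obj D j) (f j)"
    "\<And>j x. x \<in> carrier (obj C j) \<Longrightarrow> f (j - 1) (diff C j x) = diff D j (f j x)"
  shows "chain_map R C D f"
  using assms unfolding chain_map_def by blast

lemma chain_map_compose:
  assumes f: "chain_map R C D f" and g: "chain_map R D E g"
  shows "chain_map R C E (\<lambda>j x. g j (f j x))"
  using hm_compose_gh[OF cm_hom[OF f] cm_hom[OF g]] cm_diff[OF f] cm_diff[OF g] hm_closed[OF cm_hom[OF f]]
  by (intro chain_mapI) simp_all

lemma chain_map_id: "graded_complex R C \<Longrightarrow> chain_map R C C (\<lambda>j x. x)"
  by (intro chain_mapI hm_id) simp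

lemma
  assumes C: "graded_complex R C"
  shows hsub_cycles: "hsub (obj C j) (cycles C j)"
    and hsub_boundaries: "hsub (obj C j) (boundaries C j)"
    and boundaries_cycles: "boundaries C j \<subseteq> cycles C j"
proof -
  show "hsub (obj C j) (cycles C j)"
    unfolding cycles_def by (rule hsub_kernel[OF gc_module[OF C] gc_module[OF C] gc_diff[OF C]])
  show "hsub (obj C j) (boundaries C j)"
    unfolding boundaries_def by (rule hsub_image[OF gc_module[OF C] gc_module[OF C] gc_diff'[OF C]])
  show "boundaries C j \<subseteq> cycles C j"
    using gc_dd'[OF C] hm_closed[OF gc_diff'[OF C]] unfolding boundaries_def cycles_def by auto
qed

lemma cyclesD: "z \<in> cycles C j \<Longrightarrow> z \<in> carrier (obj C j)" "z \<in> cycles C j \<Longrightarrow> diff C j z = \<zero>\<^bsub>obj C (j - 1)\<^esub>"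
  and cyclesI: "z \<in> carrier (obj C j) \<Longrightarrow> diff C j z = \<zero>\<^bsub>obj C (j - 1)\<^esub> \<Longrightarrow> z \<in> cycles C j"
  by (auto simp: cycles_def)

lemma boundariesI: "x \<in> carrier (obj C (j + 1)) \<Longrightarrow> y = diff C (j + 1) x \<Longrightarrow> y \<in> boundaries C j"
  by (auto simp: boundaries_def)

lemma boundariesE:
  assumes "y \<in> boundaries C j"
  obtains x where "x \<in> carrier (obj C (j + 1))" "y = diff C (j + 1) x"
  using assms by (auto simp: boundaries_def)

context
  fixes C :: "('a, 'b) cpx"
  assumes C: "graded_complex R C"
begin

lemma graded_module_homology: "graded_module R (homology C j)"
  unfolding homology_def
  by (rule graded_module_gquot[OF gc_module[OF C] hsub_boundaries[OF C] hsub_cycles[OF C]])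

lemma hm_hcls: "graded_hom R (restrict_gmod (obj C j) (cycles C j)) (homology C j) (hcls C j)"
  unfolding homology_def
  by (rule hm_coset[OF gc_module[OF C] hsub_boundaries[OF C] hsub_cycles[OF C]])

lemma carrier_homology: "carrier (homology C j) = hcls C j ` cycles C j"
  and zero_homology: "\<zero>\<^bsub>homology C j\<^esub> = boundaries C j"
  and mgr_homology: "mgr (homology C j) n = hcls C j ` (cycles C j \<inter> mgr (obj C j) n)"
  by (simp_all add: homology_def)

lemma hcls_eq_iff:
  "x \<in> cycles C j \<Longrightarrow> y \<in> cycles C j \<Longrightarrow> hcls C j x = hcls C j y \<longleftrightarrow> x \<oplus>\<^bsub>obj C j\<^esub> \<ominus>\<^bsub>obj C j\<^esub> y \<in> boundaries C j"
  by (rule coset_eq_iff[OF gc_module[OF C] hsub_boundaries[OF C] cyclesD(1) cyclesD(1)])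

lemma hcls_zero_iff:
  "x \<in> cycles C j \<Longrightarrow> hcls C j x = \<zero>\<^bsub>homology C j\<^esub> \<longleftrightarrow> x \<in> boundaries C j"
  using coset_zero_iff[OF gc_module[OF C] hsub_boundaries[OF C]] cyclesD(1)[of x C j]
  by (simp add: zero_homology)

end

lemma chain_map_cycles:
  assumes C: "graded_complex R C" and D: "graded_complex R D" and f: "chain_map R C D f"
  shows "z \<in> cycles C j \<Longrightarrow> f j z \<in> cycles D j"
    and "z \<in> boundaries C j \<Longrightarrow> f j z \<in> boundaries D j"
proof -
  show "f j z \<in> cycles D j" if "z \<in> cycles C j"
    using cyclesD[OF that] hm_closed[OF cm_hom[OF f]] cm_diff[OF f, of z j]
      hm_zero[OF gc_module[OF C] gc_module[OF D] cm_hom[OF f]]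
    by (intro cyclesI) auto
  show "f j z \<in> boundaries D j" if z: "z \<in> boundaries C j"
  proof -
    obtain x where x: "x \<in> carrier (obj C (j + 1))" "z = diff C (j + 1) x" using boundariesE[OF z] .
    then show ?thesis using cm_diff'[OF f x(1)] hm_closed[OF cm_hom[OF f] x(1)]
      by (intro boundariesI[of "f (j + 1) x"]) auto
  qed
qed

text \<open>A chain map carries boundaries to boundaries, so the union in
  \<open>homology_map\<close> runs over equal cosets. Linearity and homogeneity are inherited from
  the factorization of \<open>z \<mapsto> hcls D j (f j z)\<close> through the homology of
  \<open>C\<close>.\<close>

lemma
  assumes C: "graded_complex R C" and D: "graded_complex R D" and f: "chain_map R C D f"
  shows homology_map_hcls: "z \<in> cycles C j \<Longrightarrow> homology_map D f j (hcls C j z) = hcls D j (f j z)"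
    and hm_homology_map: "graded_hom R (homology C j) (homology D j) (homology_map D f j)"
proof -
  note fc = chain_map_cycles[OF C D f]
  show 1: "homology_map D f j (hcls C j z) = hcls D j (f j z)" if z: "z \<in> cycles C j" for z
    unfolding homology_map_def
  proof (rule coset_UN[OF gc_module[OF C] hsub_boundaries[OF C] cyclesD(1)[OF z]])
    fix x assume x: "x \<in> carrier (obj C j)" "hcls C j x = hcls C j z"
    then have d: "x \<oplus>\<^bsub>obj C j\<^esub> \<ominus>\<^bsub>obj C j\<^esub> z \<in> boundaries C j"
      using coset_eq_iff[OF gc_module[OF C] hsub_boundaries[OF C] x(1) cyclesD(1)[OF z]] by simp
    then have "f j x \<oplus>\<^bsub>obj D j\<^esub> \<ominus>\<^bsub>obj D j\<^esub> f j z \<in> boundaries D j"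
      using fc(2)[OF d] cyclesD(1)[OF z] x(1) gc_module[OF C]
      by (simp add: hm_add[OF cm_hom[OF f]] hm_neg[OF gc_module[OF C] gc_module[OF D] cm_hom[OF f]])
    then show "hcls D j (f j x) = hcls D j (f j z)"
      using coset_eq_iff[OF gc_module[OF D] hsub_boundaries[OF D] hm_closed[OF cm_hom[OF f] x(1)]
          hm_closed[OF cm_hom[OF f] cyclesD(1)[OF z]]] by simp
  qed
  let ?Z = "restrict_gmod (obj C j) (cycles C j)" and ?Y = "restrict_gmod (obj D j) (cycles D j)"
  have Z: "graded_module R ?Z" by (rule graded_module_restrict[OF gc_module[OF C] hsub_cycles[OF C]])
  have "graded_hom R ?Z ?Y (f j)"
    using hm_from_restrict[OF hsub_cycles[OF C] cm_hom[OF f]] fc(1) Z by (intro hm_into_restrict) auto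
  from hm_compose_gh[OF this hm_hcls[OF D]]
  have w: "graded_hom R ?Z (homology D j) (\<lambda>z. hcls D j (f j z))" .
  have "hcls D j (f j x) = \<zero>\<^bsub>homology D j\<^esub>"
    if "x \<in> carrier ?Z" "hcls C j x = \<zero>\<^bsub>homology C j\<^esub>" for x
    using that hcls_zero_iff[OF C] hcls_zero_iff[OF D] fc by simp
  from graded_factor[OF Z graded_module_homology[OF C] graded_module_homology[OF D] hm_hcls[OF C] _ w this]
  obtain g where g: "graded_hom R (homology C j) (homology D j) g"
    "\<And>x. x \<in> carrier ?Z \<Longrightarrow> g (hcls C j x) = hcls D j (f j x)"
    using carrier_homology[OF C, of j] restrict_gmod_simps(1) by metis
  have "homology_map D f j X = g X" if X: "X \<in> carrier (homology C j)" for X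
  proof -
    obtain z where "z \<in> cycles C j" "X = hcls C j z" using X carrier_homology[OF C] by blast
    then show ?thesis using g(2)[of z] 1[of z] by simp
  qed
  then show "graded_hom R (homology C j) (homology D j) (homology_map D f j)"
    by (rule hm_cong[OF graded_module_homology[OF C] g(1)])
qed

subsection \<open>The complex of homomorphisms\<close>

lemma obj_hom_cpx: "obj (hom_cpx R C N) j = gHom R (obj C (- j)) N"
  by (simp add: hom_cpx_def)

lemma graded_complex_hom_cpx:
  assumes C: "graded_complex R C" and N: "graded_module R N"
  shows "graded_complex R (hom_cpx R C N)"
proof (rule graded_complexI)
  fix j
  show "graded_module R (obj (hom_cpx R C N) j)"
    unfolding obj_hom_cpx by (rule graded_module_gHom[OF gc_module[OF C] N])
  \<comment> \<open>Precomposition with this map leads from maps on \<open>obj C (- j)\<close> to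
    maps on \<open>obj C (1 - j)\<close>, that is, from index \<open>j\<close> to index
    \<open>j - 1\<close> of the Hom complex.\<close>
  have d: "graded_hom R (obj C (1 - j)) (obj C (- j)) (diff C (1 - j))"
    using gc_diff[OF C, of "1 - j"] by simp
  show "graded_hom R (obj (hom_cpx R C N) j) (obj (hom_cpx R C N) (j - 1)) (diff (hom_cpx R C N) j)"
    using graded_hom_gHom[OF gc_module[OF C] N gc_module[OF C] N d hm_id]
    by (simp add: hom_cpx_def)
  fix u assume u: "u \<in> carrier (obj (hom_cpx R C N) j)"
  then have u': "u \<in> carrier (gHom R (obj C (- j)) N)" by (simp add: obj_hom_cpx)
  have u0: "u \<zero>\<^bsub>obj C (- j)\<^esub> = \<zero>\<^bsub>N\<^esub>"
    by (rule lin_zero[OF gm_module[OF gc_module[OF C]] gm_module[OF N] gHomD(3)[OF gc_module[OF C] N u']])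
  have "u (diff C (1 - j) (diff C (2 - j) x)) = \<zero>\<^bsub>N\<^esub>" if "x \<in> carrier (obj C (2 - j))" for x
    using gc_dd[OF C that] u0 by simp
  moreover have "diff C (2 - j) x \<in> carrier (obj C (1 - j))" if "x \<in> carrier (obj C (2 - j))" for x
    using hm_closed[OF gc_diff[OF C] that] by simp
  ultimately show "diff (hom_cpx R C N) (j - 1) (diff (hom_cpx R C N) j u) = \<zero>\<^bsub>obj (hom_cpx R C N) (j - 2)\<^esub>"
    by (auto simp: hom_cpx_def restrict_def fun_eq_iff)
qed

lemma chain_map_hom_cpx:
  assumes C: "graded_complex R C" and D: "graded_complex R D" and f: "chain_map R D C f"
    and N: "graded_module R N" and N': "graded_module R N'" and h: "graded_hom R N N' h"
  shows "chain_map R (hom_cpx R C N) (hom_cpx R D N') (hom_cpx_map D f h)"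
proof (rule chain_mapI)
  fix j
  show "graded_hom R (obj (hom_cpx R C N) j) (obj (hom_cpx R D N') j) (hom_cpx_map D f h j)"
    using graded_hom_gHom[OF gc_module[OF C] N gc_module[OF D] N' cm_hom[OF f] h, of "- j"]
    by (simp add: hom_cpx_map_def obj_hom_cpx)
  fix u
  have "diff D (1 - j) x \<in> carrier (obj D (- j))" "f (1 - j) x \<in> carrier (obj C (1 - j))"
    "f (- j) (diff D (1 - j) x) = diff C (1 - j) (f (1 - j) x)" if "x \<in> carrier (obj D (1 - j))" for x
    using hm_closed[OF gc_diff[OF D] that] hm_closed[OF cm_hom[OF f] that] cm_diff[OF f that] by simp_all
  then show "hom_cpx_map D f h (j - 1) (diff (hom_cpx R C N) j u) = diff (hom_cpx R D N') j (hom_cpx_map D f h j u)"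
    by (auto simp: hom_cpx_def hom_cpx_map_def restrict_def fun_eq_iff)
qed

context
  fixes X :: "('a, 'b) cpx" and N :: "('a, 'c) gmod"
  assumes X: "graded_complex R X" and N: "graded_module R N"
begin

lemma coh_cycles_iff:
  "u \<in> cycles (hom_cpx R X N) (- k) \<longleftrightarrow> u \<in> carrier (gHom R (obj X k) N) \<and>
     (\<forall>x\<in>carrier (obj X (k + 1)). u (diff X (k + 1) x) = \<zero>\<^bsub>N\<^esub>)"
  by (auto simp: cycles_def hom_cpx_def restrict_def fun_eq_iff add.commute[of 1 k])

lemma coh_boundaries_iff:
  "w \<in> boundaries (hom_cpx R X N) (- k) \<longleftrightarrow>
     (\<exists>v\<in>carrier (gHom R (obj X (k - 1)) N). w = (\<lambda>x\<in>carrier (obj X k). v (diff X k x)))"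
  by (auto simp: boundaries_def hom_cpx_def)

text \<open>The coboundary map preserves degrees, so the degree \<open>n\<close> component of any
  primitive is again a primitive. Hence the vanishing of a homogeneous class can be tested with
  homogeneous maps alone.\<close>

lemma coh_boundary_homogeneous:
  assumes w: "w \<in> boundaries (hom_cpx R X N) (- k)" and h: "homogeneous_map R (obj X k) N n w"
  obtains v where "homogeneous_map R (obj X (k - 1)) N n v" "\<And>x. x \<in> carrier (obj X k) \<Longrightarrow> w x = v (diff X k x)"
proof -
  let ?D = "\<lambda>v. \<lambda>x\<in>carrier (obj X k). v (diff X k x)"
  obtain v where v: "v \<in> carrier (gHom R (obj X (k - 1)) N)" "w = ?D v"
    using w by (auto simp: coh_boundaries_iff)
  have G: "graded_module R (gHom R (obj X j) N)" for j by (rule graded_module_gHom[OF gc_module[OF X] N])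
  have D: "graded_hom R (gHom R (obj X (k - 1)) N) (gHom R (obj X k) N) ?D"
    using graded_hom_gHom[OF gc_module[OF X] N gc_module[OF X] N gc_diff[OF X] hm_id] .
  let ?v = "comp (gHom R (obj X (k - 1)) N) v n"
  have wm: "?D v \<in> mgr (gHom R (obj X k) N) n" using h v(2) by auto
  have "?D ?v = ?D v" by (rule homogeneous_preimage[OF G G D v(1)]) (rule wm)
  then have eq: "?D ?v = w" using v(2) by simp
  show ?thesis
  proof
    show "homogeneous_map R (obj X (k - 1)) N n ?v"
      using comp_mgr[OF G v(1), of n] by (simp add: comp_def)
    show "w x = ?v (diff X k x)" if "x \<in> carrier (obj X k)" for x
      using fun_cong[OF eq, of x] that by simp
  qed
qed

lemma coh_boundaryI:
  assumes w: "homogeneous_map R (obj X k) N n w"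
    and v: "homogeneous_map R (obj X (k - 1)) N n v" and eq: "\<And>x. x \<in> carrier (obj X k) \<Longrightarrow> w x = v (diff X k x)"
  shows "restrict w (carrier (obj X k)) \<in> boundaries (hom_cpx R X N) (- k)"
  unfolding coh_boundaries_iff
proof
  show "restrict v (carrier (obj X (k - 1))) \<in> carrier (gHom R (obj X (k - 1)) N)"
    by (rule gHomI[OF gc_module[OF X] N hsum_map_homogeneous[OF gc_module[OF X] N v]])
  show "restrict w (carrier (obj X k)) =
    (\<lambda>x\<in>carrier (obj X k). restrict v (carrier (obj X (k - 1))) (diff X k x))"
    using eq hm_closed[OF gc_diff[OF X]] by (auto simp: restrict_def fun_eq_iff)
qed

text \<open>Turns hypotheses stated as zero cohomology modules, such as \<open>condU\<close> and
  \<open>condV\<close>, into the extension property used from here on.\<close>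

lemma vanishes_of_zero:
  assumes z: "zero_module (homology (hom_cpx R X N) (- k))"
  shows "coh_vanishes R X N k"
proof (rule coh_vanishesI)
  fix n u assume u: "homogeneous_map R (obj X k) N n u"
    and c: "\<And>x. x \<in> carrier (obj X (k + 1)) \<Longrightarrow> u (diff X (k + 1) x) = \<zero>\<^bsub>N\<^esub>"
  let ?u = "restrict u (carrier (obj X k))"
  note H = graded_complex_hom_cpx[OF X N]
  have cyc: "?u \<in> cycles (hom_cpx R X N) (- k)"
    using gHomI[OF gc_module[OF X] N hsum_map_homogeneous[OF gc_module[OF X] N u]] c
      hm_closed[OF gc_diff'[OF X]] by (simp add: coh_cycles_iff)
  then have "hcls (hom_cpx R X N) (- k) ?u = \<zero>\<^bsub>homology (hom_cpx R X N) (- k)\<^esub>"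
    using z by (auto simp: zero_module_def carrier_homology[OF H])
  then have "?u \<in> boundaries (hom_cpx R X N) (- k)" using hcls_zero_iff[OF H cyc] by simp
  from coh_boundary_homogeneous[OF this hm_restrict[OF gc_module[OF X] u]]
  show "\<exists>v. homogeneous_map R (obj X (k - 1)) N n v \<and> (\<forall>x\<in>carrier (obj X k). u x = v (diff X k x))"
    by (metis restrict_apply')
qed

end

end


section \<open>Lifting along acyclic fibrations\<close>

definition nonneg :: "('a, 'b) cpx \<Rightarrow> bool" where
  "nonneg X \<longleftrightarrow> (\<forall>j<0. zero_module (obj X j))"

text \<open>The map into the fibre product of cycles and \<open>Z\<close> is onto in every degree: \<open>p\<close> is a
  surjective quasi-isomorphism.\<close>

definition acyclic_fib :: "'a gring \<Rightarrow> ('a, 'b) cpx \<Rightarrow> ('a, 'c) cpx \<Rightarrow> (int \<Rightarrow> 'b \<Rightarrow> 'c) \<Rightarrow> bool" where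
  "acyclic_fib R Y Z p \<longleftrightarrow> chain_map R Y Z p \<and>
     (\<forall>j z c. z \<in> carrier (obj Y (j - 1)) \<and> c \<in> carrier (obj Z j) \<and>
        diff Y (j - 1) z = \<zero>\<^bsub>obj Y (j - 2)\<^esub> \<and> p (j - 1) z = diff Z j c \<longrightarrow>
        (\<exists>y\<in>carrier (obj Y j). diff Y j y = z \<and> p j y = c))"

lemma fib_chain_map: "acyclic_fib R Y Z p \<Longrightarrow> chain_map R Y Z p"
  by (simp add: acyclic_fib_def)

lemma fibE:
  assumes "acyclic_fib R Y Z p" "z \<in> carrier (obj Y (j - 1))" "c \<in> carrier (obj Z j)"
    "diff Y (j - 1) z = \<zero>\<^bsub>obj Y (j - 2)\<^esub>" "p (j - 1) z = diff Z j c"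
  obtains y where "y \<in> carrier (obj Y j)" "diff Y j y = z" "p j y = c"
  using assms unfolding acyclic_fib_def by blast

lemma nonnegD: "nonneg X \<Longrightarrow> j < 0 \<Longrightarrow> x \<in> carrier (obj X j) \<Longrightarrow> x = \<zero>\<^bsub>obj X j\<^esub>"
  by (auto simp: nonneg_def zero_module_def)

definition projective_cpx :: "'s itself \<Rightarrow> 'a gring \<Rightarrow> ('a, 'b) cpx \<Rightarrow> bool" where
  "projective_cpx T R X \<longleftrightarrow> graded_complex R X \<and> nonneg X \<and> (\<forall>j. projective T R (obj X j))"

definition cone :: "('a, 'x) cpx \<Rightarrow> ('a, 'y) cpx \<Rightarrow> (int \<Rightarrow> 'x \<Rightarrow> 'y) \<Rightarrow> ('a, 'y \<times> 'x) cpx" where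
  "cone X Y f =
     \<lparr>obj = (\<lambda>j. gprod (obj Y j) (obj X (j - 1))),
      diff = (\<lambda>j w. (diff Y j (fst w) \<oplus>\<^bsub>obj Y (j - 1)\<^esub> f (j - 1) (snd w),
        \<ominus>\<^bsub>obj X (j - 2)\<^esub> diff X (j - 1) (snd w)))\<rparr>"

lemma obj_cone: "obj (cone X Y f) j = gprod (obj Y j) (obj X (j - 1))"
  and diff_cone: "diff (cone X Y f) j w = (diff Y j (fst w) \<oplus>\<^bsub>obj Y (j - 1)\<^esub> f (j - 1) (snd w),
        \<ominus>\<^bsub>obj X (j - 2)\<^esub> diff X (j - 1) (snd w))"
  by (simp_all add: cone_def)

context graded_base
begin

lemma hm_pair:
  assumes "homogeneous_map R A M n f" "homogeneous_map R A N n g"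
  shows "homogeneous_map R A (gprod M N) n (\<lambda>x. (f x, g x))"
  using hm_closed[OF assms(1)] hm_closed[OF assms(2)] hm_add[OF assms(1)] hm_add[OF assms(2)]
    hm_smult[OF assms(1)] hm_smult[OF assms(2)] hm_mgr[OF assms(1)] hm_mgr[OF assms(2)]
  by (intro homogeneous_mapI) auto

lemma hm_fst: "graded_hom R (gprod M N) M fst" and hm_snd: "graded_hom R (gprod M N) N snd"
  by (auto intro!: homogeneous_mapI)

lemma hm_inl: "graded_module R N \<Longrightarrow> graded_hom R M (gprod M N) (\<lambda>y. (y, \<zero>\<^bsub>N\<^esub>))"
  and hm_inr: "graded_module R M' \<Longrightarrow> graded_hom R N' (gprod M' N') (\<lambda>x. (\<zero>\<^bsub>M'\<^esub>, x))"
  using hm_pair[OF hm_id hm_const_zero] hm_pair[OF hm_const_zero hm_id] by blast+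

text \<open>A map with prescribed boundary \<open>t\<close> and prescribed image \<open>s\<close> is
  a lift of the pair along \<open>y \<mapsto> (diff Y j y, p j y)\<close>; the fibration property
  says that every such compatible pair is hit.\<close>

lemma lift_step:
  assumes A: "graded_module R A" "projective TYPE('s) R A"
    and Y: "graded_complex R Y" and Z: "graded_complex R Z" and p: "acyclic_fib R Y Z p"
    and t: "graded_hom R A (obj Y (j - 1)) t" and s: "graded_hom R A (obj Z j) s"
    and dt: "\<And>x. x \<in> carrier A \<Longrightarrow> diff Y (j - 1) (t x) = \<zero>\<^bsub>obj Y (j - 2)\<^esub>"
    and pt: "\<And>x. x \<in> carrier A \<Longrightarrow> p (j - 1) (t x) = diff Z j (s x)"
  obtains h where "graded_hom R A (obj Y j) h" "\<And>x. x \<in> carrier A \<Longrightarrow> diff Y j (h x) = t x"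
    "\<And>x. x \<in> carrier A \<Longrightarrow> p j (h x) = s x"
proof -
  have ex: "\<exists>y\<in>carrier (obj Y j). (diff Y j y, p j y) = (t x, s x)" if x: "x \<in> carrier A" for x
    using fibE[OF p hm_closed[OF t x] hm_closed[OF s x] dt[OF x] pt[OF x]] by metis
  from projective_lift[OF A(2,1) gc_module[OF Y] graded_module_gprod[OF gc_module[OF Y] gc_module[OF Z]]
      hm_pair[OF t s] hm_pair[OF gc_diff[OF Y] cm_hom[OF fib_chain_map[OF p]]] ex]
  obtain h where "graded_hom R A (obj Y j) h"
    "\<And>x. x \<in> carrier A \<Longrightarrow> (diff Y j (h x), p j (h x)) = (t x, s x)" by metis
  then show ?thesis using that by blast
qed

lemma
  assumes "projective_cpx T R X"
  shows projective_cpxD: "graded_complex R X" "nonneg X" "projective T R (obj X j)"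
  using assms by (auto simp: projective_cpx_def)

text \<open>Lifting degree by degree. The comparison theorem for resolutions and the lifting of maps
  to the free replacement are both instances.\<close>

lemma chain_lift:
  assumes PX: "projective_cpx TYPE('s) R X" and Y: "graded_complex R Y" and Z: "graded_complex R Z"
    and p: "acyclic_fib R Y Z p" and f: "chain_map R X Z f"
  obtains g where "chain_map R X Y g" "\<And>j x. x \<in> carrier (obj X j) \<Longrightarrow> p j (g j x) = f j x"
proof -
  note X = projective_cpxD(1)[OF PX] and nn = projective_cpxD(2)[OF PX]
  note pm = cm_hom[OF fib_chain_map[OF p]]
  \<comment> \<open>The induction starts in degree -1, where the map is zero, so \<open>n\<close>
    stands for degree \<open>n - 1\<close>. The last conjunct provides what the next
    \<open>lift_step\<close> requires: boundaries pushed through \<open>h\<close> are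
    cycles.\<close>
  let ?P = "\<lambda>(n::nat) h. graded_hom R (obj X (int n - 1)) (obj Y (int n - 1)) h \<and>
    (\<forall>x\<in>carrier (obj X (int n - 1)). p (int n - 1) (h x) = f (int n - 1) x) \<and>
    (\<forall>x\<in>carrier (obj X (int n)). diff Y (int n - 1) (h (diff X (int n) x)) = \<zero>\<^bsub>obj Y (int n - 2)\<^esub>)"
  let ?Q = "\<lambda>(n::nat) h h'. \<forall>x\<in>carrier (obj X (int n)). diff Y (int n) (h' x) = h (diff X (int n) x)"
  have "\<exists>g. \<forall>n. ?P n (g n) \<and> ?Q n (g n) (g (Suc n))"
  proof (rule dependent_nat_choice)
    show "\<exists>h. ?P 0 h"
      using hm_const_zero[OF gc_module[OF Y], of "obj X (- 1)" "- 1" 0]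
        hm_zero[OF gc_module[OF Y] gc_module[OF Z] pm, of "-1"]
        hm_zero[OF gc_module[OF Y] gc_module[OF Y] gc_diff[OF Y], of "-1"]
        hm_zero[OF gc_module[OF X] gc_module[OF Z] cm_hom[OF f], of "-1"] nonnegD[OF nn, of "-1"]
      by (intro exI[of _ "\<lambda>_. \<zero>\<^bsub>obj Y (- 1)\<^esub>"]) auto
  next
    fix h n assume P: "?P n h"
    then have h: "graded_hom R (obj X (int n - 1)) (obj Y (int n - 1)) h" by blast
    have t: "graded_hom R (obj X (int n)) (obj Y (int n - 1)) (\<lambda>x. h (diff X (int n) x))"
      by (rule hm_compose_gh[OF gc_diff[OF X] h])
    have "p (int n - 1) (h (diff X (int n) x)) = diff Z (int n) (f (int n) x)"
      if "x \<in> carrier (obj X (int n))" for x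
      using P hm_closed[OF gc_diff[OF X] that] cm_diff[OF f that] by simp
    from lift_step[OF gc_module[OF X] projective_cpxD(3)[OF PX] Y Z p t cm_hom[OF f] _ this]
    obtain h' where h': "graded_hom R (obj X (int n)) (obj Y (int n)) h'"
      "\<And>x. x \<in> carrier (obj X (int n)) \<Longrightarrow> diff Y (int n) (h' x) = h (diff X (int n) x)"
      "\<And>x. x \<in> carrier (obj X (int n)) \<Longrightarrow> p (int n) (h' x) = f (int n) x"
      using P by metis
    have "diff Y (int n) (h' (diff X (1 + int n) x)) = \<zero>\<^bsub>obj Y (int n - 1)\<^esub>"
      if x: "x \<in> carrier (obj X (1 + int n))" for x
      using h'(2)[of "diff X (1 + int n) x"] hm_closed[OF gc_diff[OF X] x] gc_dd[OF X x]
        hm_zero[OF gc_module[OF X] gc_module[OF Y] h] by simp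
    then show "\<exists>h'. ?P (Suc n) h' \<and> ?Q n h h'"
      using h' by (intro exI[of _ h']) simp
  qed
  then obtain g where g: "\<And>n. ?P n (g n)" "\<And>n. ?Q n (g n) (g (Suc n))" by blast
  \<comment> \<open>Below degree -1 the source is zero, so the zero map serves.\<close>
  define G where "G j = (if j < -1 then (\<lambda>_. \<zero>\<^bsub>obj Y j\<^esub>) else g (nat (j + 1)))" for j
  have G: "graded_hom R (obj X j) (obj Y j) (G j)" for j
    using g(1)[of "nat (j + 1)"] hm_const_zero[OF gc_module[OF Y], of "obj X j" j 0] by (auto simp: G_def)
  note G0 = hm_zero[OF gc_module[OF X] gc_module[OF Y] G]
  have "G (j - 1) (diff X j x) = diff Y j (G j x)" if x: "x \<in> carrier (obj X j)" for j x
  proof (cases "j < 0")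
    case True
    then have "x = \<zero>\<^bsub>obj X j\<^esub>" using nonnegD[OF nn _ x] by simp
    then show ?thesis
      using G0 hm_zero[OF gc_module[OF X] gc_module[OF X] gc_diff[OF X], of j]
        hm_zero[OF gc_module[OF Y] gc_module[OF Y] gc_diff[OF Y], of j] by simp
  next
    case False
    then have "nat (j + 1) = Suc (nat j)" by simp
    then show ?thesis using g(2)[of "nat j"] x False by (simp add: G_def)
  qed
  then have cm: "chain_map R X Y G" using G by (intro chain_mapI)
  have "p j (G j x) = f j x" if x: "x \<in> carrier (obj X j)" for j x
  proof (cases "j < -1")
    case True
    then have "x = \<zero>\<^bsub>obj X j\<^esub>" using nonnegD[OF nn _ x] by simp
    then show ?thesis
      using G0 hm_zero[OF gc_module[OF Y] gc_module[OF Z] pm]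
        hm_zero[OF gc_module[OF X] gc_module[OF Z] cm_hom[OF f]] by simp
  next
    case False
    then show ?thesis using g(1)[of "nat (j + 1)"] x by (simp add: G_def)
  qed
  then show ?thesis using that cm by blast
qed

text \<open>The homotopy itself is only needed modulo boundaries, through its effect on cocycles.\<close>

lemma chain_homotopy:
  assumes PX: "projective_cpx TYPE('s) R X" and Y: "graded_complex R Y" and Z: "graded_complex R Z"
    and p: "acyclic_fib R Y Z p" and f: "chain_map R X Y f" and g: "chain_map R X Y g"
    and fg: "\<And>j x. x \<in> carrier (obj X j) \<Longrightarrow> p j (f j x) = p j (g j x)"
  obtains s where "graded_hom R (obj X (k - 1)) (obj Y k) s"
    "\<And>x. x \<in> carrier (obj X k) \<Longrightarrow> \<exists>y\<in>carrier (obj Y (k + 1)).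
       f k x = g k x \<oplus>\<^bsub>obj Y k\<^esub> (diff Y (k + 1) y \<oplus>\<^bsub>obj Y k\<^esub> s (diff X k x))"
proof (cases "k < 0")
  case True
  note X = projective_cpxD(1)[OF PX] and nn = projective_cpxD(2)[OF PX]
  note Y0 = hm_zero[OF gc_module[OF Y] gc_module[OF Y] gc_diff'[OF Y]]
  show ?thesis
  proof (rule that[of "\<lambda>_. \<zero>\<^bsub>obj Y k\<^esub>"])
    show "graded_hom R (obj X (k - 1)) (obj Y k) (\<lambda>_. \<zero>\<^bsub>obj Y k\<^esub>)"
      by (rule hm_const_zero[OF gc_module[OF Y]])
    show "\<exists>y\<in>carrier (obj Y (k + 1)).
       f k x = g k x \<oplus>\<^bsub>obj Y k\<^esub> (diff Y (k + 1) y \<oplus>\<^bsub>obj Y k\<^esub> \<zero>\<^bsub>obj Y k\<^esub>)" if x: "x \<in> carrier (obj X k)" for x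
      using nonnegD[OF nn True x] hm_zero[OF gc_module[OF X] gc_module[OF Y] cm_hom[OF f]]
        hm_zero[OF gc_module[OF X] gc_module[OF Y] cm_hom[OF g]] Y0 gc_module[OF Y]
      by (intro bexI[of _ "\<zero>\<^bsub>obj Y (k + 1)\<^esub>"]) simp_all
  qed
next
  case False
  note X = projective_cpxD(1)[OF PX] and nn = projective_cpxD(2)[OF PX]
  note pc = fib_chain_map[OF p] and pm = cm_hom[OF fib_chain_map[OF p]]
  \<comment> \<open>The difference of two lifts of the same map goes to zero in \<open>Z\<close>;
    the homotopy is built by lifting it through the differential while staying over zero.\<close>
  define D where "D j x = f j x \<oplus>\<^bsub>obj Y j\<^esub> \<ominus>\<^bsub>obj Y j\<^esub> g j x" for j x
  have D: "graded_hom R (obj X j) (obj Y j) (D j)" for j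
    unfolding D_def by (rule hm_plus[OF gc_module[OF Y] cm_hom[OF f] hm_uminus[OF gc_module[OF Y] cm_hom[OF g]]])
  have Dd: "diff Y j (D j x) = D (j - 1) (diff X j x)" if x: "x \<in> carrier (obj X j)" for j x
    using hm_closed[OF cm_hom[OF f] x] hm_closed[OF cm_hom[OF g] x] gc_module[OF Y]
      cm_diff[OF f x] cm_diff[OF g x]
    by (simp add: D_def hm_add[OF gc_diff[OF Y]] hm_neg[OF gc_module[OF Y] gc_module[OF Y] gc_diff[OF Y]])
  have pD: "p j (D j x) = \<zero>\<^bsub>obj Z j\<^esub>" if x: "x \<in> carrier (obj X j)" for j x
    using hm_closed[OF cm_hom[OF f] x] hm_closed[OF cm_hom[OF g] x] gc_module[OF Y] gc_module[OF Z]
      fg[OF x] hm_closed[OF pm, of "g j x"]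
    by (simp add: D_def hm_add[OF pm] hm_neg[OF gc_module[OF Y] gc_module[OF Z] pm])
  note dX0 = hm_zero[OF gc_module[OF X] gc_module[OF X] gc_diff[OF X]]
  note dY0 = hm_zero[OF gc_module[OF Y] gc_module[OF Y] gc_diff[OF Y]]
  note dZ0 = hm_zero[OF gc_module[OF Z] gc_module[OF Z] gc_diff[OF Z]]
  note D0 = hm_zero[OF gc_module[OF X] gc_module[OF Y] D]
  note p0 = hm_zero[OF gc_module[OF Y] gc_module[OF Z] pm]
  let ?t = "\<lambda>n h x. D n x \<oplus>\<^bsub>obj Y n\<^esub> \<ominus>\<^bsub>obj Y n\<^esub> h (diff X n x)"
  \<comment> \<open>The part of the homotopy found so far leaves the error \<open>?t\<close>. The
    last conjunct says that the error is a cycle, and by the second conjunct it lies over zero, so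
    it is a boundary to be lifted in the next degree.\<close>
  let ?P = "\<lambda>(n::nat) h. graded_hom R (obj X (int n - 1)) (obj Y (int n)) h \<and>
    (\<forall>x\<in>carrier (obj X (int n - 1)). p (int n) (h x) = \<zero>\<^bsub>obj Z (int n)\<^esub>) \<and>
    (\<forall>x\<in>carrier (obj X (int n)). diff Y (int n) (?t (int n) h x) = \<zero>\<^bsub>obj Y (int n - 1)\<^esub>)"
  let ?Q = "\<lambda>(n::nat) h h'. \<forall>x\<in>carrier (obj X (int n)). diff Y (int n + 1) (h' x) = ?t (int n) h x"
  have "\<exists>s. \<forall>n. ?P n (s n) \<and> ?Q n (s n) (s (Suc n))"
  proof (rule dependent_nat_choice)
    have "diff Y 0 (?t 0 (\<lambda>_. \<zero>\<^bsub>obj Y 0\<^esub>) x) = \<zero>\<^bsub>obj Y (- 1)\<^esub>" if x: "x \<in> carrier (obj X 0)" for x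
    proof -
      have "diff X 0 x = \<zero>\<^bsub>obj X (- 1)\<^esub>"
        using nonnegD[OF nn, of "- 1"] hm_closed[OF gc_diff[OF X] x] by simp
      then show ?thesis
        using Dd[OF x] D0[of "- 1"] gc_module[OF Y] hm_closed[OF D x] by simp
    qed
    then show "\<exists>h. ?P 0 h"
      using hm_const_zero[OF gc_module[OF Y], of "obj X (- 1)" 0 0] p0[of 0]
      by (intro exI[of _ "\<lambda>_. \<zero>\<^bsub>obj Y 0\<^esub>"]) simp
  next
    fix h n assume P: "?P n h"
    let ?n = "int n"
    have h: "graded_hom R (obj X (?n - 1)) (obj Y ?n) h" using P by blast
    have hd: "graded_hom R (obj X ?n) (obj Y ?n) (\<lambda>x. h (diff X ?n x))"
      by (rule hm_compose_gh[OF gc_diff[OF X] h])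
    have t: "graded_hom R (obj X ?n) (obj Y ?n) (?t ?n h)"
      by (rule hm_plus[OF gc_module[OF Y] D hm_uminus[OF gc_module[OF Y] hd]])
    have pt: "p ?n (?t ?n h x) = \<zero>\<^bsub>obj Z ?n\<^esub>" if x: "x \<in> carrier (obj X ?n)" for x
      using P hm_closed[OF gc_diff[OF X] x] hm_closed[OF D x] hm_closed[OF hd x] pD[OF x]
        gc_module[OF Y] gc_module[OF Z]
      by (simp add: hm_add[OF pm] hm_neg[OF gc_module[OF Y] gc_module[OF Z] pm])
    obtain h' where h': "graded_hom R (obj X ?n) (obj Y (?n + 1)) h'"
      "\<And>x. x \<in> carrier (obj X ?n) \<Longrightarrow> diff Y (?n + 1) (h' x) = ?t ?n h x"
      "\<And>x. x \<in> carrier (obj X ?n) \<Longrightarrow> p (?n + 1) (h' x) = \<zero>\<^bsub>obj Z (?n + 1)\<^esub>"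
    proof (rule lift_step[OF gc_module[OF X] projective_cpxD(3)[OF PX] Y Z p, of ?n "?n + 1" "?t ?n h" "\<lambda>_. \<zero>\<^bsub>obj Z (?n + 1)\<^esub>"])
      show "graded_hom R (obj X ?n) (obj Z (?n + 1)) (\<lambda>_. \<zero>\<^bsub>obj Z (?n + 1)\<^esub>)"
        by (rule hm_const_zero[OF gc_module[OF Z]])
    qed (use t pt P dZ0[of "?n + 1"] in auto)
    have "diff Y (1 + ?n) (?t (1 + ?n) h' x) = \<zero>\<^bsub>obj Y ?n\<^esub>" if x: "x \<in> carrier (obj X (1 + ?n))" for x
    proof -
      have dx: "diff X (1 + ?n) x \<in> carrier (obj X ?n)" using hm_closed[OF gc_diff[OF X] x] by simp
      have e: "?t ?n h (diff X (1 + ?n) x) = D ?n (diff X (1 + ?n) x)"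
        using gc_dd[OF X x] hm_zero[OF gc_module[OF X] gc_module[OF Y] h] gc_module[OF Y] hm_closed[OF D dx] by simp
      have "diff Y (1 + ?n) (?t (1 + ?n) h' x)
          = diff Y (1 + ?n) (D (1 + ?n) x) \<oplus>\<^bsub>obj Y ?n\<^esub> \<ominus>\<^bsub>obj Y ?n\<^esub> diff Y (1 + ?n) (h' (diff X (1 + ?n) x))"
        using gc_diff[OF Y, of "1 + ?n"] hm_closed[OF D x] hm_closed[OF h'(1) dx] gc_module[OF Y]
        by (simp add: hm_add hm_neg[OF gc_module[OF Y] gc_module[OF Y]] add.commute)
      also have "\<dots> = \<zero>\<^bsub>obj Y ?n\<^esub>"
        using h'(2)[OF dx] e Dd[OF x] hm_closed[OF D dx] gc_module[OF Y] by (simp add: add.commute)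
      finally show ?thesis .
    qed
    then show "\<exists>h'. ?P (Suc n) h' \<and> ?Q n h h'"
      using h' by (intro exI[of _ h']) (simp add: add.commute)
  qed
  then obtain s where s: "\<And>n. ?P n (s n)" "\<And>n. ?Q n (s n) (s (Suc n))" by blast
  let ?s = "s (nat k)"
  have k: "int (nat k) = k" using False by simp
  show ?thesis
  proof (rule that[of ?s])
    show s1: "graded_hom R (obj X (k - 1)) (obj Y k) ?s" using s(1)[of "nat k"] unfolding k by blast
    fix x assume x: "x \<in> carrier (obj X k)"
    let ?y = "s (Suc (nat k)) x"
    have y: "?y \<in> carrier (obj Y (k + 1))"
      using s(1)[of "Suc (nat k)"] False x by (auto simp: add.commute dest: hm_closed)
    have e: "diff Y (k + 1) ?y = ?t k ?s x" using s(2)[of "nat k"] x unfolding k by blast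
    have c: "f k x \<in> carrier (obj Y k)" "g k x \<in> carrier (obj Y k)" "?s (diff X k x) \<in> carrier (obj Y k)"
      using hm_closed[OF cm_hom[OF f] x] hm_closed[OF cm_hom[OF g] x] hm_closed[OF s1 hm_closed[OF gc_diff[OF X] x]] by auto
    have "f k x = g k x \<oplus>\<^bsub>obj Y k\<^esub> (?t k ?s x \<oplus>\<^bsub>obj Y k\<^esub> ?s (diff X k x))"
      using c gc_module[OF Y] by (simp add: D_def gm_assoc gm_lcomm[of _ "g k x" "f k x"])
    then show "\<exists>y\<in>carrier (obj Y (k + 1)).
       f k x = g k x \<oplus>\<^bsub>obj Y k\<^esub> (diff Y (k + 1) y \<oplus>\<^bsub>obj Y k\<^esub> ?s (diff X k x))"
      using y e by (intro bexI[of _ ?y]) simp_all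
  qed
qed

text \<open>Vanishing depends only on the base \<open>Z\<close>: lifts \<open>f\<close> and
  \<open>g\<close> exist in both directions, and \<open>f \<circ> g\<close> is homotopic to the
  identity. A cocycle \<open>u\<close> on \<open>Y\<close> equals
  \<open>u \<circ> f \<circ> g\<close> plus \<open>u \<circ> s\<close> after the differential, and
  the first summand is a coboundary because \<open>u \<circ> f\<close> is one. So Ext may be tested
  on any projective resolution.\<close>

lemma vanishes_transfer:
  assumes PX: "projective_cpx TYPE('s) R X" and PY: "projective_cpx TYPE('t) R Y" and Z: "graded_complex R Z"
    and p: "acyclic_fib R X Z p" and q: "acyclic_fib R Y Z q" and N: "graded_module R N" and v: "coh_vanishes R X N k"
  shows "coh_vanishes R Y N k"
proof (rule coh_vanishesI)
  note X = projective_cpxD(1)[OF PX] and Y = projective_cpxD(1)[OF PY]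
  obtain f where f: "chain_map R X Y f" "\<And>j x. x \<in> carrier (obj X j) \<Longrightarrow> q j (f j x) = p j x"
    using chain_lift[OF PX Y Z q fib_chain_map[OF p]] by blast
  obtain g where g: "chain_map R Y X g" "\<And>j x. x \<in> carrier (obj Y j) \<Longrightarrow> p j (g j x) = q j x"
    using chain_lift[OF PY X Z p fib_chain_map[OF q]] by blast
  have "q j x = q j (f j (g j x))" if "x \<in> carrier (obj Y j)" for j x
    using f(2)[OF hm_closed[OF cm_hom[OF g(1)] that]] g(2)[OF that] by simp
  from chain_homotopy[OF PY Y Z q chain_map_id[OF Y] chain_map_compose[OF g(1) f(1)] this, of k]
  obtain s where s: "graded_hom R (obj Y (k - 1)) (obj Y k) s"
    "\<And>x. x \<in> carrier (obj Y k) \<Longrightarrow> \<exists>y\<in>carrier (obj Y (k + 1)).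
       x = f k (g k x) \<oplus>\<^bsub>obj Y k\<^esub> (diff Y (k + 1) y \<oplus>\<^bsub>obj Y k\<^esub> s (diff Y k x))" by blast
  fix n u assume u: "homogeneous_map R (obj Y k) N n u"
    and c: "\<And>x. x \<in> carrier (obj Y (k + 1)) \<Longrightarrow> u (diff Y (k + 1) x) = \<zero>\<^bsub>N\<^esub>"
  have "u (f k (diff X (k + 1) x)) = \<zero>\<^bsub>N\<^esub>" if x: "x \<in> carrier (obj X (k + 1))" for x
    using c[OF hm_closed[OF cm_hom[OF f(1)] x]] cm_diff'[OF f(1) x] by simp
  from coh_vanishesE[OF v hm_compose_gh[OF cm_hom[OF f(1)] u] this]
  obtain w where w: "homogeneous_map R (obj X (k - 1)) N n w"
    "\<And>x. x \<in> carrier (obj X k) \<Longrightarrow> u (f k x) = w (diff X k x)" by blast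
  let ?v = "\<lambda>x. w (g (k - 1) x) \<oplus>\<^bsub>N\<^esub> u (s x)"
  have "homogeneous_map R (obj Y (k - 1)) N n ?v"
    by (rule hm_plus[OF N hm_compose_gh[OF cm_hom[OF g(1)] w(1)] hm_compose_gh[OF s(1) u]])
  moreover have "u x = ?v (diff Y k x)" if x: "x \<in> carrier (obj Y k)" for x
  proof -
    obtain y where y: "y \<in> carrier (obj Y (k + 1))"
      and e: "x = f k (g k x) \<oplus>\<^bsub>obj Y k\<^esub> (diff Y (k + 1) y \<oplus>\<^bsub>obj Y k\<^esub> s (diff Y k x))"
      using s(2)[OF x] by blast
    have cc: "f k (g k x) \<in> carrier (obj Y k)" "diff Y (k + 1) y \<in> carrier (obj Y k)" "s (diff Y k x) \<in> carrier (obj Y k)"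
      using hm_closed[OF cm_hom[OF f(1)] hm_closed[OF cm_hom[OF g(1)] x]] hm_closed[OF gc_diff'[OF Y] y]
        hm_closed[OF s(1) hm_closed[OF gc_diff[OF Y] x]] by auto
    have "u x = u (f k (g k x) \<oplus>\<^bsub>obj Y k\<^esub> (diff Y (k + 1) y \<oplus>\<^bsub>obj Y k\<^esub> s (diff Y k x)))"
      using arg_cong[OF e, of u] .
    also have "\<dots> = u (f k (g k x)) \<oplus>\<^bsub>N\<^esub> u (s (diff Y k x))"
      using cc gc_module[OF Y] c[OF y] hm_closed[OF u] N by (simp add: hm_add[OF u])
    also have "\<dots> = ?v (diff Y k x)"
      using w(2)[OF hm_closed[OF cm_hom[OF g(1)] x]] cm_diff[OF g(1) x] by simp
    finally show ?thesis .
  qed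
  ultimately show "\<exists>v. homogeneous_map R (obj Y (k - 1)) N n v \<and> (\<forall>x\<in>carrier (obj Y k). u x = v (diff Y k x))"
    by blast
qed

subsection \<open>Mapping cones\<close>

context
  fixes X :: "('a, 'x) cpx" and Y :: "('a, 'y) cpx" and f
  assumes X: "graded_complex R X" and Y: "graded_complex R Y" and f: "chain_map R X Y f"
begin

lemma graded_complex_cone: "graded_complex R (cone X Y f)"
proof (rule graded_complexI)
  fix j
  show "graded_module R (obj (cone X Y f) j)"
    unfolding obj_cone by (rule graded_module_gprod[OF gc_module[OF Y] gc_module[OF X]])
  have dX: "graded_hom R (obj X (j - 1)) (obj X (j - 2)) (diff X (j - 1))"
    using gc_diff[OF X, of "j - 1"] by simp
  have 1: "graded_hom R (obj (cone X Y f) j) (obj Y (j - 1)) (\<lambda>w. diff Y j (fst w) \<oplus>\<^bsub>obj Y (j - 1)\<^esub> f (j - 1) (snd w))"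
    unfolding obj_cone
    by (rule hm_plus[OF gc_module[OF Y] hm_compose_gh[OF hm_fst gc_diff[OF Y]] hm_compose_gh[OF hm_snd cm_hom[OF f]]])
  have 2: "graded_hom R (obj (cone X Y f) j) (obj X (j - 2)) (\<lambda>w. \<ominus>\<^bsub>obj X (j - 2)\<^esub> diff X (j - 1) (snd w))"
    unfolding obj_cone by (rule hm_uminus[OF gc_module[OF X] hm_compose_gh[OF hm_snd dX]])
  have "diff (cone X Y f) j = (\<lambda>w. (diff Y j (fst w) \<oplus>\<^bsub>obj Y (j - 1)\<^esub> f (j - 1) (snd w),
      \<ominus>\<^bsub>obj X (j - 2)\<^esub> diff X (j - 1) (snd w)))"
    by (simp add: cone_def)
  then show "graded_hom R (obj (cone X Y f) j) (obj (cone X Y f) (j - 1)) (diff (cone X Y f) j)"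
    using hm_pair[OF 1 2] by (simp add: obj_cone[of X Y f "j - 1"])
  fix w assume "w \<in> carrier (obj (cone X Y f) j)"
  then have w: "fst w \<in> carrier (obj Y j)" "snd w \<in> carrier (obj X (j - 1))" by (auto simp: obj_cone)
  have fx: "f (j - 1) (snd w) \<in> carrier (obj Y (j - 1))" "diff Y j (fst w) \<in> carrier (obj Y (j - 1))"
    "diff X (j - 1) (snd w) \<in> carrier (obj X (j - 2))"
    using hm_closed[OF cm_hom[OF f] w(2)] hm_closed[OF gc_diff[OF Y] w(1)] hm_closed[OF dX w(2)] by auto
  have dY: "graded_hom R (obj Y (j - 1)) (obj Y (j - 2)) (diff Y (j - 1))"
    using gc_diff[OF Y, of "j - 1"] by simp
  \<comment> \<open>This and the sign in \<open>cone\<close> make the two mixed terms of the squared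
    differential cancel.\<close>
  have ffx: "f (j - 2) (diff X (j - 1) (snd w)) = diff Y (j - 1) (f (j - 1) (snd w))"
    using cm_diff[OF f w(2)] by simp
  have fc: "f (j - 2) (diff X (j - 1) (snd w)) \<in> carrier (obj Y (j - 2))"
    using hm_closed[OF cm_hom[OF f] fx(3)] .
  have dX2: "graded_hom R (obj X (j - 2)) (obj X (j - 3)) (diff X (j - 2))"
    using gc_diff[OF X, of "j - 2"] by simp
  have ddx: "diff X (j - 2) (diff X (j - 1) (snd w)) = \<zero>\<^bsub>obj X (j - 3)\<^esub>"
    using gc_dd[OF X w(2)] by simp
  show "diff (cone X Y f) (j - 1) (diff (cone X Y f) j w) = \<zero>\<^bsub>obj (cone X Y f) (j - 2)\<^esub>"
    using fx fc ffx ddx gc_module[OF X] gc_module[OF Y] gc_dd[OF Y w(1)]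
    by (simp add: diff_cone obj_cone hm_add[OF dY] hm_neg[OF gc_module[OF X] gc_module[OF X] dX2]
        hm_neg[OF gc_module[OF X] gc_module[OF Y] cm_hom[OF f]])
qed

lemma nonneg_cone: "nonneg X \<Longrightarrow> nonneg Y \<Longrightarrow> nonneg (cone X Y f)"
  by (auto simp: nonneg_def zero_module_def obj_cone)

lemma projective_cone:
  "projective_cpx TYPE('s) R X \<Longrightarrow> projective_cpx TYPE('t) R Y \<Longrightarrow>
    projective_cpx TYPE('t + 's) R (cone X Y f)"
  using graded_complex_cone nonneg_cone projective_gprod[OF gc_module[OF Y] gc_module[OF X]]
  unfolding projective_cpx_def obj_cone by blast

text \<open>The next two lemmas are the parts of the long exact sequence of a mapping cone that are
  needed.\<close>

lemma cone_inj:
  assumes N: "graded_module R N" and v: "coh_vanishes R (cone X Y f) N i"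
    and u: "homogeneous_map R (obj Y i) N n u"
      "\<And>y. y \<in> carrier (obj Y (i + 1)) \<Longrightarrow> u (diff Y (i + 1) y) = \<zero>\<^bsub>N\<^esub>"
    and w: "homogeneous_map R (obj X (i - 1)) N n w"
      "\<And>x. x \<in> carrier (obj X i) \<Longrightarrow> u (f i x) = w (diff X i x)"
  obtains t where "homogeneous_map R (obj Y (i - 1)) N n t" "\<And>y. y \<in> carrier (obj Y i) \<Longrightarrow> u y = t (diff Y i y)"
proof -
  let ?K = "cone X Y f"
  \<comment> \<open>The cocycle \<open>u\<close> and the primitive \<open>w\<close> of its pullback
    form one cocycle on the cone: the sign in \<open>cone\<close> turns their relation into a
    cancellation. A primitive of the pair, restricted to \<open>Y\<close>, is a primitive of
    \<open>u\<close>.\<close>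
  let ?U = "\<lambda>v. u (fst v) \<oplus>\<^bsub>N\<^esub> w (snd v)"
  have U: "homogeneous_map R (obj ?K i) N n ?U"
    unfolding obj_cone by (rule hm_plus[OF N hm_compose_gh[OF hm_fst u(1)] hm_compose_gh[OF hm_snd w(1)]])
  have "?U (diff ?K (i + 1) v) = \<zero>\<^bsub>N\<^esub>" if "v \<in> carrier (obj ?K (i + 1))" for v
  proof -
    have v: "fst v \<in> carrier (obj Y (i + 1))" "snd v \<in> carrier (obj X i)" using that by (auto simp: obj_cone)
    have c: "diff Y (i + 1) (fst v) \<in> carrier (obj Y i)" "f i (snd v) \<in> carrier (obj Y i)"
      "diff X i (snd v) \<in> carrier (obj X (i - 1))"
      using hm_closed[OF gc_diff'[OF Y] v(1)] hm_closed[OF cm_hom[OF f] v(2)] hm_closed[OF gc_diff[OF X] v(2)] by auto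
    show ?thesis
      using c u(2)[OF v(1)] w(2)[OF v(2)] hm_closed[OF w(1) c(3)] N
      by (simp add: diff_cone hm_add[OF u(1)] hm_neg[OF gc_module[OF X] N w(1)])
  qed
  from coh_vanishesE[OF v U this]
  obtain t where t: "homogeneous_map R (obj ?K (i - 1)) N n t"
    "\<And>v. v \<in> carrier (obj ?K i) \<Longrightarrow> ?U v = t (diff ?K i v)" by blast
  have t': "homogeneous_map R (obj Y (i - 1)) N n (\<lambda>y. t (y, \<zero>\<^bsub>obj X (i - 2)\<^esub>))"
    using hm_compose_gh[OF hm_inl[OF gc_module[OF X]] t(1)[unfolded obj_cone]] by simp
  have "u y = t (diff Y i y, \<zero>\<^bsub>obj X (i - 2)\<^esub>)" if y: "y \<in> carrier (obj Y i)" for y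
    using t(2)[of "(y, \<zero>\<^bsub>obj X (i - 1)\<^esub>)"] y gc_module[OF X] gc_module[OF Y] N hm_closed[OF u(1) y]
      hm_zero[OF gc_module[OF X] N w(1)] hm_closed[OF gc_diff[OF Y] y]
      hm_zero[OF gc_module[OF X] gc_module[OF Y] cm_hom[OF f]]
      hm_zero[OF gc_module[OF X] gc_module[OF X] gc_diff[OF X], of "i - 1"]
    by (simp add: obj_cone diff_cone)
  then show ?thesis using that t' by blast
qed

lemma cone_surj:
  assumes N: "graded_module R N" and v: "coh_vanishes R (cone X Y f) N (i + 1)"
    and u: "homogeneous_map R (obj X i) N n u"
      "\<And>x. x \<in> carrier (obj X (i + 1)) \<Longrightarrow> u (diff X (i + 1) x) = \<zero>\<^bsub>N\<^esub>"
  obtains w t where "homogeneous_map R (obj Y i) N n w"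
      "\<And>y. y \<in> carrier (obj Y (i + 1)) \<Longrightarrow> w (diff Y (i + 1) y) = \<zero>\<^bsub>N\<^esub>"
      "homogeneous_map R (obj X (i - 1)) N n t"
      "\<And>x. x \<in> carrier (obj X i) \<Longrightarrow> u x = w (f i x) \<oplus>\<^bsub>N\<^esub> t (diff X i x)"
proof -
  let ?K = "cone X Y f"
  \<comment> \<open>A cocycle of \<open>X\<close> in degree \<open>i\<close> is a cocycle of the
    cone in degree \<open>i + 1\<close> that ignores \<open>Y\<close>.\<close>
  let ?U = "\<lambda>v. u (snd v)"
  have U: "homogeneous_map R (obj ?K (i + 1)) N n ?U"
    using hm_compose_gh[OF hm_snd u(1), of "obj Y (i + 1)"] by (simp add: obj_cone)
  have "?U (diff ?K (i + 1 + 1) v) = \<zero>\<^bsub>N\<^esub>" if "v \<in> carrier (obj ?K (i + 1 + 1))" for v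
  proof -
    have v: "snd v \<in> carrier (obj X (i + 1))" using that by (auto simp: obj_cone add.commute)
    show ?thesis
      using u(2)[OF v] hm_closed[OF gc_diff'[OF X] v] N
      by (simp add: diff_cone hm_neg[OF gc_module[OF X] N u(1)] add.commute[of 1])
  qed
  from coh_vanishesE[OF v U this]
  obtain r where r: "homogeneous_map R (gprod (obj Y i) (obj X (i - 1))) N n r"
    "\<And>v. v \<in> carrier (obj ?K (i + 1)) \<Longrightarrow> ?U v = r (diff ?K (i + 1) v)" by (auto simp: obj_cone)
  \<comment> \<open>The primitive \<open>r\<close> restricts to a cocycle on \<open>Y\<close> and to
    a correction on \<open>X\<close>; the sign of the latter undoes the sign in
    \<open>cone\<close>.\<close>
  let ?w = "\<lambda>y. r (y, \<zero>\<^bsub>obj X (i - 1)\<^esub>)" and ?t = "\<lambda>x. \<ominus>\<^bsub>N\<^esub> r (\<zero>\<^bsub>obj Y i\<^esub>, x)"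
  have w: "homogeneous_map R (obj Y i) N n ?w"
    by (rule hm_compose_gh[OF hm_inl[OF gc_module[OF X]] r(1)])
  have r2: "homogeneous_map R (obj X (i - 1)) N n (\<lambda>x. r (\<zero>\<^bsub>obj Y i\<^esub>, x))"
    by (rule hm_compose_gh[OF hm_inr[OF gc_module[OF Y]] r(1)])
  have t: "homogeneous_map R (obj X (i - 1)) N n ?t" by (rule hm_uminus[OF N r2])
  have wc: "?w (diff Y (i + 1) y) = \<zero>\<^bsub>N\<^esub>" if y: "y \<in> carrier (obj Y (i + 1))" for y
    using r(2)[of "(y, \<zero>\<^bsub>obj X i\<^esub>)"] y gc_module[OF X] gc_module[OF Y]
      hm_zero[OF gc_module[OF X] N u(1)] hm_closed[OF gc_diff'[OF Y] y]
      hm_zero[OF gc_module[OF X] gc_module[OF Y] cm_hom[OF f]]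
      hm_zero[OF gc_module[OF X] gc_module[OF X] gc_diff[OF X], of i]
    by (simp add: obj_cone diff_cone)
  have eq: "u x = ?w (f i x) \<oplus>\<^bsub>N\<^esub> ?t (diff X i x)" if x: "x \<in> carrier (obj X i)" for x
  proof -
    have c: "f i x \<in> carrier (obj Y i)" "diff X i x \<in> carrier (obj X (i - 1))"
      using hm_closed[OF cm_hom[OF f] x] hm_closed[OF gc_diff[OF X] x] by auto
    have "u x = r (f i x, \<ominus>\<^bsub>obj X (i - 1)\<^esub> diff X i x)"
      using r(2)[of "(\<zero>\<^bsub>obj Y (i + 1)\<^esub>, x)"] x c gc_module[OF X] gc_module[OF Y]
        hm_zero[OF gc_module[OF Y] gc_module[OF Y] gc_diff'[OF Y]]
      by (simp add: obj_cone diff_cone)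
    also have "\<dots> = r ((f i x, \<zero>\<^bsub>obj X (i - 1)\<^esub>) \<oplus>\<^bsub>gprod (obj Y i) (obj X (i - 1))\<^esub> (\<zero>\<^bsub>obj Y i\<^esub>, \<ominus>\<^bsub>obj X (i - 1)\<^esub> diff X i x))"
      using c gc_module[OF X] gc_module[OF Y] by simp
    also have "\<dots> = ?w (f i x) \<oplus>\<^bsub>N\<^esub> r (\<zero>\<^bsub>obj Y i\<^esub>, \<ominus>\<^bsub>obj X (i - 1)\<^esub> diff X i x)"
      by (rule hm_add[OF r(1)]) (use c gc_module[OF X] gc_module[OF Y] in auto)
    also have "r (\<zero>\<^bsub>obj Y i\<^esub>, \<ominus>\<^bsub>obj X (i - 1)\<^esub> diff X i x) = ?t (diff X i x)"
      by (rule hm_neg[OF gc_module[OF X] N r2 c(2)])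
    finally show ?thesis .
  qed
  show ?thesis by (rule that[OF w wc t eq])
qed

end

end


section \<open>The standard resolution\<close>

text \<open>\<open>M\<close> placed in degree 0. The other terms are the zero submodule of
  \<open>M\<close> itself, so that all terms share one type.\<close>

definition conc :: "('a, 'm) gmod \<Rightarrow> ('a, 'm) cpx" where
  "conc M = \<lparr>obj = (\<lambda>j. if j = 0 then M else restrict_gmod M {\<zero>\<^bsub>M\<^esub>}), diff = (\<lambda>j x. \<zero>\<^bsub>M\<^esub>)\<rparr>"

lemma conc_simps [simp]:
  "obj (conc M) 0 = M" "j \<noteq> 0 \<Longrightarrow> obj (conc M) j = restrict_gmod M {\<zero>\<^bsub>M\<^esub>}" "diff (conc M) j x = \<zero>\<^bsub>M\<^esub>"
  "\<zero>\<^bsub>obj (conc M) j\<^esub> = \<zero>\<^bsub>M\<^esub>"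
  by (simp_all add: conc_def)

definition conc_map :: "('a, 'm) gmod \<Rightarrow> ('x \<Rightarrow> 'm) \<Rightarrow> int \<Rightarrow> 'x \<Rightarrow> 'm" where
  "conc_map M e j x = (if j = 0 then e x else \<zero>\<^bsub>M\<^esub>)"

lemma conc_map_simps [simp]: "conc_map M e 0 x = e x" "j \<noteq> 0 \<Longrightarrow> conc_map M e j x = \<zero>\<^bsub>M\<^esub>"
  by (simp_all add: conc_map_def)

text \<open>Finite support is what allows a coefficient function to be stored in an
  \<open>fset\<close>.\<close>

lemma decode_encode:
  assumes "finite {s. f s \<noteq> \<zero>\<^bsub>R\<^esub>}"
  shows "decode R (encode R f) = f"
proof
  fix s
  have "{(s, f s) | s. f s \<noteq> \<zero>\<^bsub>R\<^esub>} = (\<lambda>s. (s, f s)) ` {s. f s \<noteq> \<zero>\<^bsub>R\<^esub>}" by auto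
  then have "finite {(s, f s) | s. f s \<noteq> \<zero>\<^bsub>R\<^esub>}" using assms by simp
  then have m: "(t, a) |\<in>| encode R f \<longleftrightarrow> f t \<noteq> \<zero>\<^bsub>R\<^esub> \<and> a = f t" for t a
    unfolding encode_def by (subst Abs_fset_inverse) auto
  show "decode R (encode R f) s = f s" by (simp add: decode_def m)
qed

context graded_base
begin

lemma graded_module_zero:
  assumes M: "graded_module R M"
  shows "graded_module R (restrict_gmod M {\<zero>\<^bsub>M\<^esub>})"
  using M comp_homogeneous[OF M mgr_zero[OF M]]
  by (intro graded_module_restrict) (simp_all add: hsub_def)

lemma graded_complex_conc:
  assumes M: "graded_module R M"
  shows "graded_complex R (conc M)"
proof (rule graded_complexI)
  show o: "graded_module R (obj (conc M) j)" for j
    using M graded_module_zero[OF M] by (cases "j = 0") simp_all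
  show "graded_hom R (obj (conc M) j) (obj (conc M) (j - 1)) (diff (conc M) j)" for j
  proof -
    have "diff (conc M) j = (\<lambda>_. \<zero>\<^bsub>obj (conc M) (j - 1)\<^esub>)" by (intro ext) simp
    then show ?thesis by (simp only: hm_const_zero[OF o])
  qed
qed simp

lemma nonneg_conc: "nonneg (conc M)"
  by (simp add: nonneg_def zero_module_def)

lemma chain_map_conc:
  assumes X: "graded_complex R X" and M: "graded_module R M" and e: "graded_hom R (obj X 0) M e"
    and ed: "\<And>x. x \<in> carrier (obj X 1) \<Longrightarrow> e (diff X 1 x) = \<zero>\<^bsub>M\<^esub>"
  shows "chain_map R X (conc M) (conc_map M e)"
proof (rule chain_mapI)
  fix j
  show "graded_hom R (obj X j) (obj (conc M) j) (conc_map M e j)"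
    using e hm_const_zero[OF gc_module[OF graded_complex_conc[OF M]], of "obj X j" j 0]
    by (cases "j = 0") (simp_all add: conc_map_def[abs_def])
  show "conc_map M e (j - 1) (diff X j x) = diff (conc M) j (conc_map M e j x)" if "x \<in> carrier (obj X j)" for x
    using ed that by (cases "j = 1") simp_all
qed

text \<open>The generators reach every nonzero homogeneous element of \<open>K\<close>; zero and
  sums are reached by induction over the grading of \<open>K\<close>. This is the source of
  exactness for both free complexes.\<close>

lemma lin_comb_onto:
  assumes A: "graded_module R A" and K: "hsub A K"
    and y: "\<And>s. s \<in> G \<Longrightarrow> y s \<in> mgr A (dg s)"
    and sur: "\<And>n x. x \<in> K \<Longrightarrow> x \<in> mgr A n \<Longrightarrow> x \<noteq> \<zero>\<^bsub>A\<^esub> \<Longrightarrow> \<exists>s\<in>G. y s = x"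
    and x: "x \<in> K"
  shows "\<exists>f\<in>carrier (free_gmod R G dg). lin_comb R A y f = x"
proof -
  let ?F = "free_gmod R G dg" and ?K = "restrict_gmod A K"
  have F: "graded_module R ?F" by (rule graded_module_free)
  have h: "graded_hom R ?F A (lin_comb R A y)" by (rule hm_lin_comb[OF A]) (simp add: y)
  have x': "x \<in> carrier ?K" using x by simp
  from graded_module_restrict[OF A K] x' show ?thesis
  proof (induction rule: graded_induct)
    case zero
    then show ?case using hm_zero[OF F A h] gm_zero[OF F] by (intro bexI[of _ "\<zero>\<^bsub>?F\<^esub>"]) simp_all
  next
    case (add x z)
    then obtain f g where fg: "f \<in> carrier ?F" "g \<in> carrier ?F" "lin_comb R A y f = x" "lin_comb R A y g = z" by blast
    then show ?case using hm_add[OF h fg(1,2)] gm_add[OF F fg(1,2)] by (intro bexI[of _ "f \<oplus>\<^bsub>?F\<^esub> g"]) simp_all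
  next
    case (hom n x)
    then have xx: "x \<in> K" "x \<in> mgr A n" by auto
    show ?case
    proof (cases "x = \<zero>\<^bsub>A\<^esub>")
      case True
      then show ?thesis using hm_zero[OF F A h] gm_zero[OF F] by (intro bexI[of _ "\<zero>\<^bsub>?F\<^esub>"]) simp_all
    next
      case False
      then obtain s where s: "s \<in> G" "y s = x" using sur xx by blast
      then have "lin_comb R A y (fdelta R s) = x" using lin_comb_delta[OF A s(1)] mgr_carrier[OF A xx(2)] by simp
      then show ?thesis using mgr_carrier[OF F fdelta_mgr[OF s(1)]] by blast
    qed
  qed
qed

lemma lin_comb_zero:
  assumes A: "graded_module R A" and f: "f \<in> carrier (free_gmod R G dg)"
    and y: "\<And>s. s \<in> G \<Longrightarrow> y s = \<zero>\<^bsub>A\<^esub>"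
  shows "lin_comb R A y f = \<zero>\<^bsub>A\<^esub>"
proof -
  have "lin_comb R A y f = lin_comb R A (\<lambda>_. \<zero>\<^bsub>A\<^esub>) f"
    by (rule lin_comb_cong[OF A f y]) (use A in auto)
  also have "\<dots> = (\<lambda>_. \<zero>\<^bsub>A\<^esub>) (lin_comb R A (\<lambda>_. \<zero>\<^bsub>A\<^esub>) f)"
    using lin_comb_hom[OF A A hm_const_zero[OF A] f, of "\<lambda>_. \<zero>\<^bsub>A\<^esub>"] A by simp
  finally show ?thesis .
qed

lemma lin_comb_free:
  assumes f: "f \<in> carrier (free_gmod R G dg)" and y: "\<And>s. s \<in> G \<Longrightarrow> y s \<in> carrier (free_gmod R G' dg')"
  shows "(\<lambda>t. \<Oplus>\<^bsub>R\<^esub>s\<in>{s. f s \<noteq> \<zero>\<^bsub>R\<^esub>}. f s \<otimes>\<^bsub>R\<^esub> y s t) = lin_comb R (free_gmod R G' dg') y f"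
proof
  fix t
  let ?F = "free_gmod R G' dg'"
  have c: "f s \<odot>\<^bsub>?F\<^esub> y s \<in> carrier ?F" if "s \<in> {s. f s \<noteq> \<zero>\<^bsub>R\<^esub>}" for s
    using free_carrier[OF f] that y graded_module_free by (intro gm_smult) auto
  show "(\<Oplus>\<^bsub>R\<^esub>s\<in>{s. f s \<noteq> \<zero>\<^bsub>R\<^esub>}. f s \<otimes>\<^bsub>R\<^esub> y s t) = lin_comb R ?F y f t"
    unfolding lin_comb_def
    by (subst free_finsum[OF c]) (simp_all add: free_gmod_simps(4))
qed

lemma free_empty: "f \<in> carrier (free_gmod R {} dg) \<Longrightarrow> f = (\<lambda>s. \<zero>\<^bsub>R\<^esub>)"
  using free_carrier(2)[of f "{}" dg] by auto

lemma zero_free_empty: "zero_module (free_gmod R {} dg)"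
  using free_empty gm_zero[OF graded_module_free[of "{}" dg]]
  unfolding zero_module_def free_gmod_simps(2) by blast

abbreviation rfree :: "('a, 'm) gmod \<Rightarrow> nat \<Rightarrow> ('a, ('a, 'm) gen \<Rightarrow> 'a) gmod" where
  "rfree M n \<equiv> free_gmod R (res_gens R M n) gen_deg"

context
  fixes M :: "('a, 'm) gmod"
  assumes M: "graded_module R M"
begin

lemma res_gens_0: "s \<in> res_gens R M 0 \<Longrightarrow> elt_val s \<in> mgr M (gen_deg s)"
  by auto

lemma res_gens_Suc:
  assumes "s \<in> res_gens R M (Suc n)"
  shows "syz_val R s \<in> mgr (rfree M n) (gen_deg s)"
    "n = 0 \<Longrightarrow> res_aug R M (syz_val R s) = \<zero>\<^bsub>M\<^esub>"
    "n \<noteq> 0 \<Longrightarrow> res_diff R (syz_val R s) = (\<lambda>t. \<zero>\<^bsub>R\<^esub>)"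
proof -
  obtain d f where f: "s = Syz d (encode R f)" "f \<in> mgr (rfree M n) d"
    "if n = 0 then res_aug R M f = \<zero>\<^bsub>M\<^esub> else res_diff R f = (\<lambda>s. \<zero>\<^bsub>R\<^esub>)"
    using assms by auto
  have "decode R (encode R f) = f"
    by (rule decode_encode[OF free_carrier(3)[OF mgr_carrier[OF graded_module_free f(2)]]])
  then show "syz_val R s \<in> mgr (rfree M n) (gen_deg s)"
    "n = 0 \<Longrightarrow> res_aug R M (syz_val R s) = \<zero>\<^bsub>M\<^esub>"
    "n \<noteq> 0 \<Longrightarrow> res_diff R (syz_val R s) = (\<lambda>t. \<zero>\<^bsub>R\<^esub>)"
    using f by auto
qed

lemma res_gens_SucI:
  assumes "f \<in> mgr (rfree M n) d" "f \<noteq> (\<lambda>s. \<zero>\<^bsub>R\<^esub>)"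
    "if n = 0 then res_aug R M f = \<zero>\<^bsub>M\<^esub> else res_diff R f = (\<lambda>s. \<zero>\<^bsub>R\<^esub>)"
  shows "\<exists>s\<in>res_gens R M (Suc n). syz_val R s = f"
proof
  show "Syz d (encode R f) \<in> res_gens R M (Suc n)" using assms by auto
  show "syz_val R (Syz d (encode R f)) = f"
    using decode_encode[OF free_carrier(3)[OF mgr_carrier[OF graded_module_free assms(1)]]] by simp
qed

lemma hm_res_aug: "graded_hom R (rfree M 0) M (res_aug R M)"
proof -
  have "res_aug R M = lin_comb R M elt_val" by (intro ext) (simp add: res_aug_def lin_comb_def)
  moreover have "graded_hom R (rfree M 0) M (lin_comb R M elt_val)"
    by (rule hm_lin_comb[OF M]) (metis res_gens_0 add.right_neutral)
  ultimately show ?thesis by simp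
qed

lemma res_diff_lin_comb:
  "f \<in> carrier (rfree M (Suc n)) \<Longrightarrow> res_diff R f = lin_comb R (rfree M n) (syz_val R) f"
  unfolding res_diff_def
  by (rule lin_comb_free) (use res_gens_Suc(1) mgr_carrier[OF graded_module_free] in blast)+

lemma hm_res_diff: "graded_hom R (rfree M (Suc n)) (rfree M n) (res_diff R)"
proof (rule hm_cong[OF graded_module_free _ res_diff_lin_comb])
  show "graded_hom R (rfree M (Suc n)) (rfree M n) (lin_comb R (rfree M n) (syz_val R))"
    by (rule hm_lin_comb[OF graded_module_free]) (metis res_gens_Suc(1) add.right_neutral)
qed

lemma syz_val_carrier: "s \<in> res_gens R M (Suc n) \<Longrightarrow> syz_val R s \<in> carrier (rfree M n)"
  using res_gens_Suc(1) mgr_carrier[OF graded_module_free] by blast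

lemma res_aug_diff: 
  assumes f: "f \<in> carrier (rfree M 1)"
  shows "res_aug R M (res_diff R f) = \<zero>\<^bsub>M\<^esub>"
proof -
  have f': "f \<in> carrier (rfree M (Suc 0))" using f by (simp only: One_nat_def)
  have "res_aug R M (res_diff R f) = lin_comb R M (\<lambda>s. res_aug R M (syz_val R s)) f"
    unfolding res_diff_lin_comb[OF f']
    by (rule lin_comb_hom[OF graded_module_free M hm_res_aug f' syz_val_carrier])
  also have "\<dots> = \<zero>\<^bsub>M\<^esub>" by (rule lin_comb_zero[OF M f']) (rule res_gens_Suc(2)[OF _ refl])
  finally show ?thesis .
qed

lemma res_diff_diff: 
  assumes f: "f \<in> carrier (rfree M (Suc (Suc n)))"
  shows "res_diff R (res_diff R f) = (\<lambda>s. \<zero>\<^bsub>R\<^esub>)"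
proof -
  have "res_diff R (res_diff R f) = lin_comb R (rfree M n) (\<lambda>s. res_diff R (syz_val R s)) f"
    unfolding res_diff_lin_comb[OF f]
    by (rule lin_comb_hom[OF graded_module_free graded_module_free hm_res_diff f syz_val_carrier])
  also have "\<dots> = \<zero>\<^bsub>rfree M n\<^esub>"
    by (rule lin_comb_zero[OF graded_module_free f]) (simp only: free_gmod_simps(2), rule res_gens_Suc(3), assumption, simp)
  finally show ?thesis by (simp add: free_gmod_simps(2))
qed

lemma res_aug_surj: "x \<in> carrier M \<Longrightarrow> \<exists>f\<in>carrier (rfree M 0). res_aug R M f = x"
proof -
  assume x: "x \<in> carrier M"
  have "\<exists>f\<in>carrier (rfree M 0). lin_comb R M elt_val f = x"
  proof (rule lin_comb_onto[OF M hsub_whole[OF M] res_gens_0 _ x])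
    fix n x assume "x \<in> mgr M n" "x \<noteq> \<zero>\<^bsub>M\<^esub>"
    then show "\<exists>s\<in>res_gens R M 0. elt_val s = x" by (intro bexI[of _ "Elt n x"]) auto
  qed
  then show ?thesis by (simp only: res_aug_def lin_comb_def)
qed

lemma res_exact:
  assumes f: "f \<in> carrier (rfree M n)"
    and z: "if n = 0 then res_aug R M f = \<zero>\<^bsub>M\<^esub> else res_diff R f = (\<lambda>s. \<zero>\<^bsub>R\<^esub>)"
  shows "\<exists>g\<in>carrier (rfree M (Suc n)). res_diff R g = f"
proof -
  \<comment> \<open>For \<open>n = 0\<close> the kernel of the augmentation, otherwise that of the
    differential; its nonzero homogeneous elements are the ones named by the generators of the next
    term.\<close>
  let ?K = "{f \<in> carrier (rfree M n). if n = 0 then res_aug R M f = \<zero>\<^bsub>M\<^esub> else res_diff R f = (\<lambda>s. \<zero>\<^bsub>R\<^esub>)}"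
  have K: "hsub (rfree M n) ?K"
  proof (cases n)
    case 0
    then show ?thesis using hsub_kernel[OF graded_module_free M hm_res_aug] by simp
  next
    case (Suc m)
    then show ?thesis
      using hsub_kernel[OF graded_module_free graded_module_free hm_res_diff, of m] by (simp add: free_gmod_simps(2))
  qed
  have "\<exists>g\<in>carrier (rfree M (Suc n)). lin_comb R (rfree M n) (syz_val R) g = f"
  proof (rule lin_comb_onto[OF graded_module_free K res_gens_Suc(1)])
    show "f \<in> ?K" using f z by blast
    fix d x assume "x \<in> ?K" "x \<in> mgr (rfree M n) d" "x \<noteq> \<zero>\<^bsub>rfree M n\<^esub>"
    then show "\<exists>s\<in>res_gens R M (Suc n). syz_val R s = x"
      by (intro res_gens_SucI[of _ _ d]) (auto simp: free_gmod_simps(2))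
  qed
  then show ?thesis using res_diff_lin_comb by auto
qed

lemma obj_resolution: "obj (resolution R M) (int n) = rfree M n"
  and obj_resolution_neg: "j < 0 \<Longrightarrow> obj (resolution R M) j = free_gmod R {} gen_deg"
  and diff_resolution: "diff (resolution R M) (int (Suc n)) = res_diff R"
  and diff_resolution_le: "j \<le> 0 \<Longrightarrow> diff (resolution R M) j = (\<lambda>f s. \<zero>\<^bsub>R\<^esub>)"
  by (simp_all add: resolution_def)

lemma graded_complex_resolution: "graded_complex R (resolution R M)"
proof (rule graded_complexI)
  fix j
  show "graded_module R (obj (resolution R M) j)" by (simp add: resolution_def graded_module_free)
  show "graded_hom R (obj (resolution R M) j) (obj (resolution R M) (j - 1)) (diff (resolution R M) j)"
  proof (cases "j \<le> 0")
    case True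
    have "graded_hom R (obj (resolution R M) j) (free_gmod R {} gen_deg) (\<lambda>f s. \<zero>\<^bsub>R\<^esub>)"
      using hm_const_zero[OF graded_module_free[of "{}" gen_deg], of "obj (resolution R M) j" 0] by (simp add: free_gmod_simps(2))
    then show ?thesis using True obj_resolution_neg[of "j - 1"] diff_resolution_le by simp
  next
    case False
    then obtain n where "j = int (Suc n)" by (metis nat_eq_iff not_le nat_neq_iff Suc_pred' zero_less_nat_eq int_nat_eq not_le_imp_less less_imp_le)
    then show ?thesis using hm_res_diff[of n] obj_resolution[of n] obj_resolution[of "Suc n"] diff_resolution[of n] by simp
  qed
  fix x assume x: "x \<in> carrier (obj (resolution R M) j)"
  show "diff (resolution R M) (j - 1) (diff (resolution R M) j x) = \<zero>\<^bsub>obj (resolution R M) (j - 2)\<^esub>"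
  proof (cases "j \<le> 1")
    case True
    then show ?thesis by (simp add: diff_resolution_le) (simp add: resolution_def free_gmod_simps(2))
  next
    case False
    define n where "n = nat (j - 2)"
    then have j: "j = int (Suc (Suc n))" using False by simp
    then have x': "x \<in> carrier (rfree M (Suc (Suc n)))" using x obj_resolution by metis
    have "diff (resolution R M) (j - 1) = res_diff R" "diff (resolution R M) j = res_diff R"
      using diff_resolution[of n] diff_resolution[of "Suc n"] by (simp_all add: j)
    then show ?thesis using res_diff_diff[OF x'] by (simp add: resolution_def free_gmod_simps(2))
  qed
qed

lemma projective_resolution: "projective_cpx TYPE(('a, 'm) gen) R (resolution R M)"
proof -
  have "zero_module (obj (resolution R M) j)" if "j < 0" for j
    by (simp add: obj_resolution_neg[OF that] zero_free_empty)
  moreover have "projective TYPE(('a, 'm) gen) R (obj (resolution R M) j)" for j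
    by (simp add: resolution_def projective_free)
  ultimately show ?thesis
    using graded_complex_resolution unfolding projective_cpx_def nonneg_def by blast
qed

text \<open>The fibration property packs all of exactness: \<open>j = 0\<close> is surjectivity of
  the augmentation, \<open>j = 1\<close> is exactness at the term of degree 0, and larger
  \<open>j\<close> give exactness at the later terms.\<close>

lemma fib_resolution: "acyclic_fib R (resolution R M) (conc M) (conc_map M (res_aug R M))"
  unfolding acyclic_fib_def
proof (intro conjI allI impI)
  let ?F = "resolution R M"
  have o0: "obj ?F 0 = rfree M 0" using obj_resolution[of 0] by simp
  have o1: "obj ?F 1 = rfree M 1" using obj_resolution[of 1] by simp
  have d1: "diff ?F 1 = res_diff R" using diff_resolution[of 0] by simp
  show "chain_map R ?F (conc M) (conc_map M (res_aug R M))"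
    by (rule chain_map_conc[OF graded_complex_resolution M])
      (use hm_res_aug res_aug_diff in \<open>simp_all only: o0 o1 d1\<close>)
  fix j z c
  assume a: "z \<in> carrier (obj ?F (j - 1)) \<and> c \<in> carrier (obj (conc M) j) \<and>
    diff ?F (j - 1) z = \<zero>\<^bsub>obj ?F (j - 2)\<^esub> \<and> conc_map M (res_aug R M) (j - 1) z = diff (conc M) j c"
  consider (neg) "j < 0" | (zero) "j = 0" | (pos) n where "j = int (Suc n)"
    by (metis not_less_iff_gr_or_eq zero_less_imp_eq_int gr0_implies_Suc)
  then show "\<exists>y\<in>carrier (obj ?F j). diff ?F j y = z \<and> conc_map M (res_aug R M) j y = c"
  proof cases
    case neg
    then have "z = (\<lambda>s. \<zero>\<^bsub>R\<^esub>)" "c = \<zero>\<^bsub>M\<^esub>" using a obj_resolution_neg[of "j - 1"] free_empty[of z gen_deg] by simp_all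
    then show ?thesis
      using neg gm_zero[OF graded_module_free[of "{}" gen_deg]]
      by (intro bexI[of _ "\<lambda>s. \<zero>\<^bsub>R\<^esub>"]) (simp_all add: obj_resolution_neg diff_resolution_le free_gmod_simps(2))
  next
    case zero
    then have "z = (\<lambda>s. \<zero>\<^bsub>R\<^esub>)" "c \<in> carrier M" using a obj_resolution_neg[of "j - 1"] free_empty[of z gen_deg] by simp_all
    then show ?thesis using res_aug_surj zero by (simp add: o0 diff_resolution_le)
  next
    case pos
    have c: "c = \<zero>\<^bsub>M\<^esub>" using a pos by simp
    have z: "z \<in> carrier (rfree M n)" using a pos obj_resolution[of n] by simp
    have "if n = 0 then res_aug R M z = \<zero>\<^bsub>M\<^esub> else res_diff R z = (\<lambda>s. \<zero>\<^bsub>R\<^esub>)"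
    proof (cases n)
      case 0
      then show ?thesis using a pos by simp
    next
      case (Suc m)
      then have "j - 1 = int (Suc m)" using pos by simp
      then show ?thesis using a Suc diff_resolution[of m] by (simp add: resolution_def free_gmod_simps(2))
    qed
    from res_exact[OF z this] show ?thesis
      using c obj_resolution[of "Suc n"] diff_resolution[of n] pos by auto
  qed
qed

end

end

section \<open>Free replacement of a complex\<close>

text \<open>The generator \<open>PG d c s\<close> in degree \<open>j\<close> stands for a pair of homogeneous elements of degree \<open>d\<close>:
  the cycle listed by \<open>s\<close> in degree \<open>j - 1\<close> of the replacement and \<open>c\<close> in degree \<open>j\<close> of the complex, with
  the same image.\<close>

datatype ('a, 'c) pgen = PG int 'c "(('a, 'c) pgen \<times> 'a) fset"

primrec pdeg :: "('a, 'c) pgen \<Rightarrow> int" where "pdeg (PG d c s) = d"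
primrec pel :: "('a, 'c) pgen \<Rightarrow> 'c" where "pel (PG d c s) = c"
primrec psyz :: "'a gring \<Rightarrow> ('a, 'c) pgen \<Rightarrow> (('a, 'c) pgen \<Rightarrow> 'a)" where "psyz R (PG d c s) = decode R s"

definition pdiff :: "'a gring \<Rightarrow> (('a, 'c) pgen \<Rightarrow> 'a) \<Rightarrow> (('a, 'c) pgen \<Rightarrow> 'a)" where
  "pdiff R f = (\<lambda>t. \<Oplus>\<^bsub>R\<^esub>s\<in>{s. f s \<noteq> \<zero>\<^bsub>R\<^esub>}. f s \<otimes>\<^bsub>R\<^esub> psyz R s t)"

text \<open>\<open>pgens R C n\<close> is the basis in degree \<open>n - 1\<close>.\<close>

primrec pgens :: "'a gring \<Rightarrow> ('a, 'c) cpx \<Rightarrow> nat \<Rightarrow> ('a, 'c) pgen set" where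
  "pgens R C 0 = {}"
| "pgens R C (Suc n) = {PG d c (encode R z) | d c z.
     z \<in> mgr (free_gmod R (pgens R C n) pdeg) d \<and> c \<in> mgr (obj C (int n)) d \<and>
     pdiff R z = (\<lambda>s. \<zero>\<^bsub>R\<^esub>) \<and> lin_comb R (obj C (int n - 1)) pel z = diff C (int n) c}"

text \<open>For negative \<open>j\<close> the index \<open>nat (j + 1)\<close> is 0 and the basis is
  empty, so the complex starts in degree 0.\<close>

definition repl :: "'a gring \<Rightarrow> ('a, 'c) cpx \<Rightarrow> ('a, ('a, 'c) pgen \<Rightarrow> 'a) cpx" where
  "repl R C = \<lparr>obj = (\<lambda>j. free_gmod R (pgens R C (nat (j + 1))) pdeg), diff = (\<lambda>j. pdiff R)\<rparr>"

definition repl_map :: "'a gring \<Rightarrow> ('a, 'c) cpx \<Rightarrow> int \<Rightarrow> (('a, 'c) pgen \<Rightarrow> 'a) \<Rightarrow> 'c" where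
  "repl_map R C j = lin_comb R (obj C j) pel"

context graded_base
begin

context
  fixes C :: "('a, 'c) cpx"
  assumes C: "graded_complex R C" and nn: "nonneg C"
begin

abbreviation pfree :: "int \<Rightarrow> ('a, ('a, 'c) pgen \<Rightarrow> 'a) gmod" where
  "pfree j \<equiv> free_gmod R (pgens R C (nat (j + 1))) pdeg"

lemma obj_repl: "obj (repl R C) j = pfree j" and diff_repl: "diff (repl R C) j = pdiff R"
  by (simp_all add: repl_def)

lemma pgens_nonempty: "s \<in> pgens R C (nat (j + 1)) \<Longrightarrow> 0 \<le> j"
  by (cases "0 \<le> j") simp_all

lemma
  assumes "s \<in> pgens R C (nat (j + 1))"
  shows psyz_mgr: "psyz R s \<in> mgr (pfree (j - 1)) (pdeg s)"
    and pel_mgr: "pel s \<in> mgr (obj C j) (pdeg s)"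
    and pdiff_psyz: "pdiff R (psyz R s) = (\<lambda>t. \<zero>\<^bsub>R\<^esub>)"
    and repl_map_psyz: "repl_map R C (j - 1) (psyz R s) = diff C j (pel s)"
proof -
  have j: "0 \<le> j" by (rule pgens_nonempty[OF assms])
  then have n: "nat (j + 1) = Suc (nat j)" "int (nat j) = j" by auto
  obtain d c z where z: "s = PG d c (encode R z)" "z \<in> mgr (free_gmod R (pgens R C (nat j)) pdeg) d"
    "c \<in> mgr (obj C j) d" "pdiff R z = (\<lambda>s. \<zero>\<^bsub>R\<^esub>)" "lin_comb R (obj C (j - 1)) pel z = diff C j c"
    using assms j by (auto simp: n)
  have "decode R (encode R z) = z"
    by (rule decode_encode[OF free_carrier(3)[OF mgr_carrier[OF graded_module_free z(2)]]])
  then show "psyz R s \<in> mgr (pfree (j - 1)) (pdeg s)" "pel s \<in> mgr (obj C j) (pdeg s)"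
    "pdiff R (psyz R s) = (\<lambda>t. \<zero>\<^bsub>R\<^esub>)" "repl_map R C (j - 1) (psyz R s) = diff C j (pel s)"
    using z by (simp_all add: repl_map_def)
qed

lemma pgensI:
  assumes "0 \<le> j" "z \<in> mgr (pfree (j - 1)) d" "c \<in> mgr (obj C j) d"
    "pdiff R z = (\<lambda>s. \<zero>\<^bsub>R\<^esub>)" "repl_map R C (j - 1) z = diff C j c"
  shows "\<exists>s\<in>pgens R C (nat (j + 1)). psyz R s = z \<and> pel s = c"
proof
  have n: "nat (j + 1) = Suc (nat j)" "int (nat j) = j" using assms(1) by auto
  show "PG d c (encode R z) \<in> pgens R C (nat (j + 1))"
    using assms by (auto simp: n repl_map_def)
  show "psyz R (PG d c (encode R z)) = z \<and> pel (PG d c (encode R z)) = c"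
    using decode_encode[OF free_carrier(3)[OF mgr_carrier[OF graded_module_free assms(2)]]] by simp
qed

lemma psyz_carrier: "s \<in> pgens R C (nat (j + 1)) \<Longrightarrow> psyz R s \<in> carrier (pfree (j - 1))"
  using psyz_mgr mgr_carrier[OF graded_module_free] by blast

lemma pel_carrier: "s \<in> pgens R C (nat (j + 1)) \<Longrightarrow> pel s \<in> carrier (obj C j)"
  using pel_mgr mgr_carrier[OF gc_module[OF C]] by blast

lemma pdiff_lin_comb: "f \<in> carrier (pfree j) \<Longrightarrow> pdiff R f = lin_comb R (pfree (j - 1)) (psyz R) f"
  unfolding pdiff_def by (rule lin_comb_free[OF _ psyz_carrier])

lemma hm_pdiff: "graded_hom R (pfree j) (pfree (j - 1)) (pdiff R)"
proof (rule hm_cong[OF graded_module_free _ pdiff_lin_comb])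
  show "graded_hom R (pfree j) (pfree (j - 1)) (lin_comb R (pfree (j - 1)) (psyz R))"
    by (rule hm_lin_comb[OF graded_module_free]) (metis psyz_mgr add.right_neutral)
qed

lemma hm_repl_map: "graded_hom R (pfree j) (obj C j) (repl_map R C j)"
  unfolding repl_map_def
  by (rule hm_lin_comb[OF gc_module[OF C]]) (metis pel_mgr add.right_neutral)

lemma pdiff_pdiff:
  assumes f: "f \<in> carrier (pfree j)"
  shows "pdiff R (pdiff R f) = \<zero>\<^bsub>pfree (j - 2)\<^esub>"
proof -
  have h: "graded_hom R (pfree (j - 1)) (pfree (j - 2)) (pdiff R)" using hm_pdiff[of "j - 1"] by simp
  have "pdiff R (pdiff R f) = lin_comb R (pfree (j - 2)) (\<lambda>s. pdiff R (psyz R s)) f"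
    unfolding pdiff_lin_comb[OF f]
    by (rule lin_comb_hom[OF graded_module_free graded_module_free h f psyz_carrier])
  also have "\<dots> = \<zero>\<^bsub>pfree (j - 2)\<^esub>"
    by (rule lin_comb_zero[OF graded_module_free f]) (simp add: pdiff_psyz free_gmod_simps(2))
  finally show ?thesis .
qed

lemma graded_complex_repl: "graded_complex R (repl R C)"
proof (rule graded_complexI; unfold obj_repl diff_repl)
  show "graded_hom R (pfree j) (pfree (j - 1)) (pdiff R)" for j by (rule hm_pdiff)
qed (rule graded_module_free pdiff_pdiff; assumption)+

lemma projective_repl: "projective_cpx TYPE(('a, 'c) pgen) R (repl R C)"
proof -
  have "zero_module (obj (repl R C) j)" if "j < 0" for j
    using that by (simp add: obj_repl zero_free_empty)
  moreover have "projective TYPE(('a, 'c) pgen) R (obj (repl R C) j)" for j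
    unfolding obj_repl by (rule projective_free)
  ultimately show ?thesis
    using graded_complex_repl unfolding projective_cpx_def nonneg_def by blast
qed

lemma chain_map_repl: "chain_map R (repl R C) C (repl_map R C)"
proof (rule chain_mapI; unfold obj_repl diff_repl)
  fix j
  show "graded_hom R (pfree j) (obj C j) (repl_map R C j)" by (rule hm_repl_map)
  fix f assume f: "f \<in> carrier (pfree j)"
  have "repl_map R C (j - 1) (pdiff R f) = lin_comb R (obj C (j - 1)) (\<lambda>s. repl_map R C (j - 1) (psyz R s)) f"
    unfolding pdiff_lin_comb[OF f]
    by (rule lin_comb_hom[OF graded_module_free gc_module[OF C] hm_repl_map f psyz_carrier])
  also have "\<dots> = lin_comb R (obj C (j - 1)) (\<lambda>s. diff C j (pel s)) f"
    by (rule lin_comb_cong[OF gc_module[OF C] f]) (use repl_map_psyz hm_closed[OF gc_diff[OF C] pel_carrier] in auto)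
  also have "\<dots> = diff C j (repl_map R C j f)"
    unfolding repl_map_def
    by (rule lin_comb_hom[OF gc_module[OF C] gc_module[OF C] gc_diff[OF C] f pel_carrier, symmetric])
  finally show "repl_map R C (j - 1) (pdiff R f) = diff C j (repl_map R C j f)" .
qed

text \<open>The generators of degree \<open>j\<close> name the homogeneous elements of the fibre
  product of cycles and \<open>obj C j\<close>, so \<open>lin_comb_onto\<close> shows that the map
  onto this fibre product is surjective.\<close>

lemma fib_repl: "acyclic_fib R (repl R C) C (repl_map R C)"
  unfolding acyclic_fib_def
proof (intro conjI allI impI chain_map_repl)
  fix j z c
  assume a: "z \<in> carrier (obj (repl R C) (j - 1)) \<and> c \<in> carrier (obj C j) \<and>
    diff (repl R C) (j - 1) z = \<zero>\<^bsub>obj (repl R C) (j - 2)\<^esub> \<and> repl_map R C (j - 1) z = diff C j c"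
  then have z: "z \<in> carrier (pfree (j - 1))" "pdiff R z = (\<lambda>s. \<zero>\<^bsub>R\<^esub>)" "c \<in> carrier (obj C j)"
    "repl_map R C (j - 1) z = diff C j c"
    by (simp_all add: obj_repl diff_repl free_gmod_simps(2))
  show "\<exists>y\<in>carrier (obj (repl R C) j). diff (repl R C) j y = z \<and> repl_map R C j y = c"
  proof (cases "0 \<le> j")
    case False
    have "z = (\<lambda>s. \<zero>\<^bsub>R\<^esub>)" "c = \<zero>\<^bsub>obj C j\<^esub>"
      using False z free_empty[of z pdeg] nonnegD[OF nn, of j c] by simp_all
    moreover have "pdiff R (\<zero>\<^bsub>pfree j\<^esub>) = (\<lambda>s. \<zero>\<^bsub>R\<^esub>)"
      using hm_zero[OF graded_module_free graded_module_free hm_pdiff] by (simp add: free_gmod_simps(2))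
    moreover have "repl_map R C j (\<zero>\<^bsub>pfree j\<^esub>) = \<zero>\<^bsub>obj C j\<^esub>"
      by (rule hm_zero[OF graded_module_free gc_module[OF C] hm_repl_map])
    ultimately show ?thesis
      using gm_zero[OF graded_module_free] unfolding obj_repl diff_repl by (intro bexI[of _ "\<zero>\<^bsub>pfree j\<^esub>"]) auto
  next
    case True
    let ?A = "gprod (pfree (j - 1)) (obj C j)" and ?B = "gprod (pfree (j - 2)) (obj C (j - 1))"
    have A: "graded_module R ?A" and B: "graded_module R ?B"
      by (rule graded_module_gprod[OF graded_module_free gc_module[OF C]])+
    have h: "graded_hom R (pfree (j - 1)) (pfree (j - 2)) (pdiff R)" using hm_pdiff[of "j - 1"] by simp
    \<comment> \<open>Its kernel is the fibre product: the first coordinate tests for a cycle, the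
      second for equality of the images in \<open>obj C (j - 1)\<close>.\<close>
    let ?e = "\<lambda>w. (pdiff R (fst w), repl_map R C (j - 1) (fst w) \<oplus>\<^bsub>obj C (j - 1)\<^esub> \<ominus>\<^bsub>obj C (j - 1)\<^esub> diff C j (snd w))"
    have e: "graded_hom R ?A ?B ?e"
      by (rule hm_pair[OF hm_compose_gh[OF hm_fst h] hm_plus[OF gc_module[OF C] hm_compose_gh[OF hm_fst hm_repl_map]
          hm_uminus[OF gc_module[OF C] hm_compose_gh[OF hm_snd gc_diff[OF C]]]]])
    let ?K = "{w \<in> carrier ?A. ?e w = \<zero>\<^bsub>?B\<^esub>}"
    have K: "hsub ?A ?K" by (rule hsub_kernel[OF A B e])
    let ?y = "\<lambda>s. (psyz R s, pel s)"
    have y: "?y s \<in> mgr ?A (pdeg s)" if "s \<in> pgens R C (nat (j + 1))" for s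
      using psyz_mgr[OF that] pel_mgr[OF that] by simp
    have cl: "repl_map R C (j - 1) u \<in> carrier (obj C (j - 1))" "diff C j d \<in> carrier (obj C (j - 1))"
      if "u \<in> carrier (pfree (j - 1))" "d \<in> carrier (obj C j)" for u d
      using hm_closed[OF hm_repl_map that(1)] hm_closed[OF gc_diff[OF C] that(2)] by auto
    have "\<exists>f\<in>carrier (pfree j). lin_comb R ?A ?y f = (z, c)"
    proof (rule lin_comb_onto[OF A K y])
      show "(z, c) \<in> ?K" using z cl[OF z(1,3)] gc_module[OF C] by (simp add: free_gmod_simps(2))
      fix n w assume w: "w \<in> ?K" "w \<in> mgr ?A n"
      then have w1: "fst w \<in> mgr (pfree (j - 1)) n" "snd w \<in> mgr (obj C j) n" "pdiff R (fst w) = (\<lambda>s. \<zero>\<^bsub>R\<^esub>)"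
        and w2: "fst w \<in> carrier (pfree (j - 1))" "snd w \<in> carrier (obj C j)"
        by (auto simp: free_gmod_simps(2))
      have "repl_map R C (j - 1) (fst w) = diff C j (snd w)"
        using w cl[OF w2] gm_eq_diff[OF gc_module[OF C]] by simp
      from pgensI[OF True w1 this] show "\<exists>s\<in>pgens R C (nat (j + 1)). ?y s = w"
        by (metis prod.collapse)
    qed
    then obtain f where f: "f \<in> carrier (pfree j)" "lin_comb R ?A ?y f = (z, c)" by blast
    have yc: "?y s \<in> carrier ?A" if "s \<in> pgens R C (nat (j + 1))" for s
      using psyz_carrier[OF that] pel_carrier[OF that] by simp
    have "pdiff R f = z"
      using lin_comb_hom[OF A graded_module_free hm_fst f(1), of ?y, OF yc] f(2) by (simp add: pdiff_lin_comb[OF f(1)])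
    moreover have "repl_map R C j f = c"
      using lin_comb_hom[OF A gc_module[OF C] hm_snd f(1), of ?y, OF yc] f(2) by (simp add: repl_map_def)
    ultimately show ?thesis using f(1) by (auto simp: obj_repl diff_repl)
  qed
qed

end

end


section \<open>Vanishing of Ext in short exact sequences\<close>

context graded_base
begin

abbreviation ext_vanishes :: "('a, 'm) gmod \<Rightarrow> ('a, 'n) gmod \<Rightarrow> int \<Rightarrow> bool" where
  "ext_vanishes M N k \<equiv> coh_vanishes R (resolution R M) N k"

lemma vanishes_zero_obj:
  assumes X: "graded_complex R X" and N: "graded_module R N" and z: "zero_module (obj X k)"
  shows "coh_vanishes R X N k"
proof (rule coh_vanishesI)
  fix n u assume u: "homogeneous_map R (obj X k) N n u"
  have "u x = \<zero>\<^bsub>N\<^esub>" if "x \<in> carrier (obj X k)" for x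
    using that z hm_zero[OF gc_module[OF X] N u] by (simp add: zero_module_def)
  then show "\<exists>v. homogeneous_map R (obj X (k - 1)) N n v \<and> (\<forall>x\<in>carrier (obj X k). u x = v (diff X k x))"
    using hm_const_zero[OF N, of "obj X (k - 1)" n] by (intro exI[of _ "\<lambda>_. \<zero>\<^bsub>N\<^esub>"]) simp
qed

lemma vanishes_neg: "graded_complex R X \<Longrightarrow> nonneg X \<Longrightarrow> graded_module R N \<Longrightarrow> k < 0 \<Longrightarrow> coh_vanishes R X N k"
  using vanishes_zero_obj[of X N k] by (simp add: nonneg_def)

text \<open>A fibration over \<open>conc A\<close> is an exact complex augmented over
  \<open>A\<close>; these four rules and the converse \<open>fib_concI\<close> pass between the two
  descriptions.\<close>

lemma
  assumes X: "graded_complex R X" and A: "graded_module R A" and p: "acyclic_fib R X (conc A) (conc_map A e)"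
  shows fib_conc_hom: "graded_hom R (obj X 0) A e"
    and fib_conc_diff: "x \<in> carrier (obj X 1) \<Longrightarrow> e (diff X 1 x) = \<zero>\<^bsub>A\<^esub>"
    and fib_conc_surj: "a \<in> carrier A \<Longrightarrow> \<exists>x\<in>carrier (obj X 0). e x = a"
    and fib_conc_exact: "y \<in> carrier (obj X j) \<Longrightarrow> diff X j y = \<zero>\<^bsub>obj X (j - 1)\<^esub> \<Longrightarrow>
      (j = 0 \<Longrightarrow> e y = \<zero>\<^bsub>A\<^esub>) \<Longrightarrow> \<exists>w\<in>carrier (obj X (j + 1)). diff X (j + 1) w = y"
proof -
  note c = fib_chain_map[OF p]
  show e: "graded_hom R (obj X 0) A e"
    using cm_hom[OF c, of 0] by (simp add: conc_map_def[abs_def])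
  show "e (diff X 1 x) = \<zero>\<^bsub>A\<^esub>" if "x \<in> carrier (obj X 1)"
    using cm_diff[OF c that] by simp
  have "diff X (- 1) \<zero>\<^bsub>obj X (- 1)\<^esub> = \<zero>\<^bsub>obj X (- 2)\<^esub>"
    using hm_zero[OF gc_module[OF X] gc_module[OF X] gc_diff[OF X], of "- 1"] by simp
  then show "\<exists>x\<in>carrier (obj X 0). e x = a" if "a \<in> carrier A"
    using fibE[OF p, where z = "\<zero>\<^bsub>obj X (- 1)\<^esub>" and j = 0 and c = a] that gc_module[OF X, of "- 1"] by auto
  have z: "\<zero>\<^bsub>A\<^esub> \<in> carrier (obj (conc A) i)" for i using A by (cases "i = 0") auto
  show "\<exists>w\<in>carrier (obj X (j + 1)). diff X (j + 1) w = y"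
    if "y \<in> carrier (obj X j)" "diff X j y = \<zero>\<^bsub>obj X (j - 1)\<^esub>" "j = 0 \<Longrightarrow> e y = \<zero>\<^bsub>A\<^esub>"
  proof -
    have "conc_map A e j y = \<zero>\<^bsub>A\<^esub>" using that(3) by (cases "j = 0") simp_all
    then show ?thesis
      using fibE[OF p, where z = y and j = "j + 1" and c = "\<zero>\<^bsub>A\<^esub>"] that(1,2) z[of "j + 1"] by auto
  qed
qed

lemma fib_concI:
  assumes X: "graded_complex R X" "nonneg X" and A: "graded_module R A"
    and e: "graded_hom R (obj X 0) A e"
    and ed: "\<And>x. x \<in> carrier (obj X 1) \<Longrightarrow> e (diff X 1 x) = \<zero>\<^bsub>A\<^esub>"
    and sur: "\<And>a. a \<in> carrier A \<Longrightarrow> \<exists>x\<in>carrier (obj X 0). e x = a"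
    and ex: "\<And>j y. 0 \<le> j \<Longrightarrow> y \<in> carrier (obj X j) \<Longrightarrow> diff X j y = \<zero>\<^bsub>obj X (j - 1)\<^esub> \<Longrightarrow>
      (j = 0 \<Longrightarrow> e y = \<zero>\<^bsub>A\<^esub>) \<Longrightarrow> \<exists>w\<in>carrier (obj X (j + 1)). diff X (j + 1) w = y"
  shows "acyclic_fib R X (conc A) (conc_map A e)"
  unfolding acyclic_fib_def
proof (intro conjI allI impI)
  show "chain_map R X (conc A) (conc_map A e)" by (rule chain_map_conc[OF X(1) A e ed])
  fix j z c assume a: "z \<in> carrier (obj X (j - 1)) \<and> c \<in> carrier (obj (conc A) j) \<and>
    diff X (j - 1) z = \<zero>\<^bsub>obj X (j - 2)\<^esub> \<and> conc_map A e (j - 1) z = diff (conc A) j c"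
  consider "j < 0" | "j = 0" | "0 < j" by linarith
  then show "\<exists>y\<in>carrier (obj X j). diff X j y = z \<and> conc_map A e j y = c"
  proof cases
    case 1
    then have "z = \<zero>\<^bsub>obj X (j - 1)\<^esub>" "c = \<zero>\<^bsub>A\<^esub>" using a nonnegD[OF X(2), of "j - 1" z] by auto
    then show ?thesis
      using 1 hm_zero[OF gc_module[OF X(1)] gc_module[OF X(1)] gc_diff[OF X(1)], of j] gc_module[OF X(1), of j]
      by (intro bexI[of _ "\<zero>\<^bsub>obj X j\<^esub>"]) simp_all
  next
    case 2
    then obtain x where x: "x \<in> carrier (obj X 0)" "e x = c" using a sur by auto
    \<comment> \<open>Both elements lie in the term of degree -1, which is zero, and are therefore
      equal.\<close>
    have "z \<in> carrier (obj X (- 1))" "diff X 0 x \<in> carrier (obj X (- 1))"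
      using a 2 hm_closed[OF gc_diff[OF X(1)] x(1)] by simp_all
    then have "diff X 0 x = z"
      using nonnegD[OF X(2), of "- 1" z] nonnegD[OF X(2), of "- 1" "diff X 0 x"] by simp
    then show ?thesis using x 2 by auto
  next
    case 3
    have "e z = \<zero>\<^bsub>A\<^esub>" if "j = 1" using a that by simp
    then show ?thesis using 3 ex[of "j - 1" z] a by auto
  qed
qed

lemma fib_conc_iso:
  assumes X: "graded_complex R X" "nonneg X" and A: "graded_module R A" and B: "graded_module R B"
    and p: "acyclic_fib R X (conc A) (conc_map A e)" and f: "graded_iso R A B f"
  shows "acyclic_fib R X (conc B) (conc_map B (\<lambda>x. f (e x)))"
proof -
  note pe = fib_conc_hom[OF X(1) A p]
  have fh: "graded_hom R A B f" and inj: "inj_on f (carrier A)" and sur: "f ` carrier A = carrier B"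
    using f by (auto simp: graded_iso_def bij_betw_def)
  note f0 = hm_zero[OF A B fh]
  show ?thesis
  proof (rule fib_concI[OF X B hm_compose_gh[OF pe fh]])
    show "f (e (diff X 1 x)) = \<zero>\<^bsub>B\<^esub>" if "x \<in> carrier (obj X 1)" for x
      using fib_conc_diff[OF X(1) A p that] f0 by simp
    show "\<exists>x\<in>carrier (obj X 0). f (e x) = b" if "b \<in> carrier B" for b
    proof -
      have "b \<in> f ` carrier A" unfolding sur by (rule that)
      then obtain a where a: "b = f a" "a \<in> carrier A" by (rule imageE)
      then show ?thesis using fib_conc_surj[OF X(1) A p a(2)] by auto
    qed
    fix j y assume y: "y \<in> carrier (obj X j)" "diff X j y = \<zero>\<^bsub>obj X (j - 1)\<^esub>" "j = 0 \<Longrightarrow> f (e y) = \<zero>\<^bsub>B\<^esub>"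
    have "e y = \<zero>\<^bsub>A\<^esub>" if "j = 0"
      using inj_onD[OF inj, of "e y" "\<zero>\<^bsub>A\<^esub>"] y f0 that hm_closed[OF pe, of y] A by simp
    then show "\<exists>w\<in>carrier (obj X (j + 1)). diff X (j + 1) w = y"
      by (rule fib_conc_exact[OF X(1) A p y(1,2)])
  qed
qed

text \<open>Composing the augmentation with \<open>f\<close> makes the resolution of
  \<open>A\<close> a resolution of \<open>B\<close>, and vanishing does not depend on the
  resolution.\<close>

lemma ext_iso:
  assumes A: "graded_module R A" and B: "graded_module R B" and N: "graded_module R N"
    and f: "graded_iso R A B f"
  shows "ext_vanishes A N k \<longleftrightarrow> ext_vanishes B N k"
proof -
  note PA = projective_resolution[OF A] and PB = projective_resolution[OF B]
  note fa = fib_conc_iso[OF projective_cpxD(1,2)[OF PA] A B fib_resolution[OF A] f]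
  show ?thesis
    using vanishes_transfer[OF PA PB graded_complex_conc[OF B] fa fib_resolution[OF B] N]
      vanishes_transfer[OF PB PA graded_complex_conc[OF B] fib_resolution[OF B] fa N] by blast
qed

lemma fib_conc_id:
  assumes A: "graded_module R A"
  shows "acyclic_fib R (conc A) (conc A) (conc_map A (\<lambda>x. x))"
proof (rule fib_concI[OF graded_complex_conc[OF A] nonneg_conc A])
  fix j y assume "y \<in> carrier (obj (conc A) j)" "j = 0 \<Longrightarrow> y = \<zero>\<^bsub>A\<^esub>"
  then have "y = \<zero>\<^bsub>A\<^esub>" by (cases "j = 0") auto
  then show "\<exists>w\<in>carrier (obj (conc A) (j + 1)). diff (conc A) (j + 1) w = y"
    using gm_zero[OF gc_module[OF graded_complex_conc[OF A]], of "j + 1"] by auto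
qed (auto simp: hm_id)

text \<open>\<open>conc A\<close> is then a projective resolution of \<open>A\<close>, and its terms
  outside degree 0 are zero; if \<open>A\<close> is zero, so is the term of degree 0.\<close>

lemma ext_projective:
  assumes A: "graded_module R A" and P: "projective TYPE('s) R A" and N: "graded_module R N"
    and k: "k \<noteq> 0 \<or> zero_module A"
  shows "ext_vanishes A N k"
proof -
  have "projective TYPE('s) R (obj (conc A) j)" for j
    using P projective_zero[OF graded_module_zero[OF A]]
    by (cases "j = 0") (simp_all add: zero_module_def)
  then have "projective_cpx TYPE('s) R (conc A)"
    using graded_complex_conc[OF A] nonneg_conc by (simp add: projective_cpx_def)
  moreover have "coh_vanishes R (conc A) N k"
    using k by (intro vanishes_zero_obj[OF graded_complex_conc[OF A] N]) (cases "k = 0"; auto simp: zero_module_def)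
  ultimately show ?thesis
    using vanishes_transfer[OF _ projective_resolution[OF A] graded_complex_conc[OF A] fib_conc_id[OF A] fib_resolution[OF A] N]
    by blast
qed

lemma ext_zero: "graded_module R A \<Longrightarrow> zero_module A \<Longrightarrow> graded_module R N \<Longrightarrow> ext_vanishes A N k"
  using ext_projective[OF _ projective_zero] by blast

section \<open>Fragments of the long exact Ext sequence\<close>

definition ses :: "('a, 'x) gmod \<Rightarrow> ('a, 'y) gmod \<Rightarrow> ('a, 'z) gmod \<Rightarrow> ('x \<Rightarrow> 'y) \<Rightarrow> ('y \<Rightarrow> 'z) \<Rightarrow> bool" where
  "ses A B C i q \<longleftrightarrow> graded_module R A \<and> graded_module R B \<and> graded_module R C \<and>
     graded_hom R A B i \<and> graded_hom R B C q \<and>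
     (\<forall>a\<in>carrier A. i a = \<zero>\<^bsub>B\<^esub> \<longrightarrow> a = \<zero>\<^bsub>A\<^esub>) \<and> (\<forall>a\<in>carrier A. q (i a) = \<zero>\<^bsub>C\<^esub>) \<and>
     (\<forall>b\<in>carrier B. q b = \<zero>\<^bsub>C\<^esub> \<longrightarrow> (\<exists>a\<in>carrier A. i a = b)) \<and> (\<forall>c\<in>carrier C. \<exists>b\<in>carrier B. q b = c)"

lemma
  assumes "ses A B C i q"
  shows sesD: "graded_module R A" "graded_module R B" "graded_module R C" "graded_hom R A B i" "graded_hom R B C q"
    and ses_inj: "a \<in> carrier A \<Longrightarrow> i a = \<zero>\<^bsub>B\<^esub> \<Longrightarrow> a = \<zero>\<^bsub>A\<^esub>"
    and ses_comp: "a \<in> carrier A \<Longrightarrow> q (i a) = \<zero>\<^bsub>C\<^esub>"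
    and ses_exact: "b \<in> carrier B \<Longrightarrow> q b = \<zero>\<^bsub>C\<^esub> \<Longrightarrow> \<exists>a\<in>carrier A. i a = b"
    and ses_surj: "c \<in> carrier C \<Longrightarrow> \<exists>b\<in>carrier B. q b = c"
  using assms unfolding ses_def by blast+

text \<open>The cone of a lift of the injection \<open>i\<close> resolves the cokernel
  \<open>C\<close>. A cycle \<open>(y, x)\<close> is bounded by solving for \<open>x\<close> in the
  exact complex \<open>X\<close> and then for the remaining cycle in \<open>Y\<close>.\<close>

lemma cone_fib:
  assumes X: "graded_complex R X" "nonneg X" and Y: "graded_complex R Y" "nonneg Y"
    and s: "ses A B C i q"
    and pX: "acyclic_fib R X (conc A) (conc_map A eA)" and pY: "acyclic_fib R Y (conc B) (conc_map B eB)"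
    and f: "chain_map R X Y f" and fe: "\<And>x. x \<in> carrier (obj X 0) \<Longrightarrow> eB (f 0 x) = i (eA x)"
  shows "acyclic_fib R (cone X Y f) (conc C) (conc_map C (\<lambda>w. q (eB (fst w))))"
proof -
  let ?K = "cone X Y f"
  note A = sesD(1)[OF s] and B = sesD(2)[OF s] and C = sesD(3)[OF s] and i = sesD(4)[OF s] and q = sesD(5)[OF s]
  note eA = fib_conc_hom[OF X(1) A pX] and eB = fib_conc_hom[OF Y(1) B pY]
  note K = graded_complex_cone[OF X(1) Y(1) f] nonneg_cone[OF X(1) Y(1) f X(2) Y(2)]
  note gX = gc_module[OF X(1)] and gY = gc_module[OF Y(1)]
  have e: "graded_hom R (obj ?K 0) C (\<lambda>w. q (eB (fst w)))"
    unfolding obj_cone by (rule hm_compose_gh[OF hm_fst hm_compose_gh[OF eB q]])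
  show ?thesis
  proof (rule fib_concI[OF K C e])
    fix w assume "w \<in> carrier (obj ?K 1)"
    then have w: "fst w \<in> carrier (obj Y 1)" "snd w \<in> carrier (obj X 0)" by (auto simp: obj_cone)
    have "eB (diff Y 1 (fst w) \<oplus>\<^bsub>obj Y 0\<^esub> f 0 (snd w)) = i (eA (snd w))"
      using hm_closed[OF gc_diff[OF Y(1)] w(1)] hm_closed[OF cm_hom[OF f] w(2)] fib_conc_diff[OF Y(1) B pY w(1)]
        fe[OF w(2)] B hm_closed[OF i hm_closed[OF eA w(2)]]
      by (simp add: hm_add[OF eB])
    then show "q (eB (fst (diff ?K 1 w))) = \<zero>\<^bsub>C\<^esub>"
      using ses_comp[OF s hm_closed[OF eA w(2)]] by (simp add: diff_cone)
  next
    fix c assume "c \<in> carrier C"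
    then obtain b where "b \<in> carrier B" "q b = c" using ses_surj[OF s] by blast
    then obtain y where "y \<in> carrier (obj Y 0)" "q (eB y) = c" using fib_conc_surj[OF Y(1) B pY] by metis
    then show "\<exists>w\<in>carrier (obj ?K 0). q (eB (fst w)) = c"
      using gX by (intro bexI[of _ "(y, \<zero>\<^bsub>obj X (- 1)\<^esub>)"]) (simp_all add: obj_cone)
  next
    fix j w assume j: "0 \<le> j" and w: "w \<in> carrier (obj ?K j)" and dw: "diff ?K j w = \<zero>\<^bsub>obj ?K (j - 1)\<^esub>"
      and ew: "j = 0 \<Longrightarrow> q (eB (fst w)) = \<zero>\<^bsub>C\<^esub>"
    define y x where "y = fst w" and "x = snd w"
    have yx: "y \<in> carrier (obj Y j)" "x \<in> carrier (obj X (j - 1))" using w by (auto simp: obj_cone y_def x_def)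
    have fx: "f (j - 1) x \<in> carrier (obj Y (j - 1))" and dy: "diff Y j y \<in> carrier (obj Y (j - 1))"
      using hm_closed[OF cm_hom[OF f] yx(2)] hm_closed[OF gc_diff[OF Y(1)] yx(1)] by auto
    have dxc: "diff X (j - 1) x \<in> carrier (obj X (j - 2))" using hm_closed[OF gc_diff[OF X(1)] yx(2)] by simp
    have d1: "diff Y j y \<oplus>\<^bsub>obj Y (j - 1)\<^esub> f (j - 1) x = \<zero>\<^bsub>obj Y (j - 1)\<^esub>"
      and "\<ominus>\<^bsub>obj X (j - 2)\<^esub> diff X (j - 1) x = \<zero>\<^bsub>obj X (j - 2)\<^esub>"
      using dw by (auto simp: diff_cone obj_cone y_def x_def)
    then have d2: "diff X (j - 1) x = \<zero>\<^bsub>obj X (j - 2)\<^esub>"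
      using gm_neg_neg[OF gX dxc] gX by simp
    \<comment> \<open>In degree 0 the element \<open>x'\<close> must also match the augmentations,
      so that what remains of \<open>y\<close> lies in the kernel of \<open>eB\<close>.\<close>
    have "\<exists>x'\<in>carrier (obj X j). \<ominus>\<^bsub>obj X (j - 1)\<^esub> diff X j x' = x \<and> (j = 0 \<longrightarrow> eB y = eB (f 0 x'))"
    proof (cases "j = 0")
      case True
      then have "\<exists>a\<in>carrier A. i a = eB y" using ses_exact[OF s] ew hm_closed[OF eB] yx(1) by (simp add: y_def)
      then obtain a where a: "a \<in> carrier A" "i a = eB y" by blast
      obtain x' where x': "x' \<in> carrier (obj X 0)" "eA x' = a" using fib_conc_surj[OF X(1) A pX a(1)] by blast
      have "x = \<zero>\<^bsub>obj X (- 1)\<^esub>" "diff X 0 x' = \<zero>\<^bsub>obj X (- 1)\<^esub>"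
        using nonnegD[OF X(2), of "- 1" x] nonnegD[OF X(2), of "- 1" "diff X 0 x'"] yx(2)
          hm_closed[OF gc_diff[OF X(1)] x'(1)] True by simp_all
      then show ?thesis using True x' a fe gX by (intro bexI[of _ x']) simp_all
    next
      case False
      \<comment> \<open>Exactness of \<open>X\<close> in degree 0 asks for a vanishing augmentation.
        Here \<open>i (eA x) = eB (f 0 x)\<close> is, up to sign, the augmentation of a boundary,
        and \<open>i\<close> is injective.\<close>
      have "eA x = \<zero>\<^bsub>A\<^esub>" if "j = 1"
      proof -
        have x0: "x \<in> carrier (obj X 0)" using yx(2) that by simp
        have "diff Y 1 y \<oplus>\<^bsub>obj Y 0\<^esub> f 0 x = \<zero>\<^bsub>obj Y 0\<^esub>" using d1 that by simp
        then have "eB (diff Y 1 y) \<oplus>\<^bsub>B\<^esub> eB (f 0 x) = \<zero>\<^bsub>B\<^esub>"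
          using hm_add[OF eB] hm_zero[OF gY B eB] dy fx that by simp metis
        then have "i (eA x) = \<zero>\<^bsub>B\<^esub>"
          using fib_conc_diff[OF Y(1) B pY] yx(1) that fe[OF x0] B hm_closed[OF i hm_closed[OF eA x0]] by simp
        then show ?thesis using ses_inj[OF s hm_closed[OF eA x0]] by simp
      qed
      then obtain x'' where x'': "x'' \<in> carrier (obj X j)" "diff X j x'' = x"
        using fib_conc_exact[OF X(1) A pX yx(2)] d2 by auto
      then show ?thesis
        using False gX hm_neg[OF gX gX gc_diff[OF X(1)], of x'' j] yx(2)
        by (intro bexI[of _ "\<ominus>\<^bsub>obj X j\<^esub> x''"]) simp_all
    qed
    then obtain x' where x': "x' \<in> carrier (obj X j)" "\<ominus>\<^bsub>obj X (j - 1)\<^esub> diff X j x' = x" "j = 0 \<Longrightarrow> eB y = eB (f 0 x')"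
      by blast
    have fx': "f j x' \<in> carrier (obj Y j)" using hm_closed[OF cm_hom[OF f] x'(1)] .
    have dx': "diff X j x' \<in> carrier (obj X (j - 1))" using hm_closed[OF gc_diff[OF X(1)] x'(1)] .
    let ?y = "y \<oplus>\<^bsub>obj Y j\<^esub> \<ominus>\<^bsub>obj Y j\<^esub> f j x'"
    have yc: "?y \<in> carrier (obj Y j)" using yx(1) fx' gY by simp
    have "f (j - 1) x = \<ominus>\<^bsub>obj Y (j - 1)\<^esub> diff Y j (f j x')"
      using hm_neg[OF gX gY cm_hom[OF f] dx'] cm_diff[OF f x'(1)] x'(2) by simp
    then have "diff Y j ?y = \<zero>\<^bsub>obj Y (j - 1)\<^esub>"
      using d1 yx(1) fx' gY by (simp add: hm_add[OF gc_diff[OF Y(1)]] hm_neg[OF gY gY gc_diff[OF Y(1)]])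
    moreover have "eB ?y = \<zero>\<^bsub>B\<^esub>" if "j = 0"
      using x'(3)[OF that] that yx(1) fx' gY B hm_closed[OF eB, of "f 0 x'"]
      by (simp add: hm_add[OF eB] hm_neg[OF gY B eB])
    ultimately obtain y' where y': "y' \<in> carrier (obj Y (j + 1))" "diff Y (j + 1) y' = ?y"
      using fib_conc_exact[OF Y(1) B pY yc] by blast
    have "diff ?K (j + 1) (y', x') = w"
      using y' x' yx(1) fx' gY by (simp add: diff_cone y_def x_def gm_assoc prod_eq_iff)
    then show "\<exists>v\<in>carrier (obj ?K (j + 1)). diff ?K (j + 1) v = w"
      using y'(1) x'(1) by (intro bexI[of _ "(y', x')"]) (simp_all add: obj_cone)
  qed
qed

context
  fixes A :: "('a, 'x) gmod" and B :: "('a, 'y) gmod" and C :: "('a, 'z) gmod" and i q and N :: "('a, 'n) gmod"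
  assumes s: "ses A B C i q" and N: "graded_module R N"
begin

text \<open>The cone and the standard resolution of \<open>C\<close> are both projective over
  \<open>conc C\<close>, so the vanishing of Ext for \<open>C\<close> can be transferred to the
  cone.\<close>

lemma ses_cone:
  obtains f where "chain_map R (resolution R A) (resolution R B) f"
    "\<And>x. x \<in> carrier (obj (resolution R A) 0) \<Longrightarrow> res_aug R B (f 0 x) = i (res_aug R A x)"
    "\<And>k. ext_vanishes C N k \<Longrightarrow> coh_vanishes R (cone (resolution R A) (resolution R B) f) N k"
proof -
  note A = sesD(1)[OF s] and B = sesD(2)[OF s] and C = sesD(3)[OF s]
  note PA = projective_resolution[OF A] and PB = projective_resolution[OF B] and PC = projective_resolution[OF C]
  note FA = projective_cpxD(1,2)[OF PA] and FB = projective_cpxD(1,2)[OF PB]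
  note eA = fib_conc_hom[OF FA(1) A fib_resolution[OF A]]
  have "chain_map R (resolution R A) (conc B) (conc_map B (\<lambda>x. i (res_aug R A x)))"
    using fib_conc_diff[OF FA(1) A fib_resolution[OF A]] hm_zero[OF A B sesD(4)[OF s]]
    by (intro chain_map_conc[OF FA(1) B hm_compose_gh[OF eA sesD(4)[OF s]]]) simp
  from chain_lift[OF PA FB(1) graded_complex_conc[OF B] fib_resolution[OF B] this]
  obtain f where f: "chain_map R (resolution R A) (resolution R B) f"
    "\<And>j x. x \<in> carrier (obj (resolution R A) j) \<Longrightarrow>
      conc_map B (res_aug R B) j (f j x) = conc_map B (\<lambda>x. i (res_aug R A x)) j x" by blast
  have f0: "res_aug R B (f 0 x) = i (res_aug R A x)" if "x \<in> carrier (obj (resolution R A) 0)" for x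
    using f(2)[OF that] by simp
  note fibK = cone_fib[OF FA FB s fib_resolution[OF A] fib_resolution[OF B] f(1), OF f0]
  show ?thesis
    by (rule that[OF f(1) f0], assumption)
      (rule vanishes_transfer[OF PC projective_cone[OF FA(1) FB(1) f(1) PA PB] graded_complex_conc[OF C]
        fib_resolution[OF C] fibK N])
qed

text \<open>Exactness of Ext(C) -> Ext(B) -> Ext(A) at the middle term: a cocycle on
  \<open>B\<close> becomes a coboundary on \<open>A\<close>, and \<open>cone_inj\<close> turns that
  into a primitive on \<open>B\<close>.\<close>

lemma ext_mid:
  assumes "ext_vanishes A N k" "ext_vanishes C N k"
  shows "ext_vanishes B N k"
proof (rule coh_vanishesI)
  note A = sesD(1)[OF s] and B = sesD(2)[OF s]
  note FA = graded_complex_resolution[OF A] and FB = graded_complex_resolution[OF B]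
  obtain f where f: "chain_map R (resolution R A) (resolution R B) f"
    "coh_vanishes R (cone (resolution R A) (resolution R B) f) N k" using ses_cone assms(2) by metis
  fix n u assume u: "homogeneous_map R (obj (resolution R B) k) N n u"
    and c: "\<And>x. x \<in> carrier (obj (resolution R B) (k + 1)) \<Longrightarrow> u (diff (resolution R B) (k + 1) x) = \<zero>\<^bsub>N\<^esub>"
  have "u (f k (diff (resolution R A) (k + 1) x)) = \<zero>\<^bsub>N\<^esub>" if "x \<in> carrier (obj (resolution R A) (k + 1))" for x
    using c[OF hm_closed[OF cm_hom[OF f(1)] that]] cm_diff'[OF f(1) that] by simp
  from coh_vanishesE[OF assms(1) hm_compose_gh[OF cm_hom[OF f(1)] u], OF this]
  obtain w where w: "homogeneous_map R (obj (resolution R A) (k - 1)) N n w"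
    "\<And>x. x \<in> carrier (obj (resolution R A) k) \<Longrightarrow> u (f k x) = w (diff (resolution R A) k x)" by blast
  from cone_inj[OF FA FB f(1) N f(2) u, OF c w(1), OF _ w(2)]
  show "\<exists>v. homogeneous_map R (obj (resolution R B) (k - 1)) N n v \<and>
      (\<forall>x\<in>carrier (obj (resolution R B) k). u x = v (diff (resolution R B) k x))" by metis
qed

text \<open>Exactness of Ext(B) -> Ext(A) -> Ext(C) at the middle term, the last arrow raising the
  degree by one: modulo coboundaries, a cocycle on \<open>A\<close> comes from a cocycle on
  \<open>B\<close>.\<close>

lemma ext_sub:
  assumes "ext_vanishes B N k" "ext_vanishes C N (k + 1)"
  shows "ext_vanishes A N k"
proof (rule coh_vanishesI)
  note A = sesD(1)[OF s] and B = sesD(2)[OF s]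
  let ?FA = "resolution R A" and ?FB = "resolution R B"
  note FA = graded_complex_resolution[OF A] and FB = graded_complex_resolution[OF B]
  obtain f where f: "chain_map R ?FA ?FB f" "coh_vanishes R (cone ?FA ?FB f) N (k + 1)" using ses_cone assms(2) by metis
  fix n u assume u: "homogeneous_map R (obj ?FA k) N n u"
    and c: "\<And>x. x \<in> carrier (obj ?FA (k + 1)) \<Longrightarrow> u (diff ?FA (k + 1) x) = \<zero>\<^bsub>N\<^esub>"
  obtain w t where w: "homogeneous_map R (obj ?FB k) N n w"
    "\<And>y. y \<in> carrier (obj ?FB (k + 1)) \<Longrightarrow> w (diff ?FB (k + 1) y) = \<zero>\<^bsub>N\<^esub>"
    and t: "homogeneous_map R (obj ?FA (k - 1)) N n t"
    "\<And>x. x \<in> carrier (obj ?FA k) \<Longrightarrow> u x = w (f k x) \<oplus>\<^bsub>N\<^esub> t (diff ?FA k x)"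
    using cone_surj[OF FA FB f(1) N f(2) u, OF c] by blast
  from coh_vanishesE[OF assms(1) w(1), OF w(2)]
  obtain v where v: "homogeneous_map R (obj ?FB (k - 1)) N n v"
    "\<And>x. x \<in> carrier (obj ?FB k) \<Longrightarrow> w x = v (diff ?FB k x)" by blast
  have "homogeneous_map R (obj ?FA (k - 1)) N n (\<lambda>x. v (f (k - 1) x) \<oplus>\<^bsub>N\<^esub> t x)"
    by (rule hm_plus[OF N hm_compose_gh[OF cm_hom[OF f(1)] v(1)] t(1)])
  moreover have "u x = v (f (k - 1) (diff ?FA k x)) \<oplus>\<^bsub>N\<^esub> t (diff ?FA k x)" if x: "x \<in> carrier (obj ?FA k)" for x
    using t(2)[OF x] v(2)[OF hm_closed[OF cm_hom[OF f(1)] x]] cm_diff[OF f(1) x] by simp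
  ultimately show "\<exists>v. homogeneous_map R (obj ?FA (k - 1)) N n v \<and> (\<forall>x\<in>carrier (obj ?FA k). u x = v (diff ?FA k x))"
    by blast
qed

text \<open>Through the augmentation \<open>h\<close> becomes a cocycle of degree 0 on the
  resolution of \<open>A\<close>. By \<open>cone_surj\<close> it comes from a cocycle on the
  resolution of \<open>B\<close>, which kills boundaries and so descends to
  \<open>B\<close>.\<close>

lemma ext_extend:
  assumes C1: "ext_vanishes C N 1" and h: "homogeneous_map R A N n h"
  obtains g where "homogeneous_map R B N n g" "\<And>a. a \<in> carrier A \<Longrightarrow> g (i a) = h a"
proof -
  note A = sesD(1)[OF s] and B = sesD(2)[OF s]
  let ?FA = "resolution R A" and ?FB = "resolution R B"
  note FA = graded_complex_resolution[OF A] and FB = graded_complex_resolution[OF B]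
  note pA = fib_resolution[OF A] and pB = fib_resolution[OF B]
  note eA = fib_conc_hom[OF FA A pA] and eB = fib_conc_hom[OF FB B pB]
  obtain f where f: "chain_map R ?FA ?FB f" "coh_vanishes R (cone ?FA ?FB f) N 1"
    and f0: "\<And>x. x \<in> carrier (obj ?FA 0) \<Longrightarrow> res_aug R B (f 0 x) = i (res_aug R A x)"
    using ses_cone C1 by metis
  have c: "h (res_aug R A (diff ?FA (0 + 1) x)) = \<zero>\<^bsub>N\<^esub>" if "x \<in> carrier (obj ?FA (0 + 1))" for x
    using fib_conc_diff[OF FA A pA] that hm_zero[OF A N h] by simp
  have v1: "coh_vanishes R (cone ?FA ?FB f) N (0 + 1)" using f(2) by simp
  obtain w t where w: "homogeneous_map R (obj ?FB 0) N n w"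
    "\<And>y. y \<in> carrier (obj ?FB (0 + 1)) \<Longrightarrow> w (diff ?FB (0 + 1) y) = \<zero>\<^bsub>N\<^esub>"
    and t: "homogeneous_map R (obj ?FA (0 - 1)) N n t"
    "\<And>x. x \<in> carrier (obj ?FA 0) \<Longrightarrow> h (res_aug R A x) = w (f 0 x) \<oplus>\<^bsub>N\<^esub> t (diff ?FA 0 x)"
    using cone_surj[OF FA FB f(1) N v1 hm_compose_gh[OF eA h], OF c] by blast
  \<comment> \<open>The correction term lives in degree -1, where the resolution is zero, so the
    cocycles agree exactly and not only up to a coboundary.\<close>
  have t0: "t (diff ?FA 0 x) = \<zero>\<^bsub>N\<^esub>" if "x \<in> carrier (obj ?FA 0)" for x
  proof -
    have "diff ?FA 0 x = \<zero>\<^bsub>obj ?FA (0 - 1)\<^esub>"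
      using nonnegD[OF projective_cpxD(2)[OF projective_resolution[OF A]], of "0 - 1"] hm_closed[OF gc_diff[OF FA] that]
      by simp
    then show ?thesis using hm_zero[OF gc_module[OF FA] N t(1)] by simp
  qed
  have sur: "res_aug R B ` carrier (obj ?FB 0) = carrier B"
    using fib_conc_surj[OF FB B pB] hm_closed[OF eB] by blast
  have ker: "w y = \<zero>\<^bsub>N\<^esub>" if y: "y \<in> carrier (obj ?FB 0)" "res_aug R B y = \<zero>\<^bsub>B\<^esub>" for y
  proof -
    have "diff ?FB 0 y = \<zero>\<^bsub>obj ?FB (0 - 1)\<^esub>"
      using nonnegD[OF projective_cpxD(2)[OF projective_resolution[OF B]], of "0 - 1"] hm_closed[OF gc_diff[OF FB] y(1)]
      by simp
    then obtain y' where "y' \<in> carrier (obj ?FB (0 + 1))" "diff ?FB (0 + 1) y' = y"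
      using fib_conc_exact[OF FB B pB y(1)] y(2) by blast
    then show ?thesis using w(2) by blast
  qed
  obtain g where g: "homogeneous_map R B N n g" "\<And>y. y \<in> carrier (obj ?FB 0) \<Longrightarrow> g (res_aug R B y) = w y"
    using graded_factor[OF gc_module[OF FB] B N eB sur w(1) ker] by blast
  have "g (i a) = h a" if a: "a \<in> carrier A" for a
  proof -
    obtain x where x: "x \<in> carrier (obj ?FA 0)" "res_aug R A x = a" using fib_conc_surj[OF FA A pA a] by blast
    have fx: "f 0 x \<in> carrier (obj ?FB 0)" using hm_closed[OF cm_hom[OF f(1)] x(1)] .
    have "g (i a) = w (f 0 x)" using g(2)[OF fx] f0[OF x(1)] x(2) by simp
    then show ?thesis using t(2)[OF x(1)] t0[OF x(1)] x(2) hm_closed[OF w(1) fx] N by simp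
  qed
  then show ?thesis using that g(1) by blast
qed

end

text \<open>Ext in degree 0 is Hom, since coboundaries in degree 0 come from degree -1, where the
  resolution is zero.\<close>

lemma hom_zero:
  assumes A: "graded_module R A" and N: "graded_module R N" and v: "ext_vanishes A N 0"
    and h: "homogeneous_map R A N n h" and a: "a \<in> carrier A"
  shows "h a = \<zero>\<^bsub>N\<^esub>"
proof -
  let ?F = "resolution R A"
  note F = graded_complex_resolution[OF A] and p = fib_resolution[OF A]
  note e = fib_conc_hom[OF F A p]
  have "h (res_aug R A (diff ?F (0 + 1) x)) = \<zero>\<^bsub>N\<^esub>" if "x \<in> carrier (obj ?F (0 + 1))" for x
    using fib_conc_diff[OF F A p] that hm_zero[OF A N h] by simp
  from coh_vanishesE[OF v hm_compose_gh[OF e h], OF this]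
  obtain t where t: "homogeneous_map R (obj ?F (0 - 1)) N n t"
    "\<And>x. x \<in> carrier (obj ?F 0) \<Longrightarrow> h (res_aug R A x) = t (diff ?F 0 x)" by blast
  obtain x where x: "x \<in> carrier (obj ?F 0)" "res_aug R A x = a" using fib_conc_surj[OF F A p a] by blast
  have "diff ?F 0 x = \<zero>\<^bsub>obj ?F (0 - 1)\<^esub>"
    using nonnegD[OF projective_cpxD(2)[OF projective_resolution[OF A]], of "0 - 1"] hm_closed[OF gc_diff[OF F] x(1)]
    by simp
  then show ?thesis using t(2)[OF x(1)] x(2) hm_zero[OF gc_module[OF F] N t(1)] by simp
qed

section \<open>Cohomology of a complex from the Ext modules of its terms and its homology\<close>

context
  fixes Q :: "('a, 'q) cpx"
  assumes Q: "graded_complex R Q"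
begin

abbreviation bdm :: "int \<Rightarrow> ('a, 'q) gmod" where
  "bdm j \<equiv> restrict_gmod (obj Q j) (boundaries Q j)"

abbreviation cok :: "int \<Rightarrow> ('a, 'q set) gmod" where
  "cok j \<equiv> gquot (obj Q j) (carrier (obj Q j)) (boundaries Q j)"

lemma graded_module_bdm: "graded_module R (bdm j)"
  by (rule graded_module_restrict[OF gc_module[OF Q] hsub_boundaries[OF Q]])

lemma graded_module_cok: "graded_module R (cok j)"
  by (rule graded_module_gquot[OF gc_module[OF Q] hsub_boundaries[OF Q] hsub_whole[OF gc_module[OF Q]]])

lemma ses_bdm_cok: "ses (bdm j) (obj Q j) (cok j) (\<lambda>x. x) (hcls Q j)"
  unfolding ses_def
  using graded_module_bdm gc_module[OF Q] graded_module_cok hm_inclusion[OF hsub_boundaries[OF Q]]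
    hm_coset_whole[OF gc_module[OF Q] hsub_boundaries[OF Q]]
    coset_zero_iff[OF gc_module[OF Q] hsub_boundaries[OF Q]] hsub_carrier[OF hsub_boundaries[OF Q]]
  by (auto 0 2)

text \<open>The differential induces the map from the cokernel onto the boundaries, and the kernel
  of the induced map consists of the classes of cycles.\<close>

lemma ses_homology_cok: "\<exists>g. ses (homology Q j) (cok j) (bdm (j - 1)) (\<lambda>X. X) g"
proof -
  note gQ = gc_module[OF Q] and hB = hsub_boundaries[OF Q]
  have w: "graded_hom R (obj Q j) (bdm (j - 1)) (diff Q j)"
    by (rule hm_into_restrict[OF gQ gc_diff[OF Q]]) (auto simp: boundaries_def)
  have p: "graded_hom R (obj Q j) (cok j) (hcls Q j)" by (rule hm_coset_whole[OF gQ hB])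
  have sur: "hcls Q j ` carrier (obj Q j) = carrier (cok j)" by simp
  have "diff Q j x = \<zero>\<^bsub>bdm (j - 1)\<^esub>" if "x \<in> carrier (obj Q j)" "hcls Q j x = \<zero>\<^bsub>cok j\<^esub>" for x
    using that coset_zero_iff[OF gQ hB] boundaries_cycles[OF Q, of j] cyclesD(2)[of x Q j] by auto
  from graded_factor[OF gQ graded_module_cok graded_module_bdm p sur w this]
  obtain g where g: "graded_hom R (cok j) (bdm (j - 1)) g" "\<And>x. x \<in> carrier (obj Q j) \<Longrightarrow> g (hcls Q j x) = diff Q j x"
    by blast
  have "ses (homology Q j) (cok j) (bdm (j - 1)) (\<lambda>X. X) g"
    unfolding ses_def
  proof (intro conjI ballI impI)
    show "graded_hom R (homology Q j) (cok j) (\<lambda>X. X)"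
      using cyclesD(1)[of _ Q] unfolding homology_def by (intro homogeneous_mapI) auto
    show "g X = \<zero>\<^bsub>bdm (j - 1)\<^esub>" if "X \<in> carrier (homology Q j)" for X
      using that g(2) cyclesD[of _ Q] by (auto simp: carrier_homology[OF Q])
    show "\<exists>Y\<in>carrier (homology Q j). Y = X" if X: "X \<in> carrier (cok j)" "g X = \<zero>\<^bsub>bdm (j - 1)\<^esub>" for X
    proof -
      obtain x where x: "x \<in> carrier (obj Q j)" "X = hcls Q j x" using X(1) by auto
      then have "x \<in> cycles Q j" using X(2) g(2) by (intro cyclesI) auto
      then show ?thesis using x(2) by (auto simp: carrier_homology[OF Q])
    qed
    show "\<exists>X\<in>carrier (cok j). g X = y" if "y \<in> carrier (bdm (j - 1))" for y
      using that g(2) by (auto simp: boundaries_def)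
  qed (use graded_module_homology[OF Q] graded_module_cok graded_module_bdm g(1) in \<open>simp_all add: homology_def\<close>)
  then show ?thesis by blast
qed

lemma vanishes_of_homology:
  assumes nn: "nonneg Q" and N: "graded_module R N"
    and H: "\<And>j. 0 \<le> j \<Longrightarrow> j \<le> l \<Longrightarrow> ext_vanishes (homology Q j) N (l - j)"
    and O: "\<And>j. 0 \<le> j \<Longrightarrow> j \<le> l - 2 \<Longrightarrow> ext_vanishes (obj Q j) N (l - 1 - j)"
  shows "coh_vanishes R Q N l"
proof (cases "l < 0")
  case True
  then show ?thesis by (rule vanishes_neg[OF Q nn N])
next
  case False
  note gQ = gc_module[OF Q]
  have zm: "zero_module (cok (- 1))"
  proof -
    have "carrier (obj Q (- 1)) = {\<zero>\<^bsub>obj Q (- 1)\<^esub>}" using nn by (simp add: nonneg_def zero_module_def)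
    then have "boundaries Q (- 1) = {\<zero>\<^bsub>obj Q (- 1)\<^esub>}"
      using hsub_zero[OF hsub_boundaries[OF Q]] hsub_carrier[OF hsub_boundaries[OF Q]] by blast
    then show ?thesis
      using coset_zero_iff[OF gQ hsub_boundaries[OF Q], of "\<zero>\<^bsub>obj Q (- 1)\<^esub>" "- 1"] gQ nn
      by (simp add: zero_module_def nonneg_def)
  qed
  \<comment> \<open>The induction starts at -1, where the cokernel is zero. Each step passes from
    one cokernel to the boundaries by \<open>ses_bdm_cok\<close> and on to the next cokernel by
    \<open>ses_homology_cok\<close>. The Ext degree falls by one each time, so
    \<open>j = l - 1\<close> arrives at degree 1, the degree that controls extension of
    maps.\<close>
  have cok: "ext_vanishes (cok j) N (l - j)" if "-1 \<le> j" "j \<le> l - 1" for j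
    using that
  proof (induction rule: int_ge_induct)
    case base
    show ?case by (rule ext_zero[OF graded_module_cok zm N])
  next
    case (step j)
    \<comment> \<open>\<open>O\<close> covers nonnegative \<open>j\<close>; for
      \<open>j = - 1\<close> the term is zero.\<close>
    have 1: "ext_vanishes (obj Q j) N (l - 1 - j)"
    proof (cases "j < 0")
      case True
      then show ?thesis using nn by (intro ext_zero[OF gQ _ N]) (simp add: nonneg_def)
    qed (use O step.prems in simp)
    have "ext_vanishes (cok j) N (l - 1 - j + 1)" using step by simp
    from ext_sub[OF ses_bdm_cok N 1 this] have 2: "ext_vanishes (bdm j) N (l - (j + 1))" by (simp add: algebra_simps)
    obtain g where g: "ses (homology Q (j + 1)) (cok (j + 1)) (bdm j) (\<lambda>X. X) g"
      using ses_homology_cok[of "j + 1"] by auto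
    show ?case by (rule ext_mid[OF g N H 2]) (use step in auto)
  qed
  show ?thesis
  proof (rule coh_vanishesI)
    fix n u assume u: "homogeneous_map R (obj Q l) N n u"
      and c: "\<And>x. x \<in> carrier (obj Q (l + 1)) \<Longrightarrow> u (diff Q (l + 1) x) = \<zero>\<^bsub>N\<^esub>"
    let ?Z = "restrict_gmod (obj Q l) (cycles Q l)"
    have Z: "graded_module R ?Z" by (rule graded_module_restrict[OF gQ hsub_cycles[OF Q]])
    have uZ: "homogeneous_map R ?Z N n u" by (rule hm_from_restrict[OF hsub_cycles[OF Q] u])
    have sur: "hcls Q l ` carrier ?Z = carrier (homology Q l)" by (simp add: carrier_homology[OF Q])
    have "u x = \<zero>\<^bsub>N\<^esub>" if "x \<in> carrier ?Z" "hcls Q l x = \<zero>\<^bsub>homology Q l\<^esub>" for x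
      using that c hcls_zero_iff[OF Q, of x l] by (auto simp: boundaries_def)
    from graded_factor[OF Z graded_module_homology[OF Q] N hm_hcls[OF Q] sur uZ this]
    obtain g where g: "homogeneous_map R (homology Q l) N n g" "\<And>x. x \<in> carrier ?Z \<Longrightarrow> g (hcls Q l x) = u x"
      by blast
    \<comment> \<open>On cycles the cocycle factors through the homology in degree \<open>l\<close>,
      from which every homogeneous map to \<open>N\<close> is zero.\<close>
    have "ext_vanishes (homology Q l) N 0" using H[of l] False by simp
    from hom_zero[OF graded_module_homology[OF Q] N this g(1)]
    have uz: "u x = \<zero>\<^bsub>N\<^esub>" if "x \<in> cycles Q l" for x
      using g(2)[of x] that by (simp add: carrier_homology[OF Q])
    have d: "graded_hom R (obj Q l) (bdm (l - 1)) (diff Q l)"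
      by (rule hm_into_restrict[OF gQ gc_diff[OF Q]]) (auto simp: boundaries_def)
    have dsur: "diff Q l ` carrier (obj Q l) = carrier (bdm (l - 1))" by (simp add: boundaries_def)
    have "u x = \<zero>\<^bsub>N\<^esub>" if "x \<in> carrier (obj Q l)" "diff Q l x = \<zero>\<^bsub>bdm (l - 1)\<^esub>" for x
      by (rule uz, rule cyclesI) (use that in auto)
    from graded_factor[OF gQ graded_module_bdm N d dsur u this]
    obtain h where h: "homogeneous_map R (bdm (l - 1)) N n h" "\<And>x. x \<in> carrier (obj Q l) \<Longrightarrow> h (diff Q l x) = u x"
      by blast
    \<comment> \<open>As \<open>u\<close> kills the cycles, it is \<open>h\<close> after the
      differential, and any extension of \<open>h\<close> from the boundaries to the whole term is a
      primitive of \<open>u\<close>.\<close>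
    have "ext_vanishes (cok (l - 1)) N 1" using cok[of "l - 1"] False by simp
    from ext_extend[OF ses_bdm_cok N this h(1)]
    obtain v where v: "homogeneous_map R (obj Q (l - 1)) N n v" "\<And>a. a \<in> carrier (bdm (l - 1)) \<Longrightarrow> v a = h a"
      by blast
    have "u x = v (diff Q l x)" if x: "x \<in> carrier (obj Q l)" for x
    proof -
      have "diff Q l x \<in> carrier (bdm (l - 1))" using dsur x by blast
      then show ?thesis using v(2) h(2)[OF x] by simp
    qed
    then show "\<exists>v. homogeneous_map R (obj Q (l - 1)) N n v \<and> (\<forall>x\<in>carrier (obj Q l). u x = v (diff Q l x))"
      using v(1) by blast
  qed
qed

end

end


section \<open>The two comparison maps\<close>

context graded_base
begin

lemma ses_gprod:
  assumes A: "graded_module R A" and B: "graded_module R B"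
  shows "ses A (gprod A B) B (\<lambda>a. (a, \<zero>\<^bsub>B\<^esub>)) snd"
  unfolding ses_def
  using A B graded_module_gprod[OF A B] hm_inl[OF B, of A] hm_snd[of A B] by (auto intro: gm_zero[OF A])

lemma zero_homologyI:
  assumes X: "graded_complex R X" and b: "\<And>z. z \<in> cycles X j \<Longrightarrow> z \<in> boundaries X j"
  shows "zero_module (homology X j)"
proof -
  have "hcls X j z = \<zero>\<^bsub>homology X j\<^esub>" if "z \<in> cycles X j" for z
    using hcls_zero_iff[OF X that] b[OF that] by simp
  moreover have "\<zero>\<^bsub>obj X j\<^esub> \<in> cycles X j" by (rule hsub_zero[OF hsub_cycles[OF X]])
  ultimately show ?thesis
    unfolding zero_module_def carrier_homology[OF X] by (auto simp: image_iff)
qed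

context
  fixes C :: "('a, 'c) cpx" and N :: "('a, 'n) gmod"
  assumes C: "graded_complex R C" and nn: "nonneg C" and N: "graded_module R N"
begin

lemma vanishes_cone_repl:
  assumes V: "\<And>j. 0 \<le> j \<Longrightarrow> j \<le> l - 2 \<Longrightarrow> ext_vanishes (obj C j) N (l - 1 - j)"
  shows "coh_vanishes R (cone (repl R C) C (repl_map R C)) N l"
proof -
  let ?P = "repl R C" and ?p = "repl_map R C"
  let ?K = "cone ?P C ?p"
  note PP = projective_repl[OF C nn]
  note P = projective_cpxD(1)[OF PP] and pc = chain_map_repl[OF C nn]
  note gP = gc_module[OF P] and gC = gc_module[OF C]
  note K = graded_complex_cone[OF P C pc]
  show ?thesis
  proof (rule vanishes_of_homology[OF K nonneg_cone[OF P C pc projective_cpxD(2)[OF PP] nn] N])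
    fix j
    \<comment> \<open>A cycle of the cone consists of an element of \<open>C\<close> and a cycle of
      the replacement whose images match up to sign: these are the data that the fibration property
      lifts.\<close>
    have "w \<in> boundaries ?K j" if "w \<in> cycles ?K j" for w
    proof -
      have w: "fst w \<in> carrier (obj C j)" "snd w \<in> carrier (obj ?P (j - 1))"
        and dw: "diff ?K j w = \<zero>\<^bsub>obj ?K (j - 1)\<^esub>"
        using cyclesD[OF that] by (auto simp: obj_cone)
      have dxc: "diff ?P (j - 1) (snd w) \<in> carrier (obj ?P (j - 2))" using hm_closed[OF gc_diff[OF P] w(2)] by simp
      have d1: "diff C j (fst w) \<oplus>\<^bsub>obj C (j - 1)\<^esub> ?p (j - 1) (snd w) = \<zero>\<^bsub>obj C (j - 1)\<^esub>"
        and d2: "\<ominus>\<^bsub>obj ?P (j - 2)\<^esub> diff ?P (j - 1) (snd w) = \<zero>\<^bsub>obj ?P (j - 2)\<^esub>"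
        using dw by (auto simp: diff_cone obj_cone)
      let ?z = "\<ominus>\<^bsub>obj ?P (j - 1)\<^esub> snd w"
      have cl: "diff C j (fst w) \<in> carrier (obj C (j - 1))" "?p (j - 1) (snd w) \<in> carrier (obj C (j - 1))"
        using hm_closed[OF gc_diff[OF C] w(1)] hm_closed[OF cm_hom[OF pc] w(2)] by auto
      have z: "?z \<in> carrier (obj ?P (j - 1))" using w(2) gP by simp
      have dz: "diff ?P (j - 1) ?z = \<zero>\<^bsub>obj ?P (j - 2)\<^esub>"
        using hm_neg[OF gP gP gc_diff[OF P] w(2)] d2 by simp
      have "?p (j - 1) ?z = diff C j (fst w)"
        using hm_neg[OF gP gC cm_hom[OF pc] w(2)] gm_neg_eqI[OF gC cl d1] by simp
      from fibE[OF fib_repl[OF C nn], OF z w(1) dz this]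
      obtain y where y: "y \<in> carrier (obj ?P j)" "diff ?P j y = ?z" "?p j y = fst w" by blast
      show ?thesis
      proof (rule boundariesI)
        show "(\<zero>\<^bsub>obj C (j + 1)\<^esub>, y) \<in> carrier (obj ?K (j + 1))" using y(1) gC by (simp add: obj_cone)
        show "w = diff ?K (j + 1) (\<zero>\<^bsub>obj C (j + 1)\<^esub>, y)"
          using y w gC gP hm_zero[OF gC gC gc_diff'[OF C]] by (simp add: diff_cone prod_eq_iff)
      qed
    qed
    then show "ext_vanishes (homology ?K j) N (l - j)"
      using ext_zero[OF graded_module_homology[OF K] zero_homologyI[OF K] N] by blast
    assume j: "0 \<le> j" "j \<le> l - 2"
    \<comment> \<open>The degree \<open>l - 1 - j\<close> is at least 1, so the projective summand
      has no Ext there.\<close>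
    have "ext_vanishes (obj ?P (j - 1)) N (l - 1 - j)"
      by (rule ext_projective[OF gP projective_cpxD(3)[OF PP] N]) (use j in auto)
    then show "ext_vanishes (obj ?K j) N (l - 1 - j)"
      unfolding obj_cone by (rule ext_mid[OF ses_gprod[OF gC gP] N V[OF j]])
  qed
qed

text \<open>Here \<open>e\<close> identifies \<open>M\<close> with the homology of \<open>C\<close> in degree 0, and \<open>f\<close> compares the replacement
  of \<open>C\<close> with the resolution of \<open>M\<close>.\<close>

lemma vanishes_cone_resolution:
  fixes M :: "('a, 'm) gmod"
  assumes M: "graded_module R M" and e: "graded_hom R (obj C 0) M e"
    and es: "\<And>m. m \<in> carrier M \<Longrightarrow> \<exists>c\<in>carrier (obj C 0). e c = m"
    and ek: "\<And>c. c \<in> carrier (obj C 0) \<Longrightarrow> e c = \<zero>\<^bsub>M\<^esub> \<Longrightarrow> c \<in> boundaries C 0"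
    and f: "chain_map R (repl R C) (resolution R M) f"
    and fe: "\<And>x. x \<in> carrier (obj (repl R C) 0) \<Longrightarrow> res_aug R M (f 0 x) = e (repl_map R C 0 x)"
    and U: "\<And>j. 1 \<le> j \<Longrightarrow> j \<le> l - 1 \<Longrightarrow> ext_vanishes (homology C j) N (l - 1 - j)"
  shows "coh_vanishes R (cone (repl R C) (resolution R M) f) N l"
proof -
  let ?P = "repl R C" and ?p = "repl_map R C" and ?F = "resolution R M"
  let ?K = "cone ?P ?F f"
  note PP = projective_repl[OF C nn] and PF = projective_resolution[OF M]
  note P = projective_cpxD(1)[OF PP] and pc = chain_map_repl[OF C nn]
  note F = projective_cpxD(1)[OF PF] and pF = fib_resolution[OF M]
  note gP = gc_module[OF P] and gC = gc_module[OF C] and gF = gc_module[OF F]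
  note K = graded_complex_cone[OF P F f]
  note eF = fib_conc_hom[OF F M pF]
  have cyc: "fst w \<in> carrier (obj ?F j)" "snd w \<in> carrier (obj ?P (j - 1))"
    "diff ?F j (fst w) = f (j - 1) (\<ominus>\<^bsub>obj ?P (j - 1)\<^esub> snd w)"
    "diff ?P (j - 1) (snd w) = \<zero>\<^bsub>obj ?P (j - 2)\<^esub>" if "w \<in> cycles ?K j" for w j
  proof -
    show w: "fst w \<in> carrier (obj ?F j)" "snd w \<in> carrier (obj ?P (j - 1))"
      using cyclesD[OF that] by (auto simp: obj_cone)
    have dxc: "diff ?P (j - 1) (snd w) \<in> carrier (obj ?P (j - 2))" using hm_closed[OF gc_diff[OF P] w(2)] by simp
    have d1: "diff ?F j (fst w) \<oplus>\<^bsub>obj ?F (j - 1)\<^esub> f (j - 1) (snd w) = \<zero>\<^bsub>obj ?F (j - 1)\<^esub>"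
      and d2: "\<ominus>\<^bsub>obj ?P (j - 2)\<^esub> diff ?P (j - 1) (snd w) = \<zero>\<^bsub>obj ?P (j - 2)\<^esub>"
      using cyclesD(2)[OF that] by (auto simp: diff_cone obj_cone)
    have cl: "diff ?F j (fst w) \<in> carrier (obj ?F (j - 1))" "f (j - 1) (snd w) \<in> carrier (obj ?F (j - 1))"
      using hm_closed[OF gc_diff[OF F] w(1)] hm_closed[OF cm_hom[OF f] w(2)] by auto
    show "diff ?F j (fst w) = f (j - 1) (\<ominus>\<^bsub>obj ?P (j - 1)\<^esub> snd w)"
      using hm_neg[OF gP gF cm_hom[OF f] w(2)] gm_neg_eqI[OF gF cl d1] by simp
    show "diff ?P (j - 1) (snd w) = \<zero>\<^bsub>obj ?P (j - 2)\<^esub>" using gm_neg_neg[OF gP dxc] d2 gP by simp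
  qed
  \<comment> \<open>It suffices to bound \<open>snd w\<close>: a chain \<open>x\<close> whose
    boundary is the negative of \<open>snd w\<close> reduces \<open>w\<close> to a cycle in the
    exact complex \<open>?F\<close>, with a condition on augmentations in degree 0.\<close>
  have bd: "w \<in> boundaries ?K j"
    if w: "w \<in> cycles ?K j" and x: "x \<in> carrier (obj ?P j)" "diff ?P j x = \<ominus>\<^bsub>obj ?P (j - 1)\<^esub> snd w"
      and x0: "j = 0 \<Longrightarrow> res_aug R M (fst w) = res_aug R M (f 0 x)" for w j x
  proof -
    note c = cyc[OF w]
    have fx: "f j x \<in> carrier (obj ?F j)" using hm_closed[OF cm_hom[OF f] x(1)] .
    let ?y = "fst w \<oplus>\<^bsub>obj ?F j\<^esub> \<ominus>\<^bsub>obj ?F j\<^esub> f j x"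
    have y: "?y \<in> carrier (obj ?F j)" using c(1) fx gF by simp
    have "diff ?F j ?y = \<zero>\<^bsub>obj ?F (j - 1)\<^esub>"
      using c(1,3) x(2) cm_diff[OF f x(1)] fx gF hm_closed[OF gc_diff[OF F] fx]
      by (simp add: hm_add[OF gc_diff[OF F]] hm_neg[OF gF gF gc_diff[OF F]])
    moreover have "res_aug R M ?y = \<zero>\<^bsub>M\<^esub>" if "j = 0"
      using x0[OF that] that c(1) fx gF M hm_closed[OF eF, of "f 0 x"]
      by (simp add: hm_add[OF eF] hm_neg[OF gF M eF])
    ultimately obtain y' where y': "y' \<in> carrier (obj ?F (j + 1))" "diff ?F (j + 1) y' = ?y"
      using fib_conc_exact[OF F M pF y] by blast
    show ?thesis
    proof (rule boundariesI)
      show "(y', x) \<in> carrier (obj ?K (j + 1))" using y'(1) x(1) by (simp add: obj_cone)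
      show "w = diff ?K (j + 1) (y', x)"
        using y'(2) x(2) c(1,2) fx gF gP by (simp add: diff_cone prod_eq_iff gm_assoc)
    qed
  qed
  \<comment> \<open>By the fibration property, \<open>snd w\<close> bounds in the replacement as
    soon as its image bounds in \<open>C\<close>.\<close>
  have bd': "w \<in> boundaries ?K j"
    if w: "w \<in> cycles ?K j" and j: "1 \<le> j" and b: "?p (j - 1) (snd w) \<in> boundaries C (j - 1)" for w j
  proof -
    note c = cyc[OF w]
    obtain c' where c': "c' \<in> carrier (obj C j)" "?p (j - 1) (snd w) = diff C j c'" using boundariesE[OF b] by auto
    let ?z = "\<ominus>\<^bsub>obj ?P (j - 1)\<^esub> snd w"
    have z: "?z \<in> carrier (obj ?P (j - 1))" "\<ominus>\<^bsub>obj C j\<^esub> c' \<in> carrier (obj C j)" using c(2) c'(1) gP gC by auto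
    have dz: "diff ?P (j - 1) ?z = \<zero>\<^bsub>obj ?P (j - 2)\<^esub>"
      using hm_neg[OF gP gP gc_diff[OF P] c(2)] c(4) gP by simp
    have "?p (j - 1) ?z = diff C j (\<ominus>\<^bsub>obj C j\<^esub> c')"
      using hm_neg[OF gP gC cm_hom[OF pc] c(2)] hm_neg[OF gC gC gc_diff[OF C] c'(1)] c'(2) by simp
    from fibE[OF fib_repl[OF C nn], OF z dz this]
    obtain x where "x \<in> carrier (obj ?P j)" "diff ?P j x = ?z" by blast
    then show ?thesis using bd[OF w] j by simp
  qed
  \<comment> \<open>Surjectivity of \<open>e\<close> and of the replacement map in degree 0 provides
    an \<open>x\<close> with the same augmentation as \<open>fst w\<close>.\<close>
  have H0: "zero_module (homology ?K 0)"
  proof (rule zero_homologyI[OF K])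
    fix w assume w: "w \<in> cycles ?K 0"
    note c = cyc[OF w]
    have ac: "res_aug R M (fst w) \<in> carrier M" using hm_closed[OF eF] c(1) by simp
    obtain d where d: "d \<in> carrier (obj C 0)" "e d = res_aug R M (fst w)" using es[OF ac] by blast
    have "diff C 0 d = \<zero>\<^bsub>obj C (- 1)\<^esub>" using nonnegD[OF nn, of "- 1" "diff C 0 d"] hm_closed[OF gc_diff[OF C] d(1)] by simp
    then have "?p (0 - 1) \<zero>\<^bsub>obj ?P (0 - 1)\<^esub> = diff C 0 d" using hm_zero[OF gP gC cm_hom[OF pc], of "- 1"] by simp
    from fibE[OF fib_repl[OF C nn], OF _ d(1) _ this]
    obtain x where x: "x \<in> carrier (obj ?P 0)" "?p 0 x = d"
      using gP hm_zero[OF gP gP gc_diff[OF P], of "- 1"] by auto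
    have "snd w = \<zero>\<^bsub>obj ?P (0 - 1)\<^esub>" "diff ?P 0 x = \<zero>\<^bsub>obj ?P (0 - 1)\<^esub>"
      by (rule nonnegD[OF projective_cpxD(2)[OF PP]], simp, rule c(2) hm_closed[OF gc_diff[OF P] x(1)])+
    then have "diff ?P 0 x = \<ominus>\<^bsub>obj ?P (0 - 1)\<^esub> snd w" using gm_neg_zero[OF gP] by simp
    then show "w \<in> boundaries ?K 0" using bd[OF w x(1)] fe[OF x(1)] x(2) d(2) by simp
  qed
  \<comment> \<open>The augmentation kills boundaries of \<open>?F\<close>, so the image of
    \<open>snd w\<close> in \<open>C\<close> is killed by \<open>e\<close>; the kernel of
    \<open>e\<close> consists of boundaries.\<close>
  have H1: "zero_module (homology ?K 1)"
  proof (rule zero_homologyI[OF K])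
    fix w assume w: "w \<in> cycles ?K 1"
    note c = cyc[OF w]
    have x: "snd w \<in> carrier (obj ?P 0)" "fst w \<in> carrier (obj ?F 1)" using c by simp_all
    have px: "?p 0 (snd w) \<in> carrier (obj C 0)" using hm_closed[OF cm_hom[OF pc] x(1)] .
    have fx: "f 0 (snd w) \<in> carrier (obj ?F 0)" using hm_closed[OF cm_hom[OF f] x(1)] .
    have "res_aug R M (diff ?F 1 (fst w)) = \<zero>\<^bsub>M\<^esub>" by (rule fib_conc_diff[OF F M pF x(2)])
    moreover have "diff ?F 1 (fst w) = \<ominus>\<^bsub>obj ?F 0\<^esub> f 0 (snd w)"
      using c(3) hm_neg[OF gP gF cm_hom[OF f] x(1)] by simp
    ultimately have "\<ominus>\<^bsub>M\<^esub> res_aug R M (f 0 (snd w)) = \<zero>\<^bsub>M\<^esub>" using hm_neg[OF gF M eF fx] by simp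
    then have "res_aug R M (f 0 (snd w)) = \<zero>\<^bsub>M\<^esub>" using gm_neg_neg[OF M hm_closed[OF eF fx]] M by simp
    then have "?p 0 (snd w) \<in> boundaries C 0" using fe[OF x(1)] ek[OF px] by simp
    then show "w \<in> boundaries ?K 1" using bd'[OF w] by simp
  qed
  \<comment> \<open>From degree 2 on \<open>?F\<close> is exact at both places involved, so what
    survives is the homology of the replacement, which is that of \<open>C\<close>, shifted by
    one.\<close>
  have iso: "\<exists>g. graded_iso R (homology ?K j) (homology C (j - 1)) g" if j: "2 \<le> j" for j
  proof -
    let ?Z = "restrict_gmod (obj ?K j) (cycles ?K j)"
    let ?Y = "restrict_gmod (obj C (j - 1)) (cycles C (j - 1))"
    have Z: "graded_module R ?Z" by (rule graded_module_restrict[OF gc_module[OF K] hsub_cycles[OF K]])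
    have pcyc: "?p (j - 1) (snd w) \<in> cycles C (j - 1)" if "w \<in> cycles ?K j" for w
    proof -
      have "snd w \<in> cycles ?P (j - 1)" using cyc(2,4)[OF that] by (intro cyclesI) simp_all
      then show ?thesis by (rule chain_map_cycles(1)[OF P C pc])
    qed
    have "graded_hom R (obj ?K j) (obj C (j - 1)) (\<lambda>w. ?p (j - 1) (snd w))"
      unfolding obj_cone by (rule hm_compose_gh[OF hm_snd cm_hom[OF pc]])
    then have "graded_hom R ?Z ?Y (\<lambda>w. ?p (j - 1) (snd w))"
      using pcyc by (intro hm_into_restrict[OF Z] hm_from_restrict[OF hsub_cycles[OF K]]) simp_all
    from hm_compose_gh[OF this hm_hcls[OF C]]
    have w: "graded_hom R ?Z (homology C (j - 1)) (\<lambda>w. hcls C (j - 1) (?p (j - 1) (snd w)))" .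
    have pb: "?p (j - 1) (snd v) \<in> boundaries C (j - 1) \<longleftrightarrow> v \<in> boundaries ?K j" if v: "v \<in> cycles ?K j" for v
    proof
      assume "v \<in> boundaries ?K j"
      then obtain y where y: "y \<in> carrier (obj ?K (j + 1))" "v = diff ?K (j + 1) y" by (rule boundariesE)
      have y2: "snd y \<in> carrier (obj ?P j)" using y(1) by (auto simp: obj_cone)
      have dy: "diff ?P j (snd y) \<in> carrier (obj ?P (j - 1))" using hm_closed[OF gc_diff[OF P] y2] .
      have "diff ?P j (snd y) \<in> boundaries ?P (j - 1)" using y2 by (auto simp: boundaries_def)
      then have "snd v \<in> boundaries ?P (j - 1)"
        using y(2) hsub_neg[OF gP hsub_boundaries[OF P]] by (simp add: diff_cone)
      then show "?p (j - 1) (snd v) \<in> boundaries C (j - 1)" by (rule chain_map_cycles(2)[OF P C pc])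
    qed (use bd'[OF v] j in simp)
    have ker: "hcls C (j - 1) (?p (j - 1) (snd x)) = \<zero>\<^bsub>homology C (j - 1)\<^esub>"
      if "x \<in> carrier ?Z" "hcls ?K j x = \<zero>\<^bsub>homology ?K j\<^esub>" for x
      using that hcls_zero_iff[OF K] hcls_zero_iff[OF C pcyc] pb by simp
    have sur: "hcls ?K j ` carrier ?Z = carrier (homology ?K j)" by (simp add: carrier_homology[OF K])
    from graded_factor[OF Z graded_module_homology[OF K] graded_module_homology[OF C] hm_hcls[OF K] sur w, OF ker]
    obtain g where g: "graded_hom R (homology ?K j) (homology C (j - 1)) g"
      "\<And>x. x \<in> carrier ?Z \<Longrightarrow> g (hcls ?K j x) = hcls C (j - 1) (?p (j - 1) (snd x))" by blast
    have "inj_on g (carrier (homology ?K j))"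
    proof (rule graded_inj_onI[OF graded_module_homology[OF K] graded_module_homology[OF C] g(1)])
      fix n X assume X: "X \<in> mgr (homology ?K j) n" "g X = \<zero>\<^bsub>homology C (j - 1)\<^esub>"
      then obtain v where v: "v \<in> cycles ?K j" "X = hcls ?K j v" by (auto simp: mgr_homology[OF K])
      then have "?p (j - 1) (snd v) \<in> boundaries C (j - 1)"
        using X(2) g(2)[of v] hcls_zero_iff[OF C pcyc[OF v(1)]] by simp
      then show "X = \<zero>\<^bsub>homology ?K j\<^esub>" using pb[OF v(1)] v hcls_zero_iff[OF K v(1)] by simp
    qed
    moreover have "g ` carrier (homology ?K j) = carrier (homology C (j - 1))"
    proof
      show "g ` carrier (homology ?K j) \<subseteq> carrier (homology C (j - 1))" using hm_closed[OF g(1)] by auto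
      show "carrier (homology C (j - 1)) \<subseteq> g ` carrier (homology ?K j)"
      proof
        fix X assume "X \<in> carrier (homology C (j - 1))"
        then obtain d where d: "d \<in> cycles C (j - 1)" "X = hcls C (j - 1) d" by (auto simp: carrier_homology[OF C])
        have "?p (j - 1 - 1) \<zero>\<^bsub>obj ?P (j - 1 - 1)\<^esub> = diff C (j - 1) d"
          using hm_zero[OF gP gC cm_hom[OF pc], of "j - 2"] cyclesD(2)[OF d(1)] by simp
        from fibE[OF fib_repl[OF C nn], OF gm_zero[OF gP] cyclesD(1)[OF d(1)] _ this]
        obtain x where x: "x \<in> carrier (obj ?P (j - 1))" "diff ?P (j - 1) x = \<zero>\<^bsub>obj ?P (j - 2)\<^esub>" "?p (j - 1) x = d"
          using hm_zero[OF gP gP gc_diff[OF P], of "j - 2"] by auto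
        \<comment> \<open>\<open>x\<close> is a cycle over \<open>d\<close>. Exactness of
          \<open>?F\<close> in the positive degree \<open>j - 1\<close> yields \<open>v\<close> that
          completes \<open>x\<close> to a cycle of the cone.\<close>
        let ?y = "\<ominus>\<^bsub>obj ?F (j - 1)\<^esub> f (j - 1) x"
        have fx: "f (j - 1) x \<in> carrier (obj ?F (j - 1))" using hm_closed[OF cm_hom[OF f] x(1)] .
        have y: "?y \<in> carrier (obj ?F (j - 1))" using fx gF by simp
        have "diff ?F (j - 1) (f (j - 1) x) = \<zero>\<^bsub>obj ?F (j - 1 - 1)\<^esub>"
          using cm_diff[OF f x(1), symmetric] x(2) hm_zero[OF gP gF cm_hom[OF f], of "j - 2"] by simp
        then have "diff ?F (j - 1) ?y = \<zero>\<^bsub>obj ?F (j - 1 - 1)\<^esub>"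
          using hm_neg[OF gF gF gc_diff[OF F] fx] gm_neg_zero[OF gF] by simp
        from fib_conc_exact[OF F M pF y this]
        obtain v where v: "v \<in> carrier (obj ?F j)" "diff ?F j v = ?y" using j by auto
        have "(v, x) \<in> cycles ?K j"
          using v x fx gF gP by (intro cyclesI) (simp_all add: obj_cone diff_cone)
        then have "hcls ?K j (v, x) \<in> carrier (homology ?K j)" "g (hcls ?K j (v, x)) = X"
          using g(2)[of "(v, x)"] x(3) d(2) by (simp_all add: carrier_homology[OF K])
        then show "X \<in> g ` carrier (homology ?K j)" by blast
      qed
    qed
    ultimately show ?thesis using g(1) unfolding graded_iso_def bij_betw_def by blast
  qed
  show ?thesis
  proof (rule vanishes_of_homology[OF K nonneg_cone[OF P F f projective_cpxD(2)[OF PP] projective_cpxD(2)[OF PF]] N])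
    fix j assume j: "0 \<le> j" "j \<le> l"
    consider "j = 0" | "j = 1" | "2 \<le> j" using j by linarith
    then show "ext_vanishes (homology ?K j) N (l - j)"
    proof cases
      case 3
      then obtain g where "graded_iso R (homology ?K j) (homology C (j - 1)) g" using iso by blast
      moreover have "ext_vanishes (homology C (j - 1)) N (l - j)" using U[of "j - 1"] 3 j by simp
      ultimately show ?thesis
        using ext_iso[OF graded_module_homology[OF K] graded_module_homology[OF C] N] by blast
    qed (use H0 H1 ext_zero[OF graded_module_homology[OF K] _ N] in simp_all)
  next
    fix j assume j: "0 \<le> j" "j \<le> l - 2"
    show "ext_vanishes (obj ?K j) N (l - 1 - j)"
      unfolding obj_cone
      by (rule ext_projective[OF graded_module_gprod[OF gF gP] projective_gprod[OF gF gP projective_cpxD(3)[OF PF]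
            projective_cpxD(3)[OF PP]] N]) (use j in auto)
  qed
qed

end

subsection \<open>Induced maps on cohomology\<close>

abbreviation coh :: "('a, 'x) cpx \<Rightarrow> ('a, 'n) gmod \<Rightarrow> int \<Rightarrow> ('a, ('x \<Rightarrow> 'n) set) gmod" where
  "coh X N i \<equiv> homology (hom_cpx R X N) (- i)"

abbreviation coh_map :: "('a, 'x) cpx \<Rightarrow> ('a, 'k) gmod \<Rightarrow> (int \<Rightarrow> 'x \<Rightarrow> 'y) \<Rightarrow> ('n \<Rightarrow> 'k) \<Rightarrow> int \<Rightarrow>
    ('y \<Rightarrow> 'n) set \<Rightarrow> ('x \<Rightarrow> 'k) set" where
  "coh_map X K f h i \<equiv> homology_map (hom_cpx R X K) (hom_cpx_map X f h) (- i)"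

context
  fixes X :: "('a, 'x) cpx" and Y :: "('a, 'y) cpx" and N :: "('a, 'n) gmod" and K :: "('a, 'k) gmod" and f h
  assumes X: "graded_complex R X" and Y: "graded_complex R Y" and N: "graded_module R N" and K: "graded_module R K"
    and f: "chain_map R X Y f" and h: "graded_hom R N K h"
begin

lemma hm_coh_map: "graded_hom R (coh Y N i) (coh X K i) (coh_map X K f h i)"
  by (rule hm_homology_map[OF graded_complex_hom_cpx[OF Y N] graded_complex_hom_cpx[OF X K]
        chain_map_hom_cpx[OF Y X f N K h]])

lemma coh_map_hcls:
  assumes "u \<in> cycles (hom_cpx R Y N) (- i)"
  shows "coh_map X K f h i (hcls (hom_cpx R Y N) (- i) u)
      = hcls (hom_cpx R X K) (- i) (\<lambda>x\<in>carrier (obj X i). h (u (f i x)))"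
    and "(\<lambda>x\<in>carrier (obj X i). h (u (f i x))) \<in> cycles (hom_cpx R X K) (- i)"
  using homology_map_hcls[OF graded_complex_hom_cpx[OF Y N] graded_complex_hom_cpx[OF X K]
        chain_map_hom_cpx[OF Y X f N K h] assms]
    chain_map_cycles(1)[OF graded_complex_hom_cpx[OF Y N] graded_complex_hom_cpx[OF X K]
        chain_map_hom_cpx[OF Y X f N K h] assms]
  by (simp_all add: hom_cpx_map_def)

end

lemma mgr_coh:
  assumes X: "graded_complex R X" and N: "graded_module R N" and c: "c \<in> mgr (coh X N i) n"
  obtains u where "u \<in> cycles (hom_cpx R X N) (- i)" "c = hcls (hom_cpx R X N) (- i) u"
    "homogeneous_map R (obj X i) N n u" "u \<in> extensional (carrier (obj X i))"
    "\<And>x. x \<in> carrier (obj X (i + 1)) \<Longrightarrow> u (diff X (i + 1) x) = \<zero>\<^bsub>N\<^esub>"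
proof -
  obtain u where u: "u \<in> cycles (hom_cpx R X N) (- i)" "u \<in> mgr (obj (hom_cpx R X N) (- i)) n"
    "c = hcls (hom_cpx R X N) (- i) u"
    using c by (auto simp: mgr_homology[OF graded_complex_hom_cpx[OF X N]])
  then show ?thesis using coh_cycles_iff[OF X N, of u i] that by (simp add: obj_hom_cpx)
qed

lemma coh_class_add_boundary:
  assumes X: "graded_complex R X" and N: "graded_module R N"
    and a: "a \<in> cycles (hom_cpx R X N) (- i)" and b: "b \<in> boundaries (hom_cpx R X N) (- i)"
    and u: "u \<in> cycles (hom_cpx R X N) (- i)"
    and eq: "\<And>x. x \<in> carrier (obj X i) \<Longrightarrow> u x = a x \<oplus>\<^bsub>N\<^esub> b x"
  shows "hcls (hom_cpx R X N) (- i) u = hcls (hom_cpx R X N) (- i) a"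
proof -
  note H = graded_complex_hom_cpx[OF X N]
  let ?G = "obj (hom_cpx R X N) (- i)"
  have G: "?G = gHom R (obj X i) N" by (simp add: obj_hom_cpx)
  note gG = gc_module[OF H, of "- i"]
  have ac: "a \<in> carrier ?G" and uc: "u \<in> carrier ?G" and bc: "b \<in> carrier ?G"
    using cyclesD(1)[OF a] cyclesD(1)[OF u] hsub_carrier[OF hsub_boundaries[OF H] b] by auto
  have "u = a \<oplus>\<^bsub>?G\<^esub> b"
  proof (rule gHom_eqI[OF gc_module[OF X] N])
    show "u \<in> carrier (gHom R (obj X i) N)" using uc by (simp add: G)
    show "a \<oplus>\<^bsub>?G\<^esub> b \<in> carrier (gHom R (obj X i) N)" using gm_add[OF gG ac bc] by (simp only: G)
    show "u x = (a \<oplus>\<^bsub>?G\<^esub> b) x" if "x \<in> carrier (obj X i)" for x using eq[OF that] that by (simp add: G)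
  qed
  then have "u \<oplus>\<^bsub>?G\<^esub> \<ominus>\<^bsub>?G\<^esub> a = b"
    using ac bc gG gm_comm[OF gG ac bc] by (simp add: gm_assoc)
  then show ?thesis using hcls_eq_iff[OF H u a] b by simp
qed

text \<open>A homogeneous class in the kernel is represented by a cocycle \<open>u\<close> whose
  pullback has a homogeneous primitive, and these are the data of \<open>cone_inj\<close>.\<close>

lemma coh_map_inj:
  assumes X: "graded_complex R X" and Y: "graded_complex R Y" and N: "graded_module R N"
    and f: "chain_map R X Y f" and v: "coh_vanishes R (cone X Y f) N i"
  shows "inj_on (coh_map X N f (\<lambda>x. x) i) (carrier (coh Y N i))"
proof (rule graded_inj_onI[OF _ _ hm_coh_map[OF X Y N N f hm_id]])
  note HX = graded_complex_hom_cpx[OF X N] and HY = graded_complex_hom_cpx[OF Y N]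
  show "graded_module R (coh Y N i)" "graded_module R (coh X N i)"
    by (rule graded_module_homology[OF HY] graded_module_homology[OF HX])+
  fix n c assume c: "c \<in> mgr (coh Y N i) n" and z: "coh_map X N f (\<lambda>x. x) i c = \<zero>\<^bsub>coh X N i\<^esub>"
  obtain u where u: "u \<in> cycles (hom_cpx R Y N) (- i)" "c = hcls (hom_cpx R Y N) (- i) u"
    "homogeneous_map R (obj Y i) N n u" "u \<in> extensional (carrier (obj Y i))"
    "\<And>x. x \<in> carrier (obj Y (i + 1)) \<Longrightarrow> u (diff Y (i + 1) x) = \<zero>\<^bsub>N\<^esub>"
    using mgr_coh[OF Y N c] by blast
  let ?w = "\<lambda>x\<in>carrier (obj X i). u (f i x)"
  note cm = coh_map_hcls[OF X Y N N f hm_id u(1)]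
  have wb: "?w \<in> boundaries (hom_cpx R X N) (- i)"
    using z u(2) cm hcls_zero_iff[OF HX cm(2)] by simp
  have wh: "homogeneous_map R (obj X i) N n ?w"
    by (rule hm_restrict[OF gc_module[OF X] hm_compose_gh[OF cm_hom[OF f] u(3)]])
  obtain w where w: "homogeneous_map R (obj X (i - 1)) N n w"
    "\<And>x. x \<in> carrier (obj X i) \<Longrightarrow> ?w x = w (diff X i x)"
    using coh_boundary_homogeneous[OF X N wb wh] by blast
  have w2: "u (f i x) = w (diff X i x)" if "x \<in> carrier (obj X i)" for x
    using w(2)[OF that] that by simp
  obtain t where t: "homogeneous_map R (obj Y (i - 1)) N n t" "\<And>y. y \<in> carrier (obj Y i) \<Longrightarrow> u y = t (diff Y i y)"
    using cone_inj[OF X Y f N v u(3), OF u(5) w(1), OF _ w2] by blast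
  have "restrict u (carrier (obj Y i)) \<in> boundaries (hom_cpx R Y N) (- i)"
    by (rule coh_boundaryI[OF Y N u(3) t])
  then show "c = \<zero>\<^bsub>coh Y N i\<^esub>"
    using u(2,4) hcls_zero_iff[OF HY u(1)] by (simp add: extensional_restrict)
qed

text \<open>\<open>cone_surj\<close> writes a homogeneous cocycle as a pullback plus a
  coboundary.\<close>

lemma coh_map_surj:
  assumes X: "graded_complex R X" and Y: "graded_complex R Y" and N: "graded_module R N"
    and f: "chain_map R X Y f" and v: "coh_vanishes R (cone X Y f) N (i + 1)"
  shows "coh_map X N f (\<lambda>x. x) i ` carrier (coh Y N i) = carrier (coh X N i)"
proof (rule graded_surjI[OF _ _ hm_coh_map[OF X Y N N f hm_id]])
  note HX = graded_complex_hom_cpx[OF X N] and HY = graded_complex_hom_cpx[OF Y N]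
  show "graded_module R (coh Y N i)" "graded_module R (coh X N i)"
    by (rule graded_module_homology[OF HY] graded_module_homology[OF HX])+
  fix n c assume c: "c \<in> mgr (coh X N i) n"
  obtain u where u: "u \<in> cycles (hom_cpx R X N) (- i)" "c = hcls (hom_cpx R X N) (- i) u"
    "homogeneous_map R (obj X i) N n u" "u \<in> extensional (carrier (obj X i))"
    "\<And>x. x \<in> carrier (obj X (i + 1)) \<Longrightarrow> u (diff X (i + 1) x) = \<zero>\<^bsub>N\<^esub>"
    using mgr_coh[OF X N c] by blast
  obtain w t where w: "homogeneous_map R (obj Y i) N n w"
      "\<And>y. y \<in> carrier (obj Y (i + 1)) \<Longrightarrow> w (diff Y (i + 1) y) = \<zero>\<^bsub>N\<^esub>"
    and t: "homogeneous_map R (obj X (i - 1)) N n t"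
      "\<And>x. x \<in> carrier (obj X i) \<Longrightarrow> u x = w (f i x) \<oplus>\<^bsub>N\<^esub> t (diff X i x)"
    using cone_surj[OF X Y f N v u(3), OF u(5)] by blast
  let ?w = "restrict w (carrier (obj Y i))"
  have wc: "?w \<in> cycles (hom_cpx R Y N) (- i)"
    using gHomI[OF gc_module[OF Y] N hsum_map_homogeneous[OF gc_module[OF Y] N w(1)]] w(2)
      hm_closed[OF gc_diff'[OF Y]] by (simp add: coh_cycles_iff[OF Y N])
  note cm = coh_map_hcls[OF X Y N N f hm_id wc]
  let ?b = "\<lambda>x. t (diff X i x)"
  have b: "restrict ?b (carrier (obj X i)) \<in> boundaries (hom_cpx R X N) (- i)"
    by (rule coh_boundaryI[OF X N hm_compose_gh[OF gc_diff[OF X] t(1)] t(1)]) simp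
  have "c = coh_map X N f (\<lambda>x. x) i (hcls (hom_cpx R Y N) (- i) ?w)"
    unfolding u(2) cm(1)
    by (rule coh_class_add_boundary[OF X N cm(2) b u(1)]) (use t(2) hm_closed[OF cm_hom[OF f]] in simp)
  then show "\<exists>x\<in>carrier (coh Y N i). coh_map X N f (\<lambda>x. x) i x = c"
    using wc by (auto simp: carrier_homology[OF HY])
qed

end


section \<open>Naturality\<close>

context graded_base
begin

text \<open>Two functors \<open>F\<close>, \<open>G\<close> are compared through maps \<open>\<beta>\<close> and \<open>\<alpha>\<close> into a third module \<open>X\<close>. The latter
  need not be functorial: all that matters is that the maps induced by a morphism are compatible with some map.\<close>

context
  fixes F :: "('a, 'c, 'm, 'n, 'x) sit_functor" and G :: "('a, 'c, 'm, 'n, 'y) sit_functor"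
    and X :: "('a, 'c, 'm, 'n) situation \<Rightarrow> ('a, 'z) gmod" and \<alpha> \<beta> and \<S>
  assumes F: "\<And>S. S \<in> \<S> \<Longrightarrow> graded_module R (fst F S)" and G: "\<And>S. S \<in> \<S> \<Longrightarrow> graded_module R (fst G S)"
    and X: "\<And>S. S \<in> \<S> \<Longrightarrow> graded_module R (X S)"
    and \<alpha>: "\<And>S. S \<in> \<S> \<Longrightarrow> graded_hom R (fst G S) (X S) (\<alpha> S)"
    and \<beta>: "\<And>S. S \<in> \<S> \<Longrightarrow> graded_hom R (fst F S) (X S) (\<beta> S)"
    and Fm: "\<And>S S' f g h. S \<in> \<S> \<Longrightarrow> S' \<in> \<S> \<Longrightarrow> situation_hom R S S' f g h \<Longrightarrow>
      graded_hom R (fst F S) (fst F S') (snd F S S' f g h)"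
    and Gm: "\<And>S S' f g h. S \<in> \<S> \<Longrightarrow> S' \<in> \<S> \<Longrightarrow> situation_hom R S S' f g h \<Longrightarrow>
      graded_hom R (fst G S) (fst G S') (snd G S S' f g h)"
    and Xm: "\<And>S S' f g h. S \<in> \<S> \<Longrightarrow> S' \<in> \<S> \<Longrightarrow> situation_hom R S S' f g h \<Longrightarrow>
      \<exists>\<gamma>. graded_hom R (X S) (X S') \<gamma> \<and> (\<forall>x\<in>carrier (fst F S). \<gamma> (\<beta> S x) = \<beta> S' (snd F S S' f g h x)) \<and>
        (\<forall>y\<in>carrier (fst G S). \<gamma> (\<alpha> S y) = \<alpha> S' (snd G S S' f g h y))"
begin

text \<open>The map is \<beta> followed by the inverse of \<alpha>. Linearity, homogeneity and
  naturality are checked after applying the injective \<alpha>.\<close>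

lemma natural_through_bij:
  assumes bij: "\<And>S. S \<in> \<S> \<Longrightarrow> bij_betw (\<alpha> S) (carrier (fst G S)) (carrier (X S))"
  shows "\<exists>\<tau>. natural_hom R \<S> F G \<tau> \<and>
    (\<forall>S\<in>\<S>. inj_on (\<beta> S) (carrier (fst F S)) \<longrightarrow> inj_on (\<tau> S) (carrier (fst F S))) \<and>
    (\<forall>S\<in>\<S>. \<beta> S ` carrier (fst F S) = carrier (X S) \<longrightarrow> \<tau> S ` carrier (fst F S) = carrier (fst G S))"
proof -
  define \<tau> where "\<tau> S x = inv_into (carrier (fst G S)) (\<alpha> S) (\<beta> S x)" for S x
  have \<tau>c: "\<tau> S x \<in> carrier (fst G S)" and \<tau>: "\<alpha> S (\<tau> S x) = \<beta> S x"
    if "S \<in> \<S>" "x \<in> carrier (fst F S)" for S x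
  proof -
    have "\<beta> S x \<in> \<alpha> S ` carrier (fst G S)"
      using bij[OF that(1)] hm_closed[OF \<beta>[OF that(1)] that(2)] by (simp add: bij_betw_def)
    then show "\<tau> S x \<in> carrier (fst G S)" "\<alpha> S (\<tau> S x) = \<beta> S x"
      unfolding \<tau>_def by (rule inv_into_into, rule f_inv_into_f)
  qed
  have \<alpha>i: "y = z" if "S \<in> \<S>" "y \<in> carrier (fst G S)" "z \<in> carrier (fst G S)" "\<alpha> S y = \<alpha> S z" for S y z
    using bij[OF that(1)] that by (auto simp: bij_betw_def dest: inj_onD)
  have "graded_hom R (fst F S) (fst G S) (\<tau> S)" if S: "S \<in> \<S>" for S
  proof (rule homogeneous_mapI)
    note t = \<tau>c[OF S] \<tau>[OF S]
    show "\<tau> S x \<in> carrier (fst G S)" if "x \<in> carrier (fst F S)" for x by (rule t(1)[OF that])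
    show "\<tau> S (x \<oplus>\<^bsub>fst F S\<^esub> y) = \<tau> S x \<oplus>\<^bsub>fst G S\<^esub> \<tau> S y" if "x \<in> carrier (fst F S)" "y \<in> carrier (fst F S)" for x y
      by (rule \<alpha>i[OF S]) (use that t F[OF S] G[OF S] in \<open>simp_all add: hm_add[OF \<alpha>[OF S]] hm_add[OF \<beta>[OF S]]\<close>)
    show "\<tau> S (a \<odot>\<^bsub>fst F S\<^esub> x) = a \<odot>\<^bsub>fst G S\<^esub> \<tau> S x" if "a \<in> carrier R" "x \<in> carrier (fst F S)" for a x
      by (rule \<alpha>i[OF S]) (use that t F[OF S] G[OF S] in \<open>simp_all add: hm_smult[OF \<alpha>[OF S]] hm_smult[OF \<beta>[OF S]]\<close>)
    show "\<tau> S x \<in> mgr (fst G S) (k + 0)" if x: "x \<in> mgr (fst F S) k" for k x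
    proof -
      have xc: "x \<in> carrier (fst F S)" by (rule mgr_carrier[OF F[OF S] x])
      have "\<alpha> S (comp (fst G S) (\<tau> S x) k) = \<alpha> S (\<tau> S x)"
        by (rule homogeneous_preimage[OF G[OF S] X[OF S] \<alpha>[OF S] t(1)[OF xc]])
          (use t(2)[OF xc] hm_mgr[OF \<beta>[OF S] x] in simp)
      then have "comp (fst G S) (\<tau> S x) k = \<tau> S x"
        by (rule \<alpha>i[OF S comp_carrier[OF G[OF S] t(1)[OF xc]] t(1)[OF xc]])
      then show ?thesis using comp_mgr[OF G[OF S] t(1)[OF xc], of k] by simp
    qed
  qed
  moreover have "\<tau> S' (snd F S S' f g h x) = snd G S S' f g h (\<tau> S x)"
    if S: "S \<in> \<S>" "S' \<in> \<S>" and h: "situation_hom R S S' f g h" and x: "x \<in> carrier (fst F S)" for S S' f g h x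
  proof -
    obtain \<gamma> where \<gamma>: "\<And>x. x \<in> carrier (fst F S) \<Longrightarrow> \<gamma> (\<beta> S x) = \<beta> S' (snd F S S' f g h x)"
      "\<And>y. y \<in> carrier (fst G S) \<Longrightarrow> \<gamma> (\<alpha> S y) = \<alpha> S' (snd G S S' f g h y)"
      using Xm[OF S h] by blast
    have Fx: "snd F S S' f g h x \<in> carrier (fst F S')" by (rule hm_closed[OF Fm[OF S h] x])
    show ?thesis
      by (rule \<alpha>i[OF S(2) \<tau>c[OF S(2) Fx] hm_closed[OF Gm[OF S h] \<tau>c[OF S(1) x]]])
        (use \<gamma>(1)[OF x] \<gamma>(2)[OF \<tau>c[OF S(1) x]] \<tau>[OF S(2) Fx] \<tau>[OF S(1) x] in simp)
  qed
  ultimately have "natural_hom R \<S> F G \<tau>" unfolding natural_hom_def by blast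
  moreover have "inj_on (\<tau> S) (carrier (fst F S))" if "S \<in> \<S>" "inj_on (\<beta> S) (carrier (fst F S))" for S
    using that \<tau> by (intro inj_onI) (metis inj_onD)
  moreover have "\<tau> S ` carrier (fst F S) = carrier (fst G S)" if S: "S \<in> \<S>" and s: "\<beta> S ` carrier (fst F S) = carrier (X S)" for S
  proof
    show "\<tau> S ` carrier (fst F S) \<subseteq> carrier (fst G S)" using \<tau>c[OF S] by blast
    show "carrier (fst G S) \<subseteq> \<tau> S ` carrier (fst F S)"
    proof
      fix y assume y: "y \<in> carrier (fst G S)"
      have "\<alpha> S y \<in> \<beta> S ` carrier (fst F S)" unfolding s by (rule hm_closed[OF \<alpha>[OF S] y])
      then obtain x where x: "\<alpha> S y = \<beta> S x" "x \<in> carrier (fst F S)" by (rule imageE)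
      have "y = \<tau> S x" by (rule \<alpha>i[OF S y \<tau>c[OF S x(2)]]) (use x \<tau>[OF S x(2)] in simp)
      then show "y \<in> \<tau> S ` carrier (fst F S)" using x(2) by blast
    qed
  qed
  ultimately show ?thesis by blast
qed

text \<open>Up to isomorphism the homomorphic image is \<open>X S\<close>, but
  \<open>natural_subquotient\<close> fixes the type of its elements. So the image is modelled as
  cosets of the kernel of \<alpha>, and \<beta> is carried over by choosing preimages under
  \<alpha>.\<close>

lemma natural_subquotientI:
  assumes sur: "\<And>S. S \<in> \<S> \<Longrightarrow> \<alpha> S ` carrier (fst G S) = carrier (X S)"
    and inj: "\<And>S. S \<in> \<S> \<Longrightarrow> inj_on (\<beta> S) (carrier (fst F S))"
  shows "natural_subquotient R \<S> F G"
proof -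
  define K where "K S = {y \<in> carrier (fst G S). \<alpha> S y = \<zero>\<^bsub>X S\<^esub>}" for S
  define Q where "Q S = gquot (fst G S) (carrier (fst G S)) (K S)" for S
  define p where "p S y = K S +>\<^bsub>fst G S\<^esub> y" for S y
  define \<iota> where "\<iota> S x = p S (SOME y. y \<in> carrier (fst G S) \<and> \<alpha> S y = \<beta> S x)" for S x
  define L where "L S = \<iota> S ` carrier (fst F S)" for S
  have K: "hsub (fst G S) (K S)" if "S \<in> \<S>" for S
    unfolding K_def by (rule hsub_kernel[OF G[OF that] X[OF that] \<alpha>[OF that]])
  have Q: "graded_module R (Q S)" if "S \<in> \<S>" for S
    unfolding Q_def by (rule graded_module_gquot[OF G[OF that] K[OF that] hsub_whole[OF G[OF that]]])
  have p: "graded_hom R (fst G S) (Q S) (p S)" if "S \<in> \<S>" for S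
    unfolding Q_def p_def[abs_def] by (rule hm_coset_whole[OF G[OF that] K[OF that]])
  have ps: "p S ` carrier (fst G S) = carrier (Q S)" for S by (simp add: Q_def p_def)
  \<comment> \<open>Classes agree exactly when their images under \<alpha> do; this makes \<iota>
    independent of the choice in its definition.\<close>
  have peq: "p S y = p S z \<longleftrightarrow> \<alpha> S y = \<alpha> S z" if S: "S \<in> \<S>" and y: "y \<in> carrier (fst G S)" and z: "z \<in> carrier (fst G S)" for S y z
  proof -
    have ac: "\<alpha> S y \<in> carrier (X S)" "\<alpha> S z \<in> carrier (X S)" using hm_closed[OF \<alpha>[OF S]] y z by auto
    have "p S y = p S z \<longleftrightarrow> y \<oplus>\<^bsub>fst G S\<^esub> \<ominus>\<^bsub>fst G S\<^esub> z \<in> K S"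
      unfolding p_def by (rule coset_eq_iff[OF G[OF S] K[OF S] y z])
    also have "\<dots> \<longleftrightarrow> \<alpha> S y \<oplus>\<^bsub>X S\<^esub> \<ominus>\<^bsub>X S\<^esub> \<alpha> S z = \<zero>\<^bsub>X S\<^esub>"
      using y z G[OF S] by (simp add: K_def hm_add[OF \<alpha>[OF S]] hm_neg[OF G[OF S] X[OF S] \<alpha>[OF S]])
    also have "\<dots> \<longleftrightarrow> \<alpha> S y = \<alpha> S z"
      using gm_eq_diff[OF X[OF S] ac] gm_r_neg[OF X[OF S] ac(2)] by auto
    finally show ?thesis .
  qed
  have \<iota>: "\<exists>y\<in>carrier (fst G S). \<alpha> S y = \<beta> S x" "\<And>y. y \<in> carrier (fst G S) \<Longrightarrow> \<alpha> S y = \<beta> S x \<Longrightarrow> \<iota> S x = p S y"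
    if S: "S \<in> \<S>" and x: "x \<in> carrier (fst F S)" for S x
  proof -
    have "\<beta> S x \<in> \<alpha> S ` carrier (fst G S)" unfolding sur[OF S] by (rule hm_closed[OF \<beta>[OF S] x])
    then show ex: "\<exists>y\<in>carrier (fst G S). \<alpha> S y = \<beta> S x" by auto
    have *: "(SOME y. y \<in> carrier (fst G S) \<and> \<alpha> S y = \<beta> S x) \<in> carrier (fst G S) \<and>
        \<alpha> S (SOME y. y \<in> carrier (fst G S) \<and> \<alpha> S y = \<beta> S x) = \<beta> S x"
      using someI_ex[of "\<lambda>y. y \<in> carrier (fst G S) \<and> \<alpha> S y = \<beta> S x"] ex by blast
    show "\<iota> S x = p S y" if "y \<in> carrier (fst G S)" "\<alpha> S y = \<beta> S x" for y
      unfolding \<iota>_def using peq[OF S] * that by simp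
  qed
  have \<iota>h: "graded_hom R (fst F S) (Q S) (\<iota> S)" if S: "S \<in> \<S>" for S
  proof (rule homogeneous_mapI)
    show "\<iota> S x \<in> carrier (Q S)" if x: "x \<in> carrier (fst F S)" for x
      using \<iota>[OF S x] hm_closed[OF p[OF S]] by metis
    show "\<iota> S (x \<oplus>\<^bsub>fst F S\<^esub> x') = \<iota> S x \<oplus>\<^bsub>Q S\<^esub> \<iota> S x'" if x: "x \<in> carrier (fst F S)" and x': "x' \<in> carrier (fst F S)" for x x'
    proof -
      obtain y where y: "y \<in> carrier (fst G S)" "\<alpha> S y = \<beta> S x" using \<iota>(1)[OF S x] by blast
      obtain y' where y': "y' \<in> carrier (fst G S)" "\<alpha> S y' = \<beta> S x'" using \<iota>(1)[OF S x'] by blast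
      have "\<iota> S (x \<oplus>\<^bsub>fst F S\<^esub> x') = p S (y \<oplus>\<^bsub>fst G S\<^esub> y')"
        by (rule \<iota>(2)[OF S]) (use x x' y y' F[OF S] G[OF S] hm_add[OF \<alpha>[OF S]] hm_add[OF \<beta>[OF S]] in simp_all)
      then show ?thesis using \<iota>(2)[OF S x y] \<iota>(2)[OF S x' y'] hm_add[OF p[OF S] y(1) y'(1)] by simp
    qed
    show "\<iota> S (a \<odot>\<^bsub>fst F S\<^esub> x) = a \<odot>\<^bsub>Q S\<^esub> \<iota> S x" if a: "a \<in> carrier R" and x: "x \<in> carrier (fst F S)" for a x
    proof -
      obtain y where y: "y \<in> carrier (fst G S)" "\<alpha> S y = \<beta> S x" using \<iota>(1)[OF S x] by blast
      have "\<iota> S (a \<odot>\<^bsub>fst F S\<^esub> x) = p S (a \<odot>\<^bsub>fst G S\<^esub> y)"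
        by (rule \<iota>(2)[OF S]) (use a x y F[OF S] G[OF S] hm_smult[OF \<alpha>[OF S]] hm_smult[OF \<beta>[OF S]] in simp_all)
      then show ?thesis using \<iota>(2)[OF S x y] hm_smult[OF p[OF S] a y(1)] by simp
    qed
    show "\<iota> S x \<in> mgr (Q S) (k + 0)" if x: "x \<in> mgr (fst F S) k" for k x
    proof -
      have xc: "x \<in> carrier (fst F S)" by (rule mgr_carrier[OF F[OF S] x])
      obtain y where y: "y \<in> carrier (fst G S)" "\<alpha> S y = \<beta> S x" using \<iota>(1)[OF S xc] by blast
      let ?y = "comp (fst G S) y k"
      have "\<alpha> S ?y = \<alpha> S y"
        by (rule homogeneous_preimage[OF G[OF S] X[OF S] \<alpha>[OF S] y(1)]) (use y hm_mgr[OF \<beta>[OF S] x] in simp)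
      then have "\<iota> S x = p S ?y" using y comp_carrier[OF G[OF S] y(1)] by (intro \<iota>(2)[OF S xc]) simp_all
      then show ?thesis using hm_mgr[OF p[OF S] comp_mgr[OF G[OF S] y(1)], of k] by simp
    qed
  qed
  have \<iota>i: "inj_on (\<iota> S) (carrier (fst F S))" if S: "S \<in> \<S>" for S
  proof (rule inj_onI)
    fix x x' assume x: "x \<in> carrier (fst F S)" "x' \<in> carrier (fst F S)" "\<iota> S x = \<iota> S x'"
    obtain y where y: "y \<in> carrier (fst G S)" "\<alpha> S y = \<beta> S x" using \<iota>(1)[OF S x(1)] by blast
    obtain y' where y': "y' \<in> carrier (fst G S)" "\<alpha> S y' = \<beta> S x'" using \<iota>(1)[OF S x(2)] by blast
    have "p S y = p S y'" using \<iota>(2)[OF S x(1) y] \<iota>(2)[OF S x(2) y'] x(3) by simp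
    then have "\<beta> S x = \<beta> S x'" using peq[OF S y(1) y'(1)] y y' by simp
    then show "x = x'" using inj_onD[OF inj[OF S]] x by blast
  qed
  have 1: "graded_module R (Q S) \<and> graded_surj R (fst G S) (Q S) (p S) \<and> homogeneous_submodule R (Q S) (L S) \<and>
    graded_iso R (fst F S) (restrict_gmod (Q S) (L S)) (\<iota> S)" if S: "S \<in> \<S>" for S
  proof (intro conjI)
    show "graded_module R (Q S)" by (rule Q[OF S])
    show "graded_surj R (fst G S) (Q S) (p S)" using p[OF S] ps by (simp add: graded_surj_def)
    show "homogeneous_submodule R (Q S) (L S)"
      unfolding L_def by (rule homogeneous_submodule_hsub[OF Q[OF S] hsub_image[OF F[OF S] Q[OF S] \<iota>h[OF S]]])
    show "graded_iso R (fst F S) (restrict_gmod (Q S) (L S)) (\<iota> S)"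
      unfolding graded_iso_def using \<iota>i[OF S]
      by (auto simp: bij_betw_def L_def intro!: hm_into_restrict[OF F[OF S] \<iota>h[OF S]])
  qed
  have 2: "\<exists>q. graded_hom R (Q S) (Q S') q \<and>
      (\<forall>x\<in>carrier (fst G S). q (p S x) = p S' (snd G S S' f g h x)) \<and>
      (\<forall>x\<in>carrier (fst F S). q (\<iota> S x) = \<iota> S' (snd F S S' f g h x))"
    if S: "S \<in> \<S>" "S' \<in> \<S>" and h: "situation_hom R S S' f g h" for S S' f g h
  proof -
    obtain \<gamma> where \<gamma>h: "graded_hom R (X S) (X S') \<gamma>"
      and \<gamma>: "\<And>x. x \<in> carrier (fst F S) \<Longrightarrow> \<gamma> (\<beta> S x) = \<beta> S' (snd F S S' f g h x)"
      "\<And>y. y \<in> carrier (fst G S) \<Longrightarrow> \<gamma> (\<alpha> S y) = \<alpha> S' (snd G S S' f g h y)"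
      using Xm[OF S h] by blast
    note Gh = Gm[OF S h]
    \<comment> \<open>Compatibility with \<gamma> shows that the map induced by the morphism carries
      the kernel of \<open>\<alpha> S\<close> into that of \<open>\<alpha> S'\<close>, so it passes
      to the quotients.\<close>
    have ker: "p S' (snd G S S' f g h y) = \<zero>\<^bsub>Q S'\<^esub>" if y: "y \<in> carrier (fst G S)" "p S y = \<zero>\<^bsub>Q S\<^esub>" for y
    proof -
      have "p S y = p S \<zero>\<^bsub>fst G S\<^esub>" using y(2) hm_zero[OF G[OF S(1)] Q[OF S(1)] p[OF S(1)]] by simp
      then have "\<alpha> S y = \<zero>\<^bsub>X S\<^esub>"
        using peq[OF S(1) y(1)] G[OF S(1)] hm_zero[OF G[OF S(1)] X[OF S(1)] \<alpha>[OF S(1)]] by simp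
      then have "\<alpha> S' (snd G S S' f g h y) = \<alpha> S' \<zero>\<^bsub>fst G S'\<^esub>"
        using \<gamma>(2)[OF y(1)] hm_zero[OF X[OF S(1)] X[OF S(2)] \<gamma>h] hm_zero[OF G[OF S(2)] X[OF S(2)] \<alpha>[OF S(2)]] by simp
      then have "p S' (snd G S S' f g h y) = p S' \<zero>\<^bsub>fst G S'\<^esub>"
        using peq[OF S(2) hm_closed[OF Gh y(1)]] G[OF S(2)] by simp
      then show ?thesis using hm_zero[OF G[OF S(2)] Q[OF S(2)] p[OF S(2)]] by simp
    qed
    obtain q where q: "graded_hom R (Q S) (Q S') q"
      "\<And>y. y \<in> carrier (fst G S) \<Longrightarrow> q (p S y) = p S' (snd G S S' f g h y)"
      using graded_factor[OF G[OF S(1)] Q[OF S(1)] Q[OF S(2)] p[OF S(1)] ps hm_compose_gh[OF Gh p[OF S(2)]], OF ker]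
      by blast
    have "q (\<iota> S x) = \<iota> S' (snd F S S' f g h x)" if x: "x \<in> carrier (fst F S)" for x
    proof -
      obtain y where y: "y \<in> carrier (fst G S)" "\<alpha> S y = \<beta> S x" using \<iota>(1)[OF S(1) x] by blast
      have "\<iota> S' (snd F S S' f g h x) = p S' (snd G S S' f g h y)"
        by (rule \<iota>(2)[OF S(2) hm_closed[OF Fm[OF S h] x] hm_closed[OF Gh y(1)]])
          (use \<gamma>(1)[OF x] \<gamma>(2)[OF y(1)] y(2) in simp)
      then show ?thesis using \<iota>(2)[OF S(1) x y] q(2)[OF y(1)] by simp
    qed
    then show ?thesis using q by blast
  qed
  show ?thesis
    unfolding natural_subquotient_def
    by (rule exI[of _ Q], rule exI[of _ p], rule exI[of _ L], rule exI[of _ \<iota>], intro conjI ballI allI impI)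
      (rule 1[THEN conjunct1] 1[THEN conjunct2, THEN conjunct1] 1[THEN conjunct2, THEN conjunct2, THEN conjunct1]
        1[THEN conjunct2, THEN conjunct2, THEN conjunct2] 2; assumption)+
qed

end

subsection \<open>The comparison maps of a situation\<close>

text \<open>The augmentation of the complex onto \<open>md S\<close>. It is defined on the whole
  term of degree 0, because the terms of negative degree vanish and every element there is a
  cycle.\<close>

definition eps :: "('a, 'c, 'm, 'n) situation \<Rightarrow> 'c \<Rightarrow> 'm" where
  "eps S c = idn S (hcls (cx S) 0 c)"

lemma
  assumes "is_situation R S"
  shows sit_cx: "graded_complex R (cx S)" "nonneg (cx S)" and sit_md: "graded_module R (md S)"
    and sit_cf: "graded_module R (cf S)"
    and hm_eps: "graded_hom R (obj (cx S) 0) (md S) (eps S)"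
    and eps_surj: "m \<in> carrier (md S) \<Longrightarrow> \<exists>c\<in>carrier (obj (cx S) 0). eps S c = m"
    and eps_zero: "c \<in> carrier (obj (cx S) 0) \<Longrightarrow> eps S c = \<zero>\<^bsub>md S\<^esub> \<longleftrightarrow> c \<in> boundaries (cx S) 0"
    and cycles_0: "cycles (cx S) 0 = carrier (obj (cx S) 0)"
proof -
  let ?C = "cx S" and ?M = "md S"
  show C: "graded_complex R ?C" and nn: "nonneg ?C" and M: "graded_module R ?M" and N: "graded_module R (cf S)"
    using assms by (auto simp: is_situation_def nonneg_def)
  have iso: "graded_iso R (homology ?C 0) ?M (idn S)" using assms by (simp add: is_situation_def)
  then have ih: "graded_hom R (homology ?C 0) ?M (idn S)" and inj: "inj_on (idn S) (carrier (homology ?C 0))"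
    and sur: "idn S ` carrier (homology ?C 0) = carrier ?M" by (auto simp: graded_iso_def bij_betw_def)
  have "diff ?C 0 x = \<zero>\<^bsub>obj ?C (- 1)\<^esub>" if "x \<in> carrier (obj ?C 0)" for x
    using nonnegD[OF nn, of "- 1" "diff ?C 0 x"] hm_closed[OF gc_diff[OF C] that] by simp
  then show cyc: "cycles ?C 0 = carrier (obj ?C 0)" unfolding cycles_def by auto
  have "graded_hom R (obj ?C 0) (restrict_gmod (obj ?C 0) (cycles ?C 0)) (\<lambda>x. x)"
    by (rule hm_into_restrict[OF gc_module[OF C] hm_id]) (simp add: cyc)
  from hm_compose_gh[OF hm_compose_gh[OF this hm_hcls[OF C]] ih]
  show "graded_hom R (obj ?C 0) ?M (eps S)" unfolding eps_def[abs_def] .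
  show "\<exists>c\<in>carrier (obj ?C 0). eps S c = m" if "m \<in> carrier ?M"
  proof -
    have "m \<in> idn S ` carrier (homology ?C 0)" unfolding sur by (rule that)
    then show ?thesis by (auto simp: carrier_homology[OF C] cyc eps_def)
  qed
  show "eps S c = \<zero>\<^bsub>?M\<^esub> \<longleftrightarrow> c \<in> boundaries ?C 0" if c: "c \<in> carrier (obj ?C 0)"
  proof -
    have cH: "hcls ?C 0 c \<in> carrier (homology ?C 0)" using c by (simp add: carrier_homology[OF C] cyc)
    have "eps S c = \<zero>\<^bsub>?M\<^esub> \<longleftrightarrow> idn S (hcls ?C 0 c) = idn S \<zero>\<^bsub>homology ?C 0\<^esub>"
      using hm_zero[OF graded_module_homology[OF C] M ih] by (simp add: eps_def)
    also have "\<dots> \<longleftrightarrow> hcls ?C 0 c = \<zero>\<^bsub>homology ?C 0\<^esub>"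
      using inj_onD[OF inj _ cH gm_zero[OF graded_module_homology[OF C]]] by auto
    also have "\<dots> \<longleftrightarrow> c \<in> boundaries ?C 0" using hcls_zero_iff[OF C] c cyc by simp
    finally show ?thesis .
  qed
qed

lemma lifts_chain_map: "lifts R M' M g p \<Longrightarrow> chain_map R (resolution R M') (resolution R M) p"
  by (simp add: lifts_def)

text \<open>Gives meaning to the choice in \<open>gExt_map\<close>: the augmentation of the source
  followed by \<open>g\<close> is lifted through the resolution of the target.\<close>

lemma lift_exists:
  assumes M': "graded_module R M'" and M: "graded_module R M" and g: "graded_hom R M' M g"
  shows "\<exists>p. lifts R M' M g p"
proof -
  let ?F' = "resolution R M'"
  note P = projective_resolution[OF M'] and F' = graded_complex_resolution[OF M'] and F = graded_complex_resolution[OF M]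
  note e' = fib_conc_hom[OF F' M' fib_resolution[OF M']]
  have "chain_map R ?F' (conc M) (conc_map M (\<lambda>x. g (res_aug R M' x)))"
    using fib_conc_diff[OF F' M' fib_resolution[OF M']] hm_zero[OF M' M g]
    by (intro chain_map_conc[OF F' M hm_compose_gh[OF e' g]]) simp
  from chain_lift[OF P F graded_complex_conc[OF M] fib_resolution[OF M] this]
  obtain p where p: "chain_map R ?F' (resolution R M) p"
    "\<And>j x. x \<in> carrier (obj ?F' j) \<Longrightarrow>
      conc_map M (res_aug R M) j (p j x) = conc_map M (\<lambda>x. g (res_aug R M' x)) j x" by blast
  have "res_aug R M (p 0 x) = g (res_aug R M' x)" if "x \<in> carrier (obj ?F' 0)" for x
    using p(2)[OF that] by simp
  then show ?thesis using p(1) unfolding lifts_def by blast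
qed

definition is_comparison :: "('a, 'c, 'm, 'n) situation \<Rightarrow> (int \<Rightarrow> (('a, 'c) pgen \<Rightarrow> 'a) \<Rightarrow> (('a, 'm) gen \<Rightarrow> 'a)) \<Rightarrow> bool" where
  "is_comparison S f \<longleftrightarrow> chain_map R (repl R (cx S)) (resolution R (md S)) f \<and>
     (\<forall>x\<in>carrier (obj (repl R (cx S)) 0). res_aug R (md S) (f 0 x) = eps S (repl_map R (cx S) 0 x))"

text \<open>The choices for different situations are independent of each other; they are compatible
  up to homotopy, which is enough in cohomology.\<close>

definition comparison :: "('a, 'c, 'm, 'n) situation \<Rightarrow> int \<Rightarrow> (('a, 'c) pgen \<Rightarrow> 'a) \<Rightarrow> (('a, 'm) gen \<Rightarrow> 'a)" where
  "comparison S = (SOME f. is_comparison S f)"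

lemma comparison:
  assumes S: "is_situation R S"
  shows "chain_map R (repl R (cx S)) (resolution R (md S)) (comparison S)"
    and "x \<in> carrier (obj (repl R (cx S)) 0) \<Longrightarrow> res_aug R (md S) (comparison S 0 x) = eps S (repl_map R (cx S) 0 x)"
proof -
  let ?P = "repl R (cx S)" and ?M = "md S"
  note C = sit_cx[OF S] and M = sit_md[OF S]
  note PP = projective_repl[OF C] and pc = chain_map_repl[OF C]
  note P = projective_cpxD(1)[OF PP]
  \<comment> \<open>By \<open>eps_zero\<close> the augmentation kills boundaries, so the composite
    is a chain map into \<open>conc ?M\<close>.\<close>
  have z: "eps S (repl_map R (cx S) 0 (diff ?P 1 x)) = \<zero>\<^bsub>?M\<^esub>" if x: "x \<in> carrier (obj ?P 1)" for x
  proof -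
    have "repl_map R (cx S) 0 (diff ?P 1 x) = diff (cx S) 1 (repl_map R (cx S) 1 x)"
      using cm_diff[OF pc x] by simp
    moreover have "diff (cx S) 1 (repl_map R (cx S) 1 x) \<in> boundaries (cx S) 0"
      using hm_closed[OF cm_hom[OF pc] x] by (intro boundariesI[of "repl_map R (cx S) 1 x"]) simp_all
    ultimately show ?thesis
      using eps_zero[OF S] hsub_carrier[OF hsub_boundaries[OF C(1)]] by simp
  qed
  have "chain_map R ?P (conc ?M) (conc_map ?M (\<lambda>x. eps S (repl_map R (cx S) 0 x)))"
    by (rule chain_map_conc[OF P M hm_compose_gh[OF cm_hom[OF pc] hm_eps[OF S]], OF z])
  from chain_lift[OF PP graded_complex_resolution[OF M] graded_complex_conc[OF M] fib_resolution[OF M] this]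
  obtain f where f: "chain_map R ?P (resolution R ?M) f"
    "\<And>j x. x \<in> carrier (obj ?P j) \<Longrightarrow>
      conc_map ?M (res_aug R ?M) j (f j x) = conc_map ?M (\<lambda>x. eps S (repl_map R (cx S) 0 x)) j x" by blast
  have "res_aug R ?M (f 0 x) = eps S (repl_map R (cx S) 0 x)" if "x \<in> carrier (obj ?P 0)" for x
    using f(2)[OF that] by simp
  then have "is_comparison S f" using f(1) unfolding is_comparison_def by blast
  then have "is_comparison S (comparison S)" unfolding comparison_def by (rule someI[of "is_comparison S"])
  then show "chain_map R ?P (resolution R ?M) (comparison S)"
    "x \<in> carrier (obj ?P 0) \<Longrightarrow> res_aug R ?M (comparison S 0 x) = eps S (repl_map R (cx S) 0 x)"
    unfolding is_comparison_def by blast+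
qed

abbreviation coh_repl :: "int \<Rightarrow> ('a, 'c, 'm, 'n) situation \<Rightarrow> ('a, ((('a, 'c) pgen \<Rightarrow> 'a) \<Rightarrow> 'n) set) gmod" where
  "coh_repl i S \<equiv> coh (repl R (cx S)) (cf S) i"

abbreviation alpha :: "int \<Rightarrow> ('a, 'c, 'm, 'n) situation \<Rightarrow> ((('a, 'm) gen \<Rightarrow> 'a) \<Rightarrow> 'n) set \<Rightarrow> ((('a, 'c) pgen \<Rightarrow> 'a) \<Rightarrow> 'n) set" where
  "alpha i S \<equiv> coh_map (repl R (cx S)) (cf S) (comparison S) (\<lambda>x. x) i"

abbreviation beta :: "int \<Rightarrow> ('a, 'c, 'm, 'n) situation \<Rightarrow> ('c \<Rightarrow> 'n) set \<Rightarrow> ((('a, 'c) pgen \<Rightarrow> 'a) \<Rightarrow> 'n) set" where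
  "beta i S \<equiv> coh_map (repl R (cx S)) (cf S) (repl_map R (cx S)) (\<lambda>x. x) i"

lemma functor_values: "fst (coho_functor R i) S = coh (cx S) (cf S) i" "fst (ext_functor R i) S = coh (resolution R (md S)) (cf S) i"
  "snd (coho_functor R i) S S' f g h = coh_map (cx S') (cf S') f h i"
  "snd (ext_functor R i) S S' f g h = coh_map (resolution R (md S')) (cf S') (SOME p. lifts R (md S') (md S) g p) h i"
  by (simp_all add: coho_functor_def ext_functor_def gExt_def gExt_map_def)

context
  fixes S :: "('a, 'c, 'm, 'n) situation" and i :: int
  assumes S: "is_situation R S"
begin

lemma repl_facts: "graded_complex R (repl R (cx S))" "projective_cpx TYPE(('a, 'c) pgen) R (repl R (cx S))"
  "chain_map R (repl R (cx S)) (cx S) (repl_map R (cx S))" "acyclic_fib R (repl R (cx S)) (cx S) (repl_map R (cx S))"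
  using graded_complex_repl[OF sit_cx[OF S]] projective_repl[OF sit_cx[OF S]] chain_map_repl[OF sit_cx[OF S]]
    fib_repl[OF sit_cx[OF S]] .

lemma hm_alpha: "graded_hom R (fst (ext_functor R i) S) (coh_repl i S) (alpha i S)"
  unfolding functor_values
  by (rule hm_coh_map[OF repl_facts(1) graded_complex_resolution[OF sit_md[OF S]] sit_cf[OF S] sit_cf[OF S] comparison(1)[OF S] hm_id])

lemma hm_beta: "graded_hom R (fst (coho_functor R i) S) (coh_repl i S) (beta i S)"
  unfolding functor_values
  by (rule hm_coh_map[OF repl_facts(1) sit_cx(1)[OF S] sit_cf[OF S] sit_cf[OF S] repl_facts(3) hm_id])

lemma graded_values: "graded_module R (fst (ext_functor R i) S)" "graded_module R (fst (coho_functor R i) S)"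
  "graded_module R (coh_repl i S)"
  unfolding functor_values
  using graded_module_homology[OF graded_complex_hom_cpx[OF graded_complex_resolution[OF sit_md[OF S]] sit_cf[OF S]]]
    graded_module_homology[OF graded_complex_hom_cpx[OF sit_cx(1)[OF S] sit_cf[OF S]]]
    graded_module_homology[OF graded_complex_hom_cpx[OF repl_facts(1) sit_cf[OF S]]] .

text \<open>The homology of the cone is that of \<open>C\<close> moved up by one, hence the shift of
  the index. Index \<open>i - 1\<close> therefore decides injectivity and index \<open>i\<close>
  surjectivity of \<open>alpha\<close>.\<close>

lemma condU_vanishes:
  assumes "condU R S (l - 1)"
  shows "coh_vanishes R (cone (repl R (cx S)) (resolution R (md S)) (comparison S)) (cf S) l"
proof (rule vanishes_cone_resolution[OF sit_cx[OF S] sit_cf[OF S] sit_md[OF S] hm_eps[OF S] eps_surj[OF S] _ comparison[OF S]])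
  show "c \<in> boundaries (cx S) 0" if "c \<in> carrier (obj (cx S) 0)" "eps S c = \<zero>\<^bsub>md S\<^esub>" for c
    using eps_zero[OF S that(1)] that(2) by simp
  show "ext_vanishes (homology (cx S) j) (cf S) (l - 1 - j)" if "1 \<le> j" "j \<le> l - 1" for j
    using assms that unfolding condU_def gExt_def
    by (intro vanishes_of_zero[OF graded_complex_resolution[OF graded_module_homology[OF sit_cx(1)[OF S]]] sit_cf[OF S]]) blast
qed

text \<open>Here the shift comes from the terms: \<open>vanishes_of_homology\<close> asks for the
  Ext of the term of index \<open>j\<close> in degree \<open>l - 1 - j\<close>.\<close>

lemma condV_vanishes:
  assumes "condV R S (l - 1)"
  shows "coh_vanishes R (cone (repl R (cx S)) (cx S) (repl_map R (cx S))) (cf S) l"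
proof (rule vanishes_cone_repl[OF sit_cx[OF S] sit_cf[OF S]])
  show "ext_vanishes (obj (cx S) j) (cf S) (l - 1 - j)" if "0 \<le> j" "j \<le> l - 2" for j
    using assms that unfolding condV_def gExt_def
    by (intro vanishes_of_zero[OF graded_complex_resolution[OF gc_module[OF sit_cx(1)[OF S]]] sit_cf[OF S]]) auto
qed

lemma alpha_inj: "condU R S (i - 1) \<Longrightarrow> inj_on (alpha i S) (carrier (fst (ext_functor R i) S))"
  unfolding functor_values
  by (rule coh_map_inj[OF repl_facts(1) graded_complex_resolution[OF sit_md[OF S]] sit_cf[OF S] comparison(1)[OF S] condU_vanishes])

lemma alpha_surj: "condU R S i \<Longrightarrow> alpha i S ` carrier (fst (ext_functor R i) S) = carrier (coh_repl i S)"
  unfolding functor_values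
  by (rule coh_map_surj[OF repl_facts(1) graded_complex_resolution[OF sit_md[OF S]] sit_cf[OF S] comparison(1)[OF S] condU_vanishes]) simp

lemma beta_inj: "condV R S (i - 1) \<Longrightarrow> inj_on (beta i S) (carrier (fst (coho_functor R i) S))"
  unfolding functor_values
  by (rule coh_map_inj[OF repl_facts(1) sit_cx(1)[OF S] sit_cf[OF S] repl_facts(3) condV_vanishes])

lemma beta_surj: "condV R S i \<Longrightarrow> beta i S ` carrier (fst (coho_functor R i) S) = carrier (coh_repl i S)"
  unfolding functor_values
  by (rule coh_map_surj[OF repl_facts(1) sit_cx(1)[OF S] sit_cf[OF S] repl_facts(3) condV_vanishes]) simp

end

context
  fixes S S' :: "('a, 'c, 'm, 'n) situation" and f g h and i :: int
  assumes S: "is_situation R S" and S': "is_situation R S'" and sh: "situation_hom R S S' f g h"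
begin

lemma sit_homD: "chain_map R (cx S') (cx S) f" "graded_hom R (md S') (md S) g" "graded_hom R (cf S) (cf S') h"
  "c \<in> carrier (obj (cx S') 0) \<Longrightarrow> g (eps S' c) = eps S (f 0 c)"
proof -
  show f: "chain_map R (cx S') (cx S) f" "graded_hom R (md S') (md S) g" "graded_hom R (cf S) (cf S') h"
    using sh by (auto simp: situation_hom_def)
  show "g (eps S' c) = eps S (f 0 c)" if c: "c \<in> carrier (obj (cx S') 0)"
  proof -
    have cyc: "c \<in> cycles (cx S') 0" using c cycles_0[OF S'] by simp
    then have "hcls (cx S') 0 c \<in> carrier (homology (cx S') 0)" by (simp add: carrier_homology[OF sit_cx(1)[OF S']])
    then have "g (eps S' c) = idn S (homology_map (cx S) f 0 (hcls (cx S') 0 c))"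
      using sh by (simp add: situation_hom_def eps_def)
    then show ?thesis
      using homology_map_hcls[OF sit_cx(1)[OF S'] sit_cx(1)[OF S] f(1) cyc] by (simp add: eps_def)
  qed
qed

lemma some_lift: "lifts R (md S') (md S) g (SOME p. lifts R (md S') (md S) g p)"
  using lift_exists[OF sit_md[OF S'] sit_md[OF S] sit_homD(2)] by (rule someI_ex)

lemma hm_ext_functor: "graded_hom R (fst (ext_functor R i) S) (fst (ext_functor R i) S') (snd (ext_functor R i) S S' f g h)"
  unfolding functor_values
  by (rule hm_coh_map[OF graded_complex_resolution[OF sit_md[OF S']] graded_complex_resolution[OF sit_md[OF S]]
      sit_cf[OF S] sit_cf[OF S'] lifts_chain_map[OF some_lift] sit_homD(3)])

lemma hm_coho_functor: "graded_hom R (fst (coho_functor R i) S) (fst (coho_functor R i) S') (snd (coho_functor R i) S S' f g h)"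
  unfolding functor_values
  by (rule hm_coh_map[OF sit_cx(1)[OF S'] sit_cx(1)[OF S] sit_cf[OF S] sit_cf[OF S'] sit_homD(1,3)])

text \<open>\<gamma> is induced by a lift \<open>p\<close> of \<open>f\<close> to the replacements.
  The square with \<open>beta\<close> commutes on cocycles, as \<open>p\<close> lies over
  \<open>f\<close>; the square with \<open>alpha\<close> commutes only up to homotopy, as both ways
  around it lift the same map to \<open>md S\<close>.\<close>

lemma comparison_natural:
  "\<exists>\<gamma>. graded_hom R (coh_repl i S) (coh_repl i S') \<gamma> \<and>
     (\<forall>x\<in>carrier (fst (coho_functor R i) S). \<gamma> (beta i S x) = beta i S' (snd (coho_functor R i) S S' f g h x)) \<and>
     (\<forall>y\<in>carrier (fst (ext_functor R i) S). \<gamma> (alpha i S y) = alpha i S' (snd (ext_functor R i) S S' f g h y))"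
proof -
  let ?C = "cx S" and ?C' = "cx S'" and ?N = "cf S" and ?N' = "cf S'"
  let ?P = "repl R ?C" and ?P' = "repl R ?C'" and ?F = "resolution R (md S)" and ?F' = "resolution R (md S')"
  note P = repl_facts[OF S] and P' = repl_facts[OF S']
  note C = sit_cx(1)[OF S] and C' = sit_cx(1)[OF S'] and N = sit_cf[OF S] and N' = sit_cf[OF S']
  note M = sit_md[OF S] and M' = sit_md[OF S'] and F = graded_complex_resolution[OF sit_md[OF S]]
    and F' = graded_complex_resolution[OF sit_md[OF S']]
  note f = sit_homD(1) and g = sit_homD(2) and h = sit_homD(3)
  obtain p where p: "chain_map R ?P' ?P p"
    and pp: "\<And>j x. x \<in> carrier (obj ?P' j) \<Longrightarrow> repl_map R ?C j (p j x) = f j (repl_map R ?C' j x)"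
    using chain_lift[OF P'(2) P(1) C P(4) chain_map_compose[OF P'(3) f]] by blast
  define q where "q = (SOME p. lifts R (md S') (md S) g p)"
  have q: "chain_map R ?F' ?F q"
    and qa: "\<And>x. x \<in> carrier (obj ?F' 0) \<Longrightarrow> res_aug R (md S) (q 0 x) = g (res_aug R (md S') x)"
    using some_lift unfolding q_def lifts_def by blast+
  note c = comparison[OF S] and c' = comparison[OF S']
  let ?\<gamma> = "coh_map ?P' ?N' p h i"
  have 1: "?\<gamma> (beta i S x) = beta i S' (coh_map ?C' ?N' f h i x)" if x: "x \<in> carrier (coh ?C ?N i)" for x
  proof -
    obtain u where u: "u \<in> cycles (hom_cpx R ?C ?N) (- i)" "x = hcls (hom_cpx R ?C ?N) (- i) u"
      using x by (auto simp: carrier_homology[OF graded_complex_hom_cpx[OF C N]])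
    note b = coh_map_hcls[OF P(1) C N N P(3) hm_id u(1)]
    note d = coh_map_hcls[OF P'(1) P(1) N N' p h b(2)]
    note b' = coh_map_hcls[OF C' C N N' f h u(1)]
    note d' = coh_map_hcls[OF P'(1) C' N' N' P'(3) hm_id b'(2)]
    show ?thesis
      unfolding u(2) b(1) d(1) b'(1) d'(1)
      by (rule arg_cong[of _ _ "hcls (hom_cpx R ?P' ?N') (- i)"], rule restrict_ext)
        (use pp hm_closed[OF cm_hom[OF p]] hm_closed[OF cm_hom[OF P'(3)]] in simp)
  qed
  \<comment> \<open>One composite is traced through \<open>p\<close> over \<open>f\<close>, the
    other through \<open>q\<close> over \<open>g\<close>; \<open>sit_homD\<close> links
    \<open>f\<close> and \<open>g\<close> by way of the identifications with homology.\<close>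
  have pq: "conc_map (md S) (res_aug R (md S)) j (comparison S j (p j x)) = conc_map (md S) (res_aug R (md S)) j (q j (comparison S' j x))"
    if x: "x \<in> carrier (obj ?P' j)" for j x
  proof (cases "j = 0")
    case True
    then have x0: "x \<in> carrier (obj ?P' 0)" using x by simp
    have "res_aug R (md S) (comparison S 0 (p 0 x)) = eps S (f 0 (repl_map R ?C' 0 x))"
      using c(2)[OF hm_closed[OF cm_hom[OF p] x0]] pp[OF x0] by simp
    also have "\<dots> = g (eps S' (repl_map R ?C' 0 x))"
      using sit_homD(4)[OF hm_closed[OF cm_hom[OF P'(3)] x0]] by simp
    also have "\<dots> = res_aug R (md S) (q 0 (comparison S' 0 x))"
      using qa[OF hm_closed[OF cm_hom[OF c'(1)] x0]] c'(2)[OF x0] by simp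
    finally show ?thesis using True by simp
  qed simp
  obtain s where s: "graded_hom R (obj ?P' (i - 1)) (obj ?F i) s"
    and sd: "\<And>x. x \<in> carrier (obj ?P' i) \<Longrightarrow> \<exists>y\<in>carrier (obj ?F (i + 1)).
       comparison S i (p i x) = q i (comparison S' i x) \<oplus>\<^bsub>obj ?F i\<^esub> (diff ?F (i + 1) y \<oplus>\<^bsub>obj ?F i\<^esub> s (diff ?P' i x))"
    using chain_homotopy[OF P'(2) F graded_complex_conc[OF M] fib_resolution[OF M] chain_map_compose[OF p c(1)]
        chain_map_compose[OF c'(1) q], OF pq, of i] by blast
  have 2: "?\<gamma> (alpha i S y) = alpha i S' (coh_map ?F' ?N' q h i y)" if y: "y \<in> carrier (coh ?F ?N i)" for y
  proof -
    obtain u where u: "u \<in> cycles (hom_cpx R ?F ?N) (- i)" "y = hcls (hom_cpx R ?F ?N) (- i) u"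
      using y by (auto simp: carrier_homology[OF graded_complex_hom_cpx[OF F N]])
    note a = coh_map_hcls[OF P(1) F N N c(1) hm_id u(1)]
    note d = coh_map_hcls[OF P'(1) P(1) N N' p h a(2)]
    note a' = coh_map_hcls[OF F' F N N' q h u(1)]
    note d' = coh_map_hcls[OF P'(1) F' N' N' c'(1) hm_id a'(2)]
    have uc: "u \<in> carrier (gHom R (obj ?F i) ?N)" and ud: "\<And>y. y \<in> carrier (obj ?F (i + 1)) \<Longrightarrow> u (diff ?F (i + 1) y) = \<zero>\<^bsub>?N\<^esub>"
      using u(1) by (auto simp: coh_cycles_iff[OF F N])
    note ul = gHomD[OF gc_module[OF F] N uc]
    \<comment> \<open>Along the homotopy the two cocycles differ by \<open>?v\<close> after the
      differential; the remaining term vanishes because \<open>u\<close> is a cocycle.\<close>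
    let ?v = "\<lambda>x\<in>carrier (obj ?P' (i - 1)). h (u (s x))"
    have "?v \<in> carrier (gHom R (obj ?P' (i - 1)) ?N')"
      by (rule gHomI[OF gc_module[OF P'(1)] N' hsum_map_compose[OF gc_module[OF F] N gc_module[OF P'(1)] N' s h ul(2)]])
    then have b: "(\<lambda>x\<in>carrier (obj ?P' i). ?v (diff ?P' i x)) \<in> boundaries (hom_cpx R ?P' ?N') (- i)"
      unfolding coh_boundaries_iff[OF P'(1) N'] by blast
    have eq: "(\<lambda>x\<in>carrier (obj ?P' i). h ((\<lambda>x\<in>carrier (obj ?P i). u (comparison S i x)) (p i x))) x
        = (\<lambda>x\<in>carrier (obj ?P' i). (\<lambda>x\<in>carrier (obj ?F' i). h (u (q i x))) (comparison S' i x)) x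
          \<oplus>\<^bsub>?N'\<^esub> (\<lambda>x\<in>carrier (obj ?P' i). ?v (diff ?P' i x)) x" if x: "x \<in> carrier (obj ?P' i)" for x
    proof -
      obtain y where y: "y \<in> carrier (obj ?F (i + 1))"
        "comparison S i (p i x) = q i (comparison S' i x) \<oplus>\<^bsub>obj ?F i\<^esub> (diff ?F (i + 1) y \<oplus>\<^bsub>obj ?F i\<^esub> s (diff ?P' i x))"
        using sd[OF x] by blast
      have px: "p i x \<in> carrier (obj ?P i)" and cx: "comparison S' i x \<in> carrier (obj ?F' i)"
        using hm_closed[OF cm_hom[OF p] x] hm_closed[OF cm_hom[OF c'(1)] x] by auto
      have dx: "diff ?P' i x \<in> carrier (obj ?P' (i - 1))" using hm_closed[OF gc_diff[OF P'(1)] x] .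
      have cc: "q i (comparison S' i x) \<in> carrier (obj ?F i)" "diff ?F (i + 1) y \<in> carrier (obj ?F i)"
        "s (diff ?P' i x) \<in> carrier (obj ?F i)"
        using hm_closed[OF cm_hom[OF q] cx] hm_closed[OF gc_diff'[OF F] y(1)] hm_closed[OF s dx] by auto
      have "u (comparison S i (p i x)) = u (q i (comparison S' i x)) \<oplus>\<^bsub>?N\<^esub> u (s (diff ?P' i x))"
        using cc gc_module[OF F, of i] ud[OF y(1)] ul(4) N by (simp add: y(2) lin_add[OF ul(3)])
      then have "h (u (comparison S i (p i x))) = h (u (q i (comparison S' i x))) \<oplus>\<^bsub>?N'\<^esub> h (u (s (diff ?P' i x)))"
        using hm_add[OF h ul(4)[OF cc(1)] ul(4)[OF cc(3)]] by simp
      then show ?thesis using x px cx dx by simp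
    qed
    show ?thesis
      unfolding u(2) a(1) d(1) a'(1) d'(1)
      by (rule coh_class_add_boundary[OF P'(1) N' d'(2) b d(2) eq])
  qed
  show ?thesis
    unfolding functor_values
    using hm_coh_map[OF P'(1) P(1) N N' p h] 1 2 by (intro exI[of _ ?\<gamma>]) (simp add: q_def)
qed

end

end

section \<open>Assembly of the seven statements\<close>

theorem lemma3p2:
  fixes R :: "'a gring" and i :: int
  assumes "graded_ring R"
  shows
    "natural_iso_exists R
       {S :: ('a, 'c, 'm, 'n) situation. is_situation R S \<and>
          condU R S (i - 1) \<and> condU R S i \<and> condV R S (i - 1) \<and> condV R S i}
       (coho_functor R i) (ext_functor R i) \<and>
     natural_surj_exists R
       {S :: ('a, 'c, 'm, 'n) situation. is_situation R S \<and>
          condU R S i \<and> condV R S (i - 1) \<and> condV R S i}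
       (ext_functor R i) (coho_functor R i) \<and>
     natural_surj_exists R
       {S :: ('a, 'c, 'm, 'n) situation. is_situation R S \<and>
          condU R S (i - 1) \<and> condU R S i \<and> condV R S i}
       (coho_functor R i) (ext_functor R i) \<and>
     natural_inj_exists R
       {S :: ('a, 'c, 'm, 'n) situation. is_situation R S \<and>
          condU R S (i - 1) \<and> condU R S i \<and> condV R S (i - 1)}
       (coho_functor R i) (ext_functor R i) \<and>
     natural_inj_exists R
       {S :: ('a, 'c, 'm, 'n) situation. is_situation R S \<and>
          condU R S (i - 1) \<and> condV R S (i - 1) \<and> condV R S i}
       (ext_functor R i) (coho_functor R i) \<and>
     natural_subquotient R
       {S :: ('a, 'c, 'm, 'n) situation. is_situation R S \<and>
          condU R S i \<and> condV R S (i - 1)}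
       (coho_functor R i) (ext_functor R i) \<and>
     natural_subquotient R
       {S :: ('a, 'c, 'm, 'n) situation. is_situation R S \<and>
          condU R S (i - 1) \<and> condV R S i}
       (ext_functor R i) (coho_functor R i)"
proof -
  interpret graded_base R by unfold_locales (rule assms)
  let ?F = "coho_functor R i :: ('a, 'c, 'm, 'n, _) sit_functor"
  let ?G = "ext_functor R i :: ('a, 'c, 'm, 'n, _) sit_functor"
  let ?X = "coh_repl i :: ('a, 'c, 'm, 'n) situation \<Rightarrow> _"
  let ?a = "alpha i :: ('a, 'c, 'm, 'n) situation \<Rightarrow> _" and ?b = "beta i :: ('a, 'c, 'm, 'n) situation \<Rightarrow> _"
  \<comment> \<open>The same squares with the two functors exchanged, for the statements in which
    \<open>beta\<close> takes the place of \<alpha>.\<close>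
  have swap: "\<exists>\<gamma>. graded_hom R (coh_repl i S) (coh_repl i S') \<gamma> \<and> (\<forall>y\<in>carrier (fst ?G S). \<gamma> (alpha i S y) = alpha i S' (snd ?G S S' f g h y)) \<and>
     (\<forall>x\<in>carrier (fst ?F S). \<gamma> (beta i S x) = beta i S' (snd ?F S S' f g h x))"
    if "is_situation R S" "is_situation R S'" "situation_hom R S S' f g h" for S S' :: "('a, 'c, 'm, 'n) situation" and f g h
    using comparison_natural[OF that, of i] by (elim exE conjE, intro exI conjI) assumption+
  \<comment> \<open>With both \<open>condU\<close> hypotheses \<open>alpha\<close> is bijective, so
    the map runs from cohomology to Ext and is injective or surjective whenever \<open>beta\<close>
    is.\<close>
  have A: "\<exists>\<tau>. natural_hom R \<S> ?F ?G \<tau> \<and>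
      (\<forall>S\<in>\<S>. inj_on (beta i S) (carrier (fst ?F S)) \<longrightarrow> inj_on (\<tau> S) (carrier (fst ?F S))) \<and>
      (\<forall>S\<in>\<S>. beta i S ` carrier (fst ?F S) = carrier (coh_repl i S) \<longrightarrow> \<tau> S ` carrier (fst ?F S) = carrier (fst ?G S))"
    if \<S>: "\<And>S. S \<in> \<S> \<Longrightarrow> is_situation R S \<and> condU R S (i - 1) \<and> condU R S i" for \<S> :: "('a, 'c, 'm, 'n) situation set"
  proof -
    have sit: "is_situation R S" if "S \<in> \<S>" for S using \<S>[OF that] by blast
    have bij: "bij_betw (alpha i S) (carrier (fst ?G S)) (carrier (coh_repl i S))" if "S \<in> \<S>" for S
      unfolding bij_betw_def using alpha_inj[OF sit[OF that]] alpha_surj[OF sit[OF that]] \<S>[OF that] by blast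
    show ?thesis
      by (rule natural_through_bij[where F = ?F and G = ?G and X = ?X and \<alpha> = ?a and \<beta> = ?b and \<S> = \<S>,
            OF graded_values(2)[OF sit] graded_values(1)[OF sit] graded_values(3)[OF sit] hm_alpha[OF sit] hm_beta[OF sit]
              hm_coho_functor[OF sit sit] hm_ext_functor[OF sit sit] comparison_natural[OF sit sit] bij])
  qed
  \<comment> \<open>With both \<open>condV\<close> hypotheses it is \<open>beta\<close> that is
    inverted, and the map runs from Ext to cohomology.\<close>
  have B: "\<exists>\<tau>. natural_hom R \<S> ?G ?F \<tau> \<and>
      (\<forall>S\<in>\<S>. inj_on (alpha i S) (carrier (fst ?G S)) \<longrightarrow> inj_on (\<tau> S) (carrier (fst ?G S))) \<and>
      (\<forall>S\<in>\<S>. alpha i S ` carrier (fst ?G S) = carrier (coh_repl i S) \<longrightarrow> \<tau> S ` carrier (fst ?G S) = carrier (fst ?F S))"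
    if \<S>: "\<And>S. S \<in> \<S> \<Longrightarrow> is_situation R S \<and> condV R S (i - 1) \<and> condV R S i" for \<S> :: "('a, 'c, 'm, 'n) situation set"
  proof -
    have sit: "is_situation R S" if "S \<in> \<S>" for S using \<S>[OF that] by blast
    have bij: "bij_betw (beta i S) (carrier (fst ?F S)) (carrier (coh_repl i S))" if "S \<in> \<S>" for S
      unfolding bij_betw_def using beta_inj[OF sit[OF that]] beta_surj[OF sit[OF that]] \<S>[OF that] by blast
    show ?thesis
      by (rule natural_through_bij[where F = ?G and G = ?F and X = ?X and \<alpha> = ?b and \<beta> = ?a and \<S> = \<S>,
            OF graded_values(1)[OF sit] graded_values(2)[OF sit] graded_values(3)[OF sit] hm_beta[OF sit] hm_alpha[OF sit]
              hm_ext_functor[OF sit sit] hm_coho_functor[OF sit sit] swap[OF sit sit] bij])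
  qed
  have a: "natural_iso_exists R \<S> ?F ?G"
    if \<S>: "\<And>S. S \<in> \<S> \<Longrightarrow> is_situation R S \<and> condU R S (i - 1) \<and> condU R S i \<and> condV R S (i - 1) \<and> condV R S i"
    for \<S> :: "('a, 'c, 'm, 'n) situation set"
  proof -
    obtain \<tau> where \<tau>: "natural_hom R \<S> ?F ?G \<tau>"
      "\<And>S. S \<in> \<S> \<Longrightarrow> inj_on (\<tau> S) (carrier (fst ?F S))" "\<And>S. S \<in> \<S> \<Longrightarrow> \<tau> S ` carrier (fst ?F S) = carrier (fst ?G S)"
      using A[of \<S>] \<S> beta_inj beta_surj by metis
    then show ?thesis
      unfolding natural_iso_exists_def natural_hom_def graded_iso_def bij_betw_def by blast
  qed
  have b: "natural_surj_exists R \<S> ?G ?F"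
    if \<S>: "\<And>S. S \<in> \<S> \<Longrightarrow> is_situation R S \<and> condU R S i \<and> condV R S (i - 1) \<and> condV R S i"
    for \<S> :: "('a, 'c, 'm, 'n) situation set"
  proof -
    obtain \<tau> where \<tau>: "natural_hom R \<S> ?G ?F \<tau>" "\<And>S. S \<in> \<S> \<Longrightarrow> \<tau> S ` carrier (fst ?G S) = carrier (fst ?F S)"
      using B[of \<S>] \<S> alpha_surj by metis
    then show ?thesis
      unfolding natural_surj_exists_def natural_hom_def graded_surj_def by blast
  qed
  have c: "natural_surj_exists R \<S> ?F ?G"
    if \<S>: "\<And>S. S \<in> \<S> \<Longrightarrow> is_situation R S \<and> condU R S (i - 1) \<and> condU R S i \<and> condV R S i"
    for \<S> :: "('a, 'c, 'm, 'n) situation set"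
  proof -
    obtain \<tau> where \<tau>: "natural_hom R \<S> ?F ?G \<tau>" "\<And>S. S \<in> \<S> \<Longrightarrow> \<tau> S ` carrier (fst ?F S) = carrier (fst ?G S)"
      using A[of \<S>] \<S> beta_surj by metis
    then show ?thesis
      unfolding natural_surj_exists_def natural_hom_def graded_surj_def by blast
  qed
  have d: "natural_inj_exists R \<S> ?F ?G"
    if \<S>: "\<And>S. S \<in> \<S> \<Longrightarrow> is_situation R S \<and> condU R S (i - 1) \<and> condU R S i \<and> condV R S (i - 1)"
    for \<S> :: "('a, 'c, 'm, 'n) situation set"
  proof -
    obtain \<tau> where \<tau>: "natural_hom R \<S> ?F ?G \<tau>" "\<And>S. S \<in> \<S> \<Longrightarrow> inj_on (\<tau> S) (carrier (fst ?F S))"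
      using A[of \<S>] \<S> beta_inj by metis
    then show ?thesis
      unfolding natural_inj_exists_def natural_hom_def graded_inj_def by blast
  qed
  have e: "natural_inj_exists R \<S> ?G ?F"
    if \<S>: "\<And>S. S \<in> \<S> \<Longrightarrow> is_situation R S \<and> condU R S (i - 1) \<and> condV R S (i - 1) \<and> condV R S i"
    for \<S> :: "('a, 'c, 'm, 'n) situation set"
  proof -
    obtain \<tau> where \<tau>: "natural_hom R \<S> ?G ?F \<tau>" "\<And>S. S \<in> \<S> \<Longrightarrow> inj_on (\<tau> S) (carrier (fst ?G S))"
      using B[of \<S>] \<S> alpha_inj by metis
    then show ?thesis
      unfolding natural_inj_exists_def natural_hom_def graded_inj_def by blast
  qed
  \<comment> \<open>Neither map has to be bijective here: \<open>alpha\<close> is onto and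
    \<open>beta\<close> is injective, which places cohomology inside a quotient of Ext.\<close>
  have f: "natural_subquotient R \<S> ?F ?G"
    if \<S>: "\<And>S. S \<in> \<S> \<Longrightarrow> is_situation R S \<and> condU R S i \<and> condV R S (i - 1)"
    for \<S> :: "('a, 'c, 'm, 'n) situation set"
  proof -
    have sit: "is_situation R S" and sur: "?a S ` carrier (fst ?G S) = carrier (coh_repl i S)"
      and inj: "inj_on (?b S) (carrier (fst ?F S))" if "S \<in> \<S>" for S
      using \<S>[OF that] alpha_surj beta_inj by blast+
    show ?thesis
      by (rule natural_subquotientI[where X = ?X and \<alpha> = ?a and \<beta> = ?b,
            OF graded_values(2)[OF sit] graded_values(1)[OF sit] graded_values(3)[OF sit] hm_alpha[OF sit] hm_beta[OF sit]
              hm_coho_functor[OF sit sit] hm_ext_functor[OF sit sit] comparison_natural[OF sit sit] sur inj])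
  qed
  have g: "natural_subquotient R \<S> ?G ?F"
    if \<S>: "\<And>S. S \<in> \<S> \<Longrightarrow> is_situation R S \<and> condU R S (i - 1) \<and> condV R S i"
    for \<S> :: "('a, 'c, 'm, 'n) situation set"
  proof -
    have sit: "is_situation R S" and sur: "?b S ` carrier (fst ?F S) = carrier (coh_repl i S)"
      and inj: "inj_on (?a S) (carrier (fst ?G S))" if "S \<in> \<S>" for S
      using \<S>[OF that] beta_surj alpha_inj by blast+
    show ?thesis
      by (rule natural_subquotientI[where X = ?X and \<alpha> = ?b and \<beta> = ?a,
            OF graded_values(1)[OF sit] graded_values(2)[OF sit] graded_values(3)[OF sit] hm_beta[OF sit] hm_alpha[OF sit]
              hm_ext_functor[OF sit sit] hm_coho_functor[OF sit sit] swap[OF sit sit] sur inj])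
  qed
  show ?thesis by (intro conjI a b c d e f g) simp_all
qed

end
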